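(* Let $\mathfrak g$ be the Lie algebra attached to $(\mathfrak h,(\cdot,\cdot),\alpha_1,\dots,\alpha_R)$, $\sigma$ a diagram automorphism of order $T$, $\Omega$ the skew-symmetric bilinear form on $\mathfrak g^\sigma$ and $S_{\mathfrak g}$ the Shapovalov form on $\mathfrak g$ defined in the context. Let $x\in\mathfrak g^\sigma$. If $x\in\ker S_{\mathfrak g}$ then $\Omega(x,y)=0$ for all $y\in\mathfrak g^\sigma$.
   Context: Lie algebra. $\mathfrak h$ is a finite-dimensional complex vector space with non-degenerate symmetric bilinear form $(\cdot,\cdot)$ (inducing a form on $\mathfrak h^*$), $\alpha_1,\dots,\alpha_R\in\mathfrak h^*$ linearly independent, $H_i\in\mathfrak h$ given by $\lambda(H_i)=(\alpha_i,\lambda)$. $\mathfrak g$ is generated by $\mathfrak h$ and $E_i,F_i$ ($1\le i\le R$) with relations $[E_i,F_j]=\delta_{ij}H_i$, $[H,E_i]=\alpha_i(H)E_i$, $[H,F_i]=-\alpha_i(H)F_i$, $[H,H']=0$. $\mathfrak n,\mathfrak n_+$ are the free subalgebras generated by the $F_i$, resp. $E_i$; $\mathfrak g=\mathfrak n\oplus\mathfrak h\oplus\mathfrak n_+$. $\varphi$ is the anti-automorphism $E_i\leftrightarrow F_i$, $H\mapsto H$. $K$ is the $\mathfrak g$-invariant symmetric bilinear form on $\mathfrak g$ with $K=(\cdot,\cdot)$ on $\mathfrak h$, $K(E_i,F_j)=\delta_{ij}$, zero on $\mathfrak n\times\mathfrak n$ and $\mathfrak n_+\times\mathfrak n_+$,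 $\mathfrak h\perp\mathfrak n\oplus\mathfrak n_+$; $S_{\mathfrak g}(x,y)=K(\varphi(x),y)$. $\sigma$ is an automorphism of $\mathfrak g$ of finite order $T$, with $\sigma(\mathfrak h)=\mathfrak h$, preserving $(\cdot,\cdot)$ on $\mathfrak h$, and $\sigma(E_i)=E_{\sigma(i)}$, $\sigma(F_i)=F_{\sigma(i)}$, $\sigma(H_i)=H_{\sigma(i)}$ for a permutation $\sigma\in\Sigma_R$. $\omega$ is a primitive $T$-th root of unity, $\mathbb Z_T=\mathbb Z/T\mathbb Z$. $r$ is the number of cycles of the permutation, $\iota(i)$ a chosen element of the $i$-th cycle, $T_i$ its length. $\mathfrak n$ is $\mathbb Z^r_{\ge0}$-graded with $\sigma^kF_{\iota(i)}$ of degree $e_i$, $\mathfrak n_+$ likewise with $\sigma^kE_{\iota(i)}$. For a non-zero $\lambda\in\mathbb Z^r_{\ge0}$ put $m=\lambda_1+\dots+\lambda_r$, $i_n:=\lambda_1+\dots+\lambda_{i-1}+n$ ($1\le n\le\lambda_i$), $w_\lambda=\prod_{i=1}^r(T/T_i)^{\lambda_i}\lambda_i!$. Free Lie algebra. $\mathfrak a$ is free on $f^{(k)}_i$, $1\le i\le m$, $k\in\mathbb Z_T$; $\tau(f_i^{(k)})=f_i^{(k+1)}$; $\bar{\mathfrak a}=\mathfrak a^\tau$; $\bar g=\sum_{j\in\mathbb Z_T}\tau^jg$; $f_i=f_i^{(0)}$; $\mathbb Z^m_{\ge0}$-grading with $f^{(k)}_i$ of degree $e_i$; $[1^m]$ is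 degree $(1,\dots,1)$. The homomorphism $\jmath:\mathfrak n\to\mathfrak a$, $\jmath(\sigma^kF_{\iota(i)})=\sum_{l=0}^{T/T_i-1}\sum_{n=1}^{\lambda_i}f^{(k+T_il)}_{i_n}$ ($0\le k<T_i$), satisfies $\jmath\sigma=\tau\jmath$; $s:\mathfrak n^\sigma_\lambda\to\bar{\mathfrak a}_{[1^m]}$ is $\jmath$ followed by projection to degree $[1^m]$. Arrangement $\mathcal C_{0;m}$ in $\mathbb C^m$: hyperplanes $t_i=\omega^kt_j$ ($i<j$, $k\in\mathbb Z_T$) and $t_i=0$, with weights $a(t_{i_n}=\omega^kt_{i'_{n'}})=(\alpha_{\iota(i)},\alpha_{\sigma^k(\iota(i'))})$ and $a(t_i=0)=0$. Edges are non-empty intersections of hyperplanes ($\mathbb C^m$ included). $\mathcal F^p$ is the complex space generated by flags $\mathbb C^m=L^0\supset\dots\supset L^p$ of edges, $\operatorname{codim}L^j=j$, modulo: for each $0<i<p$ and each chain with the $i$-th edge missing, the sum of all completing flags is $0$. For a flag $F$ and hyperplanes $H_1,\dots,H_p$, $\langle F,H_1\wedge\dots\wedge H_p\rangle=(-1)^{|s|}$ if $L^i=H_{s(1)}\cap\dots\cap H_{s(i)}$ for all $i$ for some (unique) $s\in\Sigma_p$, else $0$; this is well defined on $\mathcal F^p$. $G^p(F,F')=\sum\langle F,H_1\wedge\dots\wedge H_p\rangle\langle F',H_1\wedge\dots\wedge H_p\rangle a(H_1)\cdots a(H_p)$ over unordered $p$-tuples. Maps $\psi_p:(\bigwedge^p\bar{\mathfrak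 a}\otimes U(\bar{\mathfrak a}))_{[1^m]}\to\mathcal F^{m-p}(\mathcal C_{0;m})$. A commutator is a generator or a bracket of two commutators. For a commutator $g$ with generators $f^{(k_1)}_{i_1},\dots,f^{(k_l)}_{i_l}$ let $L_g:\omega^{k_1}t_{i_1}=\dots=\omega^{k_l}t_{i_l}$ and $L_g^0:t_{i_1}=\dots=t_{i_l}=0$. The $\psi_p$ are the linear maps determined by $\psi_m(\bar f_1\wedge\dots\wedge\bar f_m\otimes1)=(L^0=\mathbb C^m)$ and: whenever $g_i$ are commutators, $x_0$ is a product of elements $\bar g$ ($g$ commutators) and $\psi_{p+1}(\bar g_{p+1}\wedge\dots\wedge\bar g_1\otimes x_0)=\pm(L^0\supset\dots\supset L^q)$, $q=m-p-1$, then with the same sign $\psi_p(\bar g_{p+1}\wedge\dots\wedge\bar g_2\otimes\bar g_1x_0)=\pm(\dots\supset L^q\supset L^q\cap L^0_{g_1})$ and $\psi_p(\bar g_{p+1}\wedge\dots\wedge\bar g_3\wedge\overline{[g_1,g_2]}\otimes x_0)=\pm(\dots\supset L^q\supset L^q\cap L_{[g_1,g_2]})$. The form $\Omega$. $\Omega$ is the skew-symmetric bilinear form on $\mathfrak g^\sigma$ with $\Omega(\varphi(x),y)=-\Omega(y,\varphi(x))=\frac{(-1)^m}{w_\lambda}\,G^m\big(\psi_0(s(x)),\psi_0(s(y))\big)$ for $x,y\in\mathfrak n^\sigma_\lambda$, $\lambda\ne0$ (where $s(x),s(y)\in\bar{\mathfrak a}_{[1^m]}\subset U(\bar{\mathfrak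 a})_{[1^m]}$), and $\Omega=0$ on all other pairs of components of the decomposition $\mathfrak g^\sigma=\bigoplus_\lambda\mathfrak n^\sigma_\lambda\oplus\mathfrak h^\sigma\oplus\bigoplus_\lambda(\mathfrak n^\sigma_+)_\lambda$. *)

theory Defs
  imports
    Complex_Main
    "HOL-Library.Function_Algebras"
    "HOL-Library.Poly_Mapping"
    "HOL-Library.Multiset"
    "HOL-Combinatorics.Permutations"
    "HOL-Combinatorics.Orbits"
begin

section \<open>Lie algebras over the complex numbers\<close>

locale lie_algebra = vector_space scale
  for scale :: "complex \<Rightarrow> 'g::ab_group_add \<Rightarrow> 'g" +
  fixes bracket :: "'g \<Rightarrow> 'g \<Rightarrow> 'g"
  assumes bracket_add_left: "bracket (x + y) z = bracket x z + bracket y z"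
    and bracket_add_right: "bracket x (y + z) = bracket x y + bracket x z"
    and bracket_scale_left: "bracket (scale c x) y = scale c (bracket x y)"
    and bracket_scale_right: "bracket x (scale c y) = scale c (bracket x y)"
    and bracket_self: "bracket x x = 0"
    and jacobi: "bracket x (bracket y z) + bracket y (bracket z x) + bracket z (bracket x y) = 0"
begin

definition subalgebra :: "'g set \<Rightarrow> bool" where
  "subalgebra S \<longleftrightarrow> subspace S \<and> (\<forall>x\<in>S. \<forall>y\<in>S. bracket x y \<in> S)"

definition generated_subalgebra :: "'g set \<Rightarrow> 'g set" where
  "generated_subalgebra X = \<Inter>{S. subalgebra S \<and> X \<subseteq> S}"

text \<open>Iterated brackets of generators; a generator \<open>x\<close> of degree \<open>d\<close> is given as the pair \<open>(x, d)\<close>.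
  Degrees are functions on indices, added pointwise.\<close>

inductive graded_monomial :: "('g \<times> (nat \<Rightarrow> nat)) set \<Rightarrow> 'g \<Rightarrow> (nat \<Rightarrow> nat) \<Rightarrow> bool"
  for X :: "('g \<times> (nat \<Rightarrow> nat)) set" where
  gen: "(x, d) \<in> X \<Longrightarrow> graded_monomial X x d"
| bracket: "graded_monomial X x d \<Longrightarrow> graded_monomial X y e \<Longrightarrow> graded_monomial X (bracket x y) (d + e)"

definition homogeneous :: "('g \<times> (nat \<Rightarrow> nat)) set \<Rightarrow> (nat \<Rightarrow> nat) \<Rightarrow> 'g set" where
  "homogeneous X d = span {x. graded_monomial X x d}"

end

definition unit_degree :: "nat \<Rightarrow> nat \<Rightarrow> nat" where
  "unit_degree i = (\<lambda>j. if j = i then 1 else 0)"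


section \<open>Presentations and free Lie algebras\<close>

datatype 'x lie_term =
    Gen 'x
  | Zero
  | Add "'x lie_term" "'x lie_term"
  | Scale complex "'x lie_term"
  | Bracket "'x lie_term" "'x lie_term"

text \<open>Equality of terms derivable from the Lie algebra axioms and the defining relations \<open>Rel\<close>.\<close>

inductive lie_eq :: "('x lie_term \<times> 'x lie_term) set \<Rightarrow> 'x lie_term \<Rightarrow> 'x lie_term \<Rightarrow> bool"
  for Rel :: "('x lie_term \<times> 'x lie_term) set" where
  rel: "(t, u) \<in> Rel \<Longrightarrow> lie_eq Rel t u"
| refl: "lie_eq Rel t t"
| sym: "lie_eq Rel t u \<Longrightarrow> lie_eq Rel u t"
| trans: "lie_eq Rel t u \<Longrightarrow> lie_eq Rel u v \<Longrightarrow> lie_eq Rel t v"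
| cong_add: "lie_eq Rel t t' \<Longrightarrow> lie_eq Rel u u' \<Longrightarrow> lie_eq Rel (Add t u) (Add t' u')"
| cong_scale: "lie_eq Rel t t' \<Longrightarrow> lie_eq Rel (Scale c t) (Scale c t')"
| cong_bracket: "lie_eq Rel t t' \<Longrightarrow> lie_eq Rel u u' \<Longrightarrow> lie_eq Rel (Bracket t u) (Bracket t' u')"
| add_assoc: "lie_eq Rel (Add (Add t u) v) (Add t (Add u v))"
| add_comm: "lie_eq Rel (Add t u) (Add u t)"
| add_zero: "lie_eq Rel (Add Zero t) t"
| add_inverse: "lie_eq Rel (Add (Scale (- 1) t) t) Zero"
| scale_add_right: "lie_eq Rel (Scale c (Add t u)) (Add (Scale c t) (Scale c u))"
| scale_add_left: "lie_eq Rel (Scale (a + b) t) (Add (Scale a t) (Scale b t))"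
| scale_scale: "lie_eq Rel (Scale a (Scale b t)) (Scale (a * b) t)"
| scale_one: "lie_eq Rel (Scale 1 t) t"
| bracket_add_left: "lie_eq Rel (Bracket (Add t u) v) (Add (Bracket t v) (Bracket u v))"
| bracket_add_right: "lie_eq Rel (Bracket t (Add u v)) (Add (Bracket t u) (Bracket t v))"
| bracket_scale_left: "lie_eq Rel (Bracket (Scale c t) u) (Scale c (Bracket t u))"
| bracket_scale_right: "lie_eq Rel (Bracket t (Scale c u)) (Scale c (Bracket t u))"
| bracket_self: "lie_eq Rel (Bracket t t) Zero"
| jacobi: "lie_eq Rel (Add (Add (Bracket t (Bracket u v)) (Bracket u (Bracket v t)))
                            (Bracket v (Bracket t u))) Zero"

context lie_algebra
begin

primrec eval_term :: "('x \<Rightarrow> 'g) \<Rightarrow> 'x lie_term \<Rightarrow> 'g" where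
  "eval_term \<gamma> (Gen x) = \<gamma> x"
| "eval_term \<gamma> Zero = 0"
| "eval_term \<gamma> (Add t u) = eval_term \<gamma> t + eval_term \<gamma> u"
| "eval_term \<gamma> (Scale c t) = scale c (eval_term \<gamma> t)"
| "eval_term \<gamma> (Bracket t u) = bracket (eval_term \<gamma> t) (eval_term \<gamma> u)"

text \<open>The whole type is the Lie algebra with generators \<open>\<gamma> x\<close>, \<open>x \<in> X\<close>, and defining relations \<open>Rel\<close>:
  the generators generate, and two terms in them agree exactly if the relations force them to.\<close>

definition presented_by ::
  "'x set \<Rightarrow> ('x lie_term \<times> 'x lie_term) set \<Rightarrow> ('x \<Rightarrow> 'g) \<Rightarrow> bool" where
  "presented_by X Rel \<gamma> \<longleftrightarrow>
     (\<forall>z. \<exists>t. set_lie_term t \<subseteq> X \<and> eval_term \<gamma> t = z) \<and>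
     (\<forall>t u. set_lie_term t \<subseteq> X \<longrightarrow> set_lie_term u \<subseteq> X \<longrightarrow>
        (eval_term \<gamma> t = eval_term \<gamma> u \<longleftrightarrow> lie_eq Rel t u))"

end

quotient_type 'x free_lie = "'x lie_term" / "lie_eq {}"
  by (auto intro!: equivpI reflpI sympI transpI intro: lie_eq.refl lie_eq.sym lie_eq.trans)

lift_definition free_gen :: "'x \<Rightarrow> 'x free_lie" is Gen .

lift_definition free_scale :: "complex \<Rightarrow> 'x free_lie \<Rightarrow> 'x free_lie" is Scale
  by (rule lie_eq.cong_scale)

lift_definition free_bracket :: "'x free_lie \<Rightarrow> 'x free_lie \<Rightarrow> 'x free_lie" is Bracket
  by (rule lie_eq.cong_bracket)

instantiation free_lie :: (type) ab_group_add
begin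

lift_definition zero_free_lie :: "'a free_lie" is Zero .

lift_definition plus_free_lie :: "'a free_lie \<Rightarrow> 'a free_lie \<Rightarrow> 'a free_lie" is Add
  by (rule lie_eq.cong_add)

lift_definition uminus_free_lie :: "'a free_lie \<Rightarrow> 'a free_lie" is "Scale (- 1)"
  by (rule lie_eq.cong_scale)

lift_definition minus_free_lie :: "'a free_lie \<Rightarrow> 'a free_lie \<Rightarrow> 'a free_lie"
  is "\<lambda>t u. Add t (Scale (- 1) u)"
  by (intro lie_eq.cong_add lie_eq.cong_scale)

instance
proof
  fix a b c :: "'a free_lie"
  show "a + b + c = a + (b + c)" by transfer (rule lie_eq.add_assoc)
  show "a + b = b + a" by transfer (rule lie_eq.add_comm)
  show "0 + a = a" by transfer (rule lie_eq.add_zero)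
  show "- a + a = 0" by transfer (rule lie_eq.add_inverse)
  show "a - b = a + - b" by transfer (rule lie_eq.refl)
qed

end

global_interpretation free: lie_algebra free_scale free_bracket
proof
  fix a b :: complex and x y z :: "'x free_lie"
  show "free_scale a (x + y) = free_scale a x + free_scale a y"
    by transfer (rule lie_eq.scale_add_right)
  show "free_scale (a + b) x = free_scale a x + free_scale b x"
    by transfer (rule lie_eq.scale_add_left)
  show "free_scale a (free_scale b x) = free_scale (a * b) x"
    by transfer (rule lie_eq.scale_scale)
  show "free_scale 1 x = x" by transfer (rule lie_eq.scale_one)
  show "free_bracket (x + y) z = free_bracket x z + free_bracket y z"
    by transfer (rule lie_eq.bracket_add_left)
  show "free_bracket x (y + z) = free_bracket x y + free_bracket x z"
    by transfer (rule lie_eq.bracket_add_right)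
  show "free_bracket (free_scale a x) y = free_scale a (free_bracket x y)"
    by transfer (rule lie_eq.bracket_scale_left)
  show "free_bracket x (free_scale a y) = free_scale a (free_bracket x y)"
    by transfer (rule lie_eq.bracket_scale_right)
  show "free_bracket x x = 0" by transfer (rule lie_eq.bracket_self)
  show "free_bracket x (free_bracket y z) + free_bracket y (free_bracket z x) +
      free_bracket z (free_bracket x y) = 0"
    by transfer (rule lie_eq.jacobi)
qed

lemma lie_eq_map: "lie_eq {} t u \<Longrightarrow> lie_eq {} (map_lie_term h t) (map_lie_term h u)"
  by (induction rule: lie_eq.induct) (auto intro: lie_eq.intros)

lift_definition free_map :: "('x \<Rightarrow> 'y) \<Rightarrow> 'x free_lie \<Rightarrow> 'y free_lie" is map_lie_term
  by (rule lie_eq_map)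


section \<open>The free Lie algebra on the generators \<open>f_i^(k)\<close>\<close>

text \<open>The generator \<open>f_i^(k)\<close> is \<open>free_gen (i, k)\<close>, with the elements of \<open>\<int>/T\<int>\<close> represented by
  \<open>{..<T}\<close>.  All the algebras \<open>\<aa>\<close> (one for each \<open>m\<close>) sit in one free Lie algebra on countably many
  generators, as the subalgebra generated by the relevant ones.\<close>

definition f_gen :: "nat \<Rightarrow> nat \<Rightarrow> nat \<Rightarrow> (nat \<times> nat) free_lie" where
  "f_gen T i k = free_gen (i, k mod T)"

definition algebra_a :: "nat \<Rightarrow> nat \<Rightarrow> (nat \<times> nat) free_lie set" where
  "algebra_a m T = free.generated_subalgebra {f_gen T i k | i k. i \<in> {1..m} \<and> k < T}"

definition a_homogeneous :: "nat \<Rightarrow> nat \<Rightarrow> (nat \<Rightarrow> nat) \<Rightarrow> (nat \<times> nat) free_lie set" where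
  "a_homogeneous m T d =
     free.homogeneous {(f_gen T i k, unit_degree i) | i k. i \<in> {1..m} \<and> k < T} d"

definition ones :: "nat \<Rightarrow> nat \<Rightarrow> nat" where
  "ones m = (\<lambda>i. if i \<in> {1..m} then 1 else 0)"

definition multilinear_part :: "nat \<Rightarrow> nat \<Rightarrow> (nat \<times> nat) free_lie \<Rightarrow> (nat \<times> nat) free_lie" where
  "multilinear_part m T x =
     (THE y. y \<in> a_homogeneous m T (ones m) \<and>
             x - y \<in> free.span (\<Union>d\<in>{d. d \<noteq> ones m}. a_homogeneous m T d))"

definition tau :: "nat \<Rightarrow> (nat \<times> nat) free_lie \<Rightarrow> (nat \<times> nat) free_lie" where
  "tau T = free_map (\<lambda>(i, k). (i, Suc k mod T))"

definition bar :: "nat \<Rightarrow> (nat \<times> nat) free_lie \<Rightarrow> (nat \<times> nat) free_lie" where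
  "bar T x = (\<Sum>j<T. (tau T ^^ j) x)"

definition a_fixed :: "nat \<Rightarrow> nat \<Rightarrow> (nat \<times> nat) free_lie set" where
  "a_fixed m T = {x \<in> algebra_a m T. tau T x = x}"

definition a_fixed_homogeneous :: "nat \<Rightarrow> nat \<Rightarrow> (nat \<Rightarrow> nat) \<Rightarrow> (nat \<times> nat) free_lie set" where
  "a_fixed_homogeneous m T d = a_fixed m T \<inter> a_homogeneous m T d"

datatype commutator = CGen nat nat | CBracket commutator commutator

primrec comm_value :: "nat \<Rightarrow> commutator \<Rightarrow> (nat \<times> nat) free_lie" where
  "comm_value T (CGen i k) = f_gen T i k"
| "comm_value T (CBracket g h) = free_bracket (comm_value T g) (comm_value T h)"

primrec comm_gens :: "commutator \<Rightarrow> (nat \<times> nat) multiset" where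
  "comm_gens (CGen i k) = {#(i, k)#}"
| "comm_gens (CBracket g h) = comm_gens g + comm_gens h"

definition comm_bar :: "nat \<Rightarrow> commutator \<Rightarrow> (nat \<times> nat) free_lie" where
  "comm_bar T g = bar T (comm_value T g)"

text \<open>A list of commutators of total degree \<open>[1^m]\<close>.\<close>

definition total_degree_ones :: "nat \<Rightarrow> nat \<Rightarrow> commutator list \<Rightarrow> bool" where
  "total_degree_ones m T gs \<longleftrightarrow>
     image_mset fst (\<Sum>g\<leftarrow>gs. comm_gens g) = mset_set {1..m} \<and>
     (\<forall>(i, k) \<in># (\<Sum>g\<leftarrow>gs. comm_gens g). k < T)"


section \<open>Free vector spaces\<close>

definition pm_scale :: "complex \<Rightarrow> ('x \<Rightarrow>\<^sub>0 complex) \<Rightarrow> ('x \<Rightarrow>\<^sub>0 complex)" where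
  "pm_scale c v = Poly_Mapping.map ((*) c) v"

lemma lookup_pm_scale [simp]: "Poly_Mapping.lookup (pm_scale c v) x = c * Poly_Mapping.lookup v x"
  by (simp add: pm_scale_def Poly_Mapping.map.rep_eq when_def)

global_interpretation pm: vector_space "pm_scale :: complex \<Rightarrow> ('x \<Rightarrow>\<^sub>0 complex) \<Rightarrow> ('x \<Rightarrow>\<^sub>0 complex)"
  by unfold_locales (auto intro!: poly_mapping_eqI simp: Poly_Mapping.lookup_add algebra_simps)

abbreviation basis_vec :: "'x \<Rightarrow> ('x \<Rightarrow>\<^sub>0 complex)" where
  "basis_vec x \<equiv> Poly_Mapping.single x 1"

text \<open>Linear maps between quotients \<open>A / (A \<inter> M)\<close> and \<open>B / N\<close> of subspaces of free vector spaces are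
  given by linear maps of the ambient free vector spaces which are compatible with the subspaces;
  equations between values are understood modulo \<open>N\<close>.\<close>

definition induces_linear ::
  "('x \<Rightarrow>\<^sub>0 complex) set \<Rightarrow> ('x \<Rightarrow>\<^sub>0 complex) set \<Rightarrow> ('y \<Rightarrow>\<^sub>0 complex) set \<Rightarrow> ('y \<Rightarrow>\<^sub>0 complex) set \<Rightarrow>
   (('x \<Rightarrow>\<^sub>0 complex) \<Rightarrow> ('y \<Rightarrow>\<^sub>0 complex)) \<Rightarrow> bool" where
  "induces_linear A M B N h \<longleftrightarrow>
     Vector_Spaces.linear pm_scale pm_scale h \<and> h ` A \<subseteq> B \<and> h ` (A \<inter> M) \<subseteq> N"


section \<open>The complex \<open>\<Lambda> \<otimes> U\<close>\<close>

text \<open>The pair of lists \<open>([w_1,...,w_p], [u_1,...,u_n])\<close> stands for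
  \<open>w_1 \<and> ... \<and> w_p \<otimes> u_1 ... u_n\<close> in \<open>\<Lambda>^p V \<otimes> U(V)\<close>, where \<open>V\<close> is the fixed-point algebra
  \<open>a_fixed m T\<close>.  This space is the free vector space on such pairs modulo \<open>wedge_U_relations\<close>.\<close>

type_synonym wedge_U = "((nat \<times> nat) free_lie list \<times> (nat \<times> nat) free_lie list) \<Rightarrow>\<^sub>0 complex"

definition wedge_U_relations :: "nat \<Rightarrow> nat \<Rightarrow> nat \<Rightarrow> wedge_U set" where
  "wedge_U_relations m T p = pm.span (
     {basis_vec (ws @ [free_scale a x + free_scale b y] @ ws', us)
        - pm_scale a (basis_vec (ws @ [x] @ ws', us)) - pm_scale b (basis_vec (ws @ [y] @ ws', us))
      | ws ws' us x y a b. length ws + length ws' + 1 = p \<and>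
          set ws \<union> set ws' \<union> set us \<union> {x, y} \<subseteq> a_fixed m T}
   \<union> {basis_vec (ws, us @ [free_scale a x + free_scale b y] @ us')
        - pm_scale a (basis_vec (ws, us @ [x] @ us')) - pm_scale b (basis_vec (ws, us @ [y] @ us'))
      | ws us us' x y a b. length ws = p \<and>
          set ws \<union> set us \<union> set us' \<union> {x, y} \<subseteq> a_fixed m T}
   \<union> {basis_vec (ws, us) | ws us. length ws = p \<and> set ws \<union> set us \<subseteq> a_fixed m T \<and>
        (\<exists>i j. i < j \<and> j < p \<and> ws ! i = ws ! j)}
   \<union> {basis_vec (ws, us @ [x, y] @ us') - basis_vec (ws, us @ [y, x] @ us')
        - basis_vec (ws, us @ [free_bracket x y] @ us')
      | ws us us' x y. length ws = p \<and>
          set ws \<union> set us \<union> set us' \<union> {x, y} \<subseteq> a_fixed m T})"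

text \<open>The part of degree \<open>[1^m]\<close> (before taking the quotient).\<close>

definition wedge_U_multilinear :: "nat \<Rightarrow> nat \<Rightarrow> nat \<Rightarrow> wedge_U set" where
  "wedge_U_multilinear m T p = pm.span
     {basis_vec (ws, us) | ws us. length ws = p \<and>
        (\<exists>ds. list_all2 (\<lambda>w d. w \<in> a_fixed_homogeneous m T d) (ws @ us) ds \<and> sum_list ds = ones m)}"

definition comm_wedge :: "nat \<Rightarrow> commutator list \<Rightarrow> commutator list \<Rightarrow> wedge_U" where
  "comm_wedge T gs xs = basis_vec (map (comm_bar T) gs, map (comm_bar T) xs)"


section \<open>The arrangement \<open>C_{0;m}\<close>, flags and the form \<open>G\<close>\<close>

text \<open>\<open>\<complex>^m\<close> is realised as the functions \<open>t :: nat \<Rightarrow> complex\<close> vanishing outside \<open>{1..m}\<close>.\<close>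

type_synonym pt = "nat \<Rightarrow> complex"

definition pt_scale :: "complex \<Rightarrow> pt \<Rightarrow> pt" where
  "pt_scale c t = (\<lambda>i. c * t i)"

global_interpretation pt: vector_space pt_scale
  by unfold_locales (auto simp: pt_scale_def fun_eq_iff algebra_simps)

definition Cspace :: "nat \<Rightarrow> pt set" where
  "Cspace m = {t. \<forall>i. i \<notin> {1..m} \<longrightarrow> t i = 0}"

text \<open>\<open>HEq i j k\<close> is \<open>t_i = \<omega>^k t_j\<close> and \<open>HZero i\<close> is \<open>t_i = 0\<close>.  For \<open>i < j\<close>, \<open>k < T\<close> and a
  primitive \<open>T\<close>-th root of unity \<open>\<omega>\<close> different indices give different hyperplanes.\<close>

datatype hyp = HEq nat nat nat | HZero nat

primrec hyp_set :: "nat \<Rightarrow> complex \<Rightarrow> hyp \<Rightarrow> pt set" where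
  "hyp_set m \<omega> (HEq i j k) = {t \<in> Cspace m. t i = \<omega> ^ k * t j}"
| "hyp_set m \<omega> (HZero i) = {t \<in> Cspace m. t i = 0}"

definition hyps :: "nat \<Rightarrow> nat \<Rightarrow> hyp set" where
  "hyps m T = {HEq i j k | i j k. 1 \<le> i \<and> i < j \<and> j \<le> m \<and> k < T} \<union> {HZero i | i. i \<in> {1..m}}"

definition edges :: "nat \<Rightarrow> nat \<Rightarrow> complex \<Rightarrow> pt set set" where
  "edges m T \<omega> = {L. L \<noteq> {} \<and> (\<exists>S \<subseteq> hyps m T. L = Cspace m \<inter> (\<Inter>H\<in>S. hyp_set m \<omega> H))}"

definition flags :: "nat \<Rightarrow> nat \<Rightarrow> complex \<Rightarrow> nat \<Rightarrow> pt set list set" where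
  "flags m T \<omega> p = {Ls. length Ls = Suc p \<and> Ls ! 0 = Cspace m \<and>
     (\<forall>j\<le>p. Ls ! j \<in> edges m T \<omega> \<and> pt.dim (Ls ! j) + j = m) \<and>
     (\<forall>j<p. Ls ! Suc j \<subseteq> Ls ! j)}"

text \<open>The space \<open>\<F>^p\<close> is \<open>flag_space m T \<omega> p\<close> modulo \<open>flag_relations m T \<omega> p\<close>.  In the relations the
  entry of \<open>E\<close> at position \<open>i\<close> is irrelevant: \<open>E\<close> only serves as a chain with the \<open>i\<close>-th edge missing.
  If it cannot be completed the sum is empty.\<close>

type_synonym flag_vec = "pt set list \<Rightarrow>\<^sub>0 complex"

definition flag_space :: "nat \<Rightarrow> nat \<Rightarrow> complex \<Rightarrow> nat \<Rightarrow> flag_vec set" where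
  "flag_space m T \<omega> p = pm.span (basis_vec ` flags m T \<omega> p)"

definition flag_relations :: "nat \<Rightarrow> nat \<Rightarrow> complex \<Rightarrow> nat \<Rightarrow> flag_vec set" where
  "flag_relations m T \<omega> p = pm.span
     {(\<Sum>Ls\<in>{Ls \<in> flags m T \<omega> p. \<forall>j\<le>p. j \<noteq> i \<longrightarrow> Ls ! j = E ! j}. basis_vec Ls)
      | i E. 0 < i \<and> i < p \<and> length E = Suc p}"

definition flag_eq :: "nat \<Rightarrow> nat \<Rightarrow> complex \<Rightarrow> nat \<Rightarrow> flag_vec \<Rightarrow> flag_vec \<Rightarrow> bool" where
  "flag_eq m T \<omega> p u v \<longleftrightarrow> u - v \<in> flag_relations m T \<omega> p"

text \<open>\<open>\<langle>L, H_1 \<and> ... \<and> H_p\<rangle>\<close>, where \<open>Hs = [H_1,...,H_p]\<close>; positions in lists start at \<open>0\<close>.\<close>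

definition flag_perm :: "nat \<Rightarrow> complex \<Rightarrow> pt set list \<Rightarrow> hyp list \<Rightarrow> (nat \<Rightarrow> nat) \<Rightarrow> bool" where
  "flag_perm m \<omega> Ls Hs s \<longleftrightarrow> s permutes {..<length Hs} \<and>
     (\<forall>i\<le>length Hs. Ls ! i = Cspace m \<inter> (\<Inter>j<i. hyp_set m \<omega> (Hs ! s j)))"

definition flag_pairing :: "nat \<Rightarrow> complex \<Rightarrow> pt set list \<Rightarrow> hyp list \<Rightarrow> complex" where
  "flag_pairing m \<omega> Ls Hs =
     (if \<exists>s. flag_perm m \<omega> Ls Hs s then of_int (sign (THE s. flag_perm m \<omega> Ls Hs s)) else 0)"

definition pairing :: "nat \<Rightarrow> complex \<Rightarrow> flag_vec \<Rightarrow> hyp list \<Rightarrow> complex" where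
  "pairing m \<omega> v Hs = (\<Sum>Ls\<in>Poly_Mapping.keys v. Poly_Mapping.lookup v Ls * flag_pairing m \<omega> Ls Hs)"

text \<open>The sum over unordered \<open>p\<close>-tuples; the summand does not depend on the chosen ordering.\<close>

definition flag_form ::
  "nat \<Rightarrow> nat \<Rightarrow> complex \<Rightarrow> (hyp \<Rightarrow> complex) \<Rightarrow> nat \<Rightarrow> flag_vec \<Rightarrow> flag_vec \<Rightarrow> complex" where
  "flag_form m T \<omega> a p u v =
     (\<Sum>A\<in>{A. A \<subseteq> hyps m T \<and> card A = p}.
        let Hs = (SOME Hs. distinct Hs \<and> set Hs = A)
        in pairing m \<omega> u Hs * pairing m \<omega> v Hs * (\<Prod>H\<in>A. a H))"


section \<open>The maps \<open>\<psi>_p\<close>\<close>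

definition L_comm :: "nat \<Rightarrow> complex \<Rightarrow> commutator \<Rightarrow> pt set" where
  "L_comm m \<omega> g = {t \<in> Cspace m. \<forall>(i, k) \<in># comm_gens g. \<forall>(i', k') \<in># comm_gens g.
     \<omega> ^ k * t i = \<omega> ^ k' * t i'}"

definition L0_comm :: "nat \<Rightarrow> commutator \<Rightarrow> pt set" where
  "L0_comm m g = {t \<in> Cspace m. \<forall>(i, k) \<in># comm_gens g. t i = 0}"

definition psi_maps :: "nat \<Rightarrow> nat \<Rightarrow> complex \<Rightarrow> (nat \<Rightarrow> wedge_U \<Rightarrow> flag_vec) \<Rightarrow> bool" where
  "psi_maps m T \<omega> \<psi> \<longleftrightarrow>
     (\<forall>p\<le>m. induces_linear (wedge_U_multilinear m T p) (wedge_U_relations m T p)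
                (flag_space m T \<omega> (m - p)) (flag_relations m T \<omega> (m - p)) (\<psi> p)) \<and>
     flag_eq m T \<omega> 0 (\<psi> m (comm_wedge T (map (\<lambda>i. CGen i 0) [1..<Suc m]) []))
                      (basis_vec [Cspace m]) \<and>
     (\<forall>p gs g1 xs Ls \<epsilon>.
        p + 1 \<le> m \<longrightarrow> length gs = p \<longrightarrow> total_degree_ones m T (gs @ [g1] @ xs) \<longrightarrow>
        Ls \<in> flags m T \<omega> (m - p - 1) \<longrightarrow> \<epsilon> \<in> {1, -1} \<longrightarrow>
        flag_eq m T \<omega> (m - p - 1) (\<psi> (p + 1) (comm_wedge T (gs @ [g1]) xs))
                                   (pm_scale \<epsilon> (basis_vec Ls)) \<longrightarrow>
        flag_eq m T \<omega> (m - p) (\<psi> p (comm_wedge T gs (g1 # xs)))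
                               (pm_scale \<epsilon> (basis_vec (Ls @ [last Ls \<inter> L0_comm m g1])))) \<and>
     (\<forall>p gs g1 g2 xs Ls \<epsilon>.
        p + 1 \<le> m \<longrightarrow> length gs + 1 = p \<longrightarrow> total_degree_ones m T (gs @ [g2, g1] @ xs) \<longrightarrow>
        Ls \<in> flags m T \<omega> (m - p - 1) \<longrightarrow> \<epsilon> \<in> {1, -1} \<longrightarrow>
        flag_eq m T \<omega> (m - p - 1) (\<psi> (p + 1) (comm_wedge T (gs @ [g2, g1]) xs))
                                   (pm_scale \<epsilon> (basis_vec Ls)) \<longrightarrow>
        flag_eq m T \<omega> (m - p) (\<psi> p (comm_wedge T (gs @ [CBracket g1 g2]) xs))
                               (pm_scale \<epsilon> (basis_vec (Ls @ [last Ls \<inter> L_comm m \<omega> (CBracket g1 g2)]))))"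

text \<open>\<open>\<psi>_0\<close> of an element of the Lie algebra, regarded as an element of its enveloping algebra.\<close>

definition psi0 :: "(nat \<Rightarrow> wedge_U \<Rightarrow> flag_vec) \<Rightarrow> (nat \<times> nat) free_lie \<Rightarrow> flag_vec" where
  "psi0 \<psi> u = \<psi> 0 (basis_vec ([], [u]))"


section \<open>The Lie algebra \<open>\<g>\<close>\<close>

definition dual_vector :: "('h \<Rightarrow> 'h \<Rightarrow> complex) \<Rightarrow> ('h \<Rightarrow> complex) \<Rightarrow> 'h" where
  "dual_vector B l = (THE v. \<forall>H. B v H = l H)"

text \<open>The form induced on the dual space.\<close>

definition dual_form :: "('h \<Rightarrow> 'h \<Rightarrow> complex) \<Rightarrow> ('h \<Rightarrow> complex) \<Rightarrow> ('h \<Rightarrow> complex) \<Rightarrow> complex" where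
  "dual_form B l l' = B (dual_vector B l) (dual_vector B l')"

definition bilinear_form :: "(complex \<Rightarrow> 'v::ab_group_add \<Rightarrow> 'v) \<Rightarrow> ('v \<Rightarrow> 'v \<Rightarrow> complex) \<Rightarrow> bool" where
  "bilinear_form sc b \<longleftrightarrow>
     (\<forall>x. Vector_Spaces.linear sc (*) (\<lambda>y. b x y)) \<and> (\<forall>y. Vector_Spaces.linear sc (*) (\<lambda>x. b x y))"

locale cartan_data = h: vector_space sh
  for sh :: "complex \<Rightarrow> 'h::ab_group_add \<Rightarrow> 'h" +
  fixes B :: "'h \<Rightarrow> 'h \<Rightarrow> complex"
    and R :: nat
    and \<alpha> :: "nat \<Rightarrow> 'h \<Rightarrow> complex"
    and Hc :: "nat \<Rightarrow> 'h"
  assumes finite_dim: "\<exists>S. finite S \<and> h.span S = UNIV"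
    and B_bilinear: "bilinear_form sh B"
    and B_sym: "B H H' = B H' H"
    and B_nondegenerate: "(\<And>H'. B H H' = 0) \<Longrightarrow> H = 0"
    and alpha_linear: "i \<in> {1..R} \<Longrightarrow> Vector_Spaces.linear sh (*) (\<alpha> i)"
    and alpha_independent:
      "(\<And>H. (\<Sum>i=1..R. c i * \<alpha> i H) = 0) \<Longrightarrow> i \<in> {1..R} \<Longrightarrow> c i = 0"
    and Hc: "i \<in> {1..R} \<Longrightarrow> Vector_Spaces.linear sh (*) l \<Longrightarrow> l (Hc i) = dual_form B (\<alpha> i) l"

datatype 'h g_gen = GenE nat | GenF nat | GenH 'h

definition g_gens :: "nat \<Rightarrow> 'h g_gen set" where
  "g_gens R = GenE ` {1..R} \<union> GenF ` {1..R} \<union> range GenH"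

text \<open>The first two families of relations make the generators from the vector space \<open>\<h>\<close> depend
  linearly on the element.\<close>

definition g_relations ::
  "(complex \<Rightarrow> 'h::ab_group_add \<Rightarrow> 'h) \<Rightarrow> nat \<Rightarrow> (nat \<Rightarrow> 'h \<Rightarrow> complex) \<Rightarrow> (nat \<Rightarrow> 'h) \<Rightarrow>
   ('h g_gen lie_term \<times> 'h g_gen lie_term) set" where
  "g_relations sh R \<alpha> Hc =
     {(Gen (GenH (H + H')), Add (Gen (GenH H)) (Gen (GenH H'))) | H H'. True}
   \<union> {(Gen (GenH (sh c H)), Scale c (Gen (GenH H))) | c H. True}
   \<union> {(Bracket (Gen (GenE i)) (Gen (GenF j)), if i = j then Gen (GenH (Hc i)) else Zero)
      | i j. i \<in> {1..R} \<and> j \<in> {1..R}}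
   \<union> {(Bracket (Gen (GenH H)) (Gen (GenE i)), Scale (\<alpha> i H) (Gen (GenE i))) | H i. i \<in> {1..R}}
   \<union> {(Bracket (Gen (GenH H)) (Gen (GenF i)), Scale (- \<alpha> i H) (Gen (GenF i))) | H i. i \<in> {1..R}}
   \<union> {(Bracket (Gen (GenH H)) (Gen (GenH H')), Zero) | H H'. True}"

locale g_algebra = cartan_data sh B R \<alpha> Hc + g: lie_algebra sg br
  for sh :: "complex \<Rightarrow> 'h::ab_group_add \<Rightarrow> 'h"
    and B :: "'h \<Rightarrow> 'h \<Rightarrow> complex"
    and R :: nat
    and \<alpha> :: "nat \<Rightarrow> 'h \<Rightarrow> complex"
    and Hc :: "nat \<Rightarrow> 'h"
    and sg :: "complex \<Rightarrow> 'g::ab_group_add \<Rightarrow> 'g"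
    and br :: "'g \<Rightarrow> 'g \<Rightarrow> 'g" +
  fixes inc :: "'h \<Rightarrow> 'g"
    and E F :: "nat \<Rightarrow> 'g"
  assumes presentation:
    "g.presented_by (g_gens R) (g_relations sh R \<alpha> Hc) (case_g_gen E F inc)"
begin

definition n_minus :: "'g set" where
  "n_minus = g.generated_subalgebra (F ` {1..R})"

definition n_plus :: "'g set" where
  "n_plus = g.generated_subalgebra (E ` {1..R})"

end

definition shapovalov_form ::
  "('g \<Rightarrow> 'g \<Rightarrow> complex) \<Rightarrow> ('g \<Rightarrow> 'g) \<Rightarrow> 'g \<Rightarrow> 'g \<Rightarrow> complex" where
  "shapovalov_form K \<phi> x y = K (\<phi> x) y"

definition form_kernel :: "('g \<Rightarrow> 'g \<Rightarrow> complex) \<Rightarrow> 'g set" where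
  "form_kernel S = {x. \<forall>y. S x y = 0}"

definition fixed_points :: "('g \<Rightarrow> 'g) \<Rightarrow> 'g set" where
  "fixed_points \<sigma> = {x. \<sigma> x = x}"

locale g_forms = g_algebra sh B R \<alpha> Hc sg br inc E F
  for sh :: "complex \<Rightarrow> 'h::ab_group_add \<Rightarrow> 'h"
    and B R \<alpha> Hc
    and sg :: "complex \<Rightarrow> 'g::ab_group_add \<Rightarrow> 'g"
    and br inc E F +
  fixes \<phi> :: "'g \<Rightarrow> 'g"
    and K :: "'g \<Rightarrow> 'g \<Rightarrow> complex"
  assumes phi_linear: "Vector_Spaces.linear sg sg \<phi>"
    and phi_bij: "bij \<phi>"
    and phi_bracket: "\<phi> (br x y) = br (\<phi> y) (\<phi> x)"
    and phi_E: "i \<in> {1..R} \<Longrightarrow> \<phi> (E i) = F i"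
    and phi_F: "i \<in> {1..R} \<Longrightarrow> \<phi> (F i) = E i"
    and phi_h: "\<phi> (inc H) = inc H"
    and K_bilinear: "bilinear_form sg K"
    and K_sym: "K x y = K y x"
    and K_invariant: "K (br x y) z = K x (br y z)"
    and K_h: "K (inc H) (inc H') = B H H'"
    and K_EF: "i \<in> {1..R} \<Longrightarrow> j \<in> {1..R} \<Longrightarrow> K (E i) (F j) = (if i = j then 1 else 0)"
    and K_minus: "x \<in> n_minus \<Longrightarrow> y \<in> n_minus \<Longrightarrow> K x y = 0"
    and K_plus: "x \<in> n_plus \<Longrightarrow> y \<in> n_plus \<Longrightarrow> K x y = 0"
    and K_h_orthogonal: "x \<in> n_minus \<union> n_plus \<Longrightarrow> K (inc H) x = 0"

definition primitive_root_of_unity :: "nat \<Rightarrow> complex \<Rightarrow> bool" where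
  "primitive_root_of_unity T \<omega> \<longleftrightarrow> \<omega> ^ T = 1 \<and> (\<forall>k. 0 < k \<and> k < T \<longrightarrow> \<omega> ^ k \<noteq> 1)"

text \<open>\<open>\<pi>\<close> is the permutation of \<open>{1..R}\<close> induced by \<open>\<sigma>\<close>, \<open>\<iota> 1, ..., \<iota> r\<close> represent its cycles
  (fixed points included).\<close>

locale diagram_automorphism = g_forms sh B R \<alpha> Hc sg br inc E F \<phi> K
  for sh :: "complex \<Rightarrow> 'h::ab_group_add \<Rightarrow> 'h"
    and B R \<alpha> Hc
    and sg :: "complex \<Rightarrow> 'g::ab_group_add \<Rightarrow> 'g"
    and br inc E F \<phi> K +
  fixes \<sigma> :: "'g \<Rightarrow> 'g"
    and \<pi> :: "nat \<Rightarrow> nat"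
    and T :: nat
    and \<omega> :: complex
    and r :: nat
    and \<iota> :: "nat \<Rightarrow> nat"
  assumes sigma_linear: "Vector_Spaces.linear sg sg \<sigma>"
    and sigma_bij: "bij \<sigma>"
    and sigma_bracket: "\<sigma> (br x y) = br (\<sigma> x) (\<sigma> y)"
    and T_pos: "0 < T"
    and sigma_pow_T: "\<sigma> ^^ T = id"
    and sigma_order: "0 < k \<Longrightarrow> k < T \<Longrightarrow> \<sigma> ^^ k \<noteq> id"
    and sigma_h: "\<sigma> ` range inc = range inc"
    and sigma_B: "\<sigma> (inc H1) = inc H1' \<Longrightarrow> \<sigma> (inc H2) = inc H2' \<Longrightarrow> B H1' H2' = B H1 H2"
    and pi_permutes: "\<pi> permutes {1..R}"
    and sigma_E: "i \<in> {1..R} \<Longrightarrow> \<sigma> (E i) = E (\<pi> i)"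
    and sigma_F: "i \<in> {1..R} \<Longrightarrow> \<sigma> (F i) = F (\<pi> i)"
    and sigma_H: "i \<in> {1..R} \<Longrightarrow> \<sigma> (inc (Hc i)) = inc (Hc (\<pi> i))"
    and omega: "primitive_root_of_unity T \<omega>"
    and iota_range: "\<iota> ` {1..r} \<subseteq> {1..R}"
    and iota_cycles: "bij_betw (\<lambda>i. orbit \<pi> (\<iota> i)) {1..r} (orbit \<pi> ` {1..R})"
begin

definition cycle_length :: "nat \<Rightarrow> nat" where
  "cycle_length i = card (orbit \<pi> (\<iota> i))"

text \<open>The elements of \<open>\<int>_{\<ge>0}^r\<close>.\<close>

definition degrees :: "(nat \<Rightarrow> nat) set" where
  "degrees = {l. \<forall>i. i \<notin> {1..r} \<longrightarrow> l i = 0}"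

definition n_minus_deg :: "(nat \<Rightarrow> nat) \<Rightarrow> 'g set" where
  "n_minus_deg l = g.homogeneous {((\<sigma> ^^ k) (F (\<iota> i)), unit_degree i) | i k. i \<in> {1..r}} l"

definition n_plus_deg :: "(nat \<Rightarrow> nat) \<Rightarrow> 'g set" where
  "n_plus_deg l = g.homogeneous {((\<sigma> ^^ k) (E (\<iota> i)), unit_degree i) | i k. i \<in> {1..r}} l"

definition weight_sum :: "(nat \<Rightarrow> nat) \<Rightarrow> nat" where
  "weight_sum l = (\<Sum>i=1..r. l i)"

text \<open>The index \<open>i_n\<close>.\<close>

definition position :: "(nat \<Rightarrow> nat) \<Rightarrow> nat \<Rightarrow> nat \<Rightarrow> nat" where
  "position l i n = (\<Sum>j=1..<i. l j) + n"

text \<open>The \<open>i\<close> with \<open>p = i_n\<close> for some \<open>1 \<le> n \<le> \<lambda>_i\<close>.\<close>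

definition block :: "(nat \<Rightarrow> nat) \<Rightarrow> nat \<Rightarrow> nat" where
  "block l p = (THE i. i \<in> {1..r} \<and> (\<exists>n\<in>{1..l i}. p = position l i n))"

definition w :: "(nat \<Rightarrow> nat) \<Rightarrow> nat" where
  "w l = (\<Prod>i=1..r. (T div cycle_length i) ^ l i * fact (l i))"

primrec hyp_weight :: "(nat \<Rightarrow> nat) \<Rightarrow> hyp \<Rightarrow> complex" where
  "hyp_weight l (HEq p q k) =
     dual_form B (\<alpha> (\<iota> (block l p))) (\<alpha> ((\<pi> ^^ k) (\<iota> (block l q))))"
| "hyp_weight l (HZero p) = 0"

text \<open>The Lie algebra homomorphism from \<open>\<n>\<close> to the free Lie algebra, for the degree \<open>l\<close>.\<close>

definition jmath_hom :: "(nat \<Rightarrow> nat) \<Rightarrow> ('g \<Rightarrow> (nat \<times> nat) free_lie) \<Rightarrow> bool" where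
  "jmath_hom l j \<longleftrightarrow>
     (\<forall>x\<in>n_minus. \<forall>y\<in>n_minus. j (x + y) = j x + j y) \<and>
     (\<forall>c. \<forall>x\<in>n_minus. j (sg c x) = free_scale c (j x)) \<and>
     (\<forall>x\<in>n_minus. \<forall>y\<in>n_minus. j (br x y) = free_bracket (j x) (j y)) \<and>
     (\<forall>i\<in>{1..r}. \<forall>k<cycle_length i.
        j ((\<sigma> ^^ k) (F (\<iota> i))) =
          (\<Sum>q<T div cycle_length i. \<Sum>n=1..l i. f_gen T (position l i n) (k + cycle_length i * q)))"

definition s_map :: "(nat \<Rightarrow> nat) \<Rightarrow> ('g \<Rightarrow> (nat \<times> nat) free_lie) \<Rightarrow> 'g \<Rightarrow> (nat \<times> nat) free_lie" where
  "s_map l j x = multilinear_part (weight_sum l) T (j x)"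

end

datatype component = Neg "nat \<Rightarrow> nat" | Cartan | Pos "nat \<Rightarrow> nat"

context diagram_automorphism
begin

definition components :: "component set" where
  "components = {Cartan} \<union> Neg ` (degrees - {0}) \<union> Pos ` (degrees - {0})"

fun component_space :: "component \<Rightarrow> 'g set" where
  "component_space (Neg l) = n_minus_deg l \<inter> fixed_points \<sigma>"
| "component_space Cartan = range inc \<inter> fixed_points \<sigma>"
| "component_space (Pos l) = n_plus_deg l \<inter> fixed_points \<sigma>"

end

text \<open>\<open>jm l\<close> is the homomorphism belonging to the degree \<open>l\<close>, and \<open>\<psi> m\<close> is the family of maps
  \<open>\<psi>_p\<close> for the arrangement in \<open>\<complex>^m\<close>.  Only the values of \<open>\<Omega>\<close> on fixed points of \<open>\<sigma>\<close> matter.\<close>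

locale omega_form = diagram_automorphism sh B R \<alpha> Hc sg br inc E F \<phi> K \<sigma> \<pi> T \<omega> r \<iota>
  for sh :: "complex \<Rightarrow> 'h::ab_group_add \<Rightarrow> 'h"
    and B R \<alpha> Hc
    and sg :: "complex \<Rightarrow> 'g::ab_group_add \<Rightarrow> 'g"
    and br inc E F \<phi> K \<sigma> \<pi> T \<omega> r \<iota> +
  fixes jm :: "(nat \<Rightarrow> nat) \<Rightarrow> 'g \<Rightarrow> (nat \<times> nat) free_lie"
    and \<psi> :: "nat \<Rightarrow> nat \<Rightarrow> wedge_U \<Rightarrow> flag_vec"
    and \<Omega> :: "'g \<Rightarrow> 'g \<Rightarrow> complex"
  assumes jmath: "l \<in> degrees \<Longrightarrow> l \<noteq> 0 \<Longrightarrow> jmath_hom l (jm l)"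
    and psi: "0 < m \<Longrightarrow> psi_maps m T \<omega> (\<psi> m)"
    and Omega_add: "x \<in> fixed_points \<sigma> \<Longrightarrow> y \<in> fixed_points \<sigma> \<Longrightarrow> z \<in> fixed_points \<sigma> \<Longrightarrow>
      \<Omega> (x + y) z = \<Omega> x z + \<Omega> y z"
    and Omega_scale: "x \<in> fixed_points \<sigma> \<Longrightarrow> y \<in> fixed_points \<sigma> \<Longrightarrow> \<Omega> (sg c x) y = c * \<Omega> x y"
    and Omega_skew: "x \<in> fixed_points \<sigma> \<Longrightarrow> y \<in> fixed_points \<sigma> \<Longrightarrow> \<Omega> x y = - \<Omega> y x"
    and Omega_value: "l \<in> degrees \<Longrightarrow> l \<noteq> 0 \<Longrightarrow>
      x \<in> n_minus_deg l \<inter> fixed_points \<sigma> \<Longrightarrow> y \<in> n_minus_deg l \<inter> fixed_points \<sigma> \<Longrightarrow>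
      \<Omega> (\<phi> x) y = (- 1) ^ weight_sum l / of_nat (w l) *
        flag_form (weight_sum l) T \<omega> (hyp_weight l) (weight_sum l)
          (psi0 (\<psi> (weight_sum l)) (s_map l (jm l) x)) (psi0 (\<psi> (weight_sum l)) (s_map l (jm l) y))"
    and Omega_zero: "C \<in> components \<Longrightarrow> D \<in> components \<Longrightarrow>
      (\<nexists>l. {C, D} = {Neg l, Pos l}) \<Longrightarrow>
      x \<in> component_space C \<Longrightarrow> y \<in> component_space D \<Longrightarrow> \<Omega> x y = 0"

end

(*
  A commutator g of degree [1^m] is turned into the polynomial P_g whose terms are the spanning trees
  that arise by choosing, for every bracket [u, v] in g, a hyperplane joining a generator of u to one of v.
  Pairing two such polynomials, weighted by the exponents of the arrangement, computes the Shapovalov form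
  on multilinear words: both sides satisfy the same recursion along the cobracket, because differentiating
  P_g in the direction of a potential on the vertices produces the cobracket of g.

  The image of g under psi_0 is a signed flag, and its pairing with m hyperplanes is a sum over the one
  hyperplane omitted from a spanning tree, with signs given by determinants of incidence vectors.
  Therefore G^m(psi_0(x), psi_0(g)) is a linear combination of Shapovalov pairings of x with
  the rotations of g and with the brackets [g_1, tau^c g_2] where g_1, g_2 are the terms of the cobracket of g.
  All of these vanish when x lies in the kernel of the Shapovalov form.
*)

theory Submission
  imports Defs "Jordan_Normal_Form.Determinant"
begin

subsection \<open>Squarefree polynomials\<close>

text \<open>The maps \<psi>_p are known only through rules on wedges of commutators, up to sign and
  modulo the flag relations. Their values are therefore never unfolded; they are pinned down by
  pairing them with hyperplanes, along an invariant that every rule preserves. Signs come from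
  determinants because two orderings of the same rows differ by one common sign, which cancels in
  products.

  The hyperplanes t_i = \<omega>^k t_j are the edges of a gain graph on m vertices. A flag ending at
  the origin is cut out by a spanning tree and one more hyperplane that does not contain the line
  left by the tree. If two different hyperplanes e and e' of one tuple are omitted in the two
  arguments of G^m, the common forest has two components, both joined by e and by e'. The gain of e'
  differs from the one that h prescribes by some c from 1 to T - 1; this is the origin of the
  rotations \<tau>^c.

  The first argument is a fixed point, hence 1/T times its own bar. The formula for G^m is proved
  for words in the F_a, which need not be fixed, and is then extended linearly to all of
  \<open>n_minus\<close> before x is inserted.\<close>

text \<open>A function \<open>p\<close> on finite sets of edges stands for the polynomial with terms \<open>p A\<close> times the
  product of the variables in \<open>A\<close>; then \<open>conv\<close> is multiplication modulo the squares of the variables.\<close>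

definition conv :: "('e set \<Rightarrow> complex) \<Rightarrow> ('e set \<Rightarrow> complex) \<Rightarrow> 'e set \<Rightarrow> complex" where
  "conv p q A = (\<Sum>B\<in>Pow A. p B * q (A - B))"

lemma conv_commute: "conv p q = conv q p"
proof
  fix A
  show "conv p q A = conv q p A" unfolding conv_def
    by (rule sum.reindex_bij_witness[of _ "\<lambda>B. A - B" "\<lambda>B. A - B"]) (auto simp: double_diff)
qed

text \<open>The power set is infinite here and the sum takes its default value. This makes
  associativity an equation between functions, usable as a rewrite rule.\<close>

lemma conv_infinite: "infinite A \<Longrightarrow> conv p q A = 0"
  by (simp add: conv_def)

lemma conv_assoc: "conv (conv p q) s = conv p (conv q s)"
proof
  fix A
  show "conv (conv p q) s A = conv p (conv q s) A"
  proof (cases "finite A")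
    case True
    have fin: "finite B" if "B \<in> Pow A" for B using that True by (auto intro: finite_subset)
    have "conv (conv p q) s A = (\<Sum>(B,C)\<in>Sigma (Pow A) Pow. p C * q (B - C) * s (A - B))"
      unfolding conv_def using True fin
      by (subst sum.Sigma[symmetric]) (auto simp: sum_distrib_right)
    \<comment> \<open>Both sums range over the ordered partitions of A into three blocks: C, D = B -
      C and the rest.\<close>
    also have "\<dots> = (\<Sum>(C,D)\<in>Sigma (Pow A) (\<lambda>C. Pow (A - C)). p C * (q D * s (A - C - D)))"
      by (rule sum.reindex_bij_witness[of _ "\<lambda>(C,D). (C \<union> D, C)" "\<lambda>(B,C). (C, B - C)"])
        (auto simp: Diff_Diff_Int mult.assoc intro!: arg_cong[of _ _ q] arg_cong[of _ _ s])
    also have "\<dots> = conv p (conv q s) A"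
      unfolding conv_def using True fin
      by (subst sum.Sigma[symmetric]) (auto simp: sum_distrib_left)
    finally show ?thesis .
  qed (simp add: conv_infinite)
qed

lemma conv_left_commute: "conv p (conv q s) = conv q (conv p s)"
  by (metis conv_assoc conv_commute)

lemmas conv_ac = conv_assoc conv_commute conv_left_commute

lemma conv_add_left: "conv (\<lambda>A. p A + q A) s A = conv p s A + conv q s A"
  by (simp add: conv_def distrib_right sum.distrib)

lemma conv_scale_left: "conv (\<lambda>A. c * p A) s A = c * conv p s A"
  by (simp add: conv_def sum_distrib_left mult.assoc)

lemma conv_cong:
  "(\<And>B. B \<subseteq> A \<Longrightarrow> p B = p' B) \<Longrightarrow> (\<And>B. B \<subseteq> A \<Longrightarrow> q B = q' B) \<Longrightarrow> conv p q A = conv p' q' A"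
  by (auto simp: conv_def intro!: sum.cong)

lemma conv_nonzeroD: "conv p q A \<noteq> 0 \<Longrightarrow> \<exists>B\<subseteq>A. p B \<noteq> 0 \<and> q (A - B) \<noteq> 0"
  unfolding conv_def by (metis (no_types, lifting) PowD mult_eq_0_iff sum.neutral)

text \<open>Product rule for the partial derivative in the variable e. On sets without e this
  derivative is \<open>\<lambda>B. p (insert e B)\<close>, and a squarefree term contains e in
  exactly one factor.\<close>

lemma conv_insert:
  assumes "finite A" "e \<notin> A"
  shows "conv p q (insert e A) = conv (\<lambda>B. p (insert e B)) q A + conv p (\<lambda>B. q (insert e B)) A"
proof -
  have "conv p q (insert e A) =
      (\<Sum>B\<in>Pow A. p B * q (insert e A - B)) + (\<Sum>B\<in>insert e ` Pow A. p B * q (insert e A - B))"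
    unfolding conv_def Pow_insert using assms by (subst sum.union_disjoint) auto
  also have "(\<Sum>B\<in>insert e ` Pow A. p B * q (insert e A - B)) = conv (\<lambda>B. p (insert e B)) q A"
    unfolding conv_def using assms
    by (subst sum.reindex) (auto simp: inj_on_def intro!: sum.cong arg_cong[of _ _ q])
  also have "(\<Sum>B\<in>Pow A. p B * q (insert e A - B)) = conv p (\<lambda>B. q (insert e B)) A"
    unfolding conv_def using assms by (intro sum.cong HOL.refl) (auto simp: insert_Diff_if)
  finally show ?thesis by simp
qed

subsection \<open>The cobracket on commutators\<close>

text \<open>For the form on roots this is the pairing of the sums of roots attached to g and h, the
  coefficient of g \<otimes> h in the cobracket of [g, h].\<close>

definition gens_weight :: "(nat \<times> nat \<Rightarrow> nat \<times> nat \<Rightarrow> complex) \<Rightarrow> commutator \<Rightarrow> commutator \<Rightarrow> complex" where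
  "gens_weight \<beta> g h = (\<Sum>x\<in>#comm_gens g. \<Sum>y\<in>#comm_gens h. \<beta> x y)"

text \<open>\<open>cobracket_sum\<close> applies \<open>f\<close> to the standard cobracket of a commutator, in which \<open>[g, h]\<close> contributes
  the term \<open>\<beta>(g, h) g \<otimes> h\<close> besides the terms required by the Leibniz rule.  The terms that
  antisymmetrise it are left to \<open>f\<close>.\<close>

primrec cobracket_sum :: "(complex \<Rightarrow> 'v::ab_group_add \<Rightarrow> 'v) \<Rightarrow> (nat \<times> nat \<Rightarrow> nat \<times> nat \<Rightarrow> complex)
    \<Rightarrow> commutator \<Rightarrow> (commutator \<Rightarrow> commutator \<Rightarrow> 'v) \<Rightarrow> 'v" where
  "cobracket_sum sc \<beta> (CGen i k) = (\<lambda>f. 0)"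
| "cobracket_sum sc \<beta> (CBracket g h) = (\<lambda>f. sc (gens_weight \<beta> g h) (f g h)
     + cobracket_sum sc \<beta> g (\<lambda>a b. f (CBracket a h) b + f a (CBracket b h))
     + cobracket_sum sc \<beta> h (\<lambda>a b. f (CBracket g a) b + f a (CBracket g b)))"

text \<open>Each term of the cobracket distributes the generators of g over two commutators. Later
  arguments draw their knowledge of degrees and supports of the pairs (a, b) from this fact.\<close>

lemma cobracket_sum_cong:
  "(\<And>a b. comm_gens a + comm_gens b = comm_gens g \<Longrightarrow> f a b = f' a b) \<Longrightarrow>
    cobracket_sum sc \<beta> g f = cobracket_sum sc \<beta> g f'"
proof (induction g arbitrary: f f')
  case (CBracket g h)
  have 1: "f g h = f' g h" by (rule CBracket.prems) simp
  have 2: "cobracket_sum sc \<beta> g (\<lambda>a b. f (CBracket a h) b + f a (CBracket b h))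
     = cobracket_sum sc \<beta> g (\<lambda>a b. f' (CBracket a h) b + f' a (CBracket b h))"
    by (rule CBracket.IH(1), intro arg_cong2[of _ _ _ _ "(+)"] CBracket.prems)
      (auto simp: ac_simps)
  have 3: "cobracket_sum sc \<beta> h (\<lambda>a b. f (CBracket g a) b + f a (CBracket g b))
     = cobracket_sum sc \<beta> h (\<lambda>a b. f' (CBracket g a) b + f' a (CBracket g b))"
    by (rule CBracket.IH(2), intro arg_cong2[of _ _ _ _ "(+)"] CBracket.prems)
      (auto simp: ac_simps)
  show ?case by (simp only: cobracket_sum.simps 1 2 3)
qed simp

lemma cobracket_sum_linear:
  fixes L :: "'v::ab_group_add \<Rightarrow> 'w::ab_group_add"
  assumes add: "\<And>x y. L (x + y) = L x + L y" and scale: "\<And>c x. L (sc c x) = sc' c (L x)" and zero: "L 0 = 0"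
  shows "L (cobracket_sum sc \<beta> g f) = cobracket_sum sc' \<beta> g (\<lambda>a b. L (f a b))"
  by (induction g arbitrary: f) (simp_all add: assms)

lemma cobracket_sum_add:
  "cobracket_sum (*) \<beta> g (\<lambda>a b. f a b + f' a b) = cobracket_sum (*) \<beta> g f + cobracket_sum (*) \<beta> g f'"
proof (induction g arbitrary: f f')
  case (CBracket g h)
  have 1: "cobracket_sum (*) \<beta> g (\<lambda>a b. (f (CBracket a h) b + f' (CBracket a h) b) + (f a (CBracket b h) + f' a (CBracket b h)))
    = cobracket_sum (*) \<beta> g (\<lambda>a b. f (CBracket a h) b + f a (CBracket b h))
      + cobracket_sum (*) \<beta> g (\<lambda>a b. f' (CBracket a h) b + f' a (CBracket b h))"
    unfolding CBracket.IH(1)[symmetric] by (simp add: algebra_simps)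
  have 2: "cobracket_sum (*) \<beta> h (\<lambda>a b. (f (CBracket g a) b + f' (CBracket g a) b) + (f a (CBracket g b) + f' a (CBracket g b)))
    = cobracket_sum (*) \<beta> h (\<lambda>a b. f (CBracket g a) b + f a (CBracket g b))
      + cobracket_sum (*) \<beta> h (\<lambda>a b. f' (CBracket g a) b + f' a (CBracket g b))"
    unfolding CBracket.IH(2)[symmetric] by (simp add: algebra_simps)
  show ?case unfolding cobracket_sum.simps 1 2 by (simp add: algebra_simps)
qed simp

lemma cobracket_sum_scale:
  "cobracket_sum (*) \<beta> g (\<lambda>a b. c * f a b) = c * cobracket_sum (*) \<beta> g f"
  by (rule cobracket_sum_linear[where L = "\<lambda>x. c * x", symmetric]) (simp_all add: algebra_simps)

lemma cobracket_sum_zero: "cobracket_sum (*) \<beta> g (\<lambda>a b. 0) = 0"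
  using cobracket_sum_scale[of \<beta> g 0] by simp

lemma cobracket_sum_sum:
  "(\<Sum>i\<in>I. cobracket_sum (*) \<beta> g (f i)) = cobracket_sum (*) \<beta> g (\<lambda>a b. \<Sum>i\<in>I. f i a b)"
  by (induction I rule: infinite_finite_induct) (simp_all add: cobracket_sum_zero cobracket_sum_add)

lemma conv_cobracket_sum:
  "conv (\<lambda>B. cobracket_sum (*) \<beta> g (\<lambda>a b. f a b B)) q A = cobracket_sum (*) \<beta> g (\<lambda>a b. conv (f a b) q A)"
  unfolding conv_def by (simp add: cobracket_sum_sum[symmetric] cobracket_sum_scale[symmetric] mult.commute)

subsection \<open>Edges and spanning trees\<close>

text \<open>For labelled vertices \<open>x = (i, k)\<close> and \<open>y = (j, l)\<close> the hyperplane \<open>\<omega>^k t_i = \<omega>^l t_j\<close> is \<open>edge T x y\<close>.\<close>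

definition gain :: "nat \<Rightarrow> nat \<Rightarrow> nat \<Rightarrow> nat" where
  "gain T a b = nat ((int b - int a) mod int T)"

definition edge :: "nat \<Rightarrow> nat \<times> nat \<Rightarrow> nat \<times> nat \<Rightarrow> hyp" where
  "edge T x y = (if fst x < fst y then HEq (fst x) (fst y) (gain T (snd x) (snd y))
                 else HEq (fst y) (fst x) (gain T (snd y) (snd x)))"

text \<open>Edges are directed from the smaller to the larger index, as in \<open>HEq\<close>. The
  value 0 for equal indices discards the degenerate \<open>HEq i i k\<close>, which is no hyperplane
  of the arrangement.\<close>

definition orient :: "nat \<times> nat \<Rightarrow> nat \<times> nat \<Rightarrow> complex" where
  "orient x y = (if fst x < fst y then 1 else if fst y < fst x then -1 else 0)"

definition crossing :: "nat \<Rightarrow> commutator \<Rightarrow> commutator \<Rightarrow> hyp \<Rightarrow> complex" where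
  "crossing T u v e = (\<Sum>x\<in>#comm_gens u. \<Sum>y\<in>#comm_gens v. if e = edge T x y then orient x y else 0)"

text \<open>The linear form with coefficients \<open>crossing\<close>, stored as a function on sets
  supported on singletons so that \<open>conv\<close> can multiply it.\<close>

definition link :: "nat \<Rightarrow> commutator \<Rightarrow> commutator \<Rightarrow> hyp set \<Rightarrow> complex" where
  "link T u v A = (\<Sum>x\<in>#comm_gens u. \<Sum>y\<in>#comm_gens v. if A = {edge T x y} then orient x y else 0)"

text \<open>This is P_g. Each joining edge enters with its orientation, so that a tree has a
  sign.\<close>

primrec tree_coeff :: "nat \<Rightarrow> commutator \<Rightarrow> hyp set \<Rightarrow> complex" where
  "tree_coeff T (CGen i k) = (\<lambda>A. if A = {} then 1 else 0)"
| "tree_coeff T (CBracket u v) = conv (link T u v) (conv (tree_coeff T u) (tree_coeff T v))"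

text \<open>The coboundary of a potential on the vertices; \<open>HZero\<close> joins no two
  vertices and gets 0.\<close>

primrec edge_diff :: "(nat \<Rightarrow> complex) \<Rightarrow> hyp \<Rightarrow> complex" where
  "edge_diff l (HEq i j k) = l i - l j"
| "edge_diff l (HZero i) = 0"

text \<open>A base vertex of the commutator, at which a potential that is constant on its tree gets
  evaluated.\<close>

primrec lead :: "commutator \<Rightarrow> nat" where
  "lead (CGen i k) = i"
| "lead (CBracket u v) = lead u"

lemma lead_mem: "lead g \<in> fst ` set_mset (comm_gens g)"
  by (induction g) auto

lemma link_eq_crossing: "link T u v A = (if \<exists>e. A = {e} then crossing T u v (the_elem A) else 0)"
proof (cases "\<exists>e. A = {e}")
  case True
  then obtain e where "A = {e}" by blast
  thus ?thesis by (simp add: link_def crossing_def)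
next
  case False
  hence "(if A = {edge T x y} then orient x y else 0) = 0" for x y by auto
  thus ?thesis using False by (simp add: link_def)
qed

lemma link_singleton: "link T u v {e} = crossing T u v e"
  by (simp add: link_eq_crossing)

lemma link_split:
  "comm_gens u = comm_gens a + comm_gens b \<Longrightarrow> link T u v A = link T a v A + link T b v A"
  "comm_gens v = comm_gens a + comm_gens b \<Longrightarrow> link T u v A = link T u a A + link T u b A"
  by (simp_all add: link_def sum_mset.distrib)

lemma sum_mset_times_left: "(c::complex) * (\<Sum>x\<in>#M. f x) = (\<Sum>x\<in>#M. c * f x)"
  by (induction M) (auto simp: distrib_left)

lemma sum_mset_nonzeroD: "(\<Sum>x\<in>#M. f x) \<noteq> (0::complex) \<Longrightarrow> \<exists>x\<in>#M. f x \<noteq> 0"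
  by (induction M) auto

lemma crossing_nonzeroD:
  "crossing T u v e \<noteq> 0 \<Longrightarrow> \<exists>x\<in>#comm_gens u. \<exists>y\<in>#comm_gens v. e = edge T x y \<and> fst x \<noteq> fst y"
  unfolding crossing_def
  by (drule sum_mset_nonzeroD, elim bexE, drule sum_mset_nonzeroD, elim bexE, intro bexI)
    (auto simp: orient_def split: if_splits)

lemma link_nonzeroD:
  "link T u v A \<noteq> 0 \<Longrightarrow> \<exists>x\<in>#comm_gens u. \<exists>y\<in>#comm_gens v. A = {edge T x y} \<and> fst x \<noteq> fst y"
  by (auto simp: link_eq_crossing split: if_splits dest!: crossing_nonzeroD)

lemma edge_diff_edge: "fst x \<noteq> fst y \<Longrightarrow>
    edge_diff l (edge T x y) = orient x y * (l (fst x) - l (fst y))"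
  by (auto simp: edge_def orient_def)

lemma orient_nonzero: "fst x \<noteq> fst y \<Longrightarrow> orient x y * orient x y = 1"
  by (auto simp: orient_def)

lemma edge_commute: "fst x \<noteq> fst y \<Longrightarrow> edge T x y = edge T y x"
  by (auto simp: edge_def)

text \<open>For g of degree [1^m] these are the hyperplanes of the arrangement that contain the line
  \<open>L_comm m \<omega> g\<close>.\<close>

definition inner_edges :: "nat \<Rightarrow> commutator \<Rightarrow> hyp set" where
  "inner_edges T g = {edge T x y | x y. x \<in># comm_gens g \<and> y \<in># comm_gens g \<and> fst x \<noteq> fst y}"

lemma inner_edgesI:
  "x \<in># comm_gens g \<Longrightarrow> y \<in># comm_gens g \<Longrightarrow> fst x \<noteq> fst y \<Longrightarrow> edge T x y \<in> inner_edges T g"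
  unfolding inner_edges_def by blast

lemma inner_edges_mono: "comm_gens u \<subseteq># comm_gens g \<Longrightarrow> inner_edges T u \<subseteq> inner_edges T g"
  unfolding inner_edges_def
  by (intro Collect_mono impI, elim exE conjE, intro exI conjI) (assumption | erule mset_subset_eqD)+

lemma tree_coeff_bracketE:
  assumes "tree_coeff T (CBracket u v) A \<noteq> 0"
  obtains B C where "B \<subseteq> A" "link T u v B \<noteq> 0"
    "C \<subseteq> A - B" "tree_coeff T u C \<noteq> 0" "tree_coeff T v (A - B - C) \<noteq> 0"
proof -
  from conv_nonzeroD[OF assms[unfolded tree_coeff.simps]]
  obtain B where B: "B \<subseteq> A" "link T u v B \<noteq> 0"
    "conv (tree_coeff T u) (tree_coeff T v) (A - B) \<noteq> 0" by blast
  from conv_nonzeroD[OF B(3)] show ?thesis using that B(1,2) by blast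
qed

lemma tree_coeff_inner: "tree_coeff T g A \<noteq> 0 \<Longrightarrow> A \<subseteq> inner_edges T g"
proof (induction g arbitrary: A)
  case (CBracket u v)
  from tree_coeff_bracketE[OF CBracket.prems] obtain B C where B: "B \<subseteq> A" "link T u v B \<noteq> 0"
    and C: "C \<subseteq> A - B" "tree_coeff T u C \<noteq> 0" "tree_coeff T v (A - B - C) \<noteq> 0" .
  have "B \<subseteq> inner_edges T (CBracket u v)"
    using link_nonzeroD[OF B(2)] by (auto simp del: split_paired_Ex intro!: inner_edgesI)
  moreover have "C \<subseteq> inner_edges T (CBracket u v)" "A - B - C \<subseteq> inner_edges T (CBracket u v)"
    using CBracket.IH(1)[OF C(2)] CBracket.IH(2)[OF C(3)]
      inner_edges_mono[of u "CBracket u v" T] inner_edges_mono[of v "CBracket u v" T] by auto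
  ultimately have "B \<union> C \<union> (A - B - C) \<subseteq> inner_edges T (CBracket u v)" by (metis Un_least)
  moreover have "A \<subseteq> B \<union> C \<union> (A - B - C)" using B(1) C(1) by blast
  ultimately show ?case by (rule subset_trans[rotated])
qed (simp split: if_splits)

text \<open>Connectedness of a spanning tree, expressed through potentials instead of paths. At a
  bracket both halves are constant by induction, and the joining edge equates the two
  constants.\<close>

lemma tree_coeff_connected:
  assumes "tree_coeff T g A \<noteq> 0" "\<forall>e\<in>A. edge_diff l e = 0" "x \<in># comm_gens g"
  shows "l (fst x) = l (lead g)"
  using assms
proof (induction g arbitrary: A x)
  case (CBracket u v)
  from tree_coeff_bracketE[OF CBracket.prems(1)] obtain B C where B: "B \<subseteq> A" "link T u v B \<noteq> 0"
    and C: "C \<subseteq> A - B" "tree_coeff T u C \<noteq> 0" "tree_coeff T v (A - B - C) \<noteq> 0" .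
  obtain a b where ab: "a \<in># comm_gens u" "b \<in># comm_gens v" "B = {edge T a b}" "fst a \<noteq> fst b"
    using link_nonzeroD[OF B(2)] by blast
  have u: "l (fst y) = l (lead u)" if "y \<in># comm_gens u" for y
    using CBracket.IH(1)[OF C(2) _ that] CBracket.prems(2) B(1) C(1) by auto
  have v: "l (fst y) = l (lead v)" if "y \<in># comm_gens v" for y
    using CBracket.IH(2)[OF C(3) _ that] CBracket.prems(2) B(1) C(1) by auto
  have "edge_diff l (edge T a b) = 0" using CBracket.prems(2) B(1) ab(3) by auto
  hence "l (fst a) = l (fst b)"
    using edge_diff_edge[OF ab(4)] orient_nonzero[OF ab(4)] by auto
  hence "l (lead u) = l (lead v)" using u[OF ab(1)] v[OF ab(2)] by metis
  moreover have "x \<in># comm_gens u \<or> x \<in># comm_gens v" using CBracket.prems(3) by simp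
  ultimately show ?case using u v by (metis lead.simps(2))
qed auto

section \<open>Derivatives along a potential\<close>

definition deriv_along :: "hyp set \<Rightarrow> (hyp \<Rightarrow> complex) \<Rightarrow> (nat \<Rightarrow> complex) \<Rightarrow> (hyp set \<Rightarrow> complex) \<Rightarrow> hyp set \<Rightarrow> complex" where
  "deriv_along X a l p A = (\<Sum>e\<in>X. a e * edge_diff l e * p (insert e A))"

text \<open>The product rule is available for variables outside A; a variable in A would give a
  square. There the direction vanishes, because the potential is constant along A.\<close>

lemma deriv_along_conv:
  assumes "finite X" "finite A" "\<forall>e\<in>A. edge_diff l e = 0"
  shows "deriv_along X a l (conv p q) A = conv (deriv_along X a l p) q A + conv p (deriv_along X a l q) A"
proof -
  have split: "conv (deriv_along X a l p) q A = (\<Sum>e\<in>X. a e * edge_diff l e * conv (\<lambda>B. p (insert e B)) q A)" for p q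
    unfolding conv_def deriv_along_def sum_distrib_left sum_distrib_right
    by (subst sum.swap) (simp add: mult.assoc)
  have "deriv_along X a l (conv p q) A =
     (\<Sum>e\<in>X. a e * edge_diff l e * (conv (\<lambda>B. p (insert e B)) q A + conv (\<lambda>B. q (insert e B)) p A))"
    unfolding deriv_along_def
  proof (intro sum.cong HOL.refl)
    fix e show "a e * edge_diff l e * conv p q (insert e A) =
      a e * edge_diff l e * (conv (\<lambda>B. p (insert e B)) q A + conv (\<lambda>B. q (insert e B)) p A)"
      using assms(2,3) conv_insert[of A e p q] conv_commute[of p] by (cases "e \<in> A") auto
  qed
  also have "\<dots> = conv (deriv_along X a l p) q A + conv (deriv_along X a l q) p A"
    by (simp add: split distrib_left sum.distrib)
  finally show ?thesis by (simp add: conv_commute[of p])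
qed

text \<open>A linear form has a constant derivative. Each edge contributes the square of its
  orientation, so the signs disappear and the differences of the potential remain.\<close>

lemma deriv_along_link:
  assumes X: "finite X" and A: "\<forall>e\<in>A. edge_diff l e = 0"
    and w: "\<And>x y. x \<in># comm_gens u \<Longrightarrow> y \<in># comm_gens v \<Longrightarrow> fst x \<noteq> fst y \<Longrightarrow>
              edge T x y \<in> X \<and> a (edge T x y) = \<beta> x y"
  shows "deriv_along X a l (link T u v) A =
    (if A = {} then \<Sum>x\<in>#comm_gens u. \<Sum>y\<in>#comm_gens v. \<beta> x y * (l (fst x) - l (fst y)) else 0)"
proof (cases "A = {}")
  case True
  have "deriv_along X a l (link T u v) A = (\<Sum>e\<in>X. a e * edge_diff l e * crossing T u v e)"
    by (simp add: deriv_along_def True link_singleton)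
  also have "\<dots> = (\<Sum>e\<in>X. \<Sum>x\<in>#comm_gens u. \<Sum>y\<in>#comm_gens v.
      if e = edge T x y then a e * edge_diff l e * orient x y else 0)"
    unfolding crossing_def sum_mset_times_left[symmetric]
    by (intro sum.cong HOL.refl, subst sum_mset_times_left, intro arg_cong[of _ _ sum_mset] image_mset_cong,
        subst sum_mset_times_left, intro arg_cong[of _ _ sum_mset] image_mset_cong) auto
  also have "\<dots> = (\<Sum>x\<in>#comm_gens u. \<Sum>y\<in>#comm_gens v.
      \<Sum>e\<in>X. if e = edge T x y then a e * edge_diff l e * orient x y else 0)"
  proof -
    have sw: "(\<Sum>e\<in>X. \<Sum>x\<in>#M. f e x) = (\<Sum>x\<in>#M. \<Sum>e\<in>X. f e x)" for M :: "'z multiset" and f :: "hyp \<Rightarrow> 'z \<Rightarrow> complex"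
      by (induction M) (auto simp: sum.distrib)
    show ?thesis by (simp add: sw)
  qed
  also have "\<dots> = (\<Sum>x\<in>#comm_gens u. \<Sum>y\<in>#comm_gens v. \<beta> x y * (l (fst x) - l (fst y)))"
  proof (intro arg_cong[of _ _ sum_mset] image_mset_cong)
    fix x y assume xy: "x \<in># comm_gens u" "y \<in># comm_gens v"
    show "(\<Sum>e\<in>X. if e = edge T x y then a e * edge_diff l e * orient x y else 0) = \<beta> x y * (l (fst x) - l (fst y))"
    proof (cases "fst x = fst y")
      case False
      thus ?thesis using w[OF xy False] X edge_diff_edge[OF False] orient_nonzero[OF False]
        by (simp add: mult.assoc mult.left_commute[of "orient x y"])
    qed (auto simp: orient_def intro!: sum.neutral)
  qed
  finally show ?thesis using True by simp
next
  case False
  \<comment> \<open>A nonempty set united with e is a singleton only if e lies in it, and on A the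
    coboundary is zero.\<close>
  have "a e * edge_diff l e * link T u v (insert e A) = 0" if "e \<in> X" for e
  proof (rule ccontr)
    assume *: "a e * edge_diff l e * link T u v (insert e A) \<noteq> 0"
    hence "link T u v (insert e A) \<noteq> 0" by auto
    then obtain f where "insert e A = {f}" using link_nonzeroD by blast
    hence "e \<in> A" using False by auto
    thus False using A * by auto
  qed
  hence "deriv_along X a l (link T u v) A = 0" unfolding deriv_along_def by (intro sum.neutral) blast
  thus ?thesis using False by simp
qed

text \<open>When the second half of a bracket is differentiated, induction evaluates the potential
  at the base vertex of a, whereas the bracket with g in front has the base vertex of g. A tree
  containing both vertices makes the two values equal whenever the term is nonzero.\<close>

lemma lead_eq_if_conv:
  assumes "conv (tree_coeff T (CBracket g a)) q A \<noteq> 0" "\<forall>e\<in>A. edge_diff l e = 0"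
  shows "l (lead g) = l (lead a)"
proof -
  obtain B where B: "B \<subseteq> A" "tree_coeff T (CBracket g a) B \<noteq> 0" using conv_nonzeroD[OF assms(1)] by blast
  obtain x where x: "x \<in># comm_gens a" "fst x = lead a" using lead_mem[of a] by auto
  show ?thesis
    using tree_coeff_connected[OF B(2), of l x] B(1) assms(2) x by (auto simp: subset_eq)
qed

text \<open>Leibniz rule on the three factors of the polynomial of [g, h]. The derivative of
  \<open>link\<close> yields the new term g \<otimes> h. For the other factors the remaining
  \<open>link\<close> splits over the two parts of the cobracket and attaches the untouched half to
  one of them; these are the Leibniz terms of \<open>cobracket_sum\<close>.\<close>

theorem deriv_along_tree:
  assumes X: "finite X" and A: "finite A" "\<forall>e\<in>A. edge_diff l e = 0"
    and w: "\<And>x y. x \<in># comm_gens g \<Longrightarrow> y \<in># comm_gens g \<Longrightarrow> fst x \<noteq> fst y \<Longrightarrow>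
              edge T x y \<in> X \<and> a (edge T x y) = \<beta> x y"
  shows "deriv_along X a l (tree_coeff T g) A =
    cobracket_sum (*) \<beta> g (\<lambda>u v. (l (lead u) - l (lead v)) * conv (tree_coeff T u) (tree_coeff T v) A)"
  using A w
proof (induction g arbitrary: A)
  case (CGen i k)
  show ?case by (simp add: deriv_along_def)
next
  case (CBracket g h)
  let ?P = "tree_coeff T" and ?D = "deriv_along X a l" and ?e = "link T g h"
  define F where "F = (\<lambda>u v. (l (lead u) - l (lead v)) * conv (?P u) (?P v) A)"
  have sub: "finite B" "\<forall>e\<in>B. edge_diff l e = 0" if "B \<subseteq> A" for B
    using that CBracket.prems(1,2) by (auto intro: finite_subset)
  have IH1: "?D (?P g) B = cobracket_sum (*) \<beta> g (\<lambda>u v. (l (lead u) - l (lead v)) * conv (?P u) (?P v) B)"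
    if "B \<subseteq> A" for B
    by (rule CBracket.IH(1)[OF sub[OF that] CBracket.prems(3)]) auto
  have IH2: "?D (?P h) B = cobracket_sum (*) \<beta> h (\<lambda>u v. (l (lead u) - l (lead v)) * conv (?P u) (?P v) B)"
    if "B \<subseteq> A" for B
    by (rule CBracket.IH(2)[OF sub[OF that] CBracket.prems(3)]) auto
  have e: "conv (?D ?e) (conv (?P g) (?P h)) A = gens_weight \<beta> g h * F g h"
  proof -
    have "conv (?D ?e) (conv (?P g) (?P h)) A =
      conv (\<lambda>B. (\<Sum>x\<in>#comm_gens g. \<Sum>y\<in>#comm_gens h. \<beta> x y * (l (fst x) - l (fst y))) * (if B = {} then 1 else 0))
        (conv (?P g) (?P h)) A"
      by (intro conv_cong HOL.refl, subst deriv_along_link[OF X sub(2)]) (use CBracket.prems(3) in auto)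
    also have "\<dots> = (\<Sum>x\<in>#comm_gens g. \<Sum>y\<in>#comm_gens h. \<beta> x y * (l (fst x) - l (fst y))) *
        conv (?P g) (?P h) A"
      unfolding conv_scale_left
      by (subst (1) conv_def) (use CBracket.prems(1) in \<open>simp add: if_distrib[of "\<lambda>z. z * _"] sum.delta cong: if_cong\<close>)
    also have "\<dots> = gens_weight \<beta> g h * F g h"
    proof (cases "conv (?P g) (?P h) A = 0")
      case False
      then obtain B where B: "B \<subseteq> A" "?P g B \<noteq> 0" "?P h (A - B) \<noteq> 0" by (auto dest!: conv_nonzeroD)
      \<comment> \<open>A nonzero product provides a tree on each half, so the potential is constant
        on both and its difference leaves the sum.\<close>
      have "(\<Sum>x\<in>#comm_gens g. \<Sum>y\<in>#comm_gens h. \<beta> x y * (l (fst x) - l (fst y))) =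
        (\<Sum>x\<in>#comm_gens g. \<Sum>y\<in>#comm_gens h. (l (lead g) - l (lead h)) * \<beta> x y)"
        using tree_coeff_connected[OF B(2) sub(2)[OF B(1)]] tree_coeff_connected[OF B(3) sub(2)[of "A - B"]]
        by (intro arg_cong[of _ _ sum_mset] image_mset_cong) (auto simp: algebra_simps)
      also have "\<dots> = (l (lead g) - l (lead h)) * gens_weight \<beta> g h"
        unfolding gens_weight_def sum_mset_times_left ..
      finally show ?thesis by (simp add: F_def)
    qed (simp add: F_def)
    finally show ?thesis .
  qed
  have g: "conv ?e (conv (?D (?P g)) (?P h)) A =
     cobracket_sum (*) \<beta> g (\<lambda>u v. F (CBracket u h) v + F u (CBracket v h))"
  proof -
    have "conv ?e (conv (?D (?P g)) (?P h)) A = conv (?D (?P g)) (conv ?e (?P h)) A"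
      by (simp add: conv_ac)
    also have "\<dots> = conv (\<lambda>B. cobracket_sum (*) \<beta> g (\<lambda>u v. (l (lead u) - l (lead v)) * conv (?P u) (?P v) B))
        (conv ?e (?P h)) A"
      by (intro conv_cong IH1 HOL.refl)
    also have "\<dots> = cobracket_sum (*) \<beta> g (\<lambda>u v. (l (lead u) - l (lead v)) * conv (conv (?P u) (?P v)) (conv ?e (?P h)) A)"
      by (simp add: conv_cobracket_sum conv_scale_left)
    also have "\<dots> = cobracket_sum (*) \<beta> g (\<lambda>u v. F (CBracket u h) v + F u (CBracket v h))"
    proof (rule cobracket_sum_cong)
      fix u v assume "comm_gens u + comm_gens v = comm_gens g"
      hence "?e = (\<lambda>A. link T u h A + link T v h A)"
        by (intro ext link_split) simp
      hence "conv (conv (?P u) (?P v)) (conv ?e (?P h)) A =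
        conv (conv (link T u h) (conv (?P u) (?P h))) (?P v) A + conv (?P u) (conv (link T v h) (conv (?P v) (?P h))) A"
        unfolding conv_left_commute[of "conv (?P u) (?P v)" ?e] by (simp only: conv_add_left) (simp only: conv_ac)
      thus "(l (lead u) - l (lead v)) * conv (conv (?P u) (?P v)) (conv ?e (?P h)) A = F (CBracket u h) v + F u (CBracket v h)"
        by (simp add: F_def algebra_simps)
    qed
    finally show ?thesis .
  qed
  have h: "conv ?e (conv (?P g) (?D (?P h))) A =
     cobracket_sum (*) \<beta> h (\<lambda>u v. F (CBracket g u) v + F u (CBracket g v))"
  proof -
    have "conv ?e (conv (?P g) (?D (?P h))) A = conv (?D (?P h)) (conv ?e (?P g)) A"
      by (simp add: conv_ac)
    also have "\<dots> = conv (\<lambda>B. cobracket_sum (*) \<beta> h (\<lambda>u v. (l (lead u) - l (lead v)) * conv (?P u) (?P v) B))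
        (conv ?e (?P g)) A"
      by (intro conv_cong IH2 HOL.refl)
    also have "\<dots> = cobracket_sum (*) \<beta> h (\<lambda>u v. (l (lead u) - l (lead v)) * conv (conv (?P u) (?P v)) (conv ?e (?P g)) A)"
      by (simp add: conv_cobracket_sum conv_scale_left)
    also have "\<dots> = cobracket_sum (*) \<beta> h (\<lambda>u v. F (CBracket g u) v + F u (CBracket g v))"
    proof (rule cobracket_sum_cong)
      fix u v assume "comm_gens u + comm_gens v = comm_gens h"
      hence "?e = (\<lambda>A. link T g u A + link T g v A)"
        by (intro ext link_split) simp
      hence 1: "conv (conv (?P u) (?P v)) (conv ?e (?P g)) A =
        conv (?P (CBracket g u)) (?P v) A + conv (?P (CBracket g v)) (?P u) A"
        unfolding conv_left_commute[of "conv (?P u) (?P v)" ?e]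
        by (simp only: conv_add_left tree_coeff.simps) (simp only: conv_ac)
      have 2: "(l (lead u) - l (lead v)) * conv (?P (CBracket g u)) (?P v) A = F (CBracket g u) v"
        using lead_eq_if_conv[of T g u "?P v" A l] CBracket.prems(2)
        by (cases "conv (?P (CBracket g u)) (?P v) A = 0") (auto simp: F_def simp del: tree_coeff.simps)
      have 3: "(l (lead u) - l (lead v)) * conv (?P (CBracket g v)) (?P u) A = F u (CBracket g v)"
        using lead_eq_if_conv[of T g v "?P u" A l] CBracket.prems(2)
        by (cases "conv (?P (CBracket g v)) (?P u) A = 0")
          (auto simp: F_def conv_commute[of "?P u"] simp del: tree_coeff.simps)
      show "(l (lead u) - l (lead v)) * conv (conv (?P u) (?P v)) (conv ?e (?P g)) A = F (CBracket g u) v + F u (CBracket g v)"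
        unfolding 1 distrib_left 2 3 ..
    qed
    finally show ?thesis .
  qed
  have "?D (?P (CBracket g h)) A = conv (?D ?e) (conv (?P g) (?P h)) A + conv ?e (?D (conv (?P g) (?P h))) A"
    unfolding tree_coeff.simps by (rule deriv_along_conv[OF X CBracket.prems(1,2)])
  also have "conv ?e (?D (conv (?P g) (?P h))) A =
      conv (\<lambda>B. conv (?D (?P g)) (?P h) B + conv (?P g) (?D (?P h)) B) ?e A"
    unfolding conv_commute[of ?e] by (intro conv_cong HOL.refl deriv_along_conv X sub)
  also have "\<dots> = conv ?e (conv (?D (?P g)) (?P h)) A + conv ?e (conv (?P g) (?D (?P h))) A"
    by (simp add: conv_add_left conv_commute[of ?e])
  finally have "?D (?P (CBracket g h)) A = cobracket_sum (*) \<beta> (CBracket g h) F"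
    unfolding e g h cobracket_sum.simps by (simp only: add.assoc)
  thus ?case by (simp only: F_def)
qed

subsection \<open>The tree pairing\<close>

lemma multilinear_gens:
  fixes M :: "(nat \<times> nat) multiset"
  assumes "image_mset fst M = mset_set I" "finite I"
  shows "M = mset_set (set_mset M)" "inj_on fst (set_mset M)" "fst ` set_mset M = I"
proof -
  obtain xs where xs: "mset xs = M" using ex_mset by blast
  have "mset (map fst xs) = mset (sorted_list_of_set I)" using assms xs mset_set_set[of "sorted_list_of_set I"] by simp
  hence d: "distinct (map fst xs)"
    by (metis mset_eq_imp_distinct_iff distinct_sorted_list_of_set)
  hence "distinct xs" "inj_on fst (set xs)" by (auto simp: distinct_map)
  thus "M = mset_set (set_mset M)" "inj_on fst (set_mset M)"
    using xs mset_set_set[of xs] by auto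
  show "fst ` set_mset M = I" using assms by (metis finite_set_mset_mset_set set_image_mset)
qed

lemma multilinear_union:
  fixes M N :: "(nat \<times> nat) multiset"
  assumes "image_mset fst (M + N) = mset_set I" "finite I"
  shows "image_mset fst M = mset_set (fst ` set_mset M)" "image_mset fst N = mset_set (fst ` set_mset N)"
    "fst ` set_mset M \<inter> fst ` set_mset N = {}"
proof -
  obtain xs ys where xs: "mset xs = M" and ys: "mset ys = N" using ex_mset by meson
  have "mset (map fst (xs @ ys)) = mset (sorted_list_of_set I)" using assms xs ys mset_set_set[of "sorted_list_of_set I"] by simp
  hence d: "distinct (map fst (xs @ ys))"
    by (metis mset_eq_imp_distinct_iff distinct_sorted_list_of_set)
  hence "mset_set (set (map fst xs)) = mset (map fst xs)" "mset_set (set (map fst ys)) = mset (map fst ys)"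
    by (intro mset_set_set; simp)+
  thus "image_mset fst M = mset_set (fst ` set_mset M)" "image_mset fst N = mset_set (fst ` set_mset N)"
    using xs ys by auto
  have "fst ` set xs \<inter> fst ` set ys = {}" using d by simp
  thus "fst ` set_mset M \<inter> fst ` set_mset N = {}" using xs ys by (simp only: set_mset_mset[symmetric])
qed

definition tree_pair :: "hyp set \<Rightarrow> (hyp \<Rightarrow> complex) \<Rightarrow> (hyp set \<Rightarrow> complex) \<Rightarrow> (hyp set \<Rightarrow> complex) \<Rightarrow> complex" where
  "tree_pair X a p q = (\<Sum>A\<in>Pow X. (\<Prod>e\<in>A. a e) * p A * q A)"

lemma tree_pair_commute: "tree_pair X a p q = tree_pair X a q p"
  by (simp add: tree_pair_def mult_ac)

lemma conv_link:
  assumes "finite A"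
  shows "conv (link T u v) q A = (\<Sum>e\<in>A. crossing T u v e * q (A - {e}))"
proof -
  have "conv (link T u v) q A = (\<Sum>B\<in>(\<lambda>e. {e}) ` A. link T u v B * q (A - B))"
    unfolding conv_def using assms
    by (intro sum.mono_neutral_right) (auto simp: link_eq_crossing)
  also have "\<dots> = (\<Sum>e\<in>A. crossing T u v e * q (A - {e}))"
    by (subst sum.reindex) (auto simp: link_singleton)
  finally show ?thesis .
qed

text \<open>Double counting of sets with a marked element: take the mark out, or add a new element
  as the mark.\<close>

lemma sum_Pow_remove:
  assumes "finite X"
  shows "(\<Sum>A\<in>Pow X. \<Sum>e\<in>A. f (A - {e}) e) = (\<Sum>B\<in>Pow X. \<Sum>e\<in>X - B. (f B e :: complex))"
proof -
  have "(\<Sum>A\<in>Pow X. \<Sum>e\<in>A. f (A - {e}) e) = (\<Sum>(A,e)\<in>Sigma (Pow X) (\<lambda>A. A). f (A - {e}) e)"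
    using assms by (subst sum.Sigma) (auto intro: finite_subset)
  also have "\<dots> = (\<Sum>(B,e)\<in>Sigma (Pow X) (\<lambda>B. X - B). f B e)"
    by (rule sum.reindex_bij_witness[of _ "\<lambda>(B,e). (insert e B, e)" "\<lambda>(A,e). (A - {e}, e)"]) auto
  also have "\<dots> = (\<Sum>B\<in>Pow X. \<Sum>e\<in>X - B. f B e)"
    using assms by (subst sum.Sigma) (auto intro: finite_subset)
  finally show ?thesis .
qed

text \<open>For the weighted pairing, multiplication by a variable is adjoint to the derivative in
  that variable times its exponent.\<close>

lemma tree_pair_link:
  assumes X: "finite X"
  shows "tree_pair X a (conv (link T u v) q) p =
    (\<Sum>B\<in>Pow X. (\<Prod>e\<in>B. a e) * q B * (\<Sum>e\<in>X - B. crossing T u v e * a e * p (insert e B)))"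
proof -
  have fin: "finite A" if "A \<in> Pow X" for A using that X by (auto intro: finite_subset)
  have "tree_pair X a (conv (link T u v) q) p =
    (\<Sum>A\<in>Pow X. \<Sum>e\<in>A. (\<Prod>e\<in>A - {e}. a e) * q (A - {e}) * (crossing T u v e * a e * p (insert e (A - {e}))))"
    unfolding tree_pair_def
  proof (intro sum.cong HOL.refl)
    fix A assume A: "A \<in> Pow X"
    have "(\<Prod>e\<in>A. a e) * conv (link T u v) q A * p A = (\<Sum>e\<in>A. (\<Prod>e\<in>A. a e) * (crossing T u v e * q (A - {e})) * p A)"
      by (simp add: conv_link[OF fin[OF A]] sum_distrib_left sum_distrib_right)
    also have "\<dots> = (\<Sum>e\<in>A. (\<Prod>e\<in>A - {e}. a e) * q (A - {e}) * (crossing T u v e * a e * p (insert e (A - {e}))))"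
    proof (intro sum.cong HOL.refl)
      fix e assume "e \<in> A"
      thus "(\<Prod>e\<in>A. a e) * (crossing T u v e * q (A - {e})) * p A =
        (\<Prod>e\<in>A - {e}. a e) * q (A - {e}) * (crossing T u v e * a e * p (insert e (A - {e})))"
        using fin[OF A] by (simp add: prod.remove[of A e] insert_absorb)
    qed
    finally show "(\<Prod>e\<in>A. a e) * conv (link T u v) q A * p A =
      (\<Sum>e\<in>A. (\<Prod>e\<in>A - {e}. a e) * q (A - {e}) * (crossing T u v e * a e * p (insert e (A - {e}))))" .
  qed
  thus ?thesis unfolding sum_distrib_left
    by (simp only: sum_Pow_remove[OF X, of "\<lambda>B e. prod a B * q B * (crossing T u v e * a e * p (insert e B))"])
qed

lemma conv_supported:
  assumes A: "finite A" and YZ: "Y \<inter> Z = {}"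
    and p: "\<And>B. p B \<noteq> 0 \<Longrightarrow> B \<subseteq> Y" and q: "\<And>B. q B \<noteq> 0 \<Longrightarrow> B \<subseteq> Z"
  shows "conv p q A = (if A \<subseteq> Y \<union> Z then p (A \<inter> Y) * q (A \<inter> Z) else 0)"
proof (cases "A \<subseteq> Y \<union> Z")
  case True
  have "conv p q A = (\<Sum>B\<in>{A \<inter> Y}. p B * q (A - B))"
    unfolding conv_def
  proof (rule sum.mono_neutral_right)
    show "\<forall>B\<in>Pow A - {A \<inter> Y}. p B * q (A - B) = 0"
    proof (intro ballI, rule ccontr)
      fix B assume B: "B \<in> Pow A - {A \<inter> Y}" "p B * q (A - B) \<noteq> 0"
      hence "B \<subseteq> Y" "A - B \<subseteq> Z" using p[of B] q[of "A - B"] by auto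
      thus False using B YZ by auto
    qed
  qed (use A in auto)
  moreover have "A - A \<inter> Y = A \<inter> Z" using True YZ by auto
  ultimately show ?thesis using True by simp
next
  case False
  hence "p B * q (A - B) = 0" if "B \<in> Pow A" for B
    using p[of B] q[of "A - B"] that by fastforce
  hence "conv p q A = 0" unfolding conv_def by (intro sum.neutral) blast
  thus ?thesis using False by simp
qed

text \<open>With disjoint sets of variables every set of edges splits in one way only, and its
  exponents factor accordingly.\<close>

lemma tree_pair_conv:
  assumes X: "finite X" and YZ: "Y \<inter> Z = {}"
    and p: "\<And>B. p B \<noteq> 0 \<Longrightarrow> B \<subseteq> Y" and q: "\<And>B. q B \<noteq> 0 \<Longrightarrow> B \<subseteq> Z"
    and p': "\<And>B. p' B \<noteq> 0 \<Longrightarrow> B \<subseteq> Y" and q': "\<And>B. q' B \<noteq> 0 \<Longrightarrow> B \<subseteq> Z"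
  shows "tree_pair X a (conv p q) (conv p' q') = tree_pair X a p p' * tree_pair X a q q'"
proof -
  have fin: "finite A" if "A \<subseteq> X" for A using that X by (auto intro: finite_subset)
  have restrict: "tree_pair X a s s' = (\<Sum>A\<in>Pow (X \<inter> W). (\<Prod>e\<in>A. a e) * s A * s' A)"
    if "\<And>B. s B \<noteq> 0 \<Longrightarrow> B \<subseteq> W" for s s' W
    unfolding tree_pair_def using that X by (intro sum.mono_neutral_right) auto
  have "tree_pair X a (conv p q) (conv p' q') =
     (\<Sum>A\<in>Pow (X \<inter> (Y \<union> Z)). (\<Prod>e\<in>A. a e) * conv p q A * conv p' q' A)"
    unfolding tree_pair_def
  proof (rule sum.mono_neutral_right)
    show "\<forall>A\<in>Pow X - Pow (X \<inter> (Y \<union> Z)). (\<Prod>e\<in>A. a e) * conv p q A * conv p' q' A = 0"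
    proof
      fix A assume "A \<in> Pow X - Pow (X \<inter> (Y \<union> Z))"
      hence "conv p q A = 0" using conv_supported[OF fin YZ p q, of A] by auto
      thus "(\<Prod>e\<in>A. a e) * conv p q A * conv p' q' A = 0" by simp
    qed
  qed (use X in auto)
  also have "\<dots> = (\<Sum>(B,C)\<in>Pow (X \<inter> Y) \<times> Pow (X \<inter> Z).
      ((\<Prod>e\<in>B. a e) * p B * p' B) * ((\<Prod>e\<in>C. a e) * q C * q' C))"
  proof (rule sum.reindex_bij_witness[of _ "\<lambda>(B,C). B \<union> C" "\<lambda>A. (A \<inter> Y, A \<inter> Z)"], goal_cases)
    case (5 A)
    have "(\<Prod>e\<in>A. a e) = (\<Prod>e\<in>(A \<inter> Y) \<union> (A \<inter> Z). a e)"
      using 5 by (intro prod.cong) auto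
    also have "\<dots> = (\<Prod>e\<in>A \<inter> Y. a e) * (\<Prod>e\<in>A \<inter> Z. a e)"
      using 5 YZ fin[of A] by (intro prod.union_disjoint) auto
    finally show ?case
      using 5 conv_supported[OF fin YZ p q, of A] conv_supported[OF fin YZ p' q', of A] by auto
  qed (use YZ in auto)
  also have "\<dots> = (\<Sum>B\<in>Pow (X \<inter> Y). (\<Prod>e\<in>B. a e) * p B * p' B) * (\<Sum>C\<in>Pow (X \<inter> Z). (\<Prod>e\<in>C. a e) * q C * q' C)"
    by (simp add: sum_product sum.cartesian_product)
  finally show ?thesis using restrict[of p Y p'] restrict[of q Z q'] p q by simp
qed

lemma edge_eq_fst: "edge T x y = edge T x' y' \<Longrightarrow> fst x \<noteq> fst y \<Longrightarrow>
    (fst x' = fst x \<and> fst y' = fst y) \<or> (fst x' = fst y \<and> fst y' = fst x)"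
  by (auto simp: edge_def split: if_splits)

lemma inner_edges_disjoint:
  "fst ` set_mset (comm_gens u) \<inter> fst ` set_mset (comm_gens v) = {} \<Longrightarrow> inner_edges T u \<inter> inner_edges T v = {}"
proof (rule ccontr)
  assume d: "fst ` set_mset (comm_gens u) \<inter> fst ` set_mset (comm_gens v) = {}"
    and "inner_edges T u \<inter> inner_edges T v \<noteq> {}"
  then obtain x y x' y' where *: "x \<in># comm_gens u" "y \<in># comm_gens u" "fst x \<noteq> fst y"
    "x' \<in># comm_gens v" "y' \<in># comm_gens v" "edge T x y = edge T x' y'"
    unfolding inner_edges_def by blast
  have "fst x' = fst x \<or> fst x' = fst y" using edge_eq_fst[OF *(6,3)] by auto
  thus False using d * by (metis disjoint_iff imageI)
qed

text \<open>The coefficients of \<open>link\<close> are the coboundary of the indicator function of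
  the indices of u. Through this the adjoint of multiplication by \<open>link\<close> becomes a
  derivative along a potential.\<close>

lemma crossing_edge:
  assumes I: "image_mset fst (comm_gens u + comm_gens v) = mset_set I" "finite I"
    and xy: "x \<in># comm_gens u + comm_gens v" "y \<in># comm_gens u + comm_gens v" "fst x \<noteq> fst y"
  shows "crossing T u v (edge T x y) =
    edge_diff (\<lambda>i. if i \<in> fst ` set_mset (comm_gens u) then 1 else 0) (edge T x y)"
proof -
  let ?U = "set_mset (comm_gens u)" and ?V = "set_mset (comm_gens v)"
  have d: "fst ` ?U \<inter> fst ` ?V = {}" by (rule multilinear_union(3)[OF I])
  have M: "comm_gens u + comm_gens v = mset_set (?U \<union> ?V)" and inj: "inj_on fst (?U \<union> ?V)"
    using multilinear_gens[OF I] by auto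
  have UV: "?U \<inter> ?V = {}" using d by auto
  have uv: "comm_gens u = mset_set ?U" "comm_gens v = mset_set ?V"
    using multilinear_gens(1) multilinear_union(1,2)[OF I] by (metis finite_imageI finite_set_mset)+
  have both: "crossing T u v (edge T x y) = orient x y" if "x \<in> ?U" "y \<in> ?V" "fst x \<noteq> fst y" for x y
  proof -
    \<comment> \<open>Every index occurs once, so a hyperplane determines its two end points
      together with their labels.\<close>
    have uniq: "x' = x \<and> y' = y" if *: "x' \<in> ?U" "y' \<in> ?V" "edge T x y = edge T x' y'" for x' y'
    proof -
      have "fst x' \<noteq> fst y" using d * \<open>y \<in> ?V\<close> by blast
      hence "fst x' = fst x \<and> fst y' = fst y" using edge_eq_fst[OF *(3) \<open>fst x \<noteq> fst y\<close>] by auto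
      thus ?thesis using inj * \<open>x \<in> ?U\<close> \<open>y \<in> ?V\<close> by (meson UnCI inj_onD)
    qed
    have "(if edge T x y = edge T x' y' then orient x' y' else 0) =
       (if x' = x then if y' = y then orient x y else 0 else 0)" if "x' \<in> ?U" "y' \<in> ?V" for x' y'
    proof (cases "x' = x \<and> y' = y")
      case False
      hence "edge T x y \<noteq> edge T x' y'" using uniq[OF that] by blast
      thus ?thesis using False by (simp only: if_False) auto
    qed simp
    hence "(\<Sum>x'\<in>?U. \<Sum>y'\<in>?V. if edge T x y = edge T x' y' then orient x' y' else 0) =
      (\<Sum>x'\<in>?U. \<Sum>y'\<in>?V. if x' = x then if y' = y then orient x y else 0 else 0)"
      by (intro sum.cong) auto
    also have "\<dots> = (\<Sum>x'\<in>?U. if x' = x then orient x y else 0)"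
      using that by (intro sum.cong) (auto simp: sum.delta)
    also have "\<dots> = orient x y" using that by (simp add: sum.delta)
    finally have "(\<Sum>x'\<in>?U. \<Sum>y'\<in>?V. if edge T x y = edge T x' y' then orient x' y' else 0) = orient x y" .
    moreover have "crossing T u v (edge T x y) =
        (\<Sum>x'\<in>?U. \<Sum>y'\<in>?V. if edge T x y = edge T x' y' then orient x' y' else 0)"
      unfolding crossing_def sum_unfold_sum_mset using uv by simp
    ultimately show ?thesis by simp
  qed
  have same: "crossing T u v (edge T x y) = 0" if "fst x \<in> fst ` ?U \<longleftrightarrow> fst y \<in> fst ` ?U" "fst x \<noteq> fst y" for x y
  proof (rule ccontr)
    assume "crossing T u v (edge T x y) \<noteq> 0"
    from crossing_nonzeroD[OF this] obtain x' y' where *: "x' \<in> ?U" "y' \<in> ?V" "edge T x y = edge T x' y'" by auto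
    have "fst x' = fst x \<and> fst y' = fst y \<or> fst x' = fst y \<and> fst y' = fst x"
      using edge_eq_fst[OF *(3) that(2)] .
    moreover have "fst x' \<in> fst ` ?U" "fst y' \<notin> fst ` ?U" using * d by auto
    ultimately show False using that(1) by metis
  qed
  consider "x \<in> ?U" "y \<in> ?V" | "x \<in> ?V" "y \<in> ?U" | "fst x \<in> fst ` ?U \<longleftrightarrow> fst y \<in> fst ` ?U"
    using xy d by auto
  thus ?thesis
  proof cases
    case 1
    hence "fst y \<notin> fst ` ?U" using d by auto
    moreover have "fst x \<in> fst ` ?U" using 1 by blast
    ultimately show ?thesis unfolding edge_diff_edge[OF xy(3)] both[OF 1 xy(3)] by simp
  next
    case 2
    hence "fst x \<notin> fst ` ?U" using d by auto
    moreover have "orient y x = - orient x y" using xy(3) by (auto simp: orient_def)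
    moreover have "crossing T u v (edge T x y) = orient y x"
      unfolding edge_commute[OF xy(3)] by (rule both[OF 2(2,1) xy(3)[symmetric]])
    moreover have "fst y \<in> fst ` ?U" using 2 by blast
    ultimately show ?thesis unfolding edge_diff_edge[OF xy(3)] by simp
  next
    case 3
    thus ?thesis unfolding edge_diff_edge[OF xy(3)] same[OF 3 xy(3)] by simp
  qed
qed

lemma multilinear_submset:
  "image_mset fst (M :: (nat \<times> nat) multiset) = mset_set I \<Longrightarrow> finite I \<Longrightarrow> N \<subseteq># M \<Longrightarrow>
    N = filter_mset (\<lambda>x. fst x \<in> fst ` set_mset N) M"
proof -
  assume I: "image_mset fst M = mset_set I" "finite I" and "N \<subseteq># M"
  then obtain N' where M: "M = N + N'" by (auto simp: mset_subset_eq_exists_conv)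
  have "fst ` set_mset N \<inter> fst ` set_mset N' = {}" using multilinear_union(3) I M by blast
  hence "filter_mset (\<lambda>x. fst x \<in> fst ` set_mset N) N' = {#}" unfolding filter_mset_eq_mempty_iff by blast
  moreover have "filter_mset (\<lambda>x. fst x \<in> fst ` set_mset N) N = N" by (auto simp: filter_mset_eq_conv)
  ultimately show ?thesis unfolding M by simp
qed

text \<open>Moving \<open>link T u v\<close> to the other side turns it into the derivative along
  the indicator potential of u, which by \<open>deriv_along_tree\<close> is a cobracket of h. Only
  the terms that split the generators like u and v survive, and for these the pairing
  factors.\<close>

theorem tree_pair_bracket:
  assumes X: "finite X" and I: "image_mset fst (comm_gens h) = mset_set I" "finite I"
    and uv: "comm_gens h = comm_gens u + comm_gens v"
    and w: "\<And>x y. x \<in># comm_gens h \<Longrightarrow> y \<in># comm_gens h \<Longrightarrow> fst x \<noteq> fst y \<Longrightarrow>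
              edge T x y \<in> X \<and> a (edge T x y) = \<beta> x y"
  shows "tree_pair X a (tree_coeff T h) (tree_coeff T (CBracket u v)) = cobracket_sum (*) \<beta> h (\<lambda>c d.
     (if comm_gens c = comm_gens u \<and> comm_gens d = comm_gens v
      then tree_pair X a (tree_coeff T c) (tree_coeff T u) * tree_pair X a (tree_coeff T d) (tree_coeff T v) else 0)
   - (if comm_gens c = comm_gens v \<and> comm_gens d = comm_gens u
      then tree_pair X a (tree_coeff T c) (tree_coeff T v) * tree_pair X a (tree_coeff T d) (tree_coeff T u) else 0))"
proof -
  let ?P = "tree_coeff T" and ?U = "fst ` set_mset (comm_gens u)" and ?V = "fst ` set_mset (comm_gens v)"
  define l :: "nat \<Rightarrow> complex" where "l = (\<lambda>i. if i \<in> ?U then 1 else 0)"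
  define q where "q = conv (?P u) (?P v)"
  have Iuv: "image_mset fst (comm_gens u + comm_gens v) = mset_set I" using I uv by simp
  have d: "?U \<inter> ?V = {}" by (rule multilinear_union(3)[OF Iuv I(2)])
  have fin: "finite B" if "B \<in> Pow X" for B using that X by (auto intro: finite_subset)
  \<comment> \<open>A term of the product for u and v has edges inside u or inside v only, and along
    these the indicator of u does not vary.\<close>
  have q0: "\<forall>e\<in>B. edge_diff l e = 0" if qB: "q B \<noteq> 0" for B
  proof
    fix e assume "e \<in> B"
    obtain C where C: "C \<subseteq> B" "?P u C \<noteq> 0" "?P v (B - C) \<noteq> 0" using conv_nonzeroD[OF qB[unfolded q_def]] by blast
    have "e \<in> inner_edges T u \<or> e \<in> inner_edges T v"
      using tree_coeff_inner[OF C(2)] tree_coeff_inner[OF C(3)] \<open>e \<in> B\<close> by blast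
    then obtain x y where xy: "e = edge T x y" "fst x \<noteq> fst y"
      "x \<in># comm_gens u \<and> y \<in># comm_gens u \<or> x \<in># comm_gens v \<and> y \<in># comm_gens v"
      unfolding inner_edges_def by blast
    have "fst x \<in> ?U \<longleftrightarrow> fst y \<in> ?U" using xy(3) d by blast
    thus "edge_diff l e = 0" unfolding xy(1) edge_diff_edge[OF xy(2)] l_def by simp
  qed
  have inner: "(\<Sum>e\<in>X - B. crossing T u v e * a e * ?P h (insert e B)) = deriv_along X a l (?P h) B"
    if B: "B \<in> Pow X" "q B \<noteq> 0" for B
  proof -
    have "(\<Sum>e\<in>X - B. crossing T u v e * a e * ?P h (insert e B)) = (\<Sum>e\<in>X - B. a e * edge_diff l e * ?P h (insert e B))"
    proof (intro sum.cong HOL.refl)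
      fix e
      show "crossing T u v e * a e * ?P h (insert e B) = a e * edge_diff l e * ?P h (insert e B)"
      proof (cases "?P h (insert e B) = 0")
        case False
        hence "e \<in> inner_edges T h" using tree_coeff_inner by blast
        then obtain x y where xy: "e = edge T x y" "x \<in># comm_gens h" "y \<in># comm_gens h" "fst x \<noteq> fst y"
          unfolding inner_edges_def by blast
        have "crossing T u v e = edge_diff l e" unfolding xy(1) l_def
          by (rule crossing_edge[OF Iuv I(2)]) (use xy uv in auto)
        thus ?thesis by simp
      qed simp
    qed
    also have "\<dots> = deriv_along X a l (?P h) B"
      unfolding deriv_along_def using q0[OF B(2)] X by (intro sum.mono_neutral_left) auto
    finally show ?thesis .
  qed
  have "tree_pair X a (?P h) (?P (CBracket u v)) = tree_pair X a (conv (link T u v) q) (?P h)"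
    by (simp add: tree_pair_commute q_def)
  also have "\<dots> = (\<Sum>B\<in>Pow X. (\<Prod>e\<in>B. a e) * q B * (\<Sum>e\<in>X - B. crossing T u v e * a e * ?P h (insert e B)))"
    by (rule tree_pair_link[OF X])
  also have "\<dots> = (\<Sum>B\<in>Pow X. cobracket_sum (*) \<beta> h (\<lambda>c d. (l (lead c) - l (lead d)) *
      ((\<Prod>e\<in>B. a e) * q B * conv (?P c) (?P d) B)))"
  proof (intro sum.cong HOL.refl)
    fix B assume B: "B \<in> Pow X"
    show "(\<Prod>e\<in>B. a e) * q B * (\<Sum>e\<in>X - B. crossing T u v e * a e * ?P h (insert e B)) =
      cobracket_sum (*) \<beta> h (\<lambda>c d. (l (lead c) - l (lead d)) * ((\<Prod>e\<in>B. a e) * q B * conv (?P c) (?P d) B))"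
    proof (cases "q B = 0")
      case False
      have "(\<Sum>e\<in>X - B. crossing T u v e * a e * ?P h (insert e B)) =
        cobracket_sum (*) \<beta> h (\<lambda>c d. (l (lead c) - l (lead d)) * conv (?P c) (?P d) B)"
        unfolding inner[OF B False] by (rule deriv_along_tree[OF X fin[OF B] q0[OF False] w])
      thus ?thesis by (simp add: cobracket_sum_scale[symmetric] mult_ac)
    qed (simp add: cobracket_sum_zero)
  qed
  also have "\<dots> = cobracket_sum (*) \<beta> h (\<lambda>c d. (l (lead c) - l (lead d)) * tree_pair X a q (conv (?P c) (?P d)))"
    by (simp add: cobracket_sum_sum sum_distrib_left[symmetric] tree_pair_def)
  also have "\<dots> = cobracket_sum (*) \<beta> h (\<lambda>c d.
     (if comm_gens c = comm_gens u \<and> comm_gens d = comm_gens v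
      then tree_pair X a (?P c) (?P u) * tree_pair X a (?P d) (?P v) else 0)
   - (if comm_gens c = comm_gens v \<and> comm_gens d = comm_gens u
      then tree_pair X a (?P c) (?P v) * tree_pair X a (?P d) (?P u) else 0))"
  proof (rule cobracket_sum_cong)
    fix c d assume cd: "comm_gens c + comm_gens d = comm_gens h"
    let ?C = "tree_pair X a q (conv (?P c) (?P d))"
    have lead_u: "lead u \<in> ?U" and lead_v: "lead v \<in> ?V" and lead_c: "lead c \<in> fst ` set_mset (comm_gens c)"
      and lead_d: "lead d \<in> fst ` set_mset (comm_gens d)" by (rule lead_mem)+
    \<comment> \<open>Equal generators allow the same edges, so all four polynomials live on the two
      disjoint edge sets of u and v.\<close>
    have factor: "tree_pair X a (conv (?P u) (?P v)) (conv (?P c) (?P d)) =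
        tree_pair X a (?P u) (?P c) * tree_pair X a (?P v) (?P d)"
      if "comm_gens c = comm_gens u" "comm_gens d = comm_gens v" for c d
    proof (rule tree_pair_conv[OF X inner_edges_disjoint[OF d]])
      show "B \<subseteq> inner_edges T u" if "?P c B \<noteq> 0" for B
        using tree_coeff_inner[OF that] \<open>comm_gens c = comm_gens u\<close> by (simp add: inner_edges_def)
      show "B \<subseteq> inner_edges T v" if "?P d B \<noteq> 0" for B
        using tree_coeff_inner[OF that] \<open>comm_gens d = comm_gens v\<close> by (simp add: inner_edges_def)
    qed (rule tree_coeff_inner, assumption)+
    consider (uv) "comm_gens c = comm_gens u" "comm_gens d = comm_gens v"
      | (vu) "comm_gens c = comm_gens v" "comm_gens d = comm_gens u"
      | (other) "\<not> (comm_gens c = comm_gens u \<and> comm_gens d = comm_gens v)"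
        "\<not> (comm_gens c = comm_gens v \<and> comm_gens d = comm_gens u)" by blast
    thus "(l (lead c) - l (lead d)) * ?C =
     (if comm_gens c = comm_gens u \<and> comm_gens d = comm_gens v
      then tree_pair X a (?P c) (?P u) * tree_pair X a (?P d) (?P v) else 0)
   - (if comm_gens c = comm_gens v \<and> comm_gens d = comm_gens u
      then tree_pair X a (?P c) (?P v) * tree_pair X a (?P d) (?P u) else 0)"
    proof cases
      case uv
      have "lead c \<in> ?U" "lead d \<in> ?V" using lead_c lead_d uv by auto
      hence "l (lead c) = 1" "l (lead d) = 0" using d by (auto simp: l_def)
      moreover have "comm_gens u \<noteq> comm_gens v" using d lead_u by auto
      ultimately show ?thesis using uv factor[OF uv]
        by (simp add: q_def tree_pair_commute[of X a "?P u"] tree_pair_commute[of X a "?P v"])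
    next
      case vu
      have "lead d \<in> ?U" "lead c \<in> ?V" using lead_c lead_d vu by auto
      hence "l (lead d) = 1" "l (lead c) = 0" using d by (auto simp: l_def)
      moreover have "comm_gens u \<noteq> comm_gens v" using d lead_u by auto
      ultimately show ?thesis using vu factor[OF vu(2,1)]
        by (simp add: q_def conv_commute[of "?P c"] tree_pair_commute[of X a "?P u"] tree_pair_commute[of X a "?P v"])
    next
      case other
      \<comment> \<open>A term shared by the products for (u, v) and (c, d) makes the potential
        constant on c and on d. If the two values differ, one of c and d has exactly the generators
        of u and the other those of v.\<close>
      have "(l (lead c) - l (lead d)) * ?C = 0"
      proof (rule ccontr)
        assume *: "(l (lead c) - l (lead d)) * ?C \<noteq> 0"
        hence "?C \<noteq> 0" by (metis mult_zero_right)
        then obtain B where "B \<in> Pow X" and nz: "(\<Prod>e\<in>B. a e) * q B * conv (?P c) (?P d) B \<noteq> 0"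
          unfolding tree_pair_def by (rule sum.not_neutral_contains_not_neutral)
        hence B: "B \<in> Pow X" "q B \<noteq> 0" "conv (?P c) (?P d) B \<noteq> 0" by simp_all
        from conv_nonzeroD[OF B(3)] obtain C where C: "C \<subseteq> B" "?P c C \<noteq> 0" "?P d (B - C) \<noteq> 0" by auto
        have eC: "\<forall>e\<in>C. edge_diff l e = 0" and eD: "\<forall>e\<in>B - C. edge_diff l e = 0"
          by (intro ballI q0[OF B(2), rule_format]; use C(1) in blast)+
        note lc = tree_coeff_connected[OF C(2) eC]
        note ld = tree_coeff_connected[OF C(3) eD]
        have u: "comm_gens u = filter_mset (\<lambda>x. fst x \<in> ?U) (comm_gens h)"
          by (rule multilinear_submset[OF I]) (simp add: uv)
        have v: "comm_gens v = filter_mset (\<lambda>x. fst x \<notin> ?U) (comm_gens h)"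
        proof -
          have "comm_gens u + comm_gens v =
              filter_mset (\<lambda>x. fst x \<in> ?U) (comm_gens h) + filter_mset (\<lambda>x. fst x \<notin> ?U) (comm_gens h)"
            unfolding uv[symmetric] by (rule multiset_partition)
          thus ?thesis unfolding u[symmetric] by (rule add_left_imp_eq)
        qed
        have L1: "i \<in> ?U" if "l i = 1" for i using that unfolding l_def by (metis zero_neq_one)
        have L0: "i \<notin> ?U" if "l i = 0" for i using that unfolding l_def by (metis zero_neq_one)
        have L: "l i = 1 \<or> l i = 0" for i unfolding l_def by simp
        have "l (lead c) \<noteq> l (lead d)" using * by auto
        hence "l (lead c) = 1 \<and> l (lead d) = 0 \<or> l (lead c) = 0 \<and> l (lead d) = 1"
          using L[of "lead c"] L[of "lead d"] by (elim disjE) simp_all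
        thus False
        proof
          assume cd': "l (lead c) = 1 \<and> l (lead d) = 0"
          have "\<forall>x\<in>#comm_gens c. fst x \<in> ?U" "\<forall>x\<in>#comm_gens d. fst x \<notin> ?U"
            using L1[OF HOL.trans[OF lc conjunct1[OF cd']]] L0[OF HOL.trans[OF ld conjunct2[OF cd']]] by blast+
          hence "filter_mset (\<lambda>x. fst x \<in> ?U) (comm_gens c) = comm_gens c" "filter_mset (\<lambda>x. fst x \<in> ?U) (comm_gens d) = {#}"
            "filter_mset (\<lambda>x. fst x \<notin> ?U) (comm_gens c) = {#}" "filter_mset (\<lambda>x. fst x \<notin> ?U) (comm_gens d) = comm_gens d"
            unfolding filter_mset_eq_conv filter_mset_eq_mempty_iff by auto
          hence "filter_mset (\<lambda>x. fst x \<in> ?U) (comm_gens h) = comm_gens c"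
            "filter_mset (\<lambda>x. fst x \<notin> ?U) (comm_gens h) = comm_gens d"
            unfolding cd[symmetric] by simp_all
          note HOL.trans[OF u this(1)] HOL.trans[OF v this(2)]
          thus False using other by simp
        next
          assume cd': "l (lead c) = 0 \<and> l (lead d) = 1"
          have "\<forall>x\<in>#comm_gens d. fst x \<in> ?U" "\<forall>x\<in>#comm_gens c. fst x \<notin> ?U"
            using L1[OF HOL.trans[OF ld conjunct2[OF cd']]] L0[OF HOL.trans[OF lc conjunct1[OF cd']]] by blast+
          hence "filter_mset (\<lambda>x. fst x \<in> ?U) (comm_gens d) = comm_gens d" "filter_mset (\<lambda>x. fst x \<in> ?U) (comm_gens c) = {#}"
            "filter_mset (\<lambda>x. fst x \<notin> ?U) (comm_gens d) = {#}" "filter_mset (\<lambda>x. fst x \<notin> ?U) (comm_gens c) = comm_gens c"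
            unfolding filter_mset_eq_conv filter_mset_eq_mempty_iff by auto
          hence "filter_mset (\<lambda>x. fst x \<in> ?U) (comm_gens h) = comm_gens d"
            "filter_mset (\<lambda>x. fst x \<notin> ?U) (comm_gens h) = comm_gens c"
            unfolding cd[symmetric] by simp_all
          note HOL.trans[OF u this(1)] HOL.trans[OF v this(2)]
          thus False using other by simp
        qed
      qed
      thus ?thesis by (simp only: if_not_P[OF other(1)] if_not_P[OF other(2)] diff_self)
    qed
  qed
  finally show ?thesis .
qed

subsection \<open>Shifting labels\<close>

primrec shift :: "nat \<Rightarrow> nat \<Rightarrow> commutator \<Rightarrow> commutator" where
  "shift T c (CGen i k) = CGen i ((k + c) mod T)"
| "shift T c (CBracket g h) = CBracket (shift T c g) (shift T c h)"

lemma comm_gens_shift: "comm_gens (shift T c g) = image_mset (\<lambda>(i, k). (i, (k + c) mod T)) (comm_gens g)"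
  by (induction g) auto

lemma fst_comm_gens_shift: "image_mset fst (comm_gens (shift T c g)) = image_mset fst (comm_gens g)"
  by (simp add: comm_gens_shift case_prod_beta image_mset.compositionality o_def)

lemma gain_shift: "gain T ((a + c) mod T) ((b + c) mod T) = gain T a b"
proof -
  have "(int ((b + c) mod T) - int ((a + c) mod T)) mod int T = (int b - int a) mod int T"
    by (simp add: zmod_int mod_diff_eq)
  thus ?thesis by (simp add: gain_def)
qed

lemma edge_shift: "edge T (i, (k + c) mod T) (j, (l + c) mod T) = edge T (i, k) (j, l)"
  by (simp add: edge_def gain_shift)

lemma edge_shift': "edge T (case x of (i, k) \<Rightarrow> (i, (k + c) mod T)) (case y of (i, k) \<Rightarrow> (i, (k + c) mod T)) = edge T x y"
  by (cases x; cases y) (simp add: edge_shift)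

lemma orient_shift: "orient (case x of (i, k) \<Rightarrow> (i, (k + c) mod T)) (case y of (i, k) \<Rightarrow> (i, (k + c) mod T)) = orient x y"
  by (cases x; cases y) (simp add: orient_def)

lemma link_shift: "link T (shift T c u) (shift T c v) = link T u v"
  by (rule ext) (simp add: link_def comm_gens_shift image_mset.compositionality o_def
      edge_shift' orient_shift cong: if_cong)

text \<open>Only differences of labels enter the hyperplanes, so a common rotation changes no edge.
  Tree polynomials therefore see words only up to rotation, which leads to the sums over rotations
  below.\<close>

lemma tree_coeff_shift: "tree_coeff T (shift T c g) = tree_coeff T g"
  by (induction g) (auto simp: link_shift)

lemma gain_less: "0 < T \<Longrightarrow> gain T a b < T"
  by (simp add: gain_def nat_less_iff)

lemma gain_cong: "0 < T \<Longrightarrow> gain T a b = gain T a' b' \<longleftrightarrow> (int b - int a) mod int T = (int b' - int a') mod int T"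
  by (simp add: gain_def nat_eq_iff)

lemma gain_add: "k' < T \<Longrightarrow> (k + gain T k k') mod T = k'"
proof -
  assume "k' < T"
  have "int ((k + gain T k k') mod T) = (int k + (int k' - int k) mod int T) mod int T"
    using \<open>k' < T\<close> by (simp add: gain_def zmod_int)
  also have "\<dots> = int k'" using \<open>k' < T\<close> by (simp add: mod_add_right_eq)
  finally show ?thesis by simp
qed

lemma gain_unique: "(s::nat) < T \<Longrightarrow> s' < T \<Longrightarrow> (k + s) mod T = (k + s') mod T \<Longrightarrow> s = s'"
proof -
  assume s: "s < T" "s' < T" and "(k + s) mod T = (k + s') mod T"
  hence "int ((k + s) mod T) = int ((k + s') mod T)" by simp
  hence "(int k + int s) mod int T = (int k + int s') mod int T" by (simp add: zmod_int)
  hence "int T dvd int s - int s'" by (simp add: mod_eq_dvd_iff)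
  moreover have "\<bar>int s - int s'\<bar> < int T" using s by linarith
  ultimately have "int s - int s' = 0" using dvd_imp_le_int[of "int s - int s'" "int T"] by linarith
  thus ?thesis by simp
qed

lemma inner_edges_orderedE:
  assumes "e \<in> inner_edges T g"
  obtains x y where "e = edge T x y" "x \<in># comm_gens g" "y \<in># comm_gens g" "fst x < fst y"
proof -
  obtain x y where xy: "e = edge T x y" "x \<in># comm_gens g" "y \<in># comm_gens g" "fst x \<noteq> fst y"
    using assms unfolding inner_edges_def by blast
  show ?thesis
  proof (cases "fst x < fst y")
    case False
    hence "fst y < fst x" using xy(4) by simp
    moreover have "e = edge T y x" using xy(1) edge_commute[OF xy(4)] by (simp only:)
    ultimately show ?thesis using that xy(2,3) by blast
  qed (rule that[OF xy(1-3)])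
qed

text \<open>The gains along a spanning tree determine the labels up to a common rotation: the
  difference of the two labels at a vertex does not change along the edges of the common
  tree.\<close>

lemma tree_coeff_labels:
  assumes T: "0 < T" and I: "image_mset fst (comm_gens g) = mset_set I" "image_mset fst (comm_gens h) = mset_set I" "finite I"
    and lt: "\<forall>x\<in>#comm_gens h. snd x < T"
    and A: "tree_coeff T g A \<noteq> 0" "A \<subseteq> inner_edges T g" "A \<subseteq> inner_edges T h"
  shows "\<exists>s<T. comm_gens h = comm_gens (shift T s g)"
proof -
  have g: "inj_on fst (set_mset (comm_gens g))" "fst ` set_mset (comm_gens g) = I"
    and h: "inj_on fst (set_mset (comm_gens h))" "fst ` set_mset (comm_gens h) = I"
    using multilinear_gens(2,3)[OF I(1,3)] multilinear_gens(2,3)[OF I(2,3)] by simp_all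
  define kg where "kg = (\<lambda>i. snd (inv_into (set_mset (comm_gens g)) fst i))"
  define kh where "kh = (\<lambda>i. snd (inv_into (set_mset (comm_gens h)) fst i))"
  have kg: "kg (fst x) = snd x" if "x \<in># comm_gens g" for x
    using g(1) that by (simp add: kg_def inv_into_f_f)
  have kh: "kh (fst x) = snd x" if "x \<in># comm_gens h" for x
    using h(1) that by (simp add: kh_def inv_into_f_f)
  \<comment> \<open>The label differences lie in {0..<T}; embedded into the complex numbers they
    form a potential to which connectedness applies.\<close>
  define l :: "nat \<Rightarrow> complex" where "l = (\<lambda>i. of_nat (gain T (kg i) (kh i)))"
  have "\<forall>e\<in>A. edge_diff l e = 0"
  proof
    fix e assume "e \<in> A"
    then obtain x y x' y' where *: "e = edge T x y" "x \<in># comm_gens g" "y \<in># comm_gens g" "fst x < fst y"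
      "e = edge T x' y'" "x' \<in># comm_gens h" "y' \<in># comm_gens h" "fst x' < fst y'"
      using inner_edges_orderedE[OF subsetD[OF A(2)]] inner_edges_orderedE[OF subsetD[OF A(3)]] by metis
    have e: "fst x = fst x'" "fst y = fst y'" "gain T (snd x) (snd y) = gain T (snd x') (snd y')"
      using *(1,4,5,8) by (auto simp: edge_def)
    have "(int (snd y) - int (snd x)) mod int T = (int (snd y') - int (snd x')) mod int T"
      using e(3) T by (simp add: gain_cong)
    hence "int T dvd (int (snd y) - int (snd x)) - (int (snd y') - int (snd x'))" by (simp add: mod_eq_dvd_iff)
    moreover have "(int (snd y) - int (snd x)) - (int (snd y') - int (snd x')) =
      (int (snd x') - int (snd x)) - (int (snd y') - int (snd y))" by simp
    ultimately have "int T dvd (int (snd x') - int (snd x)) - (int (snd y') - int (snd y))" by (simp only:)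
    hence "gain T (snd x) (snd x') = gain T (snd y) (snd y')"
      using T by (simp add: gain_cong mod_eq_dvd_iff)
    hence "l (fst x) = l (fst y)" using kg[OF *(2)] kg[OF *(3)] kh[OF *(6)] kh[OF *(7)] e(1,2) by (simp add: l_def)
    thus "edge_diff l e = 0" using *(1,4) edge_diff_edge[of x y l T] by simp
  qed
  note conn = tree_coeff_connected[OF A(1) this]
  define s where "s = gain T (kg (lead g)) (kh (lead g))"
  have s: "gain T (snd x) (kh (fst x)) = s" if "x \<in># comm_gens g" for x
    using conn[OF that] kg[OF that] by (simp add: l_def s_def)
  have "(kg i + s) mod T = kh i" if i: "i \<in> I" for i
  proof -
    obtain x where x: "x \<in># comm_gens g" "fst x = i" using i g(2) by auto
    obtain y where y: "y \<in># comm_gens h" "fst y = i" using i h(2) by auto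
    have "(snd x + gain T (snd x) (snd y)) mod T = snd y" using lt y(1) by (simp add: gain_add)
    thus ?thesis using s[OF x(1)] kg[OF x(1)] kh[OF y(1)] x y by simp
  qed
  hence kgs: "(snd x + s) mod T = kh (fst x)" if "x \<in># comm_gens g" for x
    unfolding kg[OF that, symmetric] using that g(2) by blast
  have hh: "comm_gens h = image_mset (\<lambda>i. (i, kh i)) (mset_set I)"
  proof -
    have "image_mset (\<lambda>i. (i, kh i)) (mset_set I) = image_mset (\<lambda>x. (fst x, kh (fst x))) (comm_gens h)"
      unfolding I(2)[symmetric] by (simp add: image_mset.compositionality o_def)
    also have "\<dots> = image_mset (\<lambda>x. x) (comm_gens h)" by (rule image_mset_cong) (simp add: kh)
    finally show ?thesis by simp
  qed
  have "comm_gens (shift T s g) = image_mset (\<lambda>x. (fst x, kh (fst x))) (comm_gens g)"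
    unfolding comm_gens_shift by (rule image_mset_cong) (simp add: case_prod_beta kgs)
  also have "\<dots> = image_mset (\<lambda>i. (i, kh i)) (mset_set I)"
    unfolding I(1)[symmetric] by (simp add: image_mset.compositionality o_def)
  finally have "comm_gens h = comm_gens (shift T s g)" using hh by (simp only:)
  moreover have "s < T" unfolding s_def by (rule gain_less[OF T])
  ultimately show ?thesis by blast
qed

text \<open>A nonzero pairing requires a common tree, so the generators of h arise from g by a
  rotation, and one vertex suffices to see that the rotation is unique. The right side compares
  words with equal generators, which is what the recursion \<open>tree_pair_bracket\<close> works
  with.\<close>

theorem tree_pair_shift_sum:
  assumes T: "0 < T" and X: "finite X"
    and I: "image_mset fst (comm_gens g) = mset_set I" "image_mset fst (comm_gens h) = mset_set I" "finite I" "I \<noteq> {}"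
    and lt: "\<forall>x\<in>#comm_gens h. snd x < T"
  shows "tree_pair X a (tree_coeff T g) (tree_coeff T h) =
    (\<Sum>s<T. if comm_gens h = comm_gens (shift T s g)
      then tree_pair X a (tree_coeff T (shift T s g)) (tree_coeff T h) else 0)"
proof (cases "tree_pair X a (tree_coeff T g) (tree_coeff T h) = 0")
  case True
  thus ?thesis by (simp add: tree_coeff_shift cong: if_cong)
next
  case False
  then obtain A where "(\<Prod>e\<in>A. a e) * tree_coeff T g A * tree_coeff T h A \<noteq> 0"
    unfolding tree_pair_def by (rule sum.not_neutral_contains_not_neutral)
  hence A: "tree_coeff T g A \<noteq> 0" "tree_coeff T h A \<noteq> 0" by simp_all
  obtain s where s: "s < T" "comm_gens h = comm_gens (shift T s g)"
    using tree_coeff_labels[OF T I(1,2,3) lt A(1) tree_coeff_inner[OF A(1)] tree_coeff_inner[OF A(2)]] by blast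
  have uniq: "s' = s" if s': "s' < T" "comm_gens h = comm_gens (shift T s' g)" for s'
  proof -
    obtain x where x: "x \<in># comm_gens g" using lead_mem by blast
    have "(fst x, (snd x + c) mod T) \<in># comm_gens (shift T c g)" for c
      unfolding comm_gens_shift set_image_mset by (rule image_eqI[OF _ x]) (simp add: case_prod_beta)
    note mem = this
    have "(fst x, (snd x + s) mod T) \<in># comm_gens h" by (subst s(2)) (rule mem)
    moreover have "(fst x, (snd x + s') mod T) \<in># comm_gens h" by (subst s'(2)) (rule mem)
    ultimately have "(fst x, (snd x + s) mod T) = (fst x, (snd x + s') mod T)"
      by (intro inj_onD[OF multilinear_gens(2)[OF I(2,3)]]) simp_all
    hence "(snd x + s) mod T = (snd x + s') mod T" by simp
    thus ?thesis by (rule gain_unique[OF s'(1) s(1), OF HOL.sym])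
  qed
  have "(\<Sum>s'<T. if comm_gens h = comm_gens (shift T s' g)
      then tree_pair X a (tree_coeff T (shift T s' g)) (tree_coeff T h) else 0) =
    (\<Sum>s'<T. if s' = s then tree_pair X a (tree_coeff T g) (tree_coeff T h) else 0)"
  proof (intro sum.cong HOL.refl)
    fix s' assume "s' \<in> {..<T}"
    hence "comm_gens h = comm_gens (shift T s' g) \<longleftrightarrow> s' = s" using uniq[of s'] s(2) by blast
    thus "(if comm_gens h = comm_gens (shift T s' g)
      then tree_pair X a (tree_coeff T (shift T s' g)) (tree_coeff T h) else 0) =
      (if s' = s then tree_pair X a (tree_coeff T g) (tree_coeff T h) else 0)"
      by (simp only: tree_coeff_shift)
  qed
  thus ?thesis using s(1) by (simp add: sum.delta)
qed

subsection \<open>Determinants of lists of vectors\<close>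

definition vol :: "nat \<Rightarrow> (nat \<Rightarrow> complex) list \<Rightarrow> complex" where
  "vol n vs = det (mat n n (\<lambda>(i, j). (vs ! i) j))"

lemma vol_permute:
  assumes "length xs = n" "p permutes {..<n}"
  shows "vol n (permute_list p xs) = of_int (sign p) * vol n xs"
proof -
  have p: "p permutes {0..<n}" using assms(2) by (simp add: lessThan_atLeast0)
  have "p i < n" if "i < n" for i using permutes_in_image[OF assms(2), of i] that by simp
  hence "mat n n (\<lambda>(i, j). (permute_list p xs ! i) j) = mat n n (\<lambda>(i, j). mat n n (\<lambda>(i, j). (xs ! i) j) $$ (p i, j))"
    using assms by (intro eq_matI) (auto simp: permute_list_nth)
  thus ?thesis unfolding vol_def using det_permute_rows[OF _ p, of "mat n n (\<lambda>(i, j). (xs ! i) j)"] by simp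
qed

text \<open>The sign belongs to a permutation of positions, so one sign serves all f at once.
  Determinants of different row functions over the same list thus change together.\<close>

lemma vol_mset:
  assumes "mset xs = mset ys" "length xs = n"
  shows "\<exists>s\<in>{1, -1}. \<forall>f. vol n (map f ys) = s * vol n (map f xs)"
proof -
  obtain p where p: "p permutes {..<length xs}" "permute_list p xs = ys"
    using mset_eq_permutation[OF assms(1)[symmetric]] by blast
  have "vol n (map f ys) = of_int (sign p) * vol n (map f xs)" for f
    unfolding p(2)[symmetric] using permute_list_map[OF p(1), of f] vol_permute[of "map f xs" n p] p(1) assms(2) by simp
  moreover have "(of_int (sign p) :: complex) \<in> {1, -1}" by (cases p rule: sign_cases) auto
  ultimately show ?thesis by blast
qed

lemma vol_identical:
  assumes "i < n" "j < n" "i \<noteq> j" "vs ! i = vs ! j"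
  shows "vol n vs = 0"
  unfolding vol_def by (rule det_identical_rows[of _ n i j]) (use assms in auto)

lemma vol_linear_row: "\<exists>c. \<forall>x. length us < n \<longrightarrow> vol n (us @ x # ws) = (\<Sum>j<n. x j * c j)"
proof -
  let ?A = "\<lambda>x. mat n n (\<lambda>(i, j). ((us @ x # ws) ! i) j)" and ?k = "length us"
  have "vol n (us @ x # ws) = (\<Sum>j<n. x j * cofactor (?A 0) ?k j)" if k: "?k < n" for x
  proof -
    \<comment> \<open>The cofactors along a row do not involve that row, so they may be taken at x =
      0.\<close>
    have "mat_delete (?A x) ?k j = mat_delete (?A 0) ?k j" for j
      unfolding mat_delete_def by (intro eq_matI) (auto simp: nth_append nth_Cons')
    hence c: "cofactor (?A x) ?k j = cofactor (?A 0) ?k j" for j by (simp add: cofactor_def)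
    have "vol n (us @ x # ws) = (\<Sum>j<n. ?A x $$ (?k, j) * cofactor (?A x) ?k j)"
      unfolding vol_def by (rule laplace_expansion_row) (use k in auto)
    also have "\<dots> = (\<Sum>j<n. x j * cofactor (?A 0) ?k j)"
      using k c by (intro sum.cong) auto
    finally show ?thesis .
  qed
  thus ?thesis by blast
qed

lemma vol_linear:
  assumes "length us < n"
  shows "vol n (us @ (\<lambda>i. a * x i + b * y i) # ws) = a * vol n (us @ x # ws) + b * vol n (us @ y # ws)"
proof -
  obtain c where "\<And>x. vol n (us @ x # ws) = (\<Sum>j<n. x j * c j)" using vol_linear_row[of us n ws] assms by blast
  thus ?thesis by (simp add: sum_distrib_left sum.distrib algebra_simps)
qed

lemma vol_swap:
  assumes "length us + 1 < n" "length us + length ws + 2 = n"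
  shows "vol n (us @ x # y # ws) = - vol n (us @ y # x # ws)"
proof -
  let ?z = "\<lambda>i. 1 * x i + 1 * y i"
  have same: "vol n (us @ x # x # ws) = 0" for x
    by (rule vol_identical[of "length us" _ "Suc (length us)"]) (use assms in \<open>auto simp: nth_append\<close>)
  have "0 = vol n (us @ ?z # ?z # ws)" using same[of ?z] by simp
  also have "\<dots> = vol n (us @ x # ?z # ws) + vol n (us @ y # ?z # ws)"
    using vol_linear[of us n 1 x 1 y "?z # ws"] assms by simp
  also have "vol n (us @ x # ?z # ws) = vol n (us @ x # x # ws) + vol n (us @ x # y # ws)"
    using vol_linear[of "us @ [x]" n 1 x 1 y ws] assms by simp
  also have "vol n (us @ y # ?z # ws) = vol n (us @ y # x # ws) + vol n (us @ y # y # ws)"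
    using vol_linear[of "us @ [y]" n 1 x 1 y ws] assms by simp
  finally show ?thesis using same by (simp add: eq_neg_iff_add_eq_0)
qed

lemma vol_move:
  assumes "length us + length vs + length ws + 1 = n"
  shows "vol n (us @ x # vs @ ws) = (-1) ^ length vs * vol n (us @ vs @ x # ws)"
  using assms
proof (induction vs arbitrary: us)
  case (Cons v vs)
  have "vol n (us @ x # v # vs @ ws) = - vol n ((us @ [v]) @ x # vs @ ws)"
    using vol_swap[of us n "vs @ ws" x v] Cons.prems by simp
  also have "\<dots> = - ((-1) ^ length vs * vol n ((us @ [v]) @ vs @ x # ws))"
    using Cons.prems by (subst Cons.IH) auto
  finally show ?case by simp
qed simp

subsection \<open>Flag pairings as determinants\<close>

definition cut :: "nat \<Rightarrow> complex \<Rightarrow> pt set \<Rightarrow> hyp \<Rightarrow> pt set \<Rightarrow> complex" where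
  "cut m \<omega> L H L' = of_bool (L \<inter> hyp_set m \<omega> H = L')"

lemma flag_perm_iff:
  assumes "length Hs = q" "Ls ! 0 = Cspace m"
  shows "flag_perm m \<omega> Ls Hs s \<longleftrightarrow> s permutes {..<q} \<and>
    (\<forall>i<q. Ls ! i \<inter> hyp_set m \<omega> (Hs ! s i) = Ls ! Suc i)"
proof -
  let ?I = "\<lambda>i. Cspace m \<inter> (\<Inter>j<i. hyp_set m \<omega> (Hs ! s j))"
  have Suc: "?I (Suc i) = ?I i \<inter> hyp_set m \<omega> (Hs ! s i)" for i by (auto simp: lessThan_Suc)
  have "(\<forall>i\<le>q. Ls ! i = ?I i) \<longleftrightarrow> (\<forall>i<q. Ls ! i \<inter> hyp_set m \<omega> (Hs ! s i) = Ls ! Suc i)"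
  proof
    assume "\<forall>i\<le>q. Ls ! i = ?I i"
    thus "\<forall>i<q. Ls ! i \<inter> hyp_set m \<omega> (Hs ! s i) = Ls ! Suc i" using Suc by simp
  next
    assume *: "\<forall>i<q. Ls ! i \<inter> hyp_set m \<omega> (Hs ! s i) = Ls ! Suc i"
    have "i \<le> q \<longrightarrow> Ls ! i = ?I i" for i
    proof (induction i)
      case (Suc i)
      show ?case using Suc.IH *[rule_format, of i] \<open>?I (Suc i) = _\<close> by auto
    qed (use assms in auto)
    thus "\<forall>i\<le>q. Ls ! i = ?I i" by blast
  qed
  thus ?thesis unfolding flag_perm_def assms(1) by simp
qed

text \<open>In the Leibniz expansion a permutation contributes its sign exactly if every hyperplane
  cuts its edge down to the next one. As the flag decreases strictly, at most one permutation does
  this, in accordance with the definite description in \<open>flag_pairing\<close>.\<close>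

lemma flag_pairing_det:
  assumes len: "length Ls = Suc q" "length Hs = q" "Ls ! 0 = Cspace m"
    and dec: "\<And>i. i < q \<Longrightarrow> Ls ! Suc i \<subset> Ls ! i"
  shows "flag_pairing m \<omega> Ls Hs = det (mat q q (\<lambda>(i, r). cut m \<omega> (Ls ! i) (Hs ! r) (Ls ! Suc i)))"
proof -
  let ?p = "\<lambda>s. flag_perm m \<omega> Ls Hs s"
  let ?ok = "\<lambda>s. \<forall>i<q. Ls ! i \<inter> hyp_set m \<omega> (Hs ! s i) = Ls ! Suc i"
  note iff = flag_perm_iff[OF len(2,3), of \<omega>]
  have mono: "Ls ! j \<subseteq> Ls ! i" if "i \<le> j" "j \<le> q" for i j
    using that
  proof (induction j)
    case (Suc j)
    show ?case
    proof (cases "i = Suc j")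
      case False
      thus ?thesis using Suc.IH Suc.prems dec[of j] by auto
    qed simp
  qed simp
  have uniq: "s' = s" if ss: "?p s" "?p s'" for s s'
  proof
    fix r
    note s = ss(1)[unfolded iff] and s' = ss(2)[unfolded iff]
    show "s' r = s r"
    proof (cases "r < q")
      case True
      have sr: "s r \<in> {..<q}" using permutes_in_image[of s "{..<q}" r] s True by simp
      then obtain k where k: "s' k = s r" "k < q"
        using permutes_image[of s' "{..<q}"] s' by (metis imageE lessThan_iff)
      have A: "Ls ! r \<inter> hyp_set m \<omega> (Hs ! s r) = Ls ! Suc r" using s True by blast
      have B: "Ls ! k \<inter> hyp_set m \<omega> (Hs ! s r) = Ls ! Suc k" using s' k by metis
      \<comment> \<open>A hyperplane used at an earlier step contains all later edges and cannot cut
        strictly again.\<close>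
      have "\<not> k < r"
      proof
        assume "k < r"
        hence "Ls ! r \<subseteq> Ls ! Suc k" using mono[of "Suc k" r] True by simp
        thus False using A B dec[OF True] by blast
      qed
      moreover have "\<not> r < k"
      proof
        assume "r < k"
        hence "Ls ! k \<subseteq> Ls ! Suc r" using mono[of "Suc r" k] k by simp
        thus False using A B dec[OF k(2)] by blast
      qed
      ultimately show ?thesis using k(1) by (metis linorder_neqE_nat)
    next
      case False
      thus ?thesis using s s' by (auto simp: permutes_def)
    qed
  qed
  have prod: "(\<Prod>i = 0..<q. mat q q (\<lambda>(i, r). cut m \<omega> (Ls ! i) (Hs ! r) (Ls ! Suc i)) $$ (i, s i)) = (of_bool (?p s) :: complex)"
    if s: "s permutes {0..<q}" for s
  proof -
    have lt: "s i < q" if "i < q" for i using permutes_in_image[OF s, of i] that by simp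
    have "(\<Prod>i = 0..<q. mat q q (\<lambda>(i, r). cut m \<omega> (Ls ! i) (Hs ! r) (Ls ! Suc i)) $$ (i, s i)) =
        (\<Prod>i = 0..<q. cut m \<omega> (Ls ! i) (Hs ! s i) (Ls ! Suc i))"
      using lt by (intro prod.cong) auto
    also have "\<dots> = of_bool (?ok s)"
    proof (cases "?ok s")
      case False
      then obtain i where "i < q" "Ls ! i \<inter> hyp_set m \<omega> (Hs ! s i) \<noteq> Ls ! Suc i" by blast
      hence "\<exists>i\<in>{0..<q}. cut m \<omega> (Ls ! i) (Hs ! s i) (Ls ! Suc i) = 0" by (auto simp: cut_def)
      thus ?thesis using False by (simp add: prod_zero)
    qed (simp add: cut_def)
    also have "?ok s \<longleftrightarrow> ?p s" unfolding iff using s by (simp add: lessThan_atLeast0)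
    finally show ?thesis .
  qed
  have "det (mat q q (\<lambda>(i, r). cut m \<omega> (Ls ! i) (Hs ! r) (Ls ! Suc i))) =
     (\<Sum>s\<in>{s. s permutes {0..<q}}. of_int (sign s) * of_bool (?p s))"
    unfolding det_def'[OF mat_carrier] by (intro sum.cong HOL.refl) (simp only: mem_Collect_eq prod)
  also have "\<dots> = flag_pairing m \<omega> Ls Hs"
  proof (cases "\<exists>s. ?p s")
    case True
    then obtain s where s: "?p s" by blast
    hence the: "(THE s. ?p s) = s" using uniq by blast
    have perm: "s permutes {0..<q}" using s iff by (simp add: lessThan_atLeast0)
    have "?p s' \<longleftrightarrow> s' = s" for s' using uniq s by blast
    hence "(\<Sum>s'\<in>{s. s permutes {0..<q}}. of_int (sign s') * of_bool (?p s')) =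
      (\<Sum>s'\<in>{s. s permutes {0..<q}}. if s' = s then of_int (sign s) else (0 :: complex))"
      by (intro sum.cong) auto
    also have "\<dots> = of_int (sign s)"
      using perm finite_permutations[of "{0..<q}"] by (simp add: sum.delta)
    finally show ?thesis using True the by (simp add: flag_pairing_def)
  qed (simp add: flag_pairing_def)
  finally show ?thesis by simp
qed

text \<open>Laplace expansion along the last row, which belongs to the new edge of the flag. It is
  the counterpart of the choice of a joining edge in \<open>conv_link\<close>.\<close>

lemma flag_pairing_snoc:
  assumes len: "length Ls = Suc q" "length Hs = Suc q" "Ls ! 0 = Cspace m"
    and dec: "\<And>i. i < q \<Longrightarrow> Ls ! Suc i \<subset> Ls ! i" and L: "L \<subset> last Ls"
  shows "flag_pairing m \<omega> (Ls @ [L]) Hs =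
    (\<Sum>j<Suc q. (-1) ^ (q + j) * cut m \<omega> (last Ls) (Hs ! j) L * flag_pairing m \<omega> Ls (take j Hs @ drop (Suc j) Hs))"
proof -
  let ?Ls = "Ls @ [L]"
  let ?A = "mat (Suc q) (Suc q) (\<lambda>(i, r). cut m \<omega> (?Ls ! i) (Hs ! r) (?Ls ! Suc i))"
  have last: "last Ls = Ls ! q" using len(1) by (metis diff_Suc_1 last_conv_nth list.size(3) nat.distinct(1))
  have dec': "?Ls ! Suc i \<subset> ?Ls ! i" if "i < Suc q" for i
    using that dec[of i] L len(1) last by (cases "i = q") (auto simp: nth_append)
  have "flag_pairing m \<omega> ?Ls Hs = det ?A"
    by (rule flag_pairing_det) (use len dec' in \<open>auto simp: nth_append\<close>)
  also have "\<dots> = (\<Sum>j<Suc q. ?A $$ (q, j) * cofactor ?A q j)"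
    by (rule laplace_expansion_row) auto
  also have "\<dots> = (\<Sum>j<Suc q. (-1) ^ (q + j) * cut m \<omega> (last Ls) (Hs ! j) L * flag_pairing m \<omega> Ls (take j Hs @ drop (Suc j) Hs))"
  proof (intro sum.cong HOL.refl)
    fix j assume "j \<in> {..<Suc q}"
    hence j: "j < Suc q" by simp
    have "mat_delete ?A q j = mat q q (\<lambda>(i, r). cut m \<omega> (Ls ! i) ((take j Hs @ drop (Suc j) Hs) ! r) (Ls ! Suc i))"
      unfolding mat_delete_def using len j by (intro eq_matI) (auto simp: nth_append)
    moreover have "flag_pairing m \<omega> Ls (take j Hs @ drop (Suc j) Hs) =
      det (mat q q (\<lambda>(i, r). cut m \<omega> (Ls ! i) ((take j Hs @ drop (Suc j) Hs) ! r) (Ls ! Suc i)))"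
      by (rule flag_pairing_det) (use len dec j in auto)
    moreover have "?A $$ (q, j) = cut m \<omega> (last Ls) (Hs ! j) L"
      using j len last by (simp add: nth_append)
    ultimately show "?A $$ (q, j) * cofactor ?A q j =
      (-1) ^ (q + j) * cut m \<omega> (last Ls) (Hs ! j) L * flag_pairing m \<omega> Ls (take j Hs @ drop (Suc j) Hs)"
      by (simp add: cofactor_def)
  qed
  finally show ?thesis .
qed

subsection \<open>Dimensions\<close>

primrec hyp_form :: "complex \<Rightarrow> hyp \<Rightarrow> pt \<Rightarrow> complex" where
  "hyp_form \<omega> (HEq i j k) t = t i - \<omega> ^ k * t j"
| "hyp_form \<omega> (HZero i) t = t i"

lemma hyp_set_form: "hyp_set m \<omega> H = {t \<in> Cspace m. hyp_form \<omega> H t = 0}"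
  by (cases H) auto

lemma hyp_form_linear: "hyp_form \<omega> H (s + t) = hyp_form \<omega> H s + hyp_form \<omega> H t"
    "hyp_form \<omega> H (pt_scale c t) = c * hyp_form \<omega> H t" "hyp_form \<omega> H 0 = 0"
    "hyp_form \<omega> H (s - t) = hyp_form \<omega> H s - hyp_form \<omega> H t"
  by (cases H; simp add: pt_scale_def algebra_simps)+

lemma subspace_Cspace: "pt.subspace (Cspace m)"
  by (auto simp: pt.subspace_def Cspace_def pt_scale_def)

lemma subspace_hyp_set: "pt.subspace (hyp_set m \<omega> H)"
  using subspace_Cspace[of m] by (auto simp: pt.subspace_def hyp_set_form hyp_form_linear)

lemma subspace_edge: "L \<in> edges m T \<omega> \<Longrightarrow> pt.subspace L \<and> L \<subseteq> Cspace m"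
  by (auto simp: edges_def intro!: pt.subspace_inter subspace_Cspace pt.subspace_Inter subspace_hyp_set)

lemma sum_apply: "(\<Sum>i\<in>A. f i) x = (\<Sum>i\<in>A. f i x :: complex)"
  by (induction A rule: infinite_finite_induct) auto

lemma finite_independent:
  assumes "B \<subseteq> Cspace m" "pt.independent B"
  shows "finite B"
proof -
  let ?u = "\<lambda>i j. if j = i then 1 else (0::complex)"
  have "t \<in> pt.span (?u ` {1..m})" if "t \<in> Cspace m" for t
  proof -
    have "t = (\<Sum>i\<in>{1..m}. pt_scale (t i) (?u i))"
    proof
      fix j
      have "(\<Sum>i\<in>{1..m}. pt_scale (t i) (?u i)) j = (\<Sum>i\<in>{1..m}. if i = j then t j else 0)"
        unfolding sum_apply by (intro sum.cong) (auto simp: pt_scale_def)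
      also have "\<dots> = t j" using that by (auto simp: sum.delta Cspace_def)
      finally show "t j = (\<Sum>i\<in>{1..m}. pt_scale (t i) (?u i)) j" by simp
    qed
    also have "\<dots> \<in> pt.span (?u ` {1..m})"
      by (intro pt.span_sum pt.span_scale pt.span_base) auto
    finally show ?thesis .
  qed
  hence "B \<subseteq> pt.span (?u ` {1..m})" using assms(1) by blast
  thus ?thesis using pt.independent_span_bound[OF _ assms(2)] by blast
qed

lemma dim_inter_hyp:
  assumes L: "pt.subspace L" "L \<subseteq> Cspace m"
  shows "pt.dim L \<le> pt.dim (L \<inter> hyp_set m \<omega> H) + 1"
proof (cases "L \<subseteq> hyp_set m \<omega> H")
  case True
  hence "L \<inter> hyp_set m \<omega> H = L" by blast
  thus ?thesis by simp
next
  case False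
  then obtain v where v: "v \<in> L" "hyp_form \<omega> H v \<noteq> 0" using L(2) by (auto simp: hyp_set_form)
  obtain B where B: "B \<subseteq> L \<inter> hyp_set m \<omega> H" "pt.independent B" "L \<inter> hyp_set m \<omega> H \<subseteq> pt.span B"
    "card B = pt.dim (L \<inter> hyp_set m \<omega> H)" using pt.basis_exists by blast
  have fin: "finite B" using finite_independent[of B m] B(1,2) L(2) by blast
  have "L \<subseteq> pt.span (insert v B)"
  proof
    fix t assume t: "t \<in> L"
    define s where "s = t - pt_scale (hyp_form \<omega> H t / hyp_form \<omega> H v) v"
    have "s \<in> L" unfolding s_def by (intro pt.subspace_diff pt.subspace_scale L t v)
    moreover have "hyp_form \<omega> H s = 0" using v by (simp add: s_def hyp_form_linear)
    ultimately have "s \<in> pt.span B" using B(3) L(2) by (auto simp: hyp_set_form)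
    hence "s \<in> pt.span (insert v B)" using pt.span_mono[of B "insert v B"] by blast
    hence "s + pt_scale (hyp_form \<omega> H t / hyp_form \<omega> H v) v \<in> pt.span (insert v B)"
      by (rule pt.span_add[OF _ pt.span_scale[OF pt.span_base[OF insertI1]]])
    thus "t \<in> pt.span (insert v B)" by (simp add: s_def)
  qed
  hence "pt.dim L \<le> card (insert v B)" using fin by (intro pt.dim_le_card) auto
  also have "\<dots> \<le> card B + 1" using fin by (simp add: card_insert_if)
  finally show ?thesis using B(4) by simp
qed

lemma edge_inter_hyp:
  assumes "L \<in> edges m T \<omega>" "H \<in> hyps m T"
  shows "L \<inter> hyp_set m \<omega> H \<in> edges m T \<omega>"
proof -
  obtain S where S: "S \<subseteq> hyps m T" "L = Cspace m \<inter> (\<Inter>H\<in>S. hyp_set m \<omega> H)"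
    using assms(1) unfolding edges_def by blast
  have "L \<inter> hyp_set m \<omega> H = Cspace m \<inter> (\<Inter>H\<in>insert H S. hyp_set m \<omega> H)" using S(2) by auto
  moreover have "L \<inter> hyp_set m \<omega> H \<noteq> {}"
    using pt.subspace_0[OF conjunct1[OF subspace_edge[OF assms(1)]]] pt.subspace_0[OF subspace_hyp_set] by blast
  ultimately show ?thesis unfolding edges_def using S(1) assms(2) by (auto intro!: exI[of _ "insert H S"])
qed

lemma flags_psubset: "Ls \<in> flags m T \<omega> p \<Longrightarrow> i < p \<Longrightarrow> Ls ! Suc i \<subset> Ls ! i"
proof -
  assume Ls: "Ls \<in> flags m T \<omega> p" and i: "i < p"
  hence "\<forall>j\<le>p. pt.dim (Ls ! j) + j = m" by (simp add: flags_def)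
  hence "pt.dim (Ls ! i) + i = m" "pt.dim (Ls ! Suc i) + Suc i = m" using i by (simp, blast intro: Suc_leI)
  hence "Ls ! Suc i \<noteq> Ls ! i" by auto
  moreover have "Ls ! Suc i \<subseteq> Ls ! i" using Ls i by (auto simp: flags_def)
  ultimately show ?thesis by blast
qed

subsection \<open>The pairing is well defined\<close>

lemma pairing_eq_sum:
  assumes "finite S" "Poly_Mapping.keys v \<subseteq> S"
  shows "pairing m \<omega> v Hs = (\<Sum>Ls\<in>S. Poly_Mapping.lookup v Ls * flag_pairing m \<omega> Ls Hs)"
  unfolding pairing_def using assms by (intro sum.mono_neutral_left) (auto simp: in_keys_iff)

lemma pairing_add: "pairing m \<omega> (u + v) Hs = pairing m \<omega> u Hs + pairing m \<omega> v Hs"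
proof -
  let ?S = "Poly_Mapping.keys u \<union> Poly_Mapping.keys v"
  have "Poly_Mapping.keys (u + v) \<subseteq> ?S" by (rule Poly_Mapping.keys_add)
  thus ?thesis
    by (simp add: pairing_eq_sum[of ?S "u + v"] pairing_eq_sum[of ?S u] pairing_eq_sum[of ?S v]
        Poly_Mapping.lookup_add sum.distrib algebra_simps)
qed

lemma pairing_scale: "pairing m \<omega> (pm_scale c v) Hs = c * pairing m \<omega> v Hs"
proof -
  have "Poly_Mapping.keys (pm_scale c v) \<subseteq> Poly_Mapping.keys v" by (auto simp: in_keys_iff)
  thus ?thesis by (simp add: pairing_eq_sum[of "Poly_Mapping.keys v"] sum_distrib_left mult.assoc)
qed

lemma pairing_zero: "pairing m \<omega> 0 Hs = 0"
  by (simp add: pairing_def)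

lemma pairing_diff: "pairing m \<omega> (u - v) Hs = pairing m \<omega> u Hs - pairing m \<omega> v Hs"
  using pairing_add[of m \<omega> "u - v" v Hs] by simp

lemma pairing_sum: "pairing m \<omega> (\<Sum>i\<in>I. f i) Hs = (\<Sum>i\<in>I. pairing m \<omega> (f i) Hs)"
  by (induction I rule: infinite_finite_induct) (auto simp: pairing_add pairing_zero)

lemma pairing_basis: "pairing m \<omega> (basis_vec Ls) Hs = flag_pairing m \<omega> Ls Hs"
  by (simp add: pairing_def)

text \<open>Sign-reversing exchange. If a completing flag is cut out by the hyperplanes in some
  order, exchange those used to reach the edges i and i + 1. The new order cuts out a completing
  flag with another i-th edge, and the two orders differ by a transposition.\<close>

lemma sum_completions_zero:
  assumes i: "0 < i" "i < p" and Hs: "length Hs = p" "set Hs \<subseteq> hyps m T"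
  shows "(\<Sum>Ls\<in>{Ls \<in> flags m T \<omega> p. \<forall>j\<le>p. j \<noteq> i \<longrightarrow> Ls ! j = E ! j}. flag_pairing m \<omega> Ls Hs) = 0"
    (is "(\<Sum>Ls\<in>?S. _) = 0")
proof (cases "finite ?S")
  case True
  \<comment> \<open>\<open>W s\<close> collects the completing flags cut out in the order s; the sum
    of the pairings becomes a signed count of these sets.\<close>
  define W where "W = (\<lambda>s. {Ls \<in> ?S. \<forall>k<p. Ls ! k \<inter> hyp_set m \<omega> (Hs ! s k) = Ls ! Suc k})"
  define t where "t = Transposition.transpose (i - 1) i"
  have tp: "t permutes {0..<p}" unfolding t_def using i by (intro permutes_swap_id) auto
  have tt: "t (i - 1) = i" "t i = i - 1" "k \<noteq> i - 1 \<Longrightarrow> k \<noteq> i \<Longrightarrow> t k = k" "t (t k) = k" for k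
    by (auto simp: t_def)
  define f where "f = (\<lambda>s (Ls :: pt set list). Ls[i := Ls ! (i - 1) \<inter> hyp_set m \<omega> (Hs ! s i)])"
  have fW: "f s Ls \<in> W (s \<circ> t) \<and> f (s \<circ> t) (f s Ls) = Ls" if s: "s permutes {0..<p}" and Ls: "Ls \<in> W s" for s Ls
  proof -
    let ?h = "\<lambda>k. hyp_set m \<omega> (Hs ! s k)" and ?X = "Ls ! (i - 1) \<inter> hyp_set m \<omega> (Hs ! s i)"
    have fl: "Ls \<in> flags m T \<omega> p" and E: "\<forall>j\<le>p. j \<noteq> i \<longrightarrow> Ls ! j = E ! j"
      and cond: "\<And>k. k < p \<Longrightarrow> Ls ! k \<inter> ?h k = Ls ! Suc k" using Ls unfolding W_def by auto
    have len: "length Ls = Suc p" and ed: "\<And>j. j \<le> p \<Longrightarrow> Ls ! j \<in> edges m T \<omega>"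
      and dim: "\<And>j. j \<le> p \<Longrightarrow> pt.dim (Ls ! j) + j = m" and sub: "\<And>j. j < p \<Longrightarrow> Ls ! Suc j \<subseteq> Ls ! j"
      and L0: "Ls ! 0 = Cspace m"
      using fl unfolding flags_def by auto
    have si: "s i < p" using permutes_in_image[OF s, of i] i by simp
    have H: "Hs ! s i \<in> hyps m T" using Hs si by auto
    have ci: "Ls ! i \<inter> ?h i = Ls ! Suc i" using cond i by blast
    have ci': "Ls ! (i - 1) \<inter> ?h (i - 1) = Ls ! i" using cond[of "i - 1"] i by simp
    have XI: "?X \<inter> ?h (i - 1) = Ls ! Suc i" using ci ci' by blast
    have Xed: "?X \<in> edges m T \<omega>" using edge_inter_hyp[OF ed H, of "i - 1"] i by simp
    \<comment> \<open>Each hyperplane lowers the dimension by at most one, and two of them lead from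
      edge i - 1 to edge i + 1; hence the new edge in between has the correct dimension.\<close>
    have "pt.dim (Ls ! (i - 1)) \<le> pt.dim ?X + 1"
      using subspace_edge[OF ed, of "i - 1"] i by (intro dim_inter_hyp) auto
    moreover have "pt.dim ?X \<le> pt.dim (Ls ! Suc i) + 1"
      using subspace_edge[OF Xed] unfolding XI[symmetric] by (intro dim_inter_hyp) auto
    ultimately have Xdim: "pt.dim ?X + i = m"
      using dim[of "i - 1"] dim[of "Suc i"] i by linarith
    have fs: "f s Ls = Ls[i := ?X]" by (simp add: f_def)
    have nth: "f s Ls ! j = (if j = i then ?X else Ls ! j)" if "j \<le> p" for j
      unfolding fs using len that i by simp
    have "f s Ls \<in> flags m T \<omega> p"
      unfolding flags_def mem_Collect_eq
    proof (intro conjI allI impI)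
      show "length (f s Ls) = Suc p" using len by (simp add: fs)
      show "f s Ls ! 0 = Cspace m" using L0 i nth[of 0] by simp
      fix j
      show "f s Ls ! j \<in> edges m T \<omega>" if "j \<le> p" using nth[OF that] ed[OF that] Xed by simp
      show "pt.dim (f s Ls ! j) + j = m" if "j \<le> p" using nth[OF that] dim[OF that] Xdim by simp
      show "f s Ls ! Suc j \<subseteq> f s Ls ! j" if j: "j < p"
      proof -
        consider "j = i" | "Suc j = i" | "j \<noteq> i" "Suc j \<noteq> i" by blast
        thus ?thesis
        proof cases
          case 1 thus ?thesis using nth[of j] nth[of "Suc j"] j XI by auto
        next
          case 2 thus ?thesis using nth[of j] nth[of "Suc j"] j by auto
        next
          case 3 thus ?thesis using nth[of j] nth[of "Suc j"] j sub[OF j] by auto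
        qed
      qed
    qed
    moreover have "\<forall>j\<le>p. j \<noteq> i \<longrightarrow> f s Ls ! j = E ! j" using nth E by simp
    moreover have "f s Ls ! k \<inter> hyp_set m \<omega> (Hs ! (s \<circ> t) k) = f s Ls ! Suc k" if k: "k < p" for k
    proof -
      consider "k = i" | "k = i - 1" "k \<noteq> i" | "k \<noteq> i" "k \<noteq> i - 1" by blast
      thus ?thesis
      proof cases
        case 1 thus ?thesis using nth[of k] nth[of "Suc k"] k XI tt by simp
      next
        case 2
        hence "Suc k = i" using i by simp
        thus ?thesis using nth[of k] nth[of "Suc k"] k tt 2 by simp
      next
        case 3
        hence "Suc k \<noteq> i" by auto
        thus ?thesis using nth[of k] nth[of "Suc k"] k cond[OF k] 3 tt by simp
      qed
    qed
    moreover have "f (s \<circ> t) (f s Ls) = Ls"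
    proof -
      have "f (s \<circ> t) (f s Ls) = (f s Ls)[i := f s Ls ! (i - 1) \<inter> ?h (i - 1)]"
        using tt by (simp add: f_def)
      also have "f s Ls ! (i - 1) = Ls ! (i - 1)" using nth[of "i - 1"] i by (cases i) auto
      also have "Ls ! (i - 1) \<inter> ?h (i - 1) = Ls ! i" by (rule ci')
      finally show ?thesis by (simp only: fs list_update_overwrite list_update_id)
    qed
    ultimately show ?thesis unfolding W_def by blast
  qed
  have card: "card (W (s \<circ> t)) = card (W s)" if s: "s permutes {0..<p}" for s
  proof -
    have st: "s \<circ> t permutes {0..<p}" by (rule permutes_compose[OF tp s])
    have stt: "s \<circ> t \<circ> t = s" using tt(4) by (simp add: fun_eq_iff)
    have "bij_betw (f s) (W s) (W (s \<circ> t))"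
    proof (rule bij_betwI[where g = "f (s \<circ> t)"])
      show "f s \<in> W s \<rightarrow> W (s \<circ> t)" using fW[OF s] by blast
      show "f (s \<circ> t) \<in> W (s \<circ> t) \<rightarrow> W s" using fW[OF st] unfolding stt by blast
      show "f (s \<circ> t) (f s Ls) = Ls" if "Ls \<in> W s" for Ls using fW[OF s that] by blast
      show "f s (f (s \<circ> t) Ls) = Ls" if "Ls \<in> W (s \<circ> t)" for Ls using fW[OF st that] unfolding stt by blast
    qed
    thus ?thesis by (metis bij_betw_same_card)
  qed
  have fp: "flag_pairing m \<omega> Ls Hs = (\<Sum>s\<in>{s. s permutes {0..<p}}. of_int (sign s) * of_bool (Ls \<in> W s))"
    if Ls: "Ls \<in> ?S" for Ls
  proof -
    have fl: "Ls \<in> flags m T \<omega> p" using Ls by blast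
    have "flag_pairing m \<omega> Ls Hs = det (mat p p (\<lambda>(i, r). cut m \<omega> (Ls ! i) (Hs ! r) (Ls ! Suc i)))"
      using fl by (intro flag_pairing_det Hs flags_psubset[OF fl]) (auto simp: flags_def)
    also have "\<dots> = (\<Sum>s\<in>{s. s permutes {0..<p}}. of_int (sign s) * of_bool (Ls \<in> W s))"
      unfolding det_def'[OF mat_carrier]
    proof (intro sum.cong HOL.refl arg_cong2[of _ _ _ _ "(*)"])
      fix s assume "s \<in> {s. s permutes {0..<p}}"
      hence lt: "s k < p" if "k < p" for k using permutes_in_image[of s "{0..<p}" k] that by simp
      have "(\<Prod>i = 0..<p. mat p p (\<lambda>(i, r). cut m \<omega> (Ls ! i) (Hs ! r) (Ls ! Suc i)) $$ (i, s i)) =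
        (\<Prod>i = 0..<p. of_bool (Ls ! i \<inter> hyp_set m \<omega> (Hs ! s i) = Ls ! Suc i))"
        using lt by (intro prod.cong) (auto simp: cut_def)
      also have "\<dots> = of_bool (\<forall>k<p. Ls ! k \<inter> hyp_set m \<omega> (Hs ! s k) = Ls ! Suc k)"
      proof (cases "\<forall>k<p. Ls ! k \<inter> hyp_set m \<omega> (Hs ! s k) = Ls ! Suc k")
        case False
        then obtain k where "k < p" "Ls ! k \<inter> hyp_set m \<omega> (Hs ! s k) \<noteq> Ls ! Suc k" by blast
        hence "\<exists>k\<in>{0..<p}. (of_bool (Ls ! k \<inter> hyp_set m \<omega> (Hs ! s k) = Ls ! Suc k) :: complex) = 0" by auto
        thus ?thesis using False by (simp add: prod_zero)
      qed simp
      also have "\<dots> = of_bool (Ls \<in> W s)" using Ls by (simp add: W_def)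
      finally show "(\<Prod>i = 0..<p. mat p p (\<lambda>(i, r). cut m \<omega> (Ls ! i) (Hs ! r) (Ls ! Suc i)) $$ (i, s i)) =
        (of_bool (Ls \<in> W s) :: complex)" .
    qed
    finally show ?thesis .
  qed
  have WS: "(\<Sum>Ls\<in>?S. of_bool (Ls \<in> W s)) = (of_nat (card (W s)) :: complex)" for s
  proof -
    have "?S \<inter> {Ls. Ls \<in> W s} = W s" unfolding W_def by blast
    thus ?thesis using True by simp
  qed
  let ?P = "{s. s permutes {0..<p}}"
  define G where "G = (\<Sum>s\<in>?P. of_int (sign s) * (of_nat (card (W s)) :: complex))"
  have "(\<Sum>Ls\<in>?S. flag_pairing m \<omega> Ls Hs) = (\<Sum>Ls\<in>?S. \<Sum>s\<in>?P. of_int (sign s) * of_bool (Ls \<in> W s))"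
    by (rule sum.cong[OF HOL.refl fp])
  also have "\<dots> = G" unfolding G_def by (subst sum.swap) (simp only: sum_distrib_left[symmetric] WS)
  also have "G = 0"
  proof -
    have "G = (\<Sum>s\<in>?P. of_int (sign (s \<circ> t)) * of_nat (card (W (s \<circ> t))))"
      unfolding G_def by (rule sum_permutations_compose_right[OF tp])
    also have "\<dots> = (\<Sum>s\<in>?P. - (of_int (sign s) * of_nat (card (W s))))"
    proof (intro sum.cong HOL.refl)
      fix s assume s: "s \<in> ?P"
      have "permutation s" "permutation t" using s tp permutation_permutes by blast+
      hence "sign (s \<circ> t) = sign s * sign t" by (rule sign_compose)
      moreover have "sign t = -1" unfolding t_def using i by (simp add: sign_swap_id)
      ultimately show "of_int (sign (s \<circ> t)) * of_nat (card (W (s \<circ> t))) = - (of_int (sign s) * (of_nat (card (W s)) :: complex))"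
        using card s by simp
    qed
    also have "\<dots> = - G" unfolding G_def by (rule sum_negf)
    finally show ?thesis by simp
  qed
  finally show ?thesis .
qed simp

lemma pairing_relations:
  assumes "v \<in> flag_relations m T \<omega> p" "length Hs = p" "set Hs \<subseteq> hyps m T"
  shows "pairing m \<omega> v Hs = 0"
proof -
  have "pm.subspace {v. pairing m \<omega> v Hs = 0}"
    by (auto simp: pm.subspace_def pairing_add pairing_scale pairing_zero)
  moreover have "x \<in> {v. pairing m \<omega> v Hs = 0}" if "x \<in> {(\<Sum>Ls\<in>{Ls \<in> flags m T \<omega> p. \<forall>j\<le>p. j \<noteq> i \<longrightarrow> Ls ! j = E ! j}. basis_vec Ls)
      | i E. 0 < i \<and> i < p \<and> length E = Suc p}" for x
  proof -
    from that obtain i E where x: "x = (\<Sum>Ls\<in>{Ls \<in> flags m T \<omega> p. \<forall>j\<le>p. j \<noteq> i \<longrightarrow> Ls ! j = E ! j}. basis_vec Ls)"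
      and i: "0 < i" "i < p" by blast
    show ?thesis unfolding x pairing_sum pairing_basis mem_Collect_eq by (rule sum_completions_zero[OF i assms(2,3)])
  qed
  ultimately have "flag_relations m T \<omega> p \<subseteq> {v. pairing m \<omega> v Hs = 0}"
    unfolding flag_relations_def by (intro pm.span_minimal subsetI)
  thus ?thesis using assms(1) by (rule CollectD[OF subsetD])
qed

lemma pairing_flag_eq:
  "flag_eq m T \<omega> p u v \<Longrightarrow> length Hs = p \<Longrightarrow> set Hs \<subseteq> hyps m T \<Longrightarrow> pairing m \<omega> u Hs = pairing m \<omega> v Hs"
  unfolding flag_eq_def by (drule pairing_relations) (auto simp: pairing_diff)

subsection \<open>Words in a Lie algebra\<close>

definition word_degree :: "(nat \<Rightarrow> nat \<Rightarrow> nat \<Rightarrow> nat) \<Rightarrow> commutator \<Rightarrow> nat \<Rightarrow> nat" where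
  "word_degree dg M = (\<Sum>(i, k)\<in>#comm_gens M. dg i k)"

context lie_algebra
begin

lemma bracket_zero: "bracket 0 x = 0" "bracket x 0 = 0"
  using bracket_add_left[of 0 0 x] bracket_add_right[of x 0 0] by simp_all

lemma bracket_antisym: "bracket x y = - bracket y x"
proof -
  have "bracket x y + bracket y x = bracket (x + y) (x + y)"
    unfolding bracket_add_left bracket_add_right by (simp add: bracket_self)
  thus ?thesis by (simp add: bracket_self eq_neg_iff_add_eq_0)
qed

lemma bracket_minus_right: "bracket x (- y) = - bracket x y"
  using bracket_add_right[of x y "- y"] bracket_zero by (simp add: eq_neg_iff_add_eq_0 add.commute)

lemma leibniz: "bracket z (bracket x y) = bracket (bracket z x) y + bracket x (bracket z y)"
proof -
  have "bracket z (bracket x y) + bracket x (bracket y z) + bracket y (bracket z x) = 0" by (rule jacobi)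
  moreover have "bracket x (bracket y z) = - bracket x (bracket z y)"
    by (subst bracket_antisym[of y z]) (rule bracket_minus_right)
  moreover have "bracket y (bracket z x) = - bracket (bracket z x) y" by (rule bracket_antisym)
  ultimately show ?thesis by (simp add: algebra_simps)
qed

text \<open>Commutators serve as bracket words in any Lie algebra, with \<gamma> interpreting the
  generators. Words in \<open>n_minus\<close> and words in the free Lie algebra thus share one
  cobracket.\<close>

primrec word_value :: "(nat \<Rightarrow> nat \<Rightarrow> 'g) \<Rightarrow> commutator \<Rightarrow> 'g" where
  "word_value \<gamma> (CGen i k) = \<gamma> i k"
| "word_value \<gamma> (CBracket g h) = bracket (word_value \<gamma> g) (word_value \<gamma> h)"

lemma word_value_cong:
  "(\<And>i k. (i, k) \<in># comm_gens g \<Longrightarrow> \<gamma> i k = \<gamma>' i k) \<Longrightarrow> word_value \<gamma> g = word_value \<gamma>' g"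
  by (induction g) auto

definition words :: "(nat \<Rightarrow> nat \<Rightarrow> 'g) \<Rightarrow> (nat \<times> nat) set \<Rightarrow> 'g set" where
  "words \<gamma> I = {word_value \<gamma> M | M. set_mset (comm_gens M) \<subseteq> I}"

lemma subalgebra_span_words: "subalgebra (span (words \<gamma> I))"
proof -
  have 1: "bracket x y \<in> span (words \<gamma> I)" if xy: "x \<in> words \<gamma> I" "y \<in> words \<gamma> I" for x y
  proof -
    obtain M N where "x = word_value \<gamma> M" "set_mset (comm_gens M) \<subseteq> I"
      "y = word_value \<gamma> N" "set_mset (comm_gens N) \<subseteq> I" using xy unfolding words_def by blast
    hence "bracket x y = word_value \<gamma> (CBracket M N)" "set_mset (comm_gens (CBracket M N)) \<subseteq> I" by auto
    hence "bracket x y \<in> words \<gamma> I" unfolding words_def by blast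
    thus ?thesis by (rule span_base)
  qed
  have 2: "bracket x y \<in> span (words \<gamma> I)" if x: "x \<in> words \<gamma> I" and y: "y \<in> span (words \<gamma> I)" for x y
    using y
  proof (induction rule: span_induct_alt)
    case base thus ?case by (simp add: bracket_zero span_zero)
  next
    case (step c z y) thus ?case
      by (simp add: bracket_add_right bracket_scale_right span_add span_scale 1[OF x])
  qed
  have 3: "bracket x y \<in> span (words \<gamma> I)" if x: "x \<in> span (words \<gamma> I)" and y: "y \<in> span (words \<gamma> I)" for x y
    using x
  proof (induction rule: span_induct_alt)
    case base thus ?case by (simp add: bracket_zero span_zero)
  next
    case (step c z x) thus ?case
      by (simp add: bracket_add_left bracket_scale_left span_add span_scale 2[OF _ y])
  qed
  show ?thesis unfolding subalgebra_def using 3 by (simp add: subspace_span)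
qed

lemma subalgebra_generated: "subalgebra (generated_subalgebra X)"
proof -
  have "subspace (\<Inter>{S. subalgebra S \<and> X \<subseteq> S})"
    by (rule subspace_Inter) (auto simp: subalgebra_def)
  moreover have "\<forall>x\<in>\<Inter>{S. subalgebra S \<and> X \<subseteq> S}. \<forall>y\<in>\<Inter>{S. subalgebra S \<and> X \<subseteq> S}.
      bracket x y \<in> \<Inter>{S. subalgebra S \<and> X \<subseteq> S}"
    by (auto simp: subalgebra_def)
  ultimately show ?thesis unfolding subalgebra_def generated_subalgebra_def by blast
qed

lemma generated_subset: "X \<subseteq> generated_subalgebra X"
  unfolding generated_subalgebra_def by blast

lemma generated_minimal: "subalgebra S \<Longrightarrow> X \<subseteq> S \<Longrightarrow> generated_subalgebra X \<subseteq> S"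
  unfolding generated_subalgebra_def by blast

lemma word_in_subalgebra:
  "subalgebra S \<Longrightarrow> (\<And>i k. (i, k) \<in># comm_gens M \<Longrightarrow> \<gamma> i k \<in> S) \<Longrightarrow> word_value \<gamma> M \<in> S"
  by (induction M) (auto simp: subalgebra_def)

lemma generated_eq_span_words:
  assumes "X = (\<lambda>(i, k). \<gamma> i k) ` I"
  shows "generated_subalgebra X = span (words \<gamma> I)"
proof
  have "X \<subseteq> words \<gamma> I"
  proof
    fix x assume "x \<in> X"
    then obtain i k where "(i, k) \<in> I" "x = \<gamma> i k" using assms by auto
    hence "x = word_value \<gamma> (CGen i k)" "set_mset (comm_gens (CGen i k)) \<subseteq> I" by auto
    thus "x \<in> words \<gamma> I" unfolding words_def by blast
  qed
  hence "X \<subseteq> span (words \<gamma> I)" using span_superset by blast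
  thus "generated_subalgebra X \<subseteq> span (words \<gamma> I)"
    by (rule generated_minimal[OF subalgebra_span_words])
  have "words \<gamma> I \<subseteq> generated_subalgebra X"
  proof
    fix x assume "x \<in> words \<gamma> I"
    then obtain M where M: "x = word_value \<gamma> M" "set_mset (comm_gens M) \<subseteq> I" unfolding words_def by blast
    have "\<gamma> i k \<in> generated_subalgebra X" if "(i, k) \<in># comm_gens M" for i k
      using generated_subset[of X] assms M(2) that by force
    thus "x \<in> generated_subalgebra X"
      unfolding M(1) by (rule word_in_subalgebra[OF subalgebra_generated])
  qed
  thus "span (words \<gamma> I) \<subseteq> generated_subalgebra X"
    by (rule span_minimal) (use subalgebra_generated in \<open>auto simp: subalgebra_def\<close>)
qed

lemma graded_monomial_word:
  assumes "X = (\<lambda>(i, k). (\<gamma> i k, dg i k)) ` I"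
  shows "graded_monomial X x d \<longleftrightarrow> (\<exists>M. set_mset (comm_gens M) \<subseteq> I \<and> x = word_value \<gamma> M \<and> d = word_degree dg M)"
proof
  assume "graded_monomial X x d"
  thus "\<exists>M. set_mset (comm_gens M) \<subseteq> I \<and> x = word_value \<gamma> M \<and> d = word_degree dg M"
  proof (induction rule: graded_monomial.induct)
    case (gen x d)
    then obtain i k where "(i, k) \<in> I" "x = \<gamma> i k" "d = dg i k" using assms by auto
    thus ?case by (intro exI[of _ "CGen i k"]) (simp add: word_degree_def)
  next
    case (bracket x d y e)
    then obtain M N where "set_mset (comm_gens M) \<subseteq> I" "x = word_value \<gamma> M" "d = word_degree dg M"
      "set_mset (comm_gens N) \<subseteq> I" "y = word_value \<gamma> N" "e = word_degree dg N" by blast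
    thus ?case by (intro exI[of _ "CBracket M N"]) (simp add: word_degree_def)
  qed
next
  assume "\<exists>M. set_mset (comm_gens M) \<subseteq> I \<and> x = word_value \<gamma> M \<and> d = word_degree dg M"
  then obtain M where "set_mset (comm_gens M) \<subseteq> I" "x = word_value \<gamma> M" "d = word_degree dg M" by blast
  thus "graded_monomial X x d"
  proof (induction M arbitrary: x d)
    case (CGen i k)
    hence "(x, d) \<in> X" using assms by (auto simp: word_degree_def)
    thus ?case by (rule graded_monomial.gen)
  next
    case (CBracket M N)
    have "word_degree dg (CBracket M N) = word_degree dg M + word_degree dg N" by (simp add: word_degree_def)
    moreover have "graded_monomial X (bracket (word_value \<gamma> M) (word_value \<gamma> N)) (word_degree dg M + word_degree dg N)"
      using CBracket.prems(1) by (intro graded_monomial.bracket CBracket.IH) auto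
    ultimately show ?case unfolding CBracket.prems(2,3) word_value.simps by (simp only:)
  qed
qed

lemma homogeneous_eq_span:
  assumes "X = (\<lambda>(i, k). (\<gamma> i k, dg i k)) ` I"
  shows "homogeneous X d = span {word_value \<gamma> M | M. set_mset (comm_gens M) \<subseteq> I \<and> word_degree dg M = d}"
  unfolding homogeneous_def graded_monomial_word[OF assms] by (intro arg_cong[of _ _ span]) auto

text \<open>The elements of the generated algebra P that ad z maps into P + V form a subalgebra by
  the Leibniz rule, because brackets of V with P stay in P. With V the Cartan part this describes
  [E_i, x] for x in \<open>n_minus\<close>.\<close>

lemma ad_generated:
  assumes V: "subspace V" and VP: "\<And>v p. v \<in> V \<Longrightarrow> p \<in> generated_subalgebra X \<Longrightarrow> bracket v p \<in> generated_subalgebra X"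
    and X: "\<And>x. x \<in> X \<Longrightarrow> \<exists>p\<in>generated_subalgebra X. \<exists>v\<in>V. bracket z x = p + v"
    and x: "x \<in> generated_subalgebra X"
  shows "\<exists>p\<in>generated_subalgebra X. \<exists>v\<in>V. bracket z x = p + v"
proof -
  let ?P = "generated_subalgebra X"
  have P: "subspace ?P" "\<And>x y. x \<in> ?P \<Longrightarrow> y \<in> ?P \<Longrightarrow> bracket x y \<in> ?P"
    using subalgebra_generated unfolding subalgebra_def by blast+
  have "subalgebra {x \<in> ?P. \<exists>p\<in>?P. \<exists>v\<in>V. bracket z x = p + v}"
    unfolding subalgebra_def subspace_def
  proof (intro conjI ballI allI)
    show "0 \<in> {x \<in> ?P. \<exists>p\<in>?P. \<exists>v\<in>V. bracket z x = p + v}"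
      using subspace_0[OF P(1)] subspace_0[OF V] by (auto simp: bracket_zero intro!: bexI[of _ 0])
  next
    fix x y assume "x \<in> {x \<in> ?P. \<exists>p\<in>?P. \<exists>v\<in>V. bracket z x = p + v}" "y \<in> {x \<in> ?P. \<exists>p\<in>?P. \<exists>v\<in>V. bracket z x = p + v}"
    then obtain p v q u where *: "x \<in> ?P" "y \<in> ?P" "p \<in> ?P" "v \<in> V" "bracket z x = p + v" "q \<in> ?P" "u \<in> V" "bracket z y = q + u" by blast
    have "bracket z (x + y) = (p + q) + (v + u)" unfolding bracket_add_right *(5,8) by (simp add: algebra_simps)
    thus "x + y \<in> {x \<in> ?P. \<exists>p\<in>?P. \<exists>v\<in>V. bracket z x = p + v}"
      using * subspace_add[OF P(1)] subspace_add[OF V] by blast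
    have "bracket z (bracket x y) = (bracket p y + bracket v y + (bracket x q - bracket u x)) + 0"
      unfolding leibniz *(5,8) bracket_add_left bracket_add_right bracket_antisym[of x u] by simp
    moreover have "bracket p y + bracket v y + (bracket x q - bracket u x) \<in> ?P"
      by (intro subspace_add[OF P(1)] subspace_diff[OF P(1)] P(2) VP *)
    ultimately show "bracket x y \<in> {x \<in> ?P. \<exists>p\<in>?P. \<exists>v\<in>V. bracket z x = p + v}"
      using P(2)[OF *(1,2)] subspace_0[OF V] by blast
  next
    fix c x assume "x \<in> {x \<in> ?P. \<exists>p\<in>?P. \<exists>v\<in>V. bracket z x = p + v}"
    then obtain p v where *: "x \<in> ?P" "p \<in> ?P" "v \<in> V" "bracket z x = p + v" by blast
    have "bracket z (scale c x) = scale c p + scale c v" unfolding bracket_scale_right *(4) by (rule scale_right_distrib)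
    thus "scale c x \<in> {x \<in> ?P. \<exists>p\<in>?P. \<exists>v\<in>V. bracket z x = p + v}"
      using * subspace_scale[OF P(1)] subspace_scale[OF V] by blast
  qed
  moreover have "X \<subseteq> {x \<in> ?P. \<exists>p\<in>?P. \<exists>v\<in>V. bracket z x = p + v}"
    using X generated_subset by blast
  ultimately show ?thesis using generated_minimal x by blast
qed

lemma ad_generated_closed:
  assumes "\<And>x. x \<in> X \<Longrightarrow> bracket z x \<in> generated_subalgebra X" "x \<in> generated_subalgebra X"
  shows "bracket z x \<in> generated_subalgebra X"
proof -
  have 0: "0 \<in> generated_subalgebra X"
    using subalgebra_generated subspace_0 unfolding subalgebra_def by blast
  have "\<exists>p\<in>generated_subalgebra X. \<exists>v\<in>{0}. bracket z x = p + v"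
  proof (rule ad_generated)
    show "subspace {0}" by (rule subspace_single_0)
    show "bracket v p \<in> generated_subalgebra X" if "v \<in> {0}" for v p using that 0 by (simp add: bracket_zero)
    show "\<exists>p\<in>generated_subalgebra X. \<exists>v\<in>{0}. bracket z x = p + v" if "x \<in> X" for x
      using assms(1)[OF that] by simp
  qed (rule assms(2))
  thus ?thesis by simp
qed

end

subsection \<open>The invariant form\<close>

context cartan_data
begin

lemma B_linear: "B (x + y) z = B x z + B y z" "B x (y + z) = B x y + B x z"
    "B (sh c x) y = c * B x y" "B x (sh c y) = c * B x y"
  using B_bilinear unfolding bilinear_form_def Vector_Spaces.linear_iff by blast+

lemma B_zero: "B 0 x = 0" "B x 0 = 0"
  using B_linear(1)[of 0 0 x] B_linear(2)[of x 0 0] by simp_all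

lemma B_inject: "(\<And>H. B u H = B v H) \<Longrightarrow> u = v"
proof -
  assume "\<And>H. B u H = B v H"
  hence "B (u - v) H = 0" for H
    using B_linear(1)[of u "- v" H] B_linear(1)[of v "- v" H] by (simp add: B_zero)
  thus ?thesis using B_nondegenerate[of "u - v"] by simp
qed

lemma B_represents:
  assumes l: "Vector_Spaces.linear sh (*) l"
  shows "\<exists>v. \<forall>H. B v H = l H"
proof -
  obtain S where S: "finite S" "h.span S = UNIV" using finite_dim by blast
  obtain Bs where Bs: "Bs \<subseteq> S" "h.independent Bs" "S \<subseteq> h.span Bs"
    using h.maximal_independent_subset by blast
  have fin: "finite Bs" using Bs(1) S(1) by (rule finite_subset)
  have span: "h.span Bs = UNIV" using h.span_minimal[OF Bs(3) h.subspace_span] unfolding S(2) by blast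
  interpret hf: finite_dimensional_vector_space sh Bs
    by unfold_locales (use fin Bs(2) span in auto)
  interpret hp: finite_dimensional_vector_space_pair sh Bs sh Bs by unfold_locales
  have lin: "l (x + y) = l x + l y" "l (sh c x) = c * l x" for x y c
    using l unfolding Vector_Spaces.linear_iff by blast+
  \<comment> \<open>In coordinates f lists the values of B v on the basis. Non-degeneracy makes it
    injective, finite dimension makes it surjective, and so every functional is of the form B
    v.\<close>
  define f where "f = (\<lambda>v. \<Sum>b\<in>Bs. sh (B v b) b)"
  have f_lin: "Vector_Spaces.linear sh sh f"
    unfolding Vector_Spaces.linear_iff f_def
    by (auto simp: B_linear h.scale_left_distrib sum.distrib h.scale_sum_right h.vector_space_axioms)
  have agree: "B v = l'" if l': "\<And>x y. l' (x + y) = l' x + l' y" "\<And>c x. l' (sh c x) = c * l' x"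
    and b: "\<And>b. b \<in> Bs \<Longrightarrow> B v b = l' b" for v l'
  proof
    fix H
    have l0: "l' 0 = 0" using l'(1)[of 0 0] by simp
    have "H \<in> h.span Bs" using span by simp
    thus "B v H = l' H"
      by (induction rule: h.span_induct_alt) (simp_all add: B_zero l0 B_linear l' b)
  qed
  have coord: "B v b = c b" if "f v = (\<Sum>b\<in>Bs. sh (c b) b)" "b \<in> Bs" for v c b
  proof -
    have "(\<Sum>b\<in>Bs. sh (B v b - c b) b) = 0"
      using that(1) by (simp add: f_def h.scale_left_diff_distrib sum_subtractf)
    thus ?thesis using h.independentD[OF Bs(2) fin order_refl, of "\<lambda>b. B v b - c b" b] that(2) by simp
  qed
  have "inj f"
  proof (rule injI)
    fix u v assume "f u = f v"
    hence "B u b = B v b" if "b \<in> Bs" for b using coord[of u "B v" b] that by (simp add: f_def)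
    hence "B u = B v" by (intro agree) (auto simp: B_linear)
    thus "u = v" by (intro B_inject) simp
  qed
  hence "surj f" by (rule hp.linear_injective_imp_surjective[OF f_lin]) simp
  then obtain v where "f v = (\<Sum>b\<in>Bs. sh (l b) b)" by (metis surjD)
  hence "B v = l" by (intro agree lin coord)
  thus ?thesis by metis
qed

lemma dual_vector: "Vector_Spaces.linear sh (*) l \<Longrightarrow> B (dual_vector B l) H = l H"
proof -
  assume "Vector_Spaces.linear sh (*) l"
  then obtain v where v: "\<forall>H. B v H = l H" using B_represents by blast
  have "dual_vector B l = v"
    unfolding dual_vector_def using v by (intro the_equality) (auto intro!: B_inject)
  thus ?thesis using v by simp
qed

lemma dual_form_commute: "dual_form B l l' = dual_form B l' l"
  unfolding dual_form_def by (rule B_sym)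

text \<open>The defining property of H_i is tested on the functionals B H, whose dual vector is H
  itself.\<close>

lemma dual_vector_alpha:
  assumes i: "i \<in> {1..R}"
  shows "dual_vector B (\<alpha> i) = Hc i"
proof (rule B_inject)
  fix H
  have l: "Vector_Spaces.linear sh (*) (B H)" using B_bilinear unfolding bilinear_form_def by blast
  have "dual_vector B (B H) = H" by (rule B_inject) (rule dual_vector[OF l])
  hence "B H (Hc i) = B (dual_vector B (\<alpha> i)) H" using Hc[OF i l] by (simp add: dual_form_def)
  thus "B (dual_vector B (\<alpha> i)) H = B (Hc i) H" using B_sym by metis
qed

end

section \<open>Relations of the presented algebra and its triangular decomposition\<close>

context g_algebra
begin

lemma relation: "(t, u) \<in> g_relations sh R \<alpha> Hc \<Longrightarrow> set_lie_term t \<subseteq> g_gens R \<Longrightarrow> set_lie_term u \<subseteq> g_gens R \<Longrightarrow>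
    g.eval_term (case_g_gen E F inc) t = g.eval_term (case_g_gen E F inc) u"
  using presentation lie_eq.rel unfolding g.presented_by_def by blast

lemma inc_add: "inc (H + H') = inc H + inc H'"
proof -
  have "g.eval_term (case_g_gen E F inc) (Gen (GenH (H + H'))) = g.eval_term (case_g_gen E F inc) (Add (Gen (GenH H)) (Gen (GenH H')))"
    by (rule relation) (auto simp: g_relations_def g_gens_def)
  thus ?thesis by simp
qed

lemma inc_scale: "inc (sh c H) = sg c (inc H)"
proof -
  have "g.eval_term (case_g_gen E F inc) (Gen (GenH (sh c H))) = g.eval_term (case_g_gen E F inc) (Scale c (Gen (GenH H)))"
    by (rule relation) (auto simp: g_relations_def g_gens_def)
  thus ?thesis by simp
qed

lemma br_EF: "i \<in> {1..R} \<Longrightarrow> j \<in> {1..R} \<Longrightarrow> br (E i) (F j) = (if i = j then inc (Hc i) else 0)"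
proof -
  assume ij: "i \<in> {1..R}" "j \<in> {1..R}"
  have "g.eval_term (case_g_gen E F inc) (Bracket (Gen (GenE i)) (Gen (GenF j))) =
     g.eval_term (case_g_gen E F inc) (if i = j then Gen (GenH (Hc i)) else Zero)"
    by (rule relation) (use ij in \<open>auto simp: g_relations_def g_gens_def\<close>)
  thus ?thesis by (simp split: if_splits)
qed

lemma br_HE: "i \<in> {1..R} \<Longrightarrow> br (inc H) (E i) = sg (\<alpha> i H) (E i)"
proof -
  assume i: "i \<in> {1..R}"
  have "g.eval_term (case_g_gen E F inc) (Bracket (Gen (GenH H)) (Gen (GenE i))) =
     g.eval_term (case_g_gen E F inc) (Scale (\<alpha> i H) (Gen (GenE i)))"
    by (rule relation) (use i in \<open>auto simp: g_relations_def g_gens_def\<close>)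
  thus ?thesis by simp
qed

lemma br_HF: "i \<in> {1..R} \<Longrightarrow> br (inc H) (F i) = sg (- \<alpha> i H) (F i)"
proof -
  assume i: "i \<in> {1..R}"
  have "g.eval_term (case_g_gen E F inc) (Bracket (Gen (GenH H)) (Gen (GenF i))) =
     g.eval_term (case_g_gen E F inc) (Scale (- \<alpha> i H) (Gen (GenF i)))"
    by (rule relation) (use i in \<open>auto simp: g_relations_def g_gens_def\<close>)
  thus ?thesis by simp
qed

lemma br_HH: "br (inc H) (inc H') = 0"
proof -
  have "g.eval_term (case_g_gen E F inc) (Bracket (Gen (GenH H)) (Gen (GenH H'))) = g.eval_term (case_g_gen E F inc) Zero"
    by (rule relation) (auto simp: g_relations_def g_gens_def)
  thus ?thesis by simp
qed

lemma generated:
  assumes S: "g.subalgebra S" and gens: "\<And>i. i \<in> {1..R} \<Longrightarrow> E i \<in> S" "\<And>i. i \<in> {1..R} \<Longrightarrow> F i \<in> S" "\<And>H. inc H \<in> S"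
  shows "z \<in> S"
proof -
  have "set_lie_term t \<subseteq> g_gens R \<Longrightarrow> g.eval_term (case_g_gen E F inc) t \<in> S" for t
  proof (induction t)
    case (Gen x) thus ?case using gens by (cases x) (auto simp: g_gens_def)
  qed (use S in \<open>auto simp: g.subalgebra_def g.subspace_def\<close>)
  moreover obtain t where "set_lie_term t \<subseteq> g_gens R" "g.eval_term (case_g_gen E F inc) t = z"
    using presentation unfolding g.presented_by_def by blast
  ultimately show ?thesis by blast
qed

lemma subspace_inc: "g.subspace (range inc)"
proof -
  have "0 = inc 0" using inc_scale[of 0 0] by simp
  hence "0 \<in> range inc" by (rule range_eqI)
  moreover have "inc H + inc H' \<in> range inc" "sg c (inc H) \<in> range inc" for H H' c
    unfolding inc_add[symmetric] inc_scale[symmetric] by simp_all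
  ultimately show ?thesis unfolding g.subspace_def by blast
qed

lemma subalgebra_n: "g.subalgebra n_minus" "g.subalgebra n_plus"
  unfolding n_minus_def n_plus_def by (rule g.subalgebra_generated)+

lemma n_facts: "g.subspace n_minus" "g.subspace n_plus"
    "\<And>x y. x \<in> n_minus \<Longrightarrow> y \<in> n_minus \<Longrightarrow> br x y \<in> n_minus"
    "\<And>x y. x \<in> n_plus \<Longrightarrow> y \<in> n_plus \<Longrightarrow> br x y \<in> n_plus"
  using subalgebra_n unfolding g.subalgebra_def by simp_all

lemma F_n_minus: "i \<in> {1..R} \<Longrightarrow> F i \<in> n_minus"
  unfolding n_minus_def using g.generated_subset[of "F ` {1..R}"] by blast

lemma E_n_plus: "i \<in> {1..R} \<Longrightarrow> E i \<in> n_plus"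
  unfolding n_plus_def using g.generated_subset[of "E ` {1..R}"] by blast

lemma br_h_n_minus: "x \<in> n_minus \<Longrightarrow> br (inc H) x \<in> n_minus"
  unfolding n_minus_def
proof (rule g.ad_generated_closed)
  fix y assume "y \<in> F ` {1..R}"
  then obtain i where i: "i \<in> {1..R}" "y = F i" by blast
  show "br (inc H) y \<in> g.generated_subalgebra (F ` {1..R})"
    unfolding i(2) br_HF[OF i(1)] n_minus_def[symmetric] by (rule g.subspace_scale[OF n_facts(1) F_n_minus[OF i(1)]])
qed

lemma br_h_n_plus: "x \<in> n_plus \<Longrightarrow> br (inc H) x \<in> n_plus"
  unfolding n_plus_def
proof (rule g.ad_generated_closed)
  fix y assume "y \<in> E ` {1..R}"
  then obtain i where i: "i \<in> {1..R}" "y = E i" by blast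
  show "br (inc H) y \<in> g.generated_subalgebra (E ` {1..R})"
    unfolding i(2) br_HE[OF i(1)] n_plus_def[symmetric] by (rule g.subspace_scale[OF n_facts(2) E_n_plus[OF i(1)]])
qed

lemma br_E_n_minus: "i \<in> {1..R} \<Longrightarrow> x \<in> n_minus \<Longrightarrow> \<exists>p\<in>n_minus. \<exists>H. br (E i) x = p + inc H"
proof -
  assume i: "i \<in> {1..R}" and x: "x \<in> n_minus"
  have "\<exists>p\<in>n_minus. \<exists>v\<in>range inc. br (E i) x = p + v"
    unfolding n_minus_def
  proof (rule g.ad_generated[OF subspace_inc])
    fix y assume "y \<in> F ` {1..R}"
    then obtain j where j: "j \<in> {1..R}" "y = F j" by blast
    have "br (E i) y \<in> range inc"
      unfolding j(2) br_EF[OF i j(1)] using g.subspace_0[OF subspace_inc] by auto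
    moreover have "0 \<in> n_minus" using n_facts(1) by (rule g.subspace_0)
    ultimately show "\<exists>p\<in>g.generated_subalgebra (F ` {1..R}). \<exists>v\<in>range inc. br (E i) y = p + v"
      unfolding n_minus_def by (metis add_0)
  qed (use br_h_n_minus x in \<open>auto simp: n_minus_def\<close>)
  thus ?thesis by blast
qed

lemma br_F_n_plus: "i \<in> {1..R} \<Longrightarrow> x \<in> n_plus \<Longrightarrow> \<exists>p\<in>n_plus. \<exists>H. br (F i) x = p + inc H"
proof -
  assume i: "i \<in> {1..R}" and x: "x \<in> n_plus"
  have "\<exists>p\<in>n_plus. \<exists>v\<in>range inc. br (F i) x = p + v"
    unfolding n_plus_def
  proof (rule g.ad_generated[OF subspace_inc])
    fix y assume "y \<in> E ` {1..R}"
    then obtain j where j: "j \<in> {1..R}" "y = E j" by blast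
    have "br (E j) (F i) \<in> range inc"
      unfolding br_EF[OF j(1) i] using g.subspace_0[OF subspace_inc] by auto
    hence "br (F i) y \<in> range inc"
      unfolding j(2) g.bracket_antisym[of "F i"] by (rule g.subspace_neg[OF subspace_inc])
    moreover have "0 \<in> n_plus" using n_facts(2) by (rule g.subspace_0)
    ultimately show "\<exists>p\<in>g.generated_subalgebra (E ` {1..R}). \<exists>v\<in>range inc. br (F i) y = p + v"
      unfolding n_plus_def by (metis add_0)
  qed (use br_h_n_plus x in \<open>auto simp: n_plus_def\<close>)
  thus ?thesis by blast
qed

definition triangular :: "'g set" where
  "triangular = {x + inc H + y | x H y. x \<in> n_minus \<and> y \<in> n_plus}"

lemma subspace_triangular: "g.subspace triangular"
  unfolding g.subspace_def
proof (intro conjI ballI allI)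
  have "inc 0 = 0" using inc_scale[of 0 0] by simp
  hence "0 = 0 + inc 0 + (0 :: 'g)" by simp
  thus "0 \<in> triangular" unfolding triangular_def
    using g.subspace_0[OF n_facts(1)] g.subspace_0[OF n_facts(2)] by blast
next
  fix u v assume "u \<in> triangular" "v \<in> triangular"
  then obtain x H y x' H' y' where *: "x \<in> n_minus" "y \<in> n_plus" "u = x + inc H + y" "x' \<in> n_minus" "y' \<in> n_plus" "v = x' + inc H' + y'"
    unfolding triangular_def by blast
  have "u + v = (x + x') + inc (H + H') + (y + y')" unfolding * inc_add by (simp add: algebra_simps)
  thus "u + v \<in> triangular" unfolding triangular_def
    using g.subspace_add[OF n_facts(1) *(1,4)] g.subspace_add[OF n_facts(2) *(2,5)] by blast
next
  fix c u assume "u \<in> triangular"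
  then obtain x H y where *: "x \<in> n_minus" "y \<in> n_plus" "u = x + inc H + y" unfolding triangular_def by blast
  have "sg c u = sg c x + inc (sh c H) + sg c y" unfolding * inc_scale by (simp add: g.scale_right_distrib)
  thus "sg c u \<in> triangular" unfolding triangular_def
    using g.subspace_scale[OF n_facts(1) *(1)] g.subspace_scale[OF n_facts(2) *(2)] by blast
qed

lemma triangularI: "x \<in> n_minus \<Longrightarrow> x \<in> triangular" "inc H \<in> triangular" "y \<in> n_plus \<Longrightarrow> y \<in> triangular"
proof -
  have 0: "inc 0 = 0" using inc_scale[of 0 0] by simp
  have n0: "0 \<in> n_minus" "0 \<in> n_plus" using g.subspace_0[OF n_facts(1)] g.subspace_0[OF n_facts(2)] .
  show "x \<in> triangular" if "x \<in> n_minus"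
  proof -
    have "x = x + inc 0 + 0" by (simp add: 0)
    thus ?thesis unfolding triangular_def using that n0 by blast
  qed
  show "inc H \<in> triangular"
  proof -
    have "inc H = 0 + inc H + 0" by simp
    thus ?thesis unfolding triangular_def using n0 by blast
  qed
  show "y \<in> triangular" if "y \<in> n_plus"
  proof -
    have "y = 0 + inc 0 + y" by (simp add: 0)
    thus ?thesis unfolding triangular_def using that n0 by blast
  qed
qed

text \<open>The sum of the three parts is stable under ad of each generator. Elements with this
  stability form a subalgebra, hence are everything, and so the sum is itself a subalgebra
  containing the generators. Only existence is asserted; later the parts are told apart by the
  orthogonality relations of K.\<close>

lemma triangular_decomposition: "\<exists>x\<in>n_minus. \<exists>H. \<exists>y\<in>n_plus. z = x + inc H + y"
proof -
  let ?N = "{z. \<forall>s\<in>triangular. br z s \<in> triangular}"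
  have tri: "br z s \<in> triangular" if s: "s \<in> triangular"
    and z: "\<And>x. x \<in> n_minus \<Longrightarrow> br z x \<in> triangular" "\<And>H. br z (inc H) \<in> triangular" "\<And>y. y \<in> n_plus \<Longrightarrow> br z y \<in> triangular" for z s
  proof -
    obtain x H y where *: "x \<in> n_minus" "y \<in> n_plus" "s = x + inc H + y" using s unfolding triangular_def by blast
    show ?thesis unfolding *(3) g.bracket_add_right
      by (intro g.subspace_add[OF subspace_triangular] z *)
  qed
  have sum: "p + inc H \<in> triangular" if "p \<in> n_minus \<or> p \<in> n_plus" for p H
    using that triangularI by (auto intro!: g.subspace_add[OF subspace_triangular])
  have N: "g.subalgebra ?N"
    unfolding g.subalgebra_def g.subspace_def
  proof (intro conjI ballI allI)
    show "0 \<in> ?N" using g.subspace_0[OF subspace_triangular] by (simp add: g.bracket_zero)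
    show "x + y \<in> ?N" if "x \<in> ?N" "y \<in> ?N" for x y
      using that g.subspace_add[OF subspace_triangular] by (simp add: g.bracket_add_left)
    show "sg c x \<in> ?N" if "x \<in> ?N" for c x
      using that g.subspace_scale[OF subspace_triangular] by (simp add: g.bracket_scale_left)
    show "br x y \<in> ?N" if "x \<in> ?N" "y \<in> ?N" for x y
    proof
      show "\<forall>s\<in>triangular. br (br x y) s \<in> triangular"
      proof
        fix s assume s: "s \<in> triangular"
        have "br (br x y) s = br x (br y s) - br y (br x s)" using g.leibniz[of x y s] by simp
        thus "br (br x y) s \<in> triangular"
          using that s g.subspace_diff[OF subspace_triangular] by simp
      qed
    qed
  qed
  have all: "z \<in> ?N" for z
  proof (rule generated[OF N])
    fix i assume i: "i \<in> {1..R}"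
    show "E i \<in> ?N"
    proof (intro CollectI ballI, rule tri, assumption)
      show "br (E i) x \<in> triangular" if "x \<in> n_minus" for x
        using br_E_n_minus[OF i that] sum by auto
      have "br (E i) (inc H) = sg (- \<alpha> i H) (E i)" for H
        unfolding g.bracket_antisym[of "E i"] br_HE[OF i] by simp
      thus "br (E i) (inc H) \<in> triangular" for H
        by (simp only: triangularI(3)[OF g.subspace_scale[OF n_facts(2) E_n_plus[OF i]]])
      show "br (E i) y \<in> triangular" if "y \<in> n_plus" for y
        by (intro triangularI(3) n_facts(4) E_n_plus that i)
    qed
    show "F i \<in> ?N"
    proof (intro CollectI ballI, rule tri, assumption)
      show "br (F i) x \<in> triangular" if "x \<in> n_plus" for x
        using br_F_n_plus[OF i that] sum by auto
      have "br (F i) (inc H) = sg (\<alpha> i H) (F i)" for H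
        unfolding g.bracket_antisym[of "F i"] br_HF[OF i] by simp
      thus "br (F i) (inc H) \<in> triangular" for H
        using triangularI(1)[OF g.subspace_scale[OF n_facts(1) F_n_minus[OF i]]] by simp
      show "br (F i) y \<in> triangular" if "y \<in> n_minus" for y
        by (intro triangularI(1) n_facts(3) F_n_minus that i)
    qed
  next
    fix H show "inc H \<in> ?N"
    proof (intro CollectI ballI, rule tri, assumption)
      show "br (inc H) x \<in> triangular" if "x \<in> n_minus" for x by (intro triangularI(1) br_h_n_minus that)
      show "br (inc H) (inc H') \<in> triangular" for H' by (simp add: br_HH g.subspace_0[OF subspace_triangular])
      show "br (inc H) y \<in> triangular" if "y \<in> n_plus" for y by (intro triangularI(3) br_h_n_plus that)
    qed
  qed
  have "g.subalgebra triangular"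
    unfolding g.subalgebra_def using subspace_triangular all by blast
  hence "z \<in> triangular"
    by (rule generated) (erule triangularI(3)[OF E_n_plus] triangularI(1)[OF F_n_minus] | rule triangularI(2))+
  thus ?thesis unfolding triangular_def by blast
qed

end

section \<open>Duality between the bracket of the upper part and the cobracket of words\<close>

context g_forms
begin

lemma K_linear: "K (x + y) z = K x z + K y z" "K x (y + z) = K x y + K x z"
    "K (sg c x) y = c * K x y" "K x (sg c y) = c * K x y"
  using K_bilinear unfolding bilinear_form_def Vector_Spaces.linear_iff by blast+

lemma K_zero: "K 0 x = 0" "K x 0 = 0"
  using K_linear(1)[of 0 0 x] K_linear(2)[of x 0 0] by simp_all

lemma K_minus_right: "K x (- y) = - K x y" "K (- x) y = - K x y"
  using K_linear(2)[of x y "- y"] K_linear(1)[of x "- x" y] K_zero by (simp_all add: eq_neg_iff_add_eq_0 add.commute)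

lemma K_h_orthogonal': "x \<in> n_minus \<Longrightarrow> K x (inc H) = 0" "x \<in> n_plus \<Longrightarrow> K x (inc H) = 0"
  using K_h_orthogonal[of x H] K_sym[of x "inc H"] by simp_all

lemma K_swap_bracket: "K x (br y z) = - K (br x z) y"
  by (subst g.bracket_antisym[of y z]) (simp only: K_minus_right K_invariant)

abbreviation F_word :: "(nat \<times> nat \<Rightarrow> nat) \<Rightarrow> commutator \<Rightarrow> 'g" where
  "F_word c \<equiv> g.word_value (\<lambda>i k. F (c (i, k)))"

definition letters :: "(nat \<times> nat \<Rightarrow> nat) \<Rightarrow> commutator \<Rightarrow> bool" where
  "letters c M \<longleftrightarrow> (\<forall>x\<in>#comm_gens M. c x \<in> {1..R})"

lemma lettersD: "letters c (CBracket g h) \<Longrightarrow> letters c g" "letters c (CBracket g h) \<Longrightarrow> letters c h"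
  unfolding letters_def by auto

lemma letters_part: "letters c g \<Longrightarrow> comm_gens a + comm_gens b = comm_gens g \<Longrightarrow> letters c a \<and> letters c b"
  unfolding letters_def by (metis union_iff)

lemma F_word_n_minus: "letters c M \<Longrightarrow> F_word c M \<in> n_minus"
  by (rule g.word_in_subalgebra[OF subalgebra_n(1)]) (auto simp: letters_def intro: F_n_minus)

lemma F_word_weight:
  "letters c M \<Longrightarrow> br (inc H) (F_word c M) = sg (- (\<Sum>x\<in>#comm_gens M. \<alpha> (c x) H)) (F_word c M)"
proof (induction M)
  case (CGen i k)
  thus ?case by (simp add: letters_def br_HF)
next
  case (CBracket M N)
  note IH = CBracket.IH(1)[OF lettersD(1)[OF CBracket.prems]] CBracket.IH(2)[OF lettersD(2)[OF CBracket.prems]]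
  show ?case unfolding g.word_value.simps g.leibniz[of "inc H"] IH g.bracket_scale_left g.bracket_scale_right
    by (simp add: g.scale_left_distrib[symmetric] del: g.scale_minus_left)
qed

definition letter_form :: "(nat \<times> nat \<Rightarrow> nat) \<Rightarrow> nat \<times> nat \<Rightarrow> nat \<times> nat \<Rightarrow> complex" where
  "letter_form c x y = dual_form B (\<alpha> (c x)) (\<alpha> (c y))"

text \<open>[X, v g] is split into its triangular parts. The lower part is paired with [Y, v h],
  whose upper part feeds the hypothesis for g. The Cartan part acts on v h through its weight and
  produces the coefficient \<open>gens_weight\<close>. The upper part feeds the hypothesis for
  h.\<close>

lemma K_cobracket_step:
  fixes c :: "nat \<times> nat \<Rightarrow> nat"
  defines "v \<equiv> F_word c"
  defines "S \<equiv> cobracket_sum (*) (letter_form c)"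
  assumes lg: "letters c g" and lh: "letters c h"
    and IHg: "\<And>X Y. X \<in> n_plus \<Longrightarrow> Y \<in> n_plus \<Longrightarrow>
      K (br Y X) (v g) = - S g (\<lambda>a b. K X (v a) * K Y (v b) - K X (v b) * K Y (v a))"
    and IHh: "\<And>X Y. X \<in> n_plus \<Longrightarrow> Y \<in> n_plus \<Longrightarrow>
      K (br Y X) (v h) = - S h (\<lambda>a b. K X (v a) * K Y (v b) - K X (v b) * K Y (v a))"
    and X: "X \<in> n_plus" and Y: "Y \<in> n_plus"
  shows "K Y (br (br X (v g)) (v h)) =
      S g (\<lambda>a b. K X (v a) * K Y (br (v h) (v b)) - K X (v b) * K Y (br (v h) (v a)))
    - gens_weight (letter_form c) g h * K X (v g) * K Y (v h)
    - S h (\<lambda>a b. K X (br (v g) (v a)) * K Y (v b) - K X (br (v g) (v b)) * K Y (v a))"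
proof -
  have vg: "v g \<in> n_minus" and vh: "v h \<in> n_minus" unfolding v_def using lg lh F_word_n_minus by blast+
  obtain n1 H1 y1 where 1: "n1 \<in> n_minus" "y1 \<in> n_plus" "br X (v g) = n1 + inc H1 + y1"
    using triangular_decomposition[of "br X (v g)"] by blast
  obtain n2 H2 y2 where 2: "n2 \<in> n_minus" "y2 \<in> n_plus" "br Y (v h) = n2 + inc H2 + y2"
    using triangular_decomposition[of "br Y (v h)"] by blast
  \<comment> \<open>Pairing with \<open>n_minus\<close> sees only the upper part of [X, v g], and
    invariance expresses it through a bracket inside \<open>n_minus\<close>.\<close>
  have y1: "K y1 u = K X (br (v g) u)" if "u \<in> n_minus" for u
  proof -
    have "K X (br (v g) u) = K (n1 + inc H1 + y1) u" unfolding 1(3)[symmetric] by (rule K_invariant[symmetric])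
    thus ?thesis using K_minus[OF 1(1) that] K_h_orthogonal[of u H1] that by (simp add: K_linear)
  qed
  have y2: "K y2 u = K Y (br (v h) u)" if "u \<in> n_minus" for u
  proof -
    have "K Y (br (v h) u) = K (n2 + inc H2 + y2) u" unfolding 2(3)[symmetric] by (rule K_invariant[symmetric])
    thus ?thesis using K_minus[OF 2(1) that] K_h_orthogonal[of u H2] that by (simp add: K_linear)
  qed
  have n: "K Y (br n1 (v h)) = S g (\<lambda>a b. K X (v a) * K Y (br (v h) (v b)) - K X (v b) * K Y (br (v h) (v a)))"
  proof -
    have "K Y (br n1 (v h)) = - K (n2 + inc H2 + y2) n1" unfolding K_swap_bracket 2(3) ..
    also have "\<dots> = - K y2 n1"
      using K_minus[OF 2(1) 1(1)] K_h_orthogonal[of n1 H2] 1(1) by (simp add: K_linear)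
    also have "K y2 n1 = K y2 (br X (v g))"
      unfolding 1(3) using K_plus[OF 2(2) 1(2)] K_h_orthogonal'(2)[OF 2(2)] by (simp add: K_linear)
    also have "\<dots> = K (br y2 X) (v g)" by (rule K_invariant[symmetric])
    also have "\<dots> = - S g (\<lambda>a b. K X (v a) * K y2 (v b) - K X (v b) * K y2 (v a))"
      by (rule IHg[OF X 2(2)])
    also have "S g (\<lambda>a b. K X (v a) * K y2 (v b) - K X (v b) * K y2 (v a)) =
      S g (\<lambda>a b. K X (v a) * K Y (br (v h) (v b)) - K X (v b) * K Y (br (v h) (v a)))"
      unfolding S_def
    proof (rule cobracket_sum_cong)
      fix a b assume "comm_gens a + comm_gens b = comm_gens g"
      hence "v a \<in> n_minus" "v b \<in> n_minus" unfolding v_def using letters_part[OF lg] F_word_n_minus by blast+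
      thus "K X (v a) * K y2 (v b) - K X (v b) * K y2 (v a) =
        K X (v a) * K Y (br (v h) (v b)) - K X (v b) * K Y (br (v h) (v a))" by (simp add: y2)
    qed
    finally show ?thesis by simp
  qed
  \<comment> \<open>Invariance identifies the Cartan part of [X, v g]: up to the factor K X (v g),
    it is dual to the sum of the roots of g.\<close>
  have BH1: "B H1 H = K X (v g) * (\<Sum>x\<in>#comm_gens g. \<alpha> (c x) H)" for H
  proof -
    have "B H1 H = K (n1 + inc H1 + y1) (inc H)"
      using K_h_orthogonal'(1)[OF 1(1)] K_h_orthogonal'(2)[OF 1(2)] by (simp add: K_linear K_h)
    also have "\<dots> = K X (br (v g) (inc H))" unfolding 1(3)[symmetric] by (rule K_invariant)
    also have "br (v g) (inc H) = sg (\<Sum>x\<in>#comm_gens g. \<alpha> (c x) H) (v g)"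
      unfolding v_def g.bracket_antisym[of _ "inc H"] F_word_weight[OF lg] by simp
    finally show ?thesis by (simp only: K_linear mult.commute)
  qed
  have h: "K Y (br (inc H1) (v h)) = - (gens_weight (letter_form c) g h * K X (v g) * K Y (v h))"
  proof -
    have "(\<Sum>y\<in>#comm_gens h. \<alpha> (c y) H1) = (\<Sum>y\<in>#comm_gens h. K X (v g) * (\<Sum>x\<in>#comm_gens g. letter_form c x y))"
    proof (intro arg_cong[of _ _ sum_mset] image_mset_cong)
      fix y assume "y \<in># comm_gens h"
      hence cy: "c y \<in> {1..R}" using lh unfolding letters_def by blast
      have "\<alpha> (c y) H1 = B H1 (dual_vector B (\<alpha> (c y)))"
        using dual_vector[OF alpha_linear[OF cy]] B_sym by metis
      also have "\<dots> = K X (v g) * (\<Sum>x\<in>#comm_gens g. letter_form c x y)"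
        unfolding BH1
      proof (intro arg_cong2[of _ _ _ _ "(*)"] arg_cong[of _ _ sum_mset] image_mset_cong HOL.refl)
        fix x assume "x \<in># comm_gens g"
        hence "c x \<in> {1..R}" using lg unfolding letters_def by blast
        thus "\<alpha> (c x) (dual_vector B (\<alpha> (c y))) = letter_form c x y"
          unfolding letter_form_def dual_form_def by (simp add: dual_vector[OF alpha_linear])
      qed
      finally show "\<alpha> (c y) H1 = K X (v g) * (\<Sum>x\<in>#comm_gens g. letter_form c x y)" .
    qed
    also have "\<dots> = K X (v g) * gens_weight (letter_form c) g h"
      unfolding sum_mset_times_left[symmetric] gens_weight_def by (simp only: sum_mset.swap[of _ "comm_gens h"])
    finally have "(\<Sum>y\<in>#comm_gens h. \<alpha> (c y) H1) = K X (v g) * gens_weight (letter_form c) g h" .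
    hence "br (inc H1) (v h) = sg (- (K X (v g) * gens_weight (letter_form c) g h)) (v h)"
      unfolding v_def F_word_weight[OF lh] by simp
    thus ?thesis by (simp only: K_linear) (simp add: mult_ac)
  qed
  have y: "K Y (br y1 (v h)) = - S h (\<lambda>a b. K X (br (v g) (v a)) * K Y (v b) - K X (br (v g) (v b)) * K Y (v a))"
  proof -
    have "K Y (br y1 (v h)) = K (br Y y1) (v h)" by (rule K_invariant[symmetric])
    also have "\<dots> = - S h (\<lambda>a b. K y1 (v a) * K Y (v b) - K y1 (v b) * K Y (v a))" by (rule IHh[OF 1(2) Y])
    also have "S h (\<lambda>a b. K y1 (v a) * K Y (v b) - K y1 (v b) * K Y (v a)) =
      S h (\<lambda>a b. K X (br (v g) (v a)) * K Y (v b) - K X (br (v g) (v b)) * K Y (v a))"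
      unfolding S_def
    proof (rule cobracket_sum_cong)
      fix a b assume "comm_gens a + comm_gens b = comm_gens h"
      hence "v a \<in> n_minus" "v b \<in> n_minus" unfolding v_def using letters_part[OF lh] F_word_n_minus by blast+
      thus "K y1 (v a) * K Y (v b) - K y1 (v b) * K Y (v a) =
        K X (br (v g) (v a)) * K Y (v b) - K X (br (v g) (v b)) * K Y (v a)" by (simp add: y1)
    qed
    finally show ?thesis .
  qed
  show ?thesis unfolding 1(3) g.bracket_add_left K_linear n h y by simp
qed

text \<open>On a generator both sides vanish, as [X, F_a] has no lower part. For a bracket of words
  the Leibniz rule for ad X gives the preceding step twice, with g and h exchanged; the two results
  combine to the antisymmetrised cobracket.\<close>

theorem K_cobracket:
  assumes "letters c h" "X \<in> n_plus" "Y \<in> n_plus"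
  shows "K (br Y X) (F_word c h) = - cobracket_sum (*) (letter_form c) h
    (\<lambda>a b. K X (F_word c a) * K Y (F_word c b) - K X (F_word c b) * K Y (F_word c a))"
  using assms
proof (induction h arbitrary: X Y)
  case (CGen i k)
  have i: "c (i, k) \<in> {1..R}" using CGen.prems(1) by (simp add: letters_def)
  obtain p H where p: "p \<in> n_plus" "br (F (c (i, k))) X = p + inc H"
    using br_F_n_plus[OF i CGen.prems(2)] by blast
  have "K (br Y X) (F (c (i, k))) = K Y (br X (F (c (i, k))))" by (rule K_invariant)
  also have "\<dots> = - K Y (p + inc H)" unfolding g.bracket_antisym[of X] p(2) by (rule K_minus_right)
  also have "\<dots> = 0" using K_plus[OF CGen.prems(3) p(1)] K_h_orthogonal'(2)[OF CGen.prems(3)] by (simp add: K_linear)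
  finally show ?case by simp
next
  case (CBracket g h)
  let ?v = "F_word c" and ?S = "cobracket_sum (*) (letter_form c)" and ?w = "gens_weight (letter_form c) g h"
  let ?f = "\<lambda>a b. K X (?v a) * K Y (?v b) - K X (?v b) * K Y (?v a)"
  note l = lettersD[OF CBracket.prems(1)]
  note IHg = CBracket.IH(1)[OF l(1)] and IHh = CBracket.IH(2)[OF l(2)]
  note X = CBracket.prems(2) and Y = CBracket.prems(3)
  have w: "gens_weight (letter_form c) h g = ?w"
    unfolding gens_weight_def letter_form_def by (subst sum_mset.swap) (simp add: dual_form_commute)
  have 1: "K Y (br (br X (?v g)) (?v h)) =
      ?S g (\<lambda>a b. K X (?v a) * K Y (br (?v h) (?v b)) - K X (?v b) * K Y (br (?v h) (?v a)))
    - ?w * K X (?v g) * K Y (?v h)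
    - ?S h (\<lambda>a b. K X (br (?v g) (?v a)) * K Y (?v b) - K X (br (?v g) (?v b)) * K Y (?v a))"
    by (rule K_cobracket_step[OF l IHg IHh X Y])
  have 2: "K Y (br (br X (?v h)) (?v g)) =
      ?S h (\<lambda>a b. K X (?v a) * K Y (br (?v g) (?v b)) - K X (?v b) * K Y (br (?v g) (?v a)))
    - ?w * K X (?v h) * K Y (?v g)
    - ?S g (\<lambda>a b. K X (br (?v h) (?v a)) * K Y (?v b) - K X (br (?v h) (?v b)) * K Y (?v a))"
    by (rule K_cobracket_step[OF l(2,1) IHh IHg X Y, unfolded w])
  have anti: "K Z (br x y) = - K Z (br y x)" for Z x y
    by (subst g.bracket_antisym) (rule K_minus_right)
  have Sg: "?S g (\<lambda>a b. ?f (CBracket a h) b + ?f a (CBracket b h)) =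
    - ?S g (\<lambda>a b. K X (?v a) * K Y (br (?v h) (?v b)) - K X (?v b) * K Y (br (?v h) (?v a)))
    - ?S g (\<lambda>a b. K X (br (?v h) (?v a)) * K Y (?v b) - K X (br (?v h) (?v b)) * K Y (?v a))"
  proof -
    have "?S g (\<lambda>a b. ?f (CBracket a h) b + ?f a (CBracket b h)) =
      ?S g (\<lambda>a b. (- 1) * (K X (?v a) * K Y (br (?v h) (?v b)) - K X (?v b) * K Y (br (?v h) (?v a)))
       + (- 1) * (K X (br (?v h) (?v a)) * K Y (?v b) - K X (br (?v h) (?v b)) * K Y (?v a)))"
      by (rule cobracket_sum_cong) (simp add: anti[of _ _ "?v h"] algebra_simps)
    thus ?thesis unfolding cobracket_sum_add cobracket_sum_scale by simp
  qed
  have Sh: "?S h (\<lambda>a b. ?f (CBracket g a) b + ?f a (CBracket g b)) =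
    ?S h (\<lambda>a b. K X (?v a) * K Y (br (?v g) (?v b)) - K X (?v b) * K Y (br (?v g) (?v a)))
    + ?S h (\<lambda>a b. K X (br (?v g) (?v a)) * K Y (?v b) - K X (br (?v g) (?v b)) * K Y (?v a))"
    unfolding cobracket_sum_add[symmetric] by (rule cobracket_sum_cong) (simp add: algebra_simps)
  have "K (br Y X) (?v (CBracket g h)) = K Y (br (br X (?v g)) (?v h)) - K Y (br (br X (?v h)) (?v g))"
    unfolding K_invariant g.word_value.simps g.leibniz[of X] K_linear
    by (simp add: anti[of Y "?v g" "br X (?v h)"])
  also have "\<dots> = - ?S (CBracket g h) ?f"
    unfolding cobracket_sum.simps Sg Sh 1 2 by (simp add: algebra_simps)
  finally show ?case .
qed

section \<open>Invariance of K under the anti-automorphism\<close>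

lemma phi_facts: "\<phi> (x + y) = \<phi> x + \<phi> y" "\<phi> (sg c x) = sg c (\<phi> x)"
  using phi_linear unfolding Vector_Spaces.linear_iff by blast+

lemma phi_zero: "\<phi> 0 = 0"
  using phi_facts(1)[of 0 0] by simp

lemma phi_n_minus: "x \<in> n_minus \<Longrightarrow> \<phi> x \<in> n_plus"
proof -
  have "g.subalgebra {x. \<phi> x \<in> n_plus}"
    unfolding g.subalgebra_def g.subspace_def using n_facts(2)
    by (auto simp: phi_zero phi_facts phi_bracket n_facts(4) g.subspace_0 g.subspace_add g.subspace_scale)
  moreover have "F ` {1..R} \<subseteq> {x. \<phi> x \<in> n_plus}"
    by (auto simp only: phi_F intro!: E_n_plus)
  ultimately have "n_minus \<subseteq> {x. \<phi> x \<in> n_plus}" unfolding n_minus_def by (rule g.generated_minimal)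
  thus "x \<in> n_minus \<Longrightarrow> \<phi> x \<in> n_plus" by blast
qed

lemma phi_n_plus: "x \<in> n_plus \<Longrightarrow> \<phi> x \<in> n_minus"
proof -
  have "g.subalgebra {x. \<phi> x \<in> n_minus}"
    unfolding g.subalgebra_def g.subspace_def using n_facts(1)
    by (auto simp: phi_zero phi_facts phi_bracket n_facts(3) g.subspace_0 g.subspace_add g.subspace_scale)
  moreover have "E ` {1..R} \<subseteq> {x. \<phi> x \<in> n_minus}"
    by (auto simp only: phi_E intro!: F_n_minus)
  ultimately have "n_plus \<subseteq> {x. \<phi> x \<in> n_minus}" unfolding n_plus_def by (rule g.generated_minimal)
  thus "x \<in> n_plus \<Longrightarrow> \<phi> x \<in> n_minus" by blast
qed

lemma phi_phi: "\<phi> (\<phi> x) = x"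
proof -
  have "g.subalgebra {x. \<phi> (\<phi> x) = x}"
    unfolding g.subalgebra_def g.subspace_def by (auto simp: phi_zero phi_facts phi_bracket)
  hence "x \<in> {x. \<phi> (\<phi> x) = x}"
    by (rule generated) (simp_all only: phi_E phi_F phi_h mem_Collect_eq)
  thus ?thesis by simp
qed

lemma n_minus_words: "n_minus = g.span (g.words (\<lambda>i k. F i) ({1..R} \<times> {0}))"
  unfolding n_minus_def by (rule g.generated_eq_span_words) auto

text \<open>Both sides vanish on brackets: [E_i, u] lies in the lower and Cartan parts, which are
  orthogonal to \<open>n_minus\<close>, and [F_i, \<phi> v] behaves dually. On generators the values
  of K are symmetric in the two indices.\<close>

lemma K_phi_EF: assumes i: "i \<in> {1..R}" and x: "x \<in> n_minus" shows "K (F i) (\<phi> x) = K (E i) x"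
proof -
  have bracket: "K (F i) (\<phi> (br u v)) = 0 \<and> K (E i) (br u v) = 0" if uv: "u \<in> n_minus" "v \<in> n_minus" for u v
  proof
    obtain p H where p: "p \<in> n_minus" "br (E i) u = p + inc H" using br_E_n_minus[OF i uv(1)] by blast
    have "K (E i) (br u v) = K (p + inc H) v" unfolding p(2)[symmetric] by (rule K_invariant[symmetric])
    thus "K (E i) (br u v) = 0" using K_minus[OF p(1) uv(2)] K_h_orthogonal[of v H] uv by (simp add: K_linear)
    obtain p H where p: "p \<in> n_plus" "br (F i) (\<phi> v) = p + inc H"
      using br_F_n_plus[OF i phi_n_minus[OF uv(2)]] by blast
    have "K (F i) (\<phi> (br u v)) = K (p + inc H) (\<phi> u)"
      unfolding phi_bracket p(2)[symmetric] by (rule K_invariant[symmetric])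
    thus "K (F i) (\<phi> (br u v)) = 0"
      using K_plus[OF p(1) phi_n_minus[OF uv(1)]] K_h_orthogonal[of "\<phi> u" H] phi_n_minus[OF uv(1)] by (simp add: K_linear)
  qed
  have w: "K (F i) (\<phi> y) = K (E i) y" if y: "y \<in> g.words (\<lambda>i k. F i) ({1..R} \<times> {0})" for y
  proof -
    obtain M where M: "y = g.word_value (\<lambda>i k. F i) M" "set_mset (comm_gens M) \<subseteq> {1..R} \<times> {0}"
      using y unfolding g.words_def by blast
    have inn: "g.word_value (\<lambda>i k. F i) N \<in> n_minus" if "set_mset (comm_gens N) \<subseteq> {1..R} \<times> {0}" for N
    proof (rule g.word_in_subalgebra[OF subalgebra_n(1)])
      fix j k assume "(j, k) \<in># comm_gens N"
      hence "(j, k) \<in> {1..R} \<times> {0}" using that by blast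
      thus "F j \<in> n_minus" by (intro F_n_minus) simp
    qed
    show ?thesis
    proof (cases M)
      case (CGen j k)
      hence j: "j \<in> {1..R}" using M(2) by auto
      have "K (F i) (E j) = K (E i) (F j)" using K_EF[OF i j] K_EF[OF j i] K_sym by (metis (full_types))
      thus ?thesis unfolding M(1) CGen by (simp add: phi_F[OF j])
    next
      case (CBracket N N')
      thus ?thesis unfolding M(1) CBracket using bracket[OF inn inn, of N N'] M(2)[unfolded CBracket] by simp
    qed
  qed
  have "x \<in> g.span (g.words (\<lambda>i k. F i) ({1..R} \<times> {0}))" using x n_minus_words by simp
  thus ?thesis
    by (induction rule: g.span_induct_alt) (simp_all add: phi_zero K_zero phi_facts K_linear w)
qed

text \<open>It makes the kernel of the Shapovalov form stable under \<phi>, so that components in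
  \<open>n_plus\<close> can be carried to \<open>n_minus\<close>. Invariance and symmetry of K show
  that the x satisfying the identity form a subalgebra, which reduces it to generators.\<close>

theorem K_phi: "K (\<phi> x) (\<phi> z) = K x z"
proof -
  let ?S = "{x. \<forall>z. K (\<phi> x) (\<phi> z) = K x z}"
  have S: "g.subalgebra ?S"
    unfolding g.subalgebra_def g.subspace_def
  proof (intro conjI ballI allI)
    show "0 \<in> ?S" by (simp add: phi_zero K_zero)
    show "x + y \<in> ?S" if "x \<in> ?S" "y \<in> ?S" for x y using that by (simp add: phi_facts K_linear)
    show "sg c x \<in> ?S" if "x \<in> ?S" for c x using that by (simp add: phi_facts K_linear)
    show "br x y \<in> ?S" if xy: "x \<in> ?S" "y \<in> ?S" for x y
    proof (intro CollectI allI)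
      fix z
      have "K (\<phi> (br x y)) (\<phi> z) = K (\<phi> z) (br (\<phi> y) (\<phi> x))" unfolding phi_bracket by (rule K_sym)
      also have "\<dots> = K (br (\<phi> z) (\<phi> y)) (\<phi> x)" by (rule K_invariant[symmetric])
      also have "\<dots> = K (\<phi> x) (\<phi> (br y z))" unfolding phi_bracket by (rule K_sym)
      also have "\<dots> = K x (br y z)" using xy(1) by blast
      also have "\<dots> = K (br x y) z" by (rule K_invariant[symmetric])
      finally show "K (\<phi> (br x y)) (\<phi> z) = K (br x y) z" .
    qed
  qed
  have E: "K (\<phi> (E i)) (\<phi> z) = K (E i) z" if i: "i \<in> {1..R}" for i z
  proof -
    obtain x H y where *: "x \<in> n_minus" "y \<in> n_plus" "z = x + inc H + y" using triangular_decomposition by blast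
    show ?thesis
      unfolding *(3) phi_facts phi_h phi_E[OF i] K_linear K_phi_EF[OF i *(1)]
        K_h_orthogonal'(1)[OF F_n_minus[OF i]] K_h_orthogonal'(2)[OF E_n_plus[OF i]]
        K_minus[OF F_n_minus[OF i] phi_n_plus[OF *(2)]] K_plus[OF E_n_plus[OF i] *(2)] ..
  qed
  have "x \<in> ?S"
  proof (rule generated[OF S])
    show "E i \<in> ?S" if "i \<in> {1..R}" for i using E[OF that] by blast
    show "F i \<in> ?S" if i: "i \<in> {1..R}" for i
    proof (intro CollectI allI)
      fix z
      show "K (\<phi> (F i)) (\<phi> z) = K (F i) z"
        using E[OF i, of "\<phi> z"] unfolding phi_E[OF i] phi_F[OF i] phi_phi by simp
    qed
    fix H show "inc H \<in> ?S"
    proof (intro CollectI allI)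
      fix z
      obtain x H' y where *: "x \<in> n_minus" "y \<in> n_plus" "z = x + inc H' + y" using triangular_decomposition by blast
      show "K (\<phi> (inc H)) (\<phi> z) = K (inc H) z"
        unfolding *(3) phi_facts phi_h K_linear
        using K_h_orthogonal[of x H] K_h_orthogonal[of y H] K_h_orthogonal[of "\<phi> x" H] K_h_orthogonal[of "\<phi> y" H]
          *(1,2) phi_n_minus[OF *(1)] phi_n_plus[OF *(2)] by simp
    qed
  qed
  thus ?thesis by blast
qed

end

text \<open>Terms from the same subspace are merged as they appear, which leaves one summand per
  index.\<close>

lemma (in vector_space) span_Union_decomposition:
  assumes "x \<in> span (\<Union>C\<in>I. S C)" "\<And>C. C \<in> I \<Longrightarrow> subspace (S C)"
  shows "\<exists>J f. finite J \<and> J \<subseteq> I \<and> (\<forall>C\<in>J. f C \<in> S C) \<and> x = (\<Sum>C\<in>J. f C)"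
  using assms(1)
proof (induction rule: span_induct_alt)
  case base
  show ?case by (intro exI[of _ "{}"]) simp
next
  case (step c z y)
  then obtain J f C where J: "finite J" "J \<subseteq> I" "\<forall>C\<in>J. f C \<in> S C" "y = (\<Sum>C\<in>J. f C)" and C: "C \<in> I" "z \<in> S C" by blast
  note sub = assms(2)[OF C(1)]
  define f' where "f' = f(C := (if C \<in> J then f C else 0) + scale c z)"
  have "(\<Sum>D\<in>insert C J. f' D) = f' C + (\<Sum>D\<in>J - {C}. f' D)" using J(1) by (rule sum.insert_remove)
  also have "(\<Sum>D\<in>J - {C}. f' D) = (\<Sum>D\<in>J - {C}. f D)" by (intro sum.cong) (auto simp: f'_def)
  also have "f' C + (\<Sum>D\<in>J - {C}. f D) = scale c z + y"
  proof (cases "C \<in> J")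
    case True
    thus ?thesis using sum.remove[OF J(1) True, of f] J(4) by (simp add: f'_def algebra_simps)
  next
    case False
    hence "J - {C} = J" by blast
    thus ?thesis using J(4) False by (simp add: f'_def)
  qed
  finally have "scale c z + y = (\<Sum>D\<in>insert C J. f' D)" by simp
  moreover have "f' D \<in> S D" if "D \<in> insert C J" for D
  proof (cases "D = C")
    case True
    have "f C \<in> S C" if "C \<in> J" using J(3) that by blast
    thus ?thesis unfolding True f'_def
      using subspace_add[OF sub _ subspace_scale[OF sub C(2), of c]] subspace_0[OF sub] by auto
  next
    case False
    thus ?thesis using that J(3) by (auto simp: f'_def)
  qed
  ultimately show ?case using J(1,2) C(1) by (intro exI[of _ "insert C J"] exI[of _ f']) auto
qed

section \<open>Grading by cycles, orthogonality of components, and averaging over \<sigma>\<close>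

context diagram_automorphism
begin

lemma sigma_facts: "\<sigma> (x + y) = \<sigma> x + \<sigma> y" "\<sigma> (sg c x) = sg c (\<sigma> x)"
  using sigma_linear unfolding Vector_Spaces.linear_iff by blast+

lemma sigma_zero: "\<sigma> 0 = 0"
  using sigma_facts(1)[of 0 0] by simp

lemma pi_mem: "i \<in> {1..R} \<Longrightarrow> (\<pi> ^^ k) i \<in> {1..R}"
  by (induction k) (use permutes_in_image[OF pi_permutes] in auto)

lemma sigma_pow_F: "i \<in> {1..R} \<Longrightarrow> (\<sigma> ^^ k) (F i) = F ((\<pi> ^^ k) i)"
  by (induction k) (auto simp only: funpow.simps o_apply id_apply sigma_F pi_mem)

lemma sigma_pow_E: "i \<in> {1..R} \<Longrightarrow> (\<sigma> ^^ k) (E i) = E ((\<pi> ^^ k) i)"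
  by (induction k) (auto simp only: funpow.simps o_apply id_apply sigma_E pi_mem)

lemma sigma_phi: "\<phi> (\<sigma> x) = \<sigma> (\<phi> x)"
proof -
  have "g.subalgebra {x. \<phi> (\<sigma> x) = \<sigma> (\<phi> x)}"
    unfolding g.subalgebra_def g.subspace_def
    by (auto simp: phi_zero phi_facts phi_bracket sigma_zero sigma_facts sigma_bracket)
  hence "x \<in> {x. \<phi> (\<sigma> x) = \<sigma> (\<phi> x)}"
  proof (rule generated)
    show "E i \<in> {x. \<phi> (\<sigma> x) = \<sigma> (\<phi> x)}" if i: "i \<in> {1..R}" for i
      using pi_mem[OF i, of 1] by (simp add: phi_E[OF i] sigma_E[OF i] sigma_F[OF i] phi_E)
    show "F i \<in> {x. \<phi> (\<sigma> x) = \<sigma> (\<phi> x)}" if i: "i \<in> {1..R}" for i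
      using pi_mem[OF i, of 1] by (simp add: phi_F[OF i] sigma_E[OF i] sigma_F[OF i] phi_F)
    fix H
    obtain H' where "\<sigma> (inc H) = inc H'" using sigma_h by blast
    thus "inc H \<in> {x. \<phi> (\<sigma> x) = \<sigma> (\<phi> x)}" by (simp add: phi_h)
  qed
  thus ?thesis by simp
qed

text \<open>K separates the generators. By this \<sigma>^T = id passes to the permutation
  \<pi>.\<close>

lemma F_inject: "i \<in> {1..R} \<Longrightarrow> j \<in> {1..R} \<Longrightarrow> F i = F j \<Longrightarrow> i = j"
  using K_EF[of i i] K_EF[of i j] by (auto split: if_splits)

lemma pi_pow_T: "i \<in> {1..R} \<Longrightarrow> (\<pi> ^^ T) i = i"
  using F_inject[of "(\<pi> ^^ T) i" i] sigma_pow_F[of i T] pi_mem[of i T] by (simp add: sigma_pow_T)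

lemma dual_form_pi: "i \<in> {1..R} \<Longrightarrow> j \<in> {1..R} \<Longrightarrow> dual_form B (\<alpha> (\<pi> i)) (\<alpha> (\<pi> j)) = dual_form B (\<alpha> i) (\<alpha> j)"
  using sigma_B[OF sigma_H sigma_H, of i j] pi_mem[of i 1] pi_mem[of j 1]
  by (simp add: dual_form_def dual_vector_alpha)

lemma dual_form_pi_pow: "i \<in> {1..R} \<Longrightarrow> j \<in> {1..R} \<Longrightarrow>
    dual_form B (\<alpha> ((\<pi> ^^ k) i)) (\<alpha> ((\<pi> ^^ k) j)) = dual_form B (\<alpha> i) (\<alpha> j)"
proof (induction k)
  case (Suc k)
  show ?case unfolding funpow.simps o_apply dual_form_pi[OF pi_mem[OF Suc.prems(1)] pi_mem[OF Suc.prems(2)]]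
    by (rule Suc.IH[OF Suc.prems])
qed simp

definition letter :: "nat \<times> nat \<Rightarrow> nat" where
  "letter x = (\<pi> ^^ snd x) (\<iota> (fst x))"

text \<open>The exponent is unrestricted, as in the definition of the graded pieces. One F_a then
  has many labels, all with the same first entry.\<close>

definition labels :: "(nat \<times> nat) set" where
  "labels = {1..r} \<times> UNIV"

lemma letter_mem: "x \<in> labels \<Longrightarrow> letter x \<in> {1..R}"
  unfolding letter_def labels_def using iota_range by (intro pi_mem) auto

lemma letters_labels: "set_mset (comm_gens M) \<subseteq> labels \<Longrightarrow> letters letter M"
  unfolding letters_def using letter_mem by blast

lemma permutation_pi: "permutation \<pi>"
  using pi_permutes permutation_permutes by blast

lemma orbit_letter: "orbit \<pi> (letter x) = orbit \<pi> (\<iota> (fst x))"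
proof -
  have "letter x \<in> orbit \<pi> (\<iota> (fst x))"
    unfolding letter_def by (rule funpow_in_orbit[OF permutation_self_in_orbit[OF permutation_pi]])
  thus ?thesis by (rule orbit_cyclic_eq3[OF cyclic_on_orbit'[OF permutation_pi]])
qed

lemma letter_fst: "x \<in> labels \<Longrightarrow> y \<in> labels \<Longrightarrow> letter x = letter y \<Longrightarrow> fst x = fst y"
proof -
  assume x: "x \<in> labels" "y \<in> labels" and "letter x = letter y"
  hence "orbit \<pi> (\<iota> (fst x)) = orbit \<pi> (\<iota> (fst y))" using orbit_letter by metis
  thus ?thesis using x by (intro inj_onD[OF bij_betw_imp_inj_on[OF iota_cycles]]) (auto simp: labels_def)
qed

lemma letter_surj: "c \<in> {1..R} \<Longrightarrow> \<exists>x\<in>labels. letter x = c"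
proof -
  assume c: "c \<in> {1..R}"
  hence "orbit \<pi> c \<in> (\<lambda>i. orbit \<pi> (\<iota> i)) ` {1..r}" using iota_cycles unfolding bij_betw_def by blast
  then obtain i where i: "i \<in> {1..r}" "orbit \<pi> c = orbit \<pi> (\<iota> i)" by blast
  have "c \<in> orbit \<pi> (\<iota> i)" unfolding i(2)[symmetric] by (rule permutation_self_in_orbit[OF permutation_pi])
  then obtain k where "c = (\<pi> ^^ k) (\<iota> i)" unfolding orbit_altdef_permutation[OF permutation_pi] by blast
  hence "letter (i, k) = c" "(i, k) \<in> labels" using i(1) by (auto simp: letter_def labels_def)
  thus ?thesis by blast
qed

abbreviation E_word :: "commutator \<Rightarrow> 'g" where
  "E_word \<equiv> g.word_value (\<lambda>i k. E (letter (i, k)))"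

lemma E_word_weight:
  "set_mset (comm_gens M) \<subseteq> labels \<Longrightarrow> br (inc H) (E_word M) = sg (\<Sum>x\<in>#comm_gens M. \<alpha> (letter x) H) (E_word M)"
proof (induction M)
  case (CGen i k)
  thus ?case using letter_mem[of "(i, k)"] by (simp add: br_HE)
next
  case (CBracket M N)
  have sub: "set_mset (comm_gens M) \<subseteq> labels" "set_mset (comm_gens N) \<subseteq> labels" using CBracket.prems by auto
  show ?case unfolding g.word_value.simps g.leibniz[of "inc H"] CBracket.IH(1)[OF sub(1)] CBracket.IH(2)[OF sub(2)]
      g.bracket_scale_left g.bracket_scale_right
    by (simp add: g.scale_left_distrib[symmetric])
qed

lemma word_pow_eq:
  "set_mset (comm_gens M) \<subseteq> labels \<Longrightarrow> g.word_value (\<lambda>i k. (\<sigma> ^^ k) (F (\<iota> i))) M = F_word letter M"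
  "set_mset (comm_gens M) \<subseteq> labels \<Longrightarrow> g.word_value (\<lambda>i k. (\<sigma> ^^ k) (E (\<iota> i))) M = E_word M"
  using iota_range
  by (auto intro!: g.word_value_cong simp: letter_def labels_def sigma_pow_F sigma_pow_E image_subset_iff subset_eq)

lemma n_deg_eq_span:
  "n_minus_deg l = g.span {F_word letter M | M. set_mset (comm_gens M) \<subseteq> labels \<and> word_degree (\<lambda>i k. unit_degree i) M = l}"
  "n_plus_deg l = g.span {E_word M | M. set_mset (comm_gens M) \<subseteq> labels \<and> word_degree (\<lambda>i k. unit_degree i) M = l}"
proof -
  have 1: "{((\<sigma> ^^ k) (F (\<iota> i)), unit_degree i) |i k. i \<in> {1..r}} = (\<lambda>(i, k). ((\<sigma> ^^ k) (F (\<iota> i)), unit_degree i)) ` labels"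
    "{((\<sigma> ^^ k) (E (\<iota> i)), unit_degree i) |i k. i \<in> {1..r}} = (\<lambda>(i, k). ((\<sigma> ^^ k) (E (\<iota> i)), unit_degree i)) ` labels"
    unfolding labels_def by auto
  show "n_minus_deg l = g.span {F_word letter M | M. set_mset (comm_gens M) \<subseteq> labels \<and> word_degree (\<lambda>i k. unit_degree i) M = l}"
    unfolding n_minus_deg_def g.homogeneous_eq_span[OF 1(1)]
    by (intro arg_cong[of _ _ g.span] Collect_cong ex_cong1) (auto simp: word_pow_eq)
  show "n_plus_deg l = g.span {E_word M | M. set_mset (comm_gens M) \<subseteq> labels \<and> word_degree (\<lambda>i k. unit_degree i) M = l}"
    unfolding n_plus_deg_def g.homogeneous_eq_span[OF 1(2)]
    by (intro arg_cong[of _ _ g.span] Collect_cong ex_cong1) (auto simp: word_pow_eq)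
qed

lemma n_minus_deg_subset: "n_minus_deg l \<subseteq> n_minus"
  unfolding n_deg_eq_span
  by (rule g.span_minimal[OF _ n_facts(1)]) (auto intro!: F_word_n_minus letters_labels)

lemma E_word_n_plus: "set_mset (comm_gens M) \<subseteq> labels \<Longrightarrow> E_word M \<in> n_plus"
  by (rule g.word_in_subalgebra[OF subalgebra_n(2)]) (auto intro!: E_n_plus letter_mem simp del: atLeastAtMost_iff)

lemma n_plus_deg_subset: "n_plus_deg l \<subseteq> n_plus"
  unfolding n_deg_eq_span by (rule g.span_minimal[OF _ n_facts(2)]) (auto intro!: E_word_n_plus)

lemma phi_E_word: "set_mset (comm_gens M) \<subseteq> labels \<Longrightarrow>
    \<exists>N. comm_gens N = comm_gens M \<and> \<phi> (E_word M) = F_word letter N"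
proof (induction M)
  case (CGen i k)
  thus ?case using phi_E[OF letter_mem[of "(i, k)"]] by (intro exI[of _ "CGen i k"]) simp
next
  case (CBracket M M')
  then obtain N N' where N: "comm_gens N = comm_gens M" "\<phi> (E_word M) = F_word letter N"
    "comm_gens N' = comm_gens M'" "\<phi> (E_word M') = F_word letter N'" by auto
  thus ?case by (intro exI[of _ "CBracket N' N"]) (simp add: phi_bracket)
qed

lemma phi_F_word: "set_mset (comm_gens M) \<subseteq> labels \<Longrightarrow>
    \<exists>N. comm_gens N = comm_gens M \<and> \<phi> (F_word letter M) = E_word N"
proof (induction M)
  case (CGen i k)
  thus ?case using phi_F[OF letter_mem[of "(i, k)"]] by (intro exI[of _ "CGen i k"]) simp
next
  case (CBracket M M')
  then obtain N N' where N: "comm_gens N = comm_gens M" "\<phi> (F_word letter M) = E_word N"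
    "comm_gens N' = comm_gens M'" "\<phi> (F_word letter M') = E_word N'" by auto
  thus ?case by (intro exI[of _ "CBracket N' N"]) (simp add: phi_bracket)
qed

lemma phi_deg: "x \<in> n_plus_deg l \<Longrightarrow> \<phi> x \<in> n_minus_deg l" "y \<in> n_minus_deg l \<Longrightarrow> \<phi> y \<in> n_plus_deg l"
proof -
  have d: "word_degree dg N = word_degree dg M" if "comm_gens N = comm_gens M" for N M dg
    using that by (simp add: word_degree_def)
  show "\<phi> x \<in> n_minus_deg l" if "x \<in> n_plus_deg l"
    using that unfolding n_deg_eq_span(2)
  proof (induction rule: g.span_induct_alt)
    case base show ?case by (simp add: phi_zero n_deg_eq_span g.span_zero)
  next
    case (step c u y)
    then obtain M where M: "u = E_word M" "set_mset (comm_gens M) \<subseteq> labels" "word_degree (\<lambda>i k. unit_degree i) M = l" by blast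
    obtain N where N: "comm_gens N = comm_gens M" "\<phi> (E_word M) = F_word letter N" using phi_E_word[OF M(2)] by blast
    have "\<phi> u \<in> n_minus_deg l" unfolding n_deg_eq_span M(1)
      by (intro g.span_base CollectI exI[of _ N] conjI N(2)) (use N(1) M d[OF N(1)] in simp_all)
    thus ?case using step.IH unfolding phi_facts n_deg_eq_span by (intro g.span_add g.span_scale)
  qed
  show "\<phi> y \<in> n_plus_deg l" if "y \<in> n_minus_deg l"
    using that unfolding n_deg_eq_span(1)
  proof (induction rule: g.span_induct_alt)
    case base show ?case by (simp add: phi_zero n_deg_eq_span g.span_zero)
  next
    case (step c u y)
    then obtain M where M: "u = F_word letter M" "set_mset (comm_gens M) \<subseteq> labels" "word_degree (\<lambda>i k. unit_degree i) M = l" by blast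
    obtain N where N: "comm_gens N = comm_gens M" "\<phi> (F_word letter M) = E_word N" using phi_F_word[OF M(2)] by blast
    have "\<phi> u \<in> n_plus_deg l" unfolding n_deg_eq_span M(1)
      by (intro g.span_base CollectI exI[of _ N] conjI N(2)) (use N(1) M d[OF N(1)] in simp_all)
    thus ?case using step.IH unfolding phi_facts n_deg_eq_span by (intro g.span_add g.span_scale)
  qed
qed

text \<open>Invariance under the Cartan part equates the sums of the roots of the letters, and
  linear independence of the roots equates the letters with multiplicity. The degree is a function
  of the letters, since different cycles have no letter in common.\<close>

lemma K_words_degree:
  assumes M: "set_mset (comm_gens M) \<subseteq> labels" and N: "set_mset (comm_gens N) \<subseteq> labels"
    and nz: "K (F_word letter M) (E_word N) \<noteq> 0"
  shows "word_degree (\<lambda>i k. unit_degree i) M = word_degree (\<lambda>i k. unit_degree i) N"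
proof -
  let ?K = "K (F_word letter M) (E_word N)"
  let ?n = "\<lambda>M c. count (image_mset letter (comm_gens M)) c"
  have lM: "letters letter M" using M by (rule letters_labels)
  have wt: "(\<Sum>x\<in>#A. \<alpha> (letter x) H) = (\<Sum>c=1..R. of_nat (count (image_mset letter A) c) * \<alpha> c H)"
    if "set_mset A \<subseteq> labels" for A H
    using that
  proof (induction A)
    case (add x A)
    have x: "letter x \<in> {1..R}" using add.prems by (intro letter_mem) simp
    have "(\<Sum>c=1..R. of_nat (count (image_mset letter (add_mset x A)) c) * \<alpha> c H) =
      (\<Sum>c=1..R. (if c = letter x then \<alpha> c H else 0) + of_nat (count (image_mset letter A) c) * \<alpha> c H)"
      by (intro sum.cong) (auto simp: algebra_simps)
    also have "\<dots> = \<alpha> (letter x) H + (\<Sum>c=1..R. of_nat (count (image_mset letter A) c) * \<alpha> c H)"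
      unfolding sum.distrib using x by (simp add: sum.delta)
    finally show ?case using add by simp
  qed simp
  have "(\<Sum>x\<in>#comm_gens M. \<alpha> (letter x) H) = (\<Sum>x\<in>#comm_gens N. \<alpha> (letter x) H)" for H
  proof -
    have "K (br (inc H) (F_word letter M)) (E_word N) = - K (br (F_word letter M) (inc H)) (E_word N)"
      unfolding g.bracket_antisym[of "inc H"] by (rule K_minus_right)
    also have "\<dots> = - K (F_word letter M) (br (inc H) (E_word N))" by (simp only: K_invariant)
    finally show ?thesis unfolding F_word_weight[OF lM] E_word_weight[OF N] K_linear using nz by simp
  qed
  hence "(\<Sum>c=1..R. (of_nat (?n M c) - of_nat (?n N c)) * \<alpha> c H) = 0" for H
    unfolding wt[OF M] wt[OF N] by (simp add: algebra_simps sum_subtractf)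
  hence 0: "(of_nat (?n M c) - of_nat (?n N c) :: complex) = 0" if "c \<in> {1..R}" for c
    by (rule alpha_independent[OF _ that])
  have "image_mset letter (comm_gens M) = image_mset letter (comm_gens N)"
  proof (rule multiset_eqI)
    fix c
    show "?n M c = ?n N c"
    proof (cases "c \<in> {1..R}")
      case True
      thus ?thesis using 0[OF True] by simp
    next
      case False
      hence "c \<notin># image_mset letter (comm_gens M)" "c \<notin># image_mset letter (comm_gens N)"
        using letter_mem M N by auto
      thus ?thesis by (simp only: not_in_iff)
    qed
  qed
  moreover have "word_degree (\<lambda>i k. unit_degree i) M =
      (\<Sum>c\<in>#image_mset letter (comm_gens M). unit_degree (THE i. \<exists>x\<in>labels. letter x = c \<and> fst x = i))"
    if M: "set_mset (comm_gens M) \<subseteq> labels" for M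
    unfolding word_degree_def image_mset.compositionality o_def
  proof (intro arg_cong[of _ _ sum_mset] image_mset_cong)
    fix x assume "x \<in># comm_gens M"
    hence x: "x \<in> labels" using M by blast
    have "(THE i. \<exists>y\<in>labels. letter y = letter x \<and> fst y = i) = fst x"
      by (rule the_equality) (use x letter_fst[OF _ x] in blast)+
    thus "(case x of (i, k) \<Rightarrow> unit_degree i) = unit_degree (THE i. \<exists>y\<in>labels. letter y = letter x \<and> fst y = i)"
      by (simp add: case_prod_beta)
  qed
  ultimately show ?thesis using M N by (simp only:)
qed

lemma K_deg_orthogonal: "x \<in> n_minus_deg l \<Longrightarrow> y \<in> n_plus_deg l' \<Longrightarrow> l \<noteq> l' \<Longrightarrow> K x y = 0"
proof -
  assume x: "x \<in> n_minus_deg l" and y: "y \<in> n_plus_deg l'" and ne: "l \<noteq> l'"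
  have 1: "K (F_word letter M) y = 0" if M: "set_mset (comm_gens M) \<subseteq> labels" "word_degree (\<lambda>i k. unit_degree i) M = l" for M
    using y unfolding n_deg_eq_span
  proof (induction rule: g.span_induct_alt)
    case (step c u y)
    then obtain N where "u = E_word N" "set_mset (comm_gens N) \<subseteq> labels" "word_degree (\<lambda>i k. unit_degree i) N = l'" by blast
    hence "K (F_word letter M) u = 0" using K_words_degree[OF M(1), of N] M(2) ne by metis
    thus ?case using step.IH by (simp add: K_linear)
  qed (simp add: K_zero)
  show "K x y = 0"
    using x unfolding n_deg_eq_span
  proof (induction rule: g.span_induct_alt)
    case (step c u x)
    thus ?case using 1 by (auto simp: K_linear)
  qed (simp add: K_zero)
qed

text \<open>The components before passing to fixed points. An element is decomposed here first and
  its parts are averaged over \<sigma> afterwards.\<close>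

fun raw_space :: "component \<Rightarrow> 'g set" where
  "raw_space (Neg l) = n_minus_deg l"
| "raw_space Cartan = range inc"
| "raw_space (Pos l) = n_plus_deg l"

lemma subspace_raw: "g.subspace (raw_space C)"
  by (cases C) (simp_all add: n_deg_eq_span subspace_inc)

lemma component_space_eq: "component_space C = raw_space C \<inter> fixed_points \<sigma>"
  by (cases C) auto

lemma sigma_raw: "x \<in> raw_space C \<Longrightarrow> \<sigma> x \<in> raw_space C"
proof (cases C)
  case (Neg l)
  assume "x \<in> raw_space C"
  hence "x \<in> g.homogeneous {((\<sigma> ^^ k) (F (\<iota> i)), unit_degree i) | i k. i \<in> {1..r}} l"
    by (simp add: Neg n_minus_deg_def)
  thus ?thesis unfolding Neg raw_space.simps n_minus_deg_def g.homogeneous_def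
  proof (induction rule: g.span_induct_alt)
    case base show ?case by (simp add: sigma_zero g.span_zero)
  next
    case (step c u y)
    have "g.graded_monomial {((\<sigma> ^^ k) (F (\<iota> i)), unit_degree i) | i k. i \<in> {1..r}} (\<sigma> u) l"
      using step.hyps(1)[unfolded mem_Collect_eq]
    proof (induction rule: g.graded_monomial.induct)
      case (gen x d)
      then obtain i k where "i \<in> {1..r}" "x = (\<sigma> ^^ k) (F (\<iota> i))" "d = unit_degree i" by blast
      hence "\<sigma> x = (\<sigma> ^^ Suc k) (F (\<iota> i))" "i \<in> {1..r}" "d = unit_degree i" by simp_all
      thus ?case by (intro g.graded_monomial.gen) blast
    qed (simp only: sigma_bracket g.graded_monomial.bracket)
    thus ?case unfolding sigma_facts by (rule g.span_add[OF g.span_scale[OF g.span_base[OF CollectI]] step.IH])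
  qed
next
  case (Pos l)
  assume "x \<in> raw_space C"
  hence "x \<in> g.homogeneous {((\<sigma> ^^ k) (E (\<iota> i)), unit_degree i) | i k. i \<in> {1..r}} l"
    by (simp add: Pos n_plus_deg_def)
  thus ?thesis unfolding Pos raw_space.simps n_plus_deg_def g.homogeneous_def
  proof (induction rule: g.span_induct_alt)
    case base show ?case by (simp add: sigma_zero g.span_zero)
  next
    case (step c u y)
    have "g.graded_monomial {((\<sigma> ^^ k) (E (\<iota> i)), unit_degree i) | i k. i \<in> {1..r}} (\<sigma> u) l"
      using step.hyps(1)[unfolded mem_Collect_eq]
    proof (induction rule: g.graded_monomial.induct)
      case (gen x d)
      then obtain i k where "i \<in> {1..r}" "x = (\<sigma> ^^ k) (E (\<iota> i))" "d = unit_degree i" by blast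
      hence "\<sigma> x = (\<sigma> ^^ Suc k) (E (\<iota> i))" "i \<in> {1..r}" "d = unit_degree i" by simp_all
      thus ?case by (intro g.graded_monomial.gen) blast
    qed (simp only: sigma_bracket g.graded_monomial.bracket)
    thus ?case unfolding sigma_facts by (rule g.span_add[OF g.span_scale[OF g.span_base[OF CollectI]] step.IH])
  qed
next
  case Cartan
  assume "x \<in> raw_space C"
  thus ?thesis using sigma_h Cartan by auto
qed

lemma raw_orthogonal:
  assumes "C \<in> components" "D \<in> components" "C \<noteq> D" "x \<in> raw_space C" "y \<in> raw_space D"
  shows "K (\<phi> x) y = 0"
proof (cases C)
  case (Neg l)
  hence px: "\<phi> x \<in> n_plus_deg l" using assms(4) phi_deg(2) by simp
  hence pn: "\<phi> x \<in> n_plus" using n_plus_deg_subset by blast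
  show ?thesis
  proof (cases D)
    case (Neg l')
    hence "l' \<noteq> l" using assms(3) \<open>C = Neg l\<close> by blast
    thus ?thesis using K_deg_orthogonal[of y l' "\<phi> x" l] px assms(5) Neg K_sym[of "\<phi> x" y] by simp
  next
    case Cartan
    thus ?thesis using assms(5) K_h_orthogonal'(2)[OF pn] by auto
  next
    case (Pos l')
    hence "y \<in> n_plus" using assms(5) n_plus_deg_subset by auto
    thus ?thesis by (rule K_plus[OF pn])
  qed
next
  case (Pos l)
  hence px: "\<phi> x \<in> n_minus_deg l" using assms(4) phi_deg(1) by simp
  hence pn: "\<phi> x \<in> n_minus" using n_minus_deg_subset by blast
  show ?thesis
  proof (cases D)
    case (Pos l')
    hence "l \<noteq> l'" using assms(3) \<open>C = Pos l\<close> by blast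
    thus ?thesis using K_deg_orthogonal[OF px, of y l'] assms(5) Pos by simp
  next
    case Cartan
    thus ?thesis using assms(5) K_h_orthogonal'(1)[OF pn] by auto
  next
    case (Neg l')
    hence "y \<in> n_minus" using assms(5) n_minus_deg_subset by auto
    thus ?thesis by (rule K_minus[OF pn])
  qed
next
  case Cartan
  then obtain H where H: "x = inc H" using assms(4) by auto
  have "y \<in> n_minus \<union> n_plus"
    using assms(3,5) Cartan n_minus_deg_subset n_plus_deg_subset by (cases D) auto
  thus ?thesis unfolding H phi_h by (rule K_h_orthogonal)
qed

lemma raw_decomposition: "\<exists>J f. finite J \<and> J \<subseteq> components \<and> (\<forall>C\<in>J. f C \<in> raw_space C) \<and> z = (\<Sum>C\<in>J. f C)"
proof (rule g.span_Union_decomposition)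
  let ?U = "\<Union>C\<in>components. raw_space C"
  have deg: "word_degree (\<lambda>i k. unit_degree i) M \<in> degrees - {0}" if M: "set_mset (comm_gens M) \<subseteq> labels" for M
  proof -
    have wd: "word_degree (\<lambda>i k. unit_degree i) M j = size (filter_mset (\<lambda>x. fst x = j) (comm_gens M))" for j
    proof -
      have "(\<Sum>(i, k)\<in>#A. unit_degree i) j = size (filter_mset (\<lambda>x. fst x = j) A)" for A :: "(nat \<times> nat) multiset"
        by (induction A) (auto simp: unit_degree_def)
      thus ?thesis unfolding word_degree_def .
    qed
    have "word_degree (\<lambda>i k. unit_degree i) M j = 0" if "j \<notin> {1..r}" for j
      unfolding wd using M that by (auto simp: labels_def filter_mset_eq_mempty_iff)
    moreover have "word_degree (\<lambda>i k. unit_degree i) M (lead M) \<noteq> 0"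
      unfolding wd using lead_mem[of M] by (auto simp: filter_mset_eq_mempty_iff)
    ultimately show ?thesis unfolding degrees_def by auto
  qed
  have gens: "F ` {1..R} = (\<lambda>(i, k). F (letter (i, k))) ` labels" "E ` {1..R} = (\<lambda>(i, k). E (letter (i, k))) ` labels"
  proof -
    have l: "{1..R} = letter ` labels" using letter_surj letter_mem by blast
    show "F ` {1..R} = (\<lambda>(i, k). F (letter (i, k))) ` labels" "E ` {1..R} = (\<lambda>(i, k). E (letter (i, k))) ` labels"
      unfolding l image_image by (intro image_cong HOL.refl; simp add: case_prod_beta)+
  qed
  have m: "n_minus \<subseteq> g.span ?U"
    unfolding n_minus_def g.generated_eq_span_words[OF gens(1)]
  proof (rule g.span_mono, rule subsetI)
    fix x assume "x \<in> g.words (\<lambda>i k. F (letter (i, k))) labels"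
    then obtain M where M: "x = F_word letter M" "set_mset (comm_gens M) \<subseteq> labels" unfolding g.words_def by blast
    let ?l = "word_degree (\<lambda>i k. unit_degree i) M"
    have "x \<in> n_minus_deg ?l" unfolding n_deg_eq_span M(1) using M(2) by (intro g.span_base) blast
    hence "x \<in> raw_space (Neg ?l)" by simp
    moreover have "Neg ?l \<in> components" using deg[OF M(2)] unfolding components_def by blast
    ultimately show "x \<in> ?U" by blast
  qed
  have p: "n_plus \<subseteq> g.span ?U"
    unfolding n_plus_def g.generated_eq_span_words[OF gens(2)]
  proof (rule g.span_mono, rule subsetI)
    fix x assume "x \<in> g.words (\<lambda>i k. E (letter (i, k))) labels"
    then obtain M where M: "x = E_word M" "set_mset (comm_gens M) \<subseteq> labels" unfolding g.words_def by blast
    let ?l = "word_degree (\<lambda>i k. unit_degree i) M"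
    have "x \<in> n_plus_deg ?l" unfolding n_deg_eq_span M(1) using M(2) by (intro g.span_base) blast
    hence "x \<in> raw_space (Pos ?l)" by simp
    moreover have "Pos ?l \<in> components" using deg[OF M(2)] unfolding components_def by blast
    ultimately show "x \<in> ?U" by blast
  qed
  have h: "inc H \<in> g.span ?U" for H
  proof (rule g.span_base)
    have "inc H \<in> raw_space Cartan" "Cartan \<in> components" by (auto simp: components_def)
    thus "inc H \<in> ?U" by blast
  qed
  obtain x H y where "x \<in> n_minus" "y \<in> n_plus" "z = x + inc H + y" using triangular_decomposition by blast
  thus "z \<in> g.span ?U" using m p h by (auto intro!: g.span_add)
qed (rule subspace_raw)

definition average :: "'g \<Rightarrow> 'g" where
  "average z = sg (1 / of_nat T) (\<Sum>j<T. (\<sigma> ^^ j) z)"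

lemma sigma_pow_facts: "(\<sigma> ^^ j) (x + y) = (\<sigma> ^^ j) x + (\<sigma> ^^ j) y" "(\<sigma> ^^ j) 0 = 0"
  by (induction j) (simp_all add: sigma_facts sigma_zero)

lemma sigma_sum: "\<sigma> (\<Sum>i\<in>I. f i) = (\<Sum>i\<in>I. \<sigma> (f i))"
  by (induction I rule: infinite_finite_induct) (auto simp: sigma_zero sigma_facts)

lemma sigma_pow_sum: "(\<sigma> ^^ j) (\<Sum>i\<in>I. f i) = (\<Sum>i\<in>I. (\<sigma> ^^ j) (f i))"
  by (induction I rule: infinite_finite_induct) (auto simp: sigma_pow_facts)

lemma average_fixed: "\<sigma> z = z \<Longrightarrow> average z = z"
proof -
  assume z: "\<sigma> z = z"
  have "(\<sigma> ^^ j) z = z" for j by (induction j) (simp_all add: z)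
  hence "(\<Sum>j<T. (\<sigma> ^^ j) z) = sg (of_nat T) z" by (simp add: g.sum_constant_scale)
  thus ?thesis using T_pos by (simp add: average_def)
qed

lemma average_component: "z \<in> raw_space C \<Longrightarrow> average z \<in> component_space C"
proof -
  assume z: "z \<in> raw_space C"
  have "(\<sigma> ^^ j) z \<in> raw_space C" for j by (induction j) (auto simp: z sigma_raw)
  hence "average z \<in> raw_space C"
    unfolding average_def by (intro g.subspace_scale g.subspace_sum subspace_raw)
  moreover have "\<sigma> (average z) = average z"
  proof -
    have "(\<Sum>j<T. (\<sigma> ^^ Suc j) z) = (\<Sum>j<T. (\<sigma> ^^ j) z)"
      using sum.lessThan_Suc_shift[of "\<lambda>j. (\<sigma> ^^ j) z" T] sum.lessThan_Suc[of "\<lambda>j. (\<sigma> ^^ j) z" T]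
      by (simp add: sigma_pow_T add.commute)
    thus ?thesis unfolding average_def sigma_facts sigma_sum by simp
  qed
  ultimately show ?thesis unfolding component_space_eq fixed_points_def by simp
qed

text \<open>\<sigma> preserves every component, so averaging over its powers makes each part fixed,
  and it does not change the sum because that was fixed already.\<close>

theorem component_decomposition:
  assumes "z \<in> fixed_points \<sigma>"
  shows "\<exists>J f. finite J \<and> J \<subseteq> components \<and> (\<forall>C\<in>J. f C \<in> component_space C) \<and> z = (\<Sum>C\<in>J. f C)"
proof -
  obtain J f where J: "finite J" "J \<subseteq> components" "\<forall>C\<in>J. f C \<in> raw_space C" "z = (\<Sum>C\<in>J. f C)"
    using raw_decomposition[of z] by (elim exE conjE)
  have "z = average z" using assms average_fixed by (simp add: fixed_points_def)
  also have "\<dots> = (\<Sum>C\<in>J. average (f C))"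
    unfolding average_def J(4) sigma_pow_sum by (subst sum.swap) (rule g.scale_sum_right)
  finally have "z = (\<Sum>C\<in>J. average (f C))" .
  moreover have "\<forall>C\<in>J. average (f C) \<in> component_space C" using J(3) average_component by blast
  ultimately show ?thesis using J(1,2) by (intro exI[of _ J] exI[of _ "\<lambda>C. average (f C)"] conjI)
qed

text \<open>Distinct components are orthogonal for the Shapovalov form, so its kernel is graded: a
  part is tested on its own component, to which the other parts contribute nothing.\<close>

theorem component_kernel:
  assumes J: "finite J" "J \<subseteq> components" "\<forall>C\<in>J. f C \<in> raw_space C"
    and ker: "\<And>z. K (\<phi> (\<Sum>C\<in>J. f C)) z = 0" and C: "C \<in> J"
  shows "K (\<phi> (f C)) z = 0"
proof -
  have phi_sum: "\<phi> (\<Sum>C\<in>J. f C) = (\<Sum>C\<in>J. \<phi> (f C))" for J :: "component set" and f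
    by (induction J rule: infinite_finite_induct) (auto simp: phi_zero phi_facts)
  have K_sum: "K (\<Sum>C\<in>J. f C) z = (\<Sum>C\<in>J. K (f C) z)" "K z (\<Sum>C\<in>J. f C) = (\<Sum>C\<in>J. K z (f C))" for J :: "component set" and f z
    by (induction J rule: infinite_finite_induct) (auto simp: K_zero K_linear)
  have comp: "K (\<phi> (f C)) y = 0" if y: "y \<in> raw_space D" "D \<in> components" for y D
  proof (cases "D = C")
    case True
    have "0 = (\<Sum>C'\<in>J. K (\<phi> (f C')) y)" using ker[of y] unfolding phi_sum K_sum by simp
    also have "\<dots> = K (\<phi> (f C)) y + (\<Sum>C'\<in>J - {C}. K (\<phi> (f C')) y)" by (rule sum.remove[OF J(1) C])
    also have "(\<Sum>C'\<in>J - {C}. K (\<phi> (f C')) y) = 0"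
    proof (intro sum.neutral ballI)
      fix C' assume "C' \<in> J - {C}"
      thus "K (\<phi> (f C')) y = 0" using J y True by (intro raw_orthogonal[of C' D]) auto
    qed
    finally show ?thesis by simp
  next
    case False
    thus ?thesis using J C y by (intro raw_orthogonal[of C D]) auto
  qed
  obtain L h where L: "L \<subseteq> components" "\<forall>D\<in>L. h D \<in> raw_space D" "z = (\<Sum>D\<in>L. h D)"
    using raw_decomposition[of z] by (elim exE conjE)
  show ?thesis unfolding L(3) K_sum
  proof (intro sum.neutral ballI)
    fix D assume "D \<in> L"
    thus "K (\<phi> (f C)) (h D) = 0" using comp[of "h D" D] L(1,2) by blast
  qed
qed

end

subsection \<open>Endomorphisms and the grading of the free Lie algebra\<close>

lemma (in lie_algebra) eval_term_lie_eq: "lie_eq {} t u \<Longrightarrow> eval_term \<gamma> t = eval_term \<gamma> u"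
proof (induction rule: lie_eq.induct)
  case (add_inverse t)
  show ?case by simp
next
  case (jacobi t u v)
  show ?case by (simp add: lie_algebra.jacobi[OF lie_algebra_axioms])
qed (simp_all add: bracket_add_left bracket_add_right bracket_scale_left bracket_scale_right bracket_self
    scale_right_distrib scale_left_distrib algebra_simps)

lift_definition free_subst :: "('x \<Rightarrow> 'x free_lie) \<Rightarrow> 'x free_lie \<Rightarrow> 'x free_lie" is
  "\<lambda>\<gamma> t. free.eval_term \<gamma> t"
  by (rule free.eval_term_lie_eq)

lemma free_subst_hom:
  "free_subst \<gamma> (x + y) = free_subst \<gamma> x + free_subst \<gamma> y"
  "free_subst \<gamma> (free_scale c x) = free_scale c (free_subst \<gamma> x)"
  "free_subst \<gamma> (free_bracket x y) = free_bracket (free_subst \<gamma> x) (free_subst \<gamma> y)"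
  "free_subst \<gamma> (free_gen a) = \<gamma> a"
  "free_subst \<gamma> 0 = 0"
  by (transfer; simp)+

lemma free_map_hom:
  "free_map h (x + y) = free_map h x + free_map h y"
  "free_map h (free_scale c x) = free_scale c (free_map h x)"
  "free_map h (free_bracket x y) = free_bracket (free_map h x) (free_map h y)"
  "free_map h (free_gen a) = free_gen (h a)"
  "free_map h 0 = 0"
  by (transfer; simp add: lie_eq.refl)+

lemma comm_value_word: "comm_value T g = free.word_value (f_gen T) g"
  by (induction g) auto

abbreviation leaf_degree :: "commutator \<Rightarrow> nat \<Rightarrow> nat" where
  "leaf_degree \<equiv> word_degree (\<lambda>i k. unit_degree i)"

definition leaves :: "nat \<Rightarrow> nat \<Rightarrow> (nat \<times> nat) set" where
  "leaves m T = {1..m} \<times> {..<T}"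

lemma compr_eq_image: "{f i k | i k. i \<in> I \<and> k < T} = (\<lambda>(i, k). f i k) ` (I \<times> {..<T})"
proof (intro equalityI subsetI)
  fix y assume "y \<in> (\<lambda>(i, k). f i k) ` (I \<times> {..<T})"
  then obtain i k where "i \<in> I" "k < T" "y = f i k" by auto
  thus "y \<in> {f i k | i k. i \<in> I \<and> k < T}" by blast
qed auto

lemma a_homogeneous_span:
  "a_homogeneous m T d = free.span {comm_value T M | M. set_mset (comm_gens M) \<subseteq> leaves m T \<and> leaf_degree M = d}"
proof -
  have "{(f_gen T i k, unit_degree i) | i k. i \<in> {1..m} \<and> k < T} = (\<lambda>(i, k). (f_gen T i k, unit_degree i)) ` leaves m T"
    unfolding leaves_def by (rule compr_eq_image)
  thus ?thesis unfolding a_homogeneous_def comm_value_word by (rule free.homogeneous_eq_span)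
qed

lemma algebra_a_span: "algebra_a m T = free.span {comm_value T M | M. set_mset (comm_gens M) \<subseteq> leaves m T}"
proof -
  have "{f_gen T i k | i k. i \<in> {1..m} \<and> k < T} = (\<lambda>(i, k). f_gen T i k) ` leaves m T"
    unfolding leaves_def by (rule compr_eq_image)
  thus ?thesis unfolding algebra_a_def comm_value_word free.words_def[symmetric] by (rule free.generated_eq_span_words)
qed

lemma subspace_a_homogeneous: "free.subspace (a_homogeneous m T d)"
  unfolding a_homogeneous_span by (rule free.subspace_span)

lemma a_homogeneous_algebra_a: "a_homogeneous m T d \<subseteq> algebra_a m T"
  unfolding a_homogeneous_span algebra_a_span by (rule free.span_mono) blast

text \<open>The endomorphism doubling the generators of index i acts on degree d by 2^(d i). These
  eigenvalues separate the degrees and show that the graded pieces of the free Lie algebra are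
  independent.\<close>

definition stretch :: "nat \<Rightarrow> (nat \<times> nat) free_lie \<Rightarrow> (nat \<times> nat) free_lie" where
  "stretch i = free_subst (\<lambda>x. free_scale (if fst x = i then 2 else 1) (free_gen x))"

lemma stretch_hom: "stretch i (x + y) = stretch i x + stretch i y" "stretch i (free_scale c x) = free_scale c (stretch i x)"
    "stretch i 0 = 0"
  by (simp_all add: stretch_def free_subst_hom)

lemma leaf_degree_bracket: "leaf_degree (CBracket g h) i = leaf_degree g i + leaf_degree h i"
  by (simp add: word_degree_def)

lemma stretch_comm_value: "stretch i (comm_value T M) = free_scale (2 ^ leaf_degree M i) (comm_value T M)"
proof (induction M)
  case (CGen j k)
  show ?case by (simp add: stretch_def f_gen_def free_subst_hom word_degree_def unit_degree_def)
next
  case (CBracket g h)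
  have "stretch i (comm_value T (CBracket g h)) = free_bracket (stretch i (comm_value T g)) (stretch i (comm_value T h))"
    by (simp add: stretch_def free_subst_hom)
  thus ?case unfolding CBracket leaf_degree_bracket
    by (simp add: free.bracket_scale_left free.bracket_scale_right power_add mult.commute)
qed

lemma stretch_homogeneous: "x \<in> a_homogeneous m T d \<Longrightarrow> stretch i x = free_scale (2 ^ d i) x"
  unfolding a_homogeneous_span
proof (induction rule: free.span_induct_alt)
  case base show ?case by (simp add: stretch_hom)
next
  case (step c x y)
  then obtain M where "x = comm_value T M" "leaf_degree M = d" by blast
  hence "stretch i x = free_scale (2 ^ d i) x" by (simp add: stretch_comm_value)
  thus ?case using step by (simp add: stretch_hom free.scale_right_distrib mult.commute)
qed

text \<open>Eigenvalue argument: at an index where e differs from one of the degrees in J,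
  \<open>stretch\<close> minus the eigenvalue of that degree kills its summand and multiplies z by a
  nonzero scalar.\<close>

lemma homogeneous_sum_zero:
  assumes "finite J"
  shows "z \<in> a_homogeneous m T e \<Longrightarrow> e \<notin> J \<Longrightarrow> (\<forall>d\<in>J. f d \<in> a_homogeneous m T d) \<Longrightarrow> z = (\<Sum>d\<in>J. f d) \<Longrightarrow> z = 0"
  using assms
proof (induction J arbitrary: z f rule: finite_induct)
  case (insert d0 J)
  have "d0 \<noteq> e" using insert.prems(2) by blast
  then obtain i where i: "d0 i \<noteq> e i" by blast
  let ?L = "\<lambda>x. stretch i x - free_scale (2 ^ d0 i) x"
  have L_sum: "?L (\<Sum>d\<in>J. f d) = (\<Sum>d\<in>J. ?L (f d))" for J f
    by (induction J rule: infinite_finite_induct) (auto simp: stretch_hom free.scale_right_distrib)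
  have L_hom: "?L x = free_scale (2 ^ d i - 2 ^ d0 i) x" if "x \<in> a_homogeneous m T d" for x d
    using stretch_homogeneous[OF that] by (simp add: free.scale_left_diff_distrib)
  have "?L z = ?L (f d0) + (\<Sum>d\<in>J. ?L (f d))"
    unfolding insert.prems(4) L_sum using insert.hyps by simp
  also have "?L (f d0) = 0" using L_hom[of "f d0" d0] insert.prems(3) by simp
  also have "(\<Sum>d\<in>J. ?L (f d)) = (\<Sum>d\<in>J. free_scale (2 ^ d i - 2 ^ d0 i) (f d))"
    using insert.prems(3) L_hom by (intro sum.cong) auto
  finally have eq: "free_scale (2 ^ e i - 2 ^ d0 i) z = (\<Sum>d\<in>J. free_scale (2 ^ d i - 2 ^ d0 i) (f d))"
    using L_hom[OF insert.prems(1)] by simp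
  have "free_scale (2 ^ e i - 2 ^ d0 i) z = 0"
  proof (rule insert.IH[OF _ _ _ eq])
    show "free_scale (2 ^ e i - 2 ^ d0 i) z \<in> a_homogeneous m T e"
      by (rule free.subspace_scale[OF subspace_a_homogeneous insert.prems(1)])
    show "e \<notin> J" using insert.prems(2) by blast
    show "\<forall>d\<in>J. free_scale (2 ^ d i - 2 ^ d0 i) (f d) \<in> a_homogeneous m T d"
      using insert.prems(3) by (auto intro: free.subspace_scale[OF subspace_a_homogeneous])
  qed
  moreover have "(2 :: complex) ^ e i - 2 ^ d0 i \<noteq> 0"
  proof
    assume "(2 :: complex) ^ e i - 2 ^ d0 i = 0"
    hence "(of_nat (2 ^ e i) :: complex) = of_nat (2 ^ d0 i)" by simp
    hence "(2 :: nat) ^ e i = 2 ^ d0 i" by (simp only: of_nat_eq_iff)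
    thus False using i by simp
  qed
  ultimately show ?case by (simp add: free.scale_eq_0_iff)
qed simp

abbreviation other_degrees :: "nat \<Rightarrow> nat \<Rightarrow> (nat \<times> nat) free_lie set" where
  "other_degrees m T \<equiv> free.span (\<Union>d\<in>{d. d \<noteq> ones m}. a_homogeneous m T d)"

text \<open>Independence of the degrees gives the uniqueness that the definite description in
  \<open>multilinear_part\<close> asks for.\<close>

lemma multilinear_part_eqI:
  assumes y: "y \<in> a_homogeneous m T (ones m)" "x - y \<in> other_degrees m T"
  shows "multilinear_part m T x = y"
  unfolding multilinear_part_def
proof (rule the_equality)
  fix y' assume y': "y' \<in> a_homogeneous m T (ones m) \<and> x - y' \<in> other_degrees m T"
  have "y - y' \<in> a_homogeneous m T (ones m)" using y(1) y' by (intro free.subspace_diff subspace_a_homogeneous) auto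
  moreover have "(x - y') - (x - y) = y - y'" by simp
  moreover have "(x - y') - (x - y) \<in> other_degrees m T" by (rule free.span_diff[OF conjunct2[OF y'] y(2)])
  ultimately have "y - y' \<in> other_degrees m T" by (simp only:)
  then obtain J f where J: "finite J" "J \<subseteq> {d. d \<noteq> ones m}" "\<forall>d\<in>J. f d \<in> a_homogeneous m T d" "y - y' = (\<Sum>d\<in>J. f d)"
    using free.span_Union_decomposition[of "y - y'" "a_homogeneous m T" "{d. d \<noteq> ones m}"] subspace_a_homogeneous by blast
  have "y - y' \<in> a_homogeneous m T (ones m)" using y(1) y' by (intro free.subspace_diff subspace_a_homogeneous) auto
  hence "y - y' = 0" using homogeneous_sum_zero[OF J(1) _ _ J(3,4)] J(2) by blast
  thus "y' = y" by simp
qed (use y in blast)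

lemma multilinear_part_exists:
  assumes "x \<in> algebra_a m T"
  shows "multilinear_part m T x \<in> a_homogeneous m T (ones m) \<and> x - multilinear_part m T x \<in> other_degrees m T"
proof -
  have "\<exists>y. y \<in> a_homogeneous m T (ones m) \<and> x - y \<in> other_degrees m T"
    using assms unfolding algebra_a_span
  proof (induction rule: free.span_induct_alt)
    case base
    show ?case by (intro exI[of _ 0]) (simp add: free.subspace_0[OF subspace_a_homogeneous] free.span_zero)
  next
    case (step c u x)
    then obtain M y where M: "u = comm_value T M" "set_mset (comm_gens M) \<subseteq> leaves m T"
      and y: "y \<in> a_homogeneous m T (ones m)" "x - y \<in> other_degrees m T" by blast
    have u: "u \<in> a_homogeneous m T (leaf_degree M)" unfolding a_homogeneous_span M(1) using M(2) by (intro free.span_base) blast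
    show ?case
    proof (cases "leaf_degree M = ones m")
      case True
      have "free_scale c u + x - (free_scale c u + y) = x - y" by simp
      moreover have "free_scale c u + y \<in> a_homogeneous m T (ones m)"
        using u y(1) unfolding True by (intro free.subspace_add free.subspace_scale subspace_a_homogeneous)
      ultimately show ?thesis using y(2) by metis
    next
      case False
      have "u \<in> other_degrees m T" using u False by (intro free.span_base) blast
      hence "free_scale c u + (x - y) \<in> other_degrees m T" using y(2) by (intro free.span_add free.span_scale)
      hence "free_scale c u + x - y \<in> other_degrees m T" by (simp add: algebra_simps)
      thus ?thesis using y(1) by blast
    qed
  qed
  then obtain y where "y \<in> a_homogeneous m T (ones m)" "x - y \<in> other_degrees m T" by blast
  thus ?thesis using multilinear_part_eqI by metis
qed

lemma multilinear_part_add: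
  assumes "x \<in> algebra_a m T" "y \<in> algebra_a m T"
  shows "multilinear_part m T (x + y) = multilinear_part m T x + multilinear_part m T y"
proof (rule multilinear_part_eqI)
  note x = multilinear_part_exists[OF assms(1)] and y = multilinear_part_exists[OF assms(2)]
  show "multilinear_part m T x + multilinear_part m T y \<in> a_homogeneous m T (ones m)"
    using x y by (intro free.subspace_add subspace_a_homogeneous) auto
  have "x + y - (multilinear_part m T x + multilinear_part m T y) = (x - multilinear_part m T x) + (y - multilinear_part m T y)" by simp
  thus "x + y - (multilinear_part m T x + multilinear_part m T y) \<in> other_degrees m T"
    using x y by (simp only: free.span_add)
qed

lemma multilinear_part_scale:
  assumes "x \<in> algebra_a m T"
  shows "multilinear_part m T (free_scale c x) = free_scale c (multilinear_part m T x)"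
proof (rule multilinear_part_eqI)
  note x = multilinear_part_exists[OF assms(1)]
  show "free_scale c (multilinear_part m T x) \<in> a_homogeneous m T (ones m)"
    using x by (intro free.subspace_scale subspace_a_homogeneous) auto
  show "free_scale c x - free_scale c (multilinear_part m T x) \<in> other_degrees m T"
    unfolding free.scale_right_diff_distrib[symmetric] using x by (intro free.span_scale) blast
qed

lemma multilinear_part_zero: "multilinear_part m T 0 = 0"
  by (rule multilinear_part_eqI) (simp_all add: free.subspace_0[OF subspace_a_homogeneous] free.span_zero)

lemma multilinear_part_comm_value:
  assumes M: "set_mset (comm_gens M) \<subseteq> leaves m T"
  shows "multilinear_part m T (comm_value T M) = (if leaf_degree M = ones m then comm_value T M else 0)"
proof (rule multilinear_part_eqI)
  have u: "comm_value T M \<in> a_homogeneous m T (leaf_degree M)" unfolding a_homogeneous_span using M by (intro free.span_base) blast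
  show "(if leaf_degree M = ones m then comm_value T M else 0) \<in> a_homogeneous m T (ones m)"
    using u free.subspace_0[OF subspace_a_homogeneous] by auto
  show "comm_value T M - (if leaf_degree M = ones m then comm_value T M else 0) \<in> other_degrees m T"
    using u by (auto simp: free.span_zero intro!: free.span_base)
qed

lemma comm_value_algebra_a: "set_mset (comm_gens M) \<subseteq> leaves m T \<Longrightarrow> comm_value T M \<in> algebra_a m T"
  unfolding algebra_a_span by (intro free.span_base) blast

lemma multilinear_part_sum:
  assumes "finite S" "\<And>M. M \<in> S \<Longrightarrow> set_mset (comm_gens M) \<subseteq> leaves m T"
  shows "multilinear_part m T (\<Sum>M\<in>S. comm_value T M) = (\<Sum>M\<in>{M\<in>S. leaf_degree M = ones m}. comm_value T M)"
proof -
  have sub: "free.subspace (algebra_a m T)" unfolding algebra_a_span by (rule free.subspace_span)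
  have "multilinear_part m T (\<Sum>M\<in>S. comm_value T M) = (\<Sum>M\<in>S. if leaf_degree M = ones m then comm_value T M else 0)"
    using assms
  proof (induction S rule: finite_induct)
    case (insert M S)
    have "(\<Sum>M\<in>S. comm_value T M) \<in> algebra_a m T"
      using insert.prems by (intro free.subspace_sum sub comm_value_algebra_a) auto
    thus ?case using insert multilinear_part_add[of "comm_value T M" m T] comm_value_algebra_a[of M m T]
        multilinear_part_comm_value[of M m T] by simp
  qed (simp add: multilinear_part_zero)
  also have "\<dots> = (\<Sum>M\<in>{M\<in>S. leaf_degree M = ones m}. comm_value T M)"
    using assms(1) by (simp add: sum.inter_filter)
  finally show ?thesis .
qed

subsection \<open>The cyclic automorphism of the free Lie algebra\<close>

lemma tau_hom: "tau T (x + y) = tau T x + tau T y" "tau T (free_scale c x) = free_scale c (tau T x)" "tau T 0 = 0"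
  by (simp_all add: tau_def free_map_hom)

lemma tau_comm_value: "tau T (comm_value T g) = comm_value T (shift T 1 g)"
proof (induction g)
  case (CGen i k)
  show ?case by (simp add: tau_def f_gen_def free_map_hom mod_Suc_eq)
next
  case (CBracket g h)
  have "tau T (comm_value T (CBracket g h)) = free_bracket (tau T (comm_value T g)) (tau T (comm_value T h))"
    by (simp add: tau_def free_map_hom)
  thus ?case using CBracket by simp
qed

lemma comm_value_shift_shift: "comm_value T (shift T a (shift T b g)) = comm_value T (shift T (a + b) g)"
  by (induction g) (simp_all add: f_gen_def mod_add_left_eq mod_add_right_eq ac_simps)

lemma comm_value_shift_0: "comm_value T (shift T 0 g) = comm_value T g" "comm_value T (shift T T g) = comm_value T g"
  by (induction g) (simp_all add: f_gen_def)

lemma tau_pow_comm_value: "(tau T ^^ j) (comm_value T g) = comm_value T (shift T j g)"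
proof (induction j)
  case (Suc j)
  thus ?case by (simp add: tau_comm_value comm_value_shift_shift)
qed (simp add: comm_value_shift_0)

lemma tau_pow_hom: "(tau T ^^ j) (x + y) = (tau T ^^ j) x + (tau T ^^ j) y" "(tau T ^^ j) (free_scale c x) = free_scale c ((tau T ^^ j) x)"
    "(tau T ^^ j) 0 = 0"
  by (induction j) (simp_all add: tau_hom)

lemma bar_hom: "bar T (x + y) = bar T x + bar T y" "bar T (free_scale c x) = free_scale c (bar T x)" "bar T 0 = 0"
  by (simp_all add: bar_def tau_pow_hom sum.distrib free.scale_sum_right)

lemma comm_bar_eq: "comm_bar T g = (\<Sum>j<T. comm_value T (shift T j g))"
  by (simp add: comm_bar_def bar_def tau_pow_comm_value)

lemma tau_sum: "tau T (\<Sum>i\<in>I. f i) = (\<Sum>i\<in>I. tau T (f i))"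
  by (induction I rule: infinite_finite_induct) (auto simp: tau_hom)

lemma sum_rotate: "f T = f 0 \<Longrightarrow> (\<Sum>j<T. f (Suc j)) = (\<Sum>j<T. (f j :: 'a::ab_group_add))"
  using sum.lessThan_Suc_shift[of f T] sum.lessThan_Suc[of f T] by (simp add: add.commute)

lemma tau_comm_bar: "tau T (comm_bar T g) = comm_bar T g"
proof -
  have "tau T (comm_bar T g) = (\<Sum>j<T. comm_value T (shift T (Suc j) g))"
    unfolding comm_bar_eq tau_sum tau_comm_value comm_value_shift_shift by simp
  also have "\<dots> = comm_bar T g" unfolding comm_bar_eq by (rule sum_rotate) (simp add: comm_value_shift_0)
  finally show ?thesis .
qed

lemma comm_bar_shift: "comm_bar T (shift T c g) = comm_bar T g"
proof (induction c)
  case 0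
  have "comm_value T (shift T j (shift T 0 g)) = comm_value T (shift T j g)" for j by (simp add: comm_value_shift_shift)
  thus ?case by (simp add: comm_bar_eq)
next
  case (Suc c)
  have "comm_bar T (shift T (Suc c) g) = (\<Sum>j<T. comm_value T (shift T (Suc j + c) g))"
    unfolding comm_bar_eq comm_value_shift_shift by simp
  also have "\<dots> = (\<Sum>j<T. comm_value T (shift T (j + c) g))"
  proof (rule sum_rotate)
    have "comm_value T (shift T (T + c) g) = comm_value T (shift T T (shift T c g))" by (simp add: comm_value_shift_shift)
    thus "comm_value T (shift T (T + c) g) = comm_value T (shift T (0 + c) g)" by (simp add: comm_value_shift_0)
  qed
  also have "\<dots> = comm_bar T (shift T c g)" unfolding comm_bar_eq comm_value_shift_shift ..
  finally show ?case using Suc by simp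
qed

lemma comm_gens_shift_leaves:
  "0 < T \<Longrightarrow> set_mset (comm_gens g) \<subseteq> leaves m T \<Longrightarrow> set_mset (comm_gens (shift T c g)) \<subseteq> leaves m T"
  by (auto simp: comm_gens_shift leaves_def)

lemma leaf_degree_shift: "leaf_degree (shift T c g) = leaf_degree g"
  by (simp add: word_degree_def comm_gens_shift image_mset.compositionality o_def case_prod_beta')

lemma comm_value_homogeneous:
  "set_mset (comm_gens M) \<subseteq> leaves m T \<Longrightarrow> comm_value T M \<in> a_homogeneous m T (leaf_degree M)"
  unfolding a_homogeneous_span by (intro free.span_base) blast

lemma comm_bar_homogeneous:
  assumes "0 < T" "set_mset (comm_gens g) \<subseteq> leaves m T"
  shows "comm_bar T g \<in> a_fixed_homogeneous m T (leaf_degree g)"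
proof -
  have "comm_value T (shift T j g) \<in> a_homogeneous m T (leaf_degree g)" for j
    using comm_value_homogeneous[OF comm_gens_shift_leaves[OF assms]] by (simp only: leaf_degree_shift)
  hence "comm_bar T g \<in> a_homogeneous m T (leaf_degree g)"
    unfolding comm_bar_eq by (intro free.subspace_sum subspace_a_homogeneous)
  thus ?thesis using tau_comm_bar a_homogeneous_algebra_a
    unfolding a_fixed_homogeneous_def a_fixed_def by blast
qed

lemma tau_homogeneous:
  assumes "0 < T" "x \<in> a_homogeneous m T d"
  shows "tau T x \<in> a_homogeneous m T d"
  using assms(2) unfolding a_homogeneous_span
proof (induction rule: free.span_induct_alt)
  case base show ?case by (simp add: tau_hom free.span_zero)
next
  case (step c x y)
  then obtain M where M: "x = comm_value T M" "set_mset (comm_gens M) \<subseteq> leaves m T" "leaf_degree M = d" by blast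
  have "tau T x \<in> a_homogeneous m T d"
    using comm_value_homogeneous[OF comm_gens_shift_leaves[OF assms(1) M(2), of 1]]
    unfolding M(1) tau_comm_value leaf_degree_shift M(3) .
  thus ?case using step.IH unfolding tau_hom a_homogeneous_span by (intro free.span_add free.span_scale)
qed

lemma multilinear_part_tau:
  assumes T: "0 < T" and x: "x \<in> algebra_a m T"
  shows "multilinear_part m T (tau T x) = tau T (multilinear_part m T x)"
proof (rule multilinear_part_eqI)
  note e = multilinear_part_exists[OF x]
  show "tau T (multilinear_part m T x) \<in> a_homogeneous m T (ones m)" using e by (intro tau_homogeneous T) blast
  have "tau T u \<in> other_degrees m T" if "u \<in> other_degrees m T" for u
    using that
  proof (induction rule: free.span_induct_alt)
    case base show ?case by (simp add: tau_hom free.span_zero)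
  next
    case (step c u y)
    hence "tau T u \<in> (\<Union>d\<in>{d. d \<noteq> ones m}. a_homogeneous m T d)" using tau_homogeneous[OF T] by blast
    thus ?case unfolding tau_hom by (intro free.span_add free.span_scale free.span_base step.IH)
  qed
  moreover have "tau T x - tau T (multilinear_part m T x) = tau T (x - multilinear_part m T x)"
    using tau_hom(1)[of T "x - multilinear_part m T x" "multilinear_part m T x"] by simp
  ultimately show "tau T x - tau T (multilinear_part m T x) \<in> other_degrees m T" using e by simp
qed

text \<open>Presents a fixed element as a multiple of a bar; bars of commutators are what the rules
  for \<psi>_p can evaluate.\<close>

lemma bar_fixed: "tau T x = x \<Longrightarrow> bar T x = free_scale (of_nat T) x"
proof -
  assume x: "tau T x = x"
  have "(tau T ^^ j) x = x" for j by (induction j) (simp_all add: x)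
  thus ?thesis by (simp add: bar_def free.sum_constant_scale)
qed

subsection \<open>The map from the Lie algebra to multilinear elements\<close>

text \<open>Words in the \<open>F_a\<close> are commutators whose generators are \<open>(a, 0)\<close>.\<close>

primrec relabel :: "(nat \<times> nat \<Rightarrow> nat) \<Rightarrow> commutator \<Rightarrow> commutator" where
  "relabel c (CGen i k) = CGen (c (i, k)) 0"
| "relabel c (CBracket g h) = CBracket (relabel c g) (relabel c h)"

text \<open>The homomorphism sends F_a to the sum of the generators f_p^(k) of colour a, hence a
  word to the sum over the words that recolour to it.\<close>

definition labellings :: "(nat \<times> nat \<Rightarrow> nat) \<Rightarrow> nat \<Rightarrow> nat \<Rightarrow> commutator \<Rightarrow> commutator set" where
  "labellings c m T M = {g. relabel c g = M \<and> set_mset (comm_gens g) \<subseteq> leaves m T}"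

lemma labellings_CGen:
  "labellings c m T (CGen a 0) = (\<lambda>(p, k). CGen p k) ` {x \<in> leaves m T. c x = a}"
proof
  show "labellings c m T (CGen a 0) \<subseteq> (\<lambda>(p, k). CGen p k) ` {x \<in> leaves m T. c x = a}"
  proof
    fix g assume "g \<in> labellings c m T (CGen a 0)"
    hence "relabel c g = CGen a 0" "set_mset (comm_gens g) \<subseteq> leaves m T" unfolding labellings_def by auto
    thus "g \<in> (\<lambda>(p, k). CGen p k) ` {x \<in> leaves m T. c x = a}" by (cases g) (auto intro!: image_eqI)
  qed
qed (auto simp: labellings_def)

lemma labellings_CBracket:
  "labellings c m T (CBracket M N) = (\<lambda>(g, h). CBracket g h) ` (labellings c m T M \<times> labellings c m T N)"
proof
  show "labellings c m T (CBracket M N) \<subseteq> (\<lambda>(g, h). CBracket g h) ` (labellings c m T M \<times> labellings c m T N)"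
  proof
    fix g assume "g \<in> labellings c m T (CBracket M N)"
    hence "relabel c g = CBracket M N" "set_mset (comm_gens g) \<subseteq> leaves m T" unfolding labellings_def by auto
    thus "g \<in> (\<lambda>(g, h). CBracket g h) ` (labellings c m T M \<times> labellings c m T N)"
      by (cases g) (auto simp: labellings_def intro!: image_eqI)
  qed
qed (auto simp: labellings_def)

lemma finite_labellings: "snd ` set_mset (comm_gens M) \<subseteq> {0} \<Longrightarrow> finite (labellings c m T M)"
proof (induction M)
  case (CGen a k)
  have "finite {x \<in> leaves m T. c x = a}" by (rule finite_subset[of _ "leaves m T"]) (auto simp: leaves_def)
  thus ?case using CGen by (simp add: labellings_CGen)
qed (simp add: labellings_CBracket image_Un)

lemma sum_labellings_CBracket:
  "(\<Sum>g\<in>labellings c m T (CBracket M N). f g) = (\<Sum>g\<in>labellings c m T M. \<Sum>h\<in>labellings c m T N. f (CBracket g h))"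
  unfolding labellings_CBracket sum.cartesian_product
  by (subst sum.reindex) (auto simp: inj_on_def case_prod_beta)

section \<open>The homomorphism on words, and its compatibility with \<sigma>\<close>

context diagram_automorphism
begin

text \<open>The index a for which f_p^(k) occurs in the image of F_a.\<close>

definition color :: "(nat \<Rightarrow> nat) \<Rightarrow> nat \<times> nat \<Rightarrow> nat" where
  "color l x = letter (block l (fst x), snd x)"

lemma position_less:
  assumes "1 \<le> i" "i < i'" "n \<in> {1..l i}" "n' \<in> {1..l i'}"
  shows "position l i n < position l i' n'"
proof -
  have "(\<Sum>j=1..<i. l j) + l i = (\<Sum>j=1..<Suc i. l j)" using assms(1) by simp
  moreover have "(\<Sum>j=1..<Suc i. l j) \<le> (\<Sum>j=1..<i'. l j)" using assms(2) by (intro sum_mono2) auto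
  ultimately show ?thesis using assms(3,4) unfolding position_def by simp
qed

lemma position_inject:
  assumes "i \<in> {1..r}" "i' \<in> {1..r}" "n \<in> {1..l i}" "n' \<in> {1..l i'}" "position l i n = position l i' n'"
  shows "i = i' \<and> n = n'"
proof -
  have "\<not> i < i'" using position_less[of i i' n l n'] assms by auto
  moreover have "\<not> i' < i" using position_less[of i' i n' l n] assms by auto
  ultimately have "i = i'" by simp
  thus ?thesis using assms(5) by (simp add: position_def)
qed

lemma iota_mem: "i \<in> {1..r} \<Longrightarrow> \<iota> i \<in> {1..R}"
  using iota_range by blast

lemma block_position: "i \<in> {1..r} \<Longrightarrow> n \<in> {1..l i} \<Longrightarrow> block l (position l i n) = i"
  unfolding block_def by (rule the_equality) (use position_inject in blast)+

lemma position_mem: "i \<in> {1..r} \<Longrightarrow> n \<in> {1..l i} \<Longrightarrow> position l i n \<in> {1..weight_sum l}"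
proof -
  assume i: "i \<in> {1..r}" and n: "n \<in> {1..l i}"
  have "(\<Sum>j=1..<i. l j) + l i = (\<Sum>j=1..<Suc i. l j)" using i by simp
  also have "\<dots> \<le> weight_sum l" unfolding weight_sum_def using i by (intro sum_mono2) auto
  finally show ?thesis using n by (simp add: position_def)
qed

lemma position_surj: "p \<in> {1..weight_sum l} \<Longrightarrow> \<exists>i\<in>{1..r}. \<exists>n\<in>{1..l i}. p = position l i n"
proof -
  have "p \<in> {1..(\<Sum>j=1..s. l j)} \<Longrightarrow> \<exists>i\<in>{1..s}. \<exists>n\<in>{1..l i}. p = position l i n" for s
  proof (induction s)
    case (Suc s)
    show ?case
    proof (cases "p \<le> (\<Sum>j=1..s. l j)")
      case True
      hence "\<exists>i\<in>{1..s}. \<exists>n\<in>{1..l i}. p = position l i n" using Suc by simp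
      moreover have "{1..s} \<subseteq> {1..Suc s}" by auto
      ultimately show ?thesis by blast
    next
      case False
      have "p = position l (Suc s) (p - (\<Sum>j=1..s. l j))"
        using False by (simp add: position_def atLeastLessThanSuc_atLeastAtMost)
      moreover have "p - (\<Sum>j=1..s. l j) \<in> {1..l (Suc s)}" using False Suc.prems by auto
      ultimately show ?thesis by (intro bexI[of _ "Suc s"] bexI) auto
    qed
  qed simp
  thus "p \<in> {1..weight_sum l} \<Longrightarrow> \<exists>i\<in>{1..r}. \<exists>n\<in>{1..l i}. p = position l i n" unfolding weight_sum_def .
qed

lemma block_mem: "p \<in> {1..weight_sum l} \<Longrightarrow> block l p \<in> {1..r}"
proof -
  assume "p \<in> {1..weight_sum l}"
  then obtain i n where "i \<in> {1..r}" "n \<in> {1..l i}" "p = position l i n" using position_surj by blast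
  thus ?thesis by (simp only: block_position)
qed

lemma color_mem: "x \<in> leaves (weight_sum l) T \<Longrightarrow> color l x \<in> {1..R}"
  unfolding color_def by (rule letter_mem) (use block_mem in \<open>auto simp: leaves_def labels_def simp del: atLeastAtMost_iff\<close>)

lemma cycle_facts:
  shows "0 < cycle_length i" "(\<pi> ^^ cycle_length i) (\<iota> i) = \<iota> i"
    "inj_on (\<lambda>n. (\<pi> ^^ n) (\<iota> i)) {0..<cycle_length i}"
    "orbit \<pi> (\<iota> i) = (\<lambda>n. (\<pi> ^^ n) (\<iota> i)) ` {0..<cycle_length i}"
proof -
  have self: "\<iota> i \<in> orbit \<pi> (\<iota> i)" by (rule permutation_self_in_orbit[OF permutation_pi])
  let ?d = "funpow_dist1 \<pi> (\<iota> i) (\<iota> i)"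
  have "cycle_length i = card ((\<lambda>n. (\<pi> ^^ n) (\<iota> i)) ` {0..<?d})"
    unfolding cycle_length_def by (subst orbit_conv_funpow_dist1[OF self]) (rule HOL.refl)
  also have "\<dots> = ?d" by (subst card_image[OF inj_on_funpow_dist1[OF self]]) simp
  finally have d: "cycle_length i = ?d" .
  show "0 < cycle_length i" unfolding d by simp
  show "(\<pi> ^^ cycle_length i) (\<iota> i) = \<iota> i" unfolding d by (rule funpow_dist1_prop[OF self])
  show "inj_on (\<lambda>n. (\<pi> ^^ n) (\<iota> i)) {0..<cycle_length i}" unfolding d by (rule inj_on_funpow_dist1[OF self])
  show "orbit \<pi> (\<iota> i) = (\<lambda>n. (\<pi> ^^ n) (\<iota> i)) ` {0..<cycle_length i}"
    unfolding d by (rule orbit_conv_funpow_dist1[OF self])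
qed

lemma pow_iota_eq_iff: "(\<pi> ^^ a) (\<iota> i) = (\<pi> ^^ b) (\<iota> i) \<longleftrightarrow> a mod cycle_length i = b mod cycle_length i"
proof -
  have m: "(\<pi> ^^ a) (\<iota> i) = (\<pi> ^^ (a mod cycle_length i)) (\<iota> i)" for a
    by (rule funpow_mod_eq[OF cycle_facts(2), symmetric])
  have lt: "a mod cycle_length i \<in> {0..<cycle_length i}" for a using cycle_facts(1)[of i] by simp
  show ?thesis unfolding m[of a] m[of b] using inj_on_eq_iff[OF cycle_facts(3) lt lt] .
qed

lemma cycle_length_dvd: "i \<in> {1..r} \<Longrightarrow> cycle_length i dvd T"
proof -
  assume "i \<in> {1..r}"
  hence "(\<pi> ^^ T) (\<iota> i) = (\<pi> ^^ 0) (\<iota> i)" using pi_pow_T[OF iota_mem] by simp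
  hence "T mod cycle_length i = 0" unfolding pow_iota_eq_iff by simp
  thus ?thesis by (simp add: dvd_eq_mod_eq_0)
qed

text \<open>The prescribed double sum runs once over the leaves of colour a: q enumerates the
  exponents congruent to k modulo the cycle length, and n the positions in the block.\<close>

lemma jmath_letter:
  assumes j: "jmath_hom l j" and a: "a \<in> {1..R}"
  shows "j (F a) = (\<Sum>g\<in>labellings (color l) (weight_sum l) T (CGen a 0). comm_value T g)"
proof -
  let ?m = "weight_sum l"
  obtain x where x: "x \<in> labels" "letter x = a" using letter_surj[OF a] by blast
  define i where "i = fst x"
  define d where "d = cycle_length i"
  \<comment> \<open>The homomorphism is prescribed for exponents below the cycle length, so the
    label is reduced first.\<close>
  define k where "k = snd x mod d"
  have i: "i \<in> {1..r}" using x(1) by (auto simp: i_def labels_def)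
  have d0: "0 < d" and dT: "d dvd T" unfolding d_def using cycle_facts(1) cycle_length_dvd[OF i] by auto
  have kd: "k < d" unfolding k_def using d0 by simp
  have ak: "a = (\<pi> ^^ k) (\<iota> i)"
    unfolding x(2)[symmetric] letter_def i_def[symmetric] k_def d_def pow_iota_eq_iff by simp
  have Td: "T div d * d = T" using dT by simp
  have "F a = (\<sigma> ^^ k) (F (\<iota> i))"
    unfolding ak by (rule sigma_pow_F[OF iota_mem[OF i], symmetric])
  hence "j (F a) = (\<Sum>q<T div d. \<Sum>n=1..l i. f_gen T (position l i n) (k + d * q))"
    using j i kd unfolding jmath_hom_def d_def by simp
  also have "\<dots> = (\<Sum>(q, n)\<in>{..<T div d} \<times> {1..l i}. f_gen T (position l i n) (k + d * q))"
    by (rule sum.cartesian_product)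
  also have "\<dots> = (\<Sum>(p, k')\<in>{x \<in> leaves ?m T. color l x = a}. f_gen T p k')"
  proof -
    have "bij_betw (\<lambda>(q, n). (position l i n, k + d * q)) ({..<T div d} \<times> {1..l i}) {x \<in> leaves ?m T. color l x = a}"
      unfolding bij_betw_def
    proof
      show "inj_on (\<lambda>(q, n). (position l i n, k + d * q)) ({..<T div d} \<times> {1..l i})"
        using d0 by (auto simp: inj_on_def position_def)
      show "(\<lambda>(q, n). (position l i n, k + d * q)) ` ({..<T div d} \<times> {1..l i}) = {x \<in> leaves ?m T. color l x = a}"
      proof (intro equalityI subsetI)
        fix y assume "y \<in> (\<lambda>(q, n). (position l i n, k + d * q)) ` ({..<T div d} \<times> {1..l i})"
        then obtain q n where q: "q < T div d" "n \<in> {1..l i}" "y = (position l i n, k + d * q)" by auto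
        have "k + d * q < d * Suc q" using kd by simp
        also have "\<dots> \<le> d * (T div d)" using q(1) by (intro mult_le_mono2) simp
        finally have "k + d * q < T" using Td by (simp add: mult.commute)
        moreover have "color l y = a"
          unfolding q(3) color_def fst_conv snd_conv block_position[of i n l, OF i q(2)] letter_def ak
          by (simp only: pow_iota_eq_iff fst_conv snd_conv) (simp add: d_def)
        ultimately show "y \<in> {x \<in> leaves ?m T. color l x = a}"
          using position_mem[of i n l, OF i q(2)] q(3) by (simp add: leaves_def)
      next
        fix y assume "y \<in> {x \<in> leaves ?m T. color l x = a}"
        then obtain p k' where y: "y = (p, k')" "p \<in> {1..?m}" "k' < T" "color l (p, k') = a" by (auto simp: leaves_def)
        obtain i' n where n: "i' \<in> {1..r}" "n \<in> {1..l i'}" "p = position l i' n" using position_surj[OF y(2)] by blast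
        have b: "block l p = i'" unfolding n(3) by (rule block_position[of i' n l, OF n(1,2)])
        have "letter (i', k') = letter x" using y(4) x(2) b by (simp add: color_def)
        hence ii: "i' = i" using letter_fst[of "(i', k')" x] n(1) x(1) by (simp add: i_def labels_def)
        have "(\<pi> ^^ k') (\<iota> i) = (\<pi> ^^ k) (\<iota> i)"
          using y(4) b ii ak by (simp add: color_def letter_def)
        hence "k' mod d = k" unfolding pow_iota_eq_iff d_def[symmetric] using kd by simp
        hence k': "k' = k + d * (k' div d)" using mod_mult_div_eq[of k' d] by simp
        have "k' div d < T div d" using y(3) Td d0 by (metis less_mult_imp_div_less)
        thus "y \<in> (\<lambda>(q, n). (position l i n, k + d * q)) ` ({..<T div d} \<times> {1..l i})"
          using k' n y(1) ii by (intro image_eqI[of _ _ "(k' div d, n)"]) auto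
      qed
    qed
    from sum.reindex_bij_betw[OF this, of "\<lambda>(p, k'). f_gen T p k'"] show ?thesis by (simp add: case_prod_beta')
  qed
  also have "\<dots> = (\<Sum>g\<in>labellings (color l) ?m T (CGen a 0). comm_value T g)"
    unfolding labellings_CGen by (subst sum.reindex) (auto simp: inj_on_def case_prod_beta)
  finally show ?thesis .
qed

definition letter_word :: "commutator \<Rightarrow> bool" where
  "letter_word M \<longleftrightarrow> set_mset (comm_gens M) \<subseteq> {1..R} \<times> {0}"

abbreviation plain_word :: "commutator \<Rightarrow> 'g" where
  "plain_word \<equiv> g.word_value (\<lambda>i k. F i)"

lemma plain_word_n_minus: "letter_word M \<Longrightarrow> plain_word M \<in> n_minus"
  unfolding n_minus_words letter_word_def by (intro g.span_base) (auto simp: g.words_def)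

lemma free_bracket_sum:
  "free_bracket (\<Sum>g\<in>A. f g) (\<Sum>h\<in>A'. f' h) = (\<Sum>g\<in>A. \<Sum>h\<in>A'. free_bracket (f g) (f' h))"
proof -
  have 1: "free_bracket x (\<Sum>h\<in>A'. f' h) = (\<Sum>h\<in>A'. free_bracket x (f' h))" for x
    by (induction A' rule: infinite_finite_induct) (auto simp: free.bracket_zero free.bracket_add_right)
  show ?thesis
    by (induction A rule: infinite_finite_induct) (auto simp: free.bracket_zero free.bracket_add_left 1 sum.distrib)
qed

lemma jmath_word:
  assumes j: "jmath_hom l j"
  shows "letter_word M \<Longrightarrow> j (plain_word M) = (\<Sum>g\<in>labellings (color l) (weight_sum l) T M. comm_value T g)"
proof (induction M)
  case (CGen a k)
  hence "a \<in> {1..R}" "k = 0" by (auto simp: letter_word_def)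
  thus ?case using jmath_letter[OF j] by simp
next
  case (CBracket M N)
  have l: "letter_word M" "letter_word N" using CBracket.prems by (auto simp: letter_word_def)
  have "j (plain_word (CBracket M N)) = free_bracket (j (plain_word M)) (j (plain_word N))"
    using j plain_word_n_minus[OF l(1)] plain_word_n_minus[OF l(2)] unfolding jmath_hom_def by simp
  also have "\<dots> = (\<Sum>g\<in>labellings (color l) (weight_sum l) T (CBracket M N). comm_value T g)"
    unfolding CBracket.IH(1)[OF l(1)] CBracket.IH(2)[OF l(2)] sum_labellings_CBracket free_bracket_sum by simp
  finally show ?case .
qed

lemma n_minus_induct [consumes 1, case_names zero add]:
  assumes "x \<in> n_minus" "P 0"
    "\<And>c M y. letter_word M \<Longrightarrow> y \<in> n_minus \<Longrightarrow> P y \<Longrightarrow> P (sg c (plain_word M) + y)"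
  shows "P x"
proof -
  have "x \<in> g.span (g.words (\<lambda>i k. F i) ({1..R} \<times> {0}))" using assms(1) n_minus_words by simp
  hence "x \<in> n_minus \<and> P x"
  proof (induction rule: g.span_induct_alt)
    case base show ?case using assms(2) g.subspace_0[OF n_facts(1)] by blast
  next
    case (step c u y)
    then obtain M where M: "u = plain_word M" "letter_word M" unfolding g.words_def letter_word_def by blast
    show ?case using step.IH assms(3)[OF M(2), of y c] plain_word_n_minus[OF M(2)] unfolding M(1)
      by (auto intro: g.subspace_add[OF n_facts(1)] g.subspace_scale[OF n_facts(1)])
  qed
  thus ?thesis by blast
qed

lemma jmath_facts:
  assumes j: "jmath_hom l j"
  shows "x \<in> n_minus \<Longrightarrow> y \<in> n_minus \<Longrightarrow> j (x + y) = j x + j y"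
    "x \<in> n_minus \<Longrightarrow> j (sg c x) = free_scale c (j x)" "j 0 = 0"
proof -
  show "x \<in> n_minus \<Longrightarrow> y \<in> n_minus \<Longrightarrow> j (x + y) = j x + j y"
    "x \<in> n_minus \<Longrightarrow> j (sg c x) = free_scale c (j x)" using j unfolding jmath_hom_def by blast+
  have "0 \<in> n_minus" by (rule g.subspace_0[OF n_facts(1)])
  hence "j (0 + 0) = j 0 + j 0" using j unfolding jmath_hom_def by blast
  thus "j 0 = 0" by simp
qed

lemma labellings_leaves: "M' \<in> labellings c m T M \<Longrightarrow> set_mset (comm_gens M') \<subseteq> leaves m T"
  by (simp add: labellings_def)

lemma jmath_algebra_a: "jmath_hom l j \<Longrightarrow> x \<in> n_minus \<Longrightarrow> j x \<in> algebra_a (weight_sum l) T"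
proof -
  assume j: "jmath_hom l j" and x: "x \<in> n_minus"
  have sub: "free.subspace (algebra_a (weight_sum l) T)" unfolding algebra_a_span by (rule free.subspace_span)
  show ?thesis
    using x
  proof (induction rule: n_minus_induct)
    case zero show ?case unfolding jmath_facts(3)[OF j] by (rule free.subspace_0[OF sub])
  next
    case (add c M y)
    note w = plain_word_n_minus[OF add(1)]
    show ?case
      unfolding jmath_facts(1)[OF j g.subspace_scale[OF n_facts(1) w] add(2)] jmath_facts(2)[OF j w] jmath_word[OF j add(1)]
      by (intro free.subspace_add[OF sub] free.subspace_scale[OF sub] free.subspace_sum[OF sub]
          comm_value_algebra_a add(3)) (rule labellings_leaves)
  qed
qed

lemma s_map_facts:
  assumes j: "jmath_hom l j" and x: "x \<in> n_minus"
  shows "y \<in> n_minus \<Longrightarrow> s_map l j (x + y) = s_map l j x + s_map l j y"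
    "s_map l j (sg c x) = free_scale c (s_map l j x)" "s_map l j 0 = 0"
    "s_map l j x \<in> a_homogeneous (weight_sum l) T (ones (weight_sum l))"
  unfolding s_map_def using jmath_algebra_a[OF j] x
  by (simp_all add: jmath_facts[OF j] multilinear_part_add multilinear_part_scale multilinear_part_zero multilinear_part_exists)

lemma s_map_word:
  assumes j: "jmath_hom l j" and M: "letter_word M"
  shows "s_map l j (plain_word M) =
    (\<Sum>g\<in>{g \<in> labellings (color l) (weight_sum l) T M. leaf_degree g = ones (weight_sum l)}. comm_value T g)"
  unfolding s_map_def jmath_word[OF j M]
  by (rule multilinear_part_sum) (use M in \<open>auto intro!: finite_labellings simp: letter_word_def dest!: labellings_leaves\<close>)

lemma color_shift:
  assumes l: "(p, k) \<in> leaves (weight_sum l) T"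
  shows "color l (p, (k + 1) mod T) = \<pi> (color l (p, k))"
proof -
  let ?i = "\<iota> (block l p)"
  have i: "?i \<in> {1..R}" using l by (intro iota_mem block_mem) (simp add: leaves_def)
  have "(\<pi> ^^ ((k + 1) mod T)) ?i = (\<pi> ^^ (k + 1)) ?i" by (rule funpow_mod_eq[OF pi_pow_T[OF i]])
  thus ?thesis by (simp add: color_def letter_def)
qed

text \<open>Rotating a leaf by one step applies \<pi> to its colour, so the leaves of colour a are
  carried bijectively to those of colour \<pi> a. This settles generators, and brackets and sums
  follow.\<close>

lemma jmath_sigma:
  assumes j: "jmath_hom l j" and x: "x \<in> n_minus"
  shows "\<sigma> x \<in> n_minus \<and> j (\<sigma> x) = tau T (j x)"
proof -
  have letter: "j (F (\<pi> a)) = tau T (j (F a))" if a: "a \<in> {1..R}" for a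
  proof -
    let ?S = "\<lambda>a. {x \<in> leaves (weight_sum l) T. color l x = a}"
    have e: "j (F a) = (\<Sum>(p, k)\<in>?S a. f_gen T p k)" if "a \<in> {1..R}" for a
      unfolding jmath_letter[OF j that] labellings_CGen by (subst sum.reindex) (auto simp: inj_on_def case_prod_beta)
    have tj: "tau T (j (F a)) = (\<Sum>x\<in>?S a. f_gen T (fst x) ((snd x + 1) mod T))"
      unfolding e[OF a] tau_sum using tau_comm_value[of T "CGen _ _"]
      by (intro sum.cong HOL.refl) (simp add: case_prod_beta f_gen_def)
    have pa: "\<pi> a \<in> {1..R}" using pi_mem[OF a, of 1] by simp
    have "(\<Sum>x\<in>?S a. f_gen T (fst x) ((snd x + 1) mod T)) = (\<Sum>x\<in>?S (\<pi> a). f_gen T (fst x) (snd x))"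
    proof -
      have fin: "finite (leaves (weight_sum l) T)" by (simp add: leaves_def)
      have inj: "inj_on (\<lambda>x. (fst x, (snd x + 1) mod T)) (leaves (weight_sum l) T)"
      proof (rule inj_onI)
        fix x y assume "x \<in> leaves (weight_sum l) T" "y \<in> leaves (weight_sum l) T"
          and "(fst x, (snd x + 1) mod T) = (fst y, (snd y + 1) mod T)"
        hence "fst x = fst y" "snd x < T" "snd y < T" "(1 + snd x) mod T = (1 + snd y) mod T"
          by (auto simp: leaves_def)
        thus "x = y" using gain_unique[of "snd x" T "snd y" 1] by (simp add: prod_eq_iff)
      qed
      have "(\<lambda>x. (fst x, (snd x + 1) mod T)) ` leaves (weight_sum l) T \<subseteq> leaves (weight_sum l) T"
        using T_pos by (auto simp: leaves_def)
      hence surj: "(\<lambda>x. (fst x, (snd x + 1) mod T)) ` leaves (weight_sum l) T = leaves (weight_sum l) T"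
        by (rule endo_inj_surj[OF fin _ inj])
      have pi: "color l (fst x, (snd x + 1) mod T) = \<pi> a \<longleftrightarrow> color l x = a" if "x \<in> leaves (weight_sum l) T" for x
        using color_shift[of "fst x" "snd x" l] that permutes_inj[OF pi_permutes] by (auto dest: injD)
      have "bij_betw (\<lambda>x. (fst x, (snd x + 1) mod T)) (?S a) (?S (\<pi> a))"
        unfolding bij_betw_def
      proof
        show "inj_on (\<lambda>x. (fst x, (snd x + 1) mod T)) (?S a)" by (rule inj_on_subset[OF inj]) blast
        show "(\<lambda>x. (fst x, (snd x + 1) mod T)) ` ?S a = ?S (\<pi> a)"
        proof (intro equalityI subsetI)
          fix y assume "y \<in> (\<lambda>x. (fst x, (snd x + 1) mod T)) ` ?S a"
          then obtain x where "x \<in> leaves (weight_sum l) T" "color l x = a" "y = (fst x, (snd x + 1) mod T)" by blast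
          thus "y \<in> ?S (\<pi> a)" using surj pi by blast
        next
          fix y assume y: "y \<in> ?S (\<pi> a)"
          then obtain x where x: "x \<in> leaves (weight_sum l) T" "y = (fst x, (snd x + 1) mod T)" using surj by blast
          hence "color l x = a" using pi[OF x(1)] y by blast
          thus "y \<in> (\<lambda>x. (fst x, (snd x + 1) mod T)) ` ?S a" using x by blast
        qed
      qed
      from sum.reindex_bij_betw[OF this, of "\<lambda>x. f_gen T (fst x) (snd x)"] show ?thesis by simp
    qed
    also have "\<dots> = j (F (\<pi> a))" unfolding e[OF pa]
      by (simp add: case_prod_beta)
    finally show ?thesis using tj by simp
  qed
  have word: "\<sigma> (plain_word M) \<in> n_minus \<and> j (\<sigma> (plain_word M)) = tau T (j (plain_word M))" if "letter_word M" for M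
    using that
  proof (induction M)
    case (CGen a k)
    hence a: "a \<in> {1..R}" by (auto simp: letter_word_def)
    have "F (\<pi> a) \<in> n_minus" using pi_mem[OF a, of 1] by (intro F_n_minus) simp
    thus ?case using letter[OF a] by (simp add: sigma_F[OF a])
  next
    case (CBracket M N)
    have l: "letter_word M" "letter_word N" using CBracket.prems by (auto simp: letter_word_def)
    note w = plain_word_n_minus[OF l(1)] plain_word_n_minus[OF l(2)]
    have jb: "j (br u v) = free_bracket (j u) (j v)" if "u \<in> n_minus" "v \<in> n_minus" for u v
      using j that unfolding jmath_hom_def by blast
    show ?case using CBracket.IH(1)[OF l(1)] CBracket.IH(2)[OF l(2)] n_facts(3)
      by (simp add: sigma_bracket jb w tau_def free_map_hom)
  qed
  show ?thesis
    using x
  proof (induction rule: n_minus_induct)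
    case zero show ?case by (simp add: sigma_zero jmath_facts(3)[OF j] tau_hom g.subspace_0[OF n_facts(1)])
  next
    case (add c M y)
    note w = plain_word_n_minus[OF add(1)]
    have sw: "sg c (plain_word M) \<in> n_minus" "sg c (\<sigma> (plain_word M)) \<in> n_minus"
      using w word[OF add(1)] by (auto intro: g.subspace_scale[OF n_facts(1)])
    show ?case using add(3) word[OF add(1)] sw
      by (simp add: sigma_facts jmath_facts(1,2)[OF j] w add(2) tau_hom g.subspace_add[OF n_facts(1)])
  qed
qed

theorem s_map_fixed:
  assumes j: "jmath_hom l j" and x: "x \<in> n_minus" "\<sigma> x = x"
  shows "tau T (s_map l j x) = s_map l j x"
  unfolding s_map_def using multilinear_part_tau[OF T_pos jmath_algebra_a[OF j x(1)]] jmath_sigma[OF j x(1)] x(2) by simp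

end

subsection \<open>Dimension count and edges of the arrangement\<close>

lemma dim_inter_hyp_strict:
  assumes L: "pt.subspace L" "L \<subseteq> Cspace m" and v: "v \<in> L" "v \<notin> hyp_set m \<omega> H"
  shows "pt.dim L = pt.dim (L \<inter> hyp_set m \<omega> H) + 1"
proof -
  let ?L = "L \<inter> hyp_set m \<omega> H"
  obtain B where B: "B \<subseteq> ?L" "pt.independent B" "?L \<subseteq> pt.span B" "card B = pt.dim ?L" using pt.basis_exists by blast
  obtain C where C: "C \<subseteq> L" "pt.independent C" "L \<subseteq> pt.span C" "card C = pt.dim L" using pt.basis_exists by blast
  have fin: "finite B" "finite C" using finite_independent[of B m] finite_independent[of C m] B(1,2) C(1,2) L(2) by blast+
  have "pt.span B \<subseteq> hyp_set m \<omega> H" using B(1) by (intro pt.span_minimal subspace_hyp_set) blast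
  hence nv: "v \<notin> pt.span B" using v(2) by blast
  hence "pt.independent (insert v B)" using B(2) by (simp add: pt.independent_insert)
  moreover have "insert v B \<subseteq> pt.span C" using v(1) B(1) C(3) by blast
  ultimately have "card (insert v B) \<le> card C" using pt.independent_span_bound[OF fin(2)] by blast
  moreover have "v \<notin> B" using nv pt.span_base by blast
  ultimately have "pt.dim ?L + 1 \<le> pt.dim L" using fin(1) B(4) C(4) by simp
  thus ?thesis using dim_inter_hyp[OF L, of \<omega> H] by simp
qed

lemma dim_Cspace: "pt.dim (Cspace m) = m"
proof (induction m)
  case 0
  have "Cspace 0 = {0}" by (auto simp: Cspace_def fun_eq_iff)
  thus ?case using pt.dim_le_card[of "{0}" "{}"] by simp
next
  case (Suc m)
  define v :: pt where "v = (\<lambda>i. if i = Suc m then 1 else 0)"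
  have v: "v \<in> Cspace (Suc m)" "v \<notin> hyp_set (Suc m) 1 (HZero (Suc m))" by (auto simp: v_def Cspace_def)
  have "Cspace (Suc m) \<inter> hyp_set (Suc m) 1 (HZero (Suc m)) = Cspace m"
  proof (intro equalityI subsetI)
    fix t assume "t \<in> Cspace (Suc m) \<inter> hyp_set (Suc m) 1 (HZero (Suc m))"
    thus "t \<in> Cspace m" unfolding Cspace_def by (auto simp: le_Suc_eq)
  qed (auto simp: Cspace_def)
  thus ?case using dim_inter_hyp_strict[OF subspace_Cspace order_refl v] Suc by simp
qed

lemma Cspace_edge: "Cspace m \<in> edges m T \<omega>"
proof -
  have "(0 :: pt) \<in> Cspace m" by (simp add: Cspace_def)
  thus ?thesis unfolding edges_def by (auto intro!: exI[of _ "{}"])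
qed

lemma finite_hyps: "finite (hyps m T)"
proof -
  have "hyps m T \<subseteq> (\<lambda>(i, j, k). HEq i j k) ` ({..m} \<times> {..m} \<times> {..<T}) \<union> HZero ` {1..m}"
  proof
    fix H assume "H \<in> hyps m T"
    thus "H \<in> (\<lambda>(i, j, k). HEq i j k) ` ({..m} \<times> {..m} \<times> {..<T}) \<union> HZero ` {1..m}"
    proof (cases H)
      case (HEq i j k)
      hence "(i, j, k) \<in> {..m} \<times> {..m} \<times> {..<T}" using \<open>H \<in> hyps m T\<close> by (auto simp: hyps_def)
      thus ?thesis using HEq by (intro UnI1 image_eqI[of _ _ "(i, j, k)"]) auto
    qed (auto simp: hyps_def)
  qed
  thus ?thesis by (rule finite_subset) auto
qed

lemma edge_hyps:
  "0 < T \<Longrightarrow> x \<in> leaves m T \<Longrightarrow> y \<in> leaves m T \<Longrightarrow> fst x \<noteq> fst y \<Longrightarrow> edge T x y \<in> hyps m T"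
  unfolding edge_def hyps_def leaves_def by (auto simp: gain_less)

definition total_gens :: "commutator list \<Rightarrow> (nat \<times> nat) multiset" where
  "total_gens gs = (\<Sum>g\<leftarrow>gs. comm_gens g)"

lemma total_degree_ones_iff: "total_degree_ones m T gs \<longleftrightarrow>
    image_mset fst (total_gens gs) = mset_set {1..m} \<and> set_mset (total_gens gs) \<subseteq> leaves m T"
proof
  assume *: "total_degree_ones m T gs"
  hence fst: "image_mset fst (total_gens gs) = mset_set {1..m}" unfolding total_degree_ones_def total_gens_def by blast
  have "x \<in> leaves m T" if x: "x \<in># total_gens gs" for x
  proof -
    have "fst x \<in># image_mset fst (total_gens gs)" using x by simp
    hence "fst x \<in> {1..m}" unfolding fst by simp
    moreover have "\<forall>(i, k)\<in>#total_gens gs. k < T" using * unfolding total_degree_ones_def total_gens_def by blast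
    hence "snd x < T" using x by (auto simp: case_prod_beta' simp del: set_mset_sum_list)
    ultimately show ?thesis by (cases x) (simp add: leaves_def)
  qed
  thus "image_mset fst (total_gens gs) = mset_set {1..m} \<and> set_mset (total_gens gs) \<subseteq> leaves m T" using fst by blast
next
  assume "image_mset fst (total_gens gs) = mset_set {1..m} \<and> set_mset (total_gens gs) \<subseteq> leaves m T"
  thus "total_degree_ones m T gs" unfolding total_degree_ones_def total_gens_def leaves_def by auto
qed

lemma total_gens_simps [simp]: "total_gens [] = {#}" "total_gens (g # gs) = comm_gens g + total_gens gs"
    "total_gens (gs @ hs) = total_gens gs + total_gens hs"
  by (simp_all add: total_gens_def)

lemma total_gens_mem: "g \<in> set gs \<Longrightarrow> set_mset (comm_gens g) \<subseteq> set_mset (total_gens gs)"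
  by (induction gs) auto

lemma total_degree_ones_cong: "total_gens gs = total_gens hs \<Longrightarrow> total_degree_ones m T gs = total_degree_ones m T hs"
  unfolding total_degree_ones_iff by simp

lemma total_leaf_degree: "total_degree_ones m T gs \<Longrightarrow> sum_list (map leaf_degree gs) = ones m"
proof -
  assume "total_degree_ones m T gs"
  hence fst: "image_mset fst (total_gens gs) = mset_set {1..m}" unfolding total_degree_ones_iff by blast
  have "sum_list (map leaf_degree gs) = (\<Sum>i\<in>#image_mset fst (total_gens gs). unit_degree i)"
    by (induction gs) (simp_all add: word_degree_def image_mset.compositionality o_def case_prod_beta')
  also have "\<dots> = (\<Sum>i\<in>{1..m}. unit_degree i)" unfolding fst by (simp add: sum_unfold_sum_mset)
  also have "\<dots> = ones m"
  proof
    fix j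
    have "(\<Sum>i\<in>I. unit_degree i) j = (\<Sum>i\<in>I. if i = j then 1 else 0)" for I
      by (induction I rule: infinite_finite_induct) (auto simp: unit_degree_def)
    thus "(\<Sum>i\<in>{1..m}. unit_degree i) j = ones m j" by (simp add: ones_def sum.delta)
  qed
  finally show ?thesis .
qed

text \<open>Generating function of the forests with one spanning tree on each commutator; a wedge of
  p commutators corresponds to p components.\<close>

primrec forest_coeff :: "nat \<Rightarrow> commutator list \<Rightarrow> hyp set \<Rightarrow> complex" where
  "forest_coeff T [] = (\<lambda>A. if A = {} then 1 else 0)"
| "forest_coeff T (g # gs) = conv (tree_coeff T g) (forest_coeff T gs)"

lemma conv_one: "finite A \<Longrightarrow> conv p (\<lambda>A. if A = {} then 1 else 0) A = p A"
proof -
  assume A: "finite A"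
  have "conv p (\<lambda>A. if A = {} then 1 else 0) A = (\<Sum>B\<in>Pow A. if B = A then p A else 0)"
    unfolding conv_def by (intro sum.cong) auto
  thus ?thesis using A by (simp add: sum.delta)
qed

lemma forest_coeff_move: "forest_coeff T (us @ g # vs) = conv (tree_coeff T g) (forest_coeff T (us @ vs))"
  by (induction us) (simp_all add: conv_left_commute)

lemma forest_coeff_swap: "forest_coeff T (us @ x # y # vs) = forest_coeff T (us @ y # x # vs)"
  using forest_coeff_move[of T us x "y # vs"] forest_coeff_move[of T us y vs]
    forest_coeff_move[of T us y "x # vs"] forest_coeff_move[of T us x vs] by (simp add: conv_left_commute)

lemma forest_coeff_bracket:
  "forest_coeff T (gs @ [CBracket g1 g2]) = conv (link T g1 g2) (forest_coeff T (gs @ [g2, g1]))"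
proof -
  have "forest_coeff T (gs @ [CBracket g1 g2]) = conv (tree_coeff T (CBracket g1 g2)) (forest_coeff T gs)"
    using forest_coeff_move[of T gs "CBracket g1 g2" "[]"] by simp
  moreover have "forest_coeff T (gs @ [g2, g1]) = conv (tree_coeff T g2) (conv (tree_coeff T g1) (forest_coeff T gs))"
    using forest_coeff_move[of T gs g2 "[g1]"] forest_coeff_move[of T gs g1 "[]"] by simp
  ultimately show ?thesis by (simp add: conv_ac)
qed

lemma forest_coeff_component:
  assumes "forest_coeff T (us @ g # vs) A \<noteq> 0"
  obtains B where "B \<subseteq> A" "tree_coeff T g B \<noteq> 0"
  using conv_nonzeroD[of "tree_coeff T g" "forest_coeff T (us @ vs)" A] assms unfolding forest_coeff_move by blast

subsection \<open>Incidence vectors\<close>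

definition unit :: "nat \<Rightarrow> nat \<Rightarrow> complex" where
  "unit i = (\<lambda>j. if j = i then 1 else 0)"

text \<open>A row of the oriented incidence matrix. The gain is forgotten: signs are a matter of the
  underlying graph.\<close>

primrec incidence :: "hyp \<Rightarrow> nat \<Rightarrow> complex" where
  "incidence (HEq i j k) = (\<lambda>x. unit i x - unit j x)"
| "incidence (HZero i) = (\<lambda>x. 0)"

text \<open>A determinant with one row \<open>unit i\<close> is a potential in i, and an incidence
  row evaluates its coboundary. This brings determinants within reach of
  \<open>tree_coeff_connected\<close>.\<close>

lemma vol_incidence:
  assumes "length us < n"
  shows "vol n (us @ incidence e # ws) = edge_diff (\<lambda>i. vol n (us @ unit i # ws)) e"
proof (cases e)
  case (HEq i j k)
  thus ?thesis using vol_linear[OF assms, of 1 "unit i" "-1" "unit j" ws] by simp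
next
  case (HZero i)
  thus ?thesis using vol_linear[OF assms, of 0 "unit i" 0 "unit i" ws] by simp
qed

text \<open>Modulo the incidence vectors of a tree all its vertices have the same unit vector:
  repeating a row gives zero, so the coboundary vanishes along the tree.\<close>

lemma vol_move_unit:
  assumes tree: "tree_coeff T g B \<noteq> 0" and B: "incidence ` B \<subseteq> set us" and n: "length us + length ws + 1 = n"
    and x: "x \<in> fst ` set_mset (comm_gens g)" and y: "y \<in> fst ` set_mset (comm_gens g)"
  shows "vol n (us @ unit x # ws) = vol n (us @ unit y # ws)"
proof -
  let ?l = "\<lambda>i. vol n (us @ unit i # ws)"
  have "edge_diff ?l e = 0" if "e \<in> B" for e
  proof -
    have "incidence e \<in> set us" using B that by blast
    then obtain k where k: "k < length us" "us ! k = incidence e" by (auto simp: in_set_conv_nth)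
    have "vol n (us @ incidence e # ws) = 0"
      by (rule vol_identical[of k _ "length us"]) (use k n in \<open>auto simp: nth_append\<close>)
    thus ?thesis using vol_incidence[of us n e ws] n by simp
  qed
  hence "\<forall>e\<in>B. edge_diff ?l e = 0" by blast
  note c = tree_coeff_connected[OF tree this]
  obtain x' y' where "x' \<in># comm_gens g" "x = fst x'" "y' \<in># comm_gens g" "y = fst y'" using x y by blast
  thus ?thesis using c[of x'] c[of y'] by simp
qed

lemma vol_equal_units:
  assumes tree: "tree_coeff T g B \<noteq> 0" and B: "incidence ` B \<subseteq> set us" and n: "length us + length ws + 2 = n"
    and x: "x \<in> fst ` set_mset (comm_gens g)" and y: "y \<in> fst ` set_mset (comm_gens g)"
  shows "vol n (us @ unit x # unit y # ws) = 0"
proof -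
  have "vol n (us @ unit x # unit y # ws) = vol n (us @ unit y # unit y # ws)"
    by (rule vol_move_unit[OF tree B _ x y]) (use n in simp)
  also have "\<dots> = 0" by (rule vol_identical[of "length us" _ "Suc (length us)"]) (use n in \<open>auto simp: nth_append\<close>)
  finally show ?thesis .
qed

lemma vol_units: "vol n (map unit [0..<n]) = 1"
proof -
  have "mat n n (\<lambda>(i, j). (map unit [0..<n] ! i) j) = (1\<^sub>m n :: complex mat)"
    by (intro eq_matI) (auto simp: unit_def)
  thus ?thesis by (simp add: vol_def)
qed

lemma vol_units_sign:
  assumes "mset xs = mset [0..<n]"
  shows "vol n (map unit xs) * vol n (map unit xs) = 1"
proof -
  have "length [0..<n] = n" by simp
  then obtain s where "s \<in> {1, -1}" "vol n (map unit xs) = s * vol n (map unit [0..<n])"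
    using vol_mset[OF assms[symmetric]] by blast
  thus ?thesis unfolding vol_units by auto
qed

text \<open>The entries of the target are carried to their places one after the other by adjacent
  exchanges. It serves to reorder wedge factors, for which only adjacent exchanges are
  analysed.\<close>

lemma adjacent_swap_induct:
  assumes swap: "\<And>us x y vs. P (us @ x # y # vs) \<Longrightarrow> P (us @ y # x # vs)"
    and P: "P xs" and eq: "mset xs = mset ys"
  shows "P ys"
proof -
  have move: "P (us @ x # vs @ ws) \<longleftrightarrow> P (us @ vs @ x # ws)" for us x vs ws
  proof (induction vs arbitrary: us)
    case (Cons v vs)
    have "P (us @ x # v # vs @ ws) \<longleftrightarrow> P (us @ v # x # vs @ ws)" using swap by blast
    thus ?case using Cons[of "us @ [v]"] by simp
  qed simp
  have "P (zs @ xs) \<Longrightarrow> mset xs = mset ys \<Longrightarrow> P (zs @ ys)" for zs xs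
  proof (induction ys arbitrary: zs xs)
    case (Cons y ys)
    have "y \<in> set xs" using Cons.prems(2) by (metis list.set_intros(1) set_mset_mset)
    then obtain us vs where xs: "xs = us @ y # vs" by (meson split_list)
    have "P (zs @ y # us @ vs)" using Cons.prems(1) move[of zs y us vs] unfolding xs by simp
    moreover have "mset (us @ vs) = mset ys" using Cons.prems(2) unfolding xs by simp
    ultimately show ?case using Cons.IH[of "zs @ [y]" "us @ vs"] by simp
  qed simp
  from this[of "[]" xs] P eq show ?thesis by simp
qed

subsection \<open>Evaluation of the maps from commutators to flags\<close>

locale psi_family =
  fixes m T :: nat and \<omega> :: complex and \<psi> :: "nat \<Rightarrow> wedge_U \<Rightarrow> flag_vec"
  assumes m_pos: "0 < m" and T_pos: "0 < T" and prim: "primitive_root_of_unity T \<omega>" and psi: "psi_maps m T \<omega> \<psi>"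
begin

lemma omega_nonzero: "\<omega> \<noteq> 0"
proof
  assume "\<omega> = 0"
  hence "\<omega> ^ T = 0" using T_pos by simp
  moreover have "\<omega> ^ T = 1" using prim unfolding primitive_root_of_unity_def by blast
  ultimately show False by simp
qed

lemma omega_pow_mod: "\<omega> ^ (n mod T) = \<omega> ^ n"
proof -
  have "\<omega> ^ n = \<omega> ^ (n mod T + T * (n div T))" by simp
  also have "\<dots> = \<omega> ^ (n mod T) * (\<omega> ^ T) ^ (n div T)" by (simp only: power_add power_mult)
  finally show ?thesis using prim by (simp add: primitive_root_of_unity_def)
qed

lemma omega_pow_inj: "a < T \<Longrightarrow> b < T \<Longrightarrow> \<omega> ^ a = \<omega> ^ b \<Longrightarrow> a = b"
proof (induction a b rule: linorder_wlog)
  case (le a b)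
  have "\<omega> ^ b = \<omega> ^ a * \<omega> ^ (b - a)" using le(1) by (simp add: power_add[symmetric])
  hence "\<omega> ^ (b - a) = 1" using le(4) omega_nonzero by simp
  hence "b - a = 0" using prim le(2,3) unfolding primitive_root_of_unity_def by (metis gr0I less_imp_diff_less)
  thus ?case using le(1) by simp
next
  case (sym a b) thus ?case by simp
qed

lemma omega_gain: "k' < T \<Longrightarrow> \<omega> ^ k * \<omega> ^ gain T k k' = \<omega> ^ k'"
  using omega_pow_mod[of "k + gain T k k'"] gain_add[of k' T k] by (simp add: power_add)

lemma gain_if: "k < T \<Longrightarrow> b < T \<Longrightarrow> \<omega> ^ a * \<omega> ^ k = \<omega> ^ b \<Longrightarrow> k = gain T a b"
proof -
  assume k: "k < T" and b: "b < T" and "\<omega> ^ a * \<omega> ^ k = \<omega> ^ b"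
  hence "\<omega> ^ a * \<omega> ^ k = \<omega> ^ a * \<omega> ^ gain T a b" using omega_gain[OF b] by simp
  hence "\<omega> ^ k = \<omega> ^ gain T a b" using omega_nonzero by simp
  thus ?thesis by (rule omega_pow_inj[OF k gain_less[OF T_pos]])
qed

lemma L_comm_iff: "t \<in> L_comm m \<omega> g \<longleftrightarrow> t \<in> Cspace m \<and>
    (\<forall>x\<in>#comm_gens g. \<forall>y\<in>#comm_gens g. \<omega> ^ snd x * t (fst x) = \<omega> ^ snd y * t (fst y))"
  unfolding L_comm_def by (auto simp: case_prod_beta')

text \<open>The last edge of the flag that \<psi>_p attaches to a wedge of commutators, as recorded
  in the invariant \<open>stage\<close>.\<close>

definition comp_space :: "commutator list \<Rightarrow> pt set" where
  "comp_space gs = {t \<in> Cspace m. \<forall>g\<in>set gs. t \<in> L_comm m \<omega> g}"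

lemma edge_hyp_set:
  assumes "x \<in> leaves m T" "y \<in> leaves m T" "fst x \<noteq> fst y"
  shows "t \<in> hyp_set m \<omega> (edge T x y) \<longleftrightarrow> t \<in> Cspace m \<and> \<omega> ^ snd x * t (fst x) = \<omega> ^ snd y * t (fst y)"
proof -
  have lt: "snd x < T" "snd y < T" using assms by (auto simp: leaves_def)
  have "t i = \<omega> ^ gain T a b * s j \<longleftrightarrow> \<omega> ^ a * t i = \<omega> ^ b * s j" if "b < T" for a b i j and t s :: pt
  proof -
    have "\<omega> ^ b * s j = \<omega> ^ a * (\<omega> ^ gain T a b * s j)" by (simp only: mult.assoc[symmetric] omega_gain[OF that])
    thus ?thesis using omega_nonzero mult_cancel_left[of "\<omega> ^ a"] by (metis power_not_zero)
  qed
  from this[OF lt(2), of t "fst x" "snd x" t "fst y"] this[OF lt(1), of t "fst y" "snd y" t "fst x"]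
  show ?thesis unfolding edge_def by auto
qed

text \<open>A test point for \<open>comp_space\<close>: for g with distinct indices it has
  \<omega>^k t_i = 1 on the generators of g and vanishes elsewhere. The inverse powers undo the
  factors \<omega>^k.\<close>

definition indicator_vec :: "commutator \<Rightarrow> pt" where
  "indicator_vec g = (\<lambda>i. \<Sum>x\<in>#comm_gens g. if fst x = i then inverse \<omega> ^ snd x else 0)"

lemma indicator_vec_leaf:
  assumes "image_mset fst (comm_gens g) = mset_set I" "finite I" "x \<in># comm_gens g"
  shows "\<omega> ^ snd x * indicator_vec g (fst x) = 1"
proof -
  note M = multilinear_gens[OF assms(1,2)]
  have "indicator_vec g (fst x) = (\<Sum>y\<in>set_mset (comm_gens g). if fst y = fst x then inverse \<omega> ^ snd y else 0)"
    unfolding indicator_vec_def by (subst M(1)) (simp add: sum_unfold_sum_mset)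
  also have "\<dots> = (\<Sum>y\<in>set_mset (comm_gens g). if y = x then inverse \<omega> ^ snd x else 0)"
    using M(2) assms(3) by (intro sum.cong) (auto dest: inj_onD)
  also have "\<dots> = inverse \<omega> ^ snd x" using assms(3) by (simp add: sum.delta)
  finally show ?thesis using omega_nonzero by (simp add: power_mult_distrib[symmetric])
qed

lemma indicator_vec_zero: "i \<notin> fst ` set_mset (comm_gens g) \<Longrightarrow> indicator_vec g i = 0"
proof -
  assume i: "i \<notin> fst ` set_mset (comm_gens g)"
  have "(\<Sum>x\<in>#M. if fst x = i then inverse \<omega> ^ snd x else 0) = 0" if "i \<notin> fst ` set_mset M" for M :: "(nat \<times> nat) multiset"
    using that by (induction M) auto
  thus ?thesis unfolding indicator_vec_def using i by blast
qed

lemma total_degree_parts: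
  assumes "total_degree_ones m T gs"
  shows "\<And>g. g \<in> set gs \<Longrightarrow> set_mset (comm_gens g) \<subseteq> leaves m T"
    "\<And>g. g \<in> set gs \<Longrightarrow> image_mset fst (comm_gens g) = mset_set (fst ` set_mset (comm_gens g))"
    "\<And>us g vs h. gs = us @ g # vs \<Longrightarrow> h \<in> set (us @ vs) \<Longrightarrow> fst ` set_mset (comm_gens g) \<inter> fst ` set_mset (comm_gens h) = {}"
proof -
  have 1: "image_mset fst (total_gens gs) = mset_set {1..m}" and 2: "set_mset (total_gens gs) \<subseteq> leaves m T"
    using assms unfolding total_degree_ones_iff by auto
  show "set_mset (comm_gens g) \<subseteq> leaves m T" if "g \<in> set gs" for g using total_gens_mem[OF that] 2 by blast
  have split: "total_gens gs = comm_gens g + total_gens (us @ vs)" if "gs = us @ g # vs" for us g vs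
    unfolding that by simp
  show "image_mset fst (comm_gens g) = mset_set (fst ` set_mset (comm_gens g))" if gm: "g \<in> set gs" for g
  proof -
    obtain us vs where "gs = us @ g # vs" using split_list[OF gm] by blast
    from split[OF this] show ?thesis
      using multilinear_union(1)[of "comm_gens g" "total_gens (us @ vs)" "{1..m}"] 1 by simp
  qed
  show "fst ` set_mset (comm_gens g) \<inter> fst ` set_mset (comm_gens h) = {}"
    if "gs = us @ g # vs" "h \<in> set (us @ vs)" for us g vs h
  proof -
    have "fst ` set_mset (comm_gens g) \<inter> fst ` set_mset (total_gens (us @ vs)) = {}"
      using multilinear_union(3)[of "comm_gens g" "total_gens (us @ vs)" "{1..m}"] 1 split[OF that(1)] by simp
    thus ?thesis using total_gens_mem[OF that(2)] by blast
  qed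
qed

lemma indicator_vec_comp:
  assumes gs: "total_degree_ones m T gs" and g: "gs = us @ g # vs"
  shows "indicator_vec g \<in> comp_space gs"
proof -
  note P = total_degree_parts[OF gs]
  have gm: "g \<in> set gs" using g by simp
  have C: "indicator_vec g \<in> Cspace m"
    unfolding Cspace_def using P(1)[OF gm] by (auto intro!: indicator_vec_zero simp: leaves_def)
  moreover have "indicator_vec g \<in> L_comm m \<omega> h" if h: "h \<in> set gs" for h
    unfolding L_comm_iff
  proof (intro conjI ballI C)
    fix x y assume xy: "x \<in># comm_gens h" "y \<in># comm_gens h"
    show "\<omega> ^ snd x * indicator_vec g (fst x) = \<omega> ^ snd y * indicator_vec g (fst y)"
    proof (cases "h \<in> set (us @ vs)")
      case True
      hence "fst x \<notin> fst ` set_mset (comm_gens g)" "fst y \<notin> fst ` set_mset (comm_gens g)" using P(3)[OF g True] xy by blast+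
      thus ?thesis by (simp add: indicator_vec_zero)
    next
      case False
      hence "h = g" using h g by auto
      thus ?thesis using indicator_vec_leaf[OF P(2)[OF gm]] xy by simp
    qed
  qed
  ultimately show ?thesis unfolding comp_space_def by blast
qed

lemma comp_space_bracket:
  "comp_space (gs @ [CBracket g1 g2]) = comp_space (gs @ [g2, g1]) \<inter> L_comm m \<omega> (CBracket g1 g2)"
proof -
  have "L_comm m \<omega> (CBracket g1 g2) \<subseteq> L_comm m \<omega> g1 \<inter> L_comm m \<omega> g2" by (auto simp: L_comm_iff)
  thus ?thesis unfolding comp_space_def by auto
qed

lemma comp_space_inter_edge:
  assumes gs: "total_degree_ones m T (gs @ [g2, g1])" and xy: "x \<in># comm_gens g1" "y \<in># comm_gens g2" "fst x \<noteq> fst y"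
  shows "comp_space (gs @ [g2, g1]) \<inter> hyp_set m \<omega> (edge T x y) = comp_space (gs @ [CBracket g1 g2])"
proof -
  note P = total_degree_parts[OF gs]
  have lx: "x \<in> leaves m T" and ly: "y \<in> leaves m T" using P(1)[of g1] P(1)[of g2] xy by auto
  show ?thesis
  proof (intro equalityI subsetI)
    fix t assume "t \<in> comp_space (gs @ [g2, g1]) \<inter> hyp_set m \<omega> (edge T x y)"
    hence t: "t \<in> comp_space (gs @ [g2, g1])" "\<omega> ^ snd x * t (fst x) = \<omega> ^ snd y * t (fst y)"
      using edge_hyp_set[OF lx ly xy(3)] by auto
    hence L: "t \<in> Cspace m" "t \<in> L_comm m \<omega> g1" "t \<in> L_comm m \<omega> g2" unfolding comp_space_def by auto
    have a: "\<omega> ^ snd u * t (fst u) = \<omega> ^ snd x * t (fst x)" if "u \<in># comm_gens (CBracket g1 g2)" for u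
    proof (cases "u \<in># comm_gens g1")
      case True
      thus ?thesis using L(2) xy(1) unfolding L_comm_iff by blast
    next
      case False
      hence "u \<in># comm_gens g2" using that by simp
      hence "\<omega> ^ snd u * t (fst u) = \<omega> ^ snd y * t (fst y)" using L(3) xy(2) unfolding L_comm_iff by blast
      thus ?thesis using t(2) by simp
    qed
    have "t \<in> L_comm m \<omega> (CBracket g1 g2)" unfolding L_comm_iff using L(1) a by simp
    thus "t \<in> comp_space (gs @ [CBracket g1 g2])" unfolding comp_space_bracket using t(1) by blast
  next
    fix t assume "t \<in> comp_space (gs @ [CBracket g1 g2])"
    hence t: "t \<in> comp_space (gs @ [g2, g1])" "t \<in> L_comm m \<omega> (CBracket g1 g2)" unfolding comp_space_bracket by blast+
    have "x \<in># comm_gens (CBracket g1 g2)" "y \<in># comm_gens (CBracket g1 g2)" using xy by auto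
    hence "\<omega> ^ snd x * t (fst x) = \<omega> ^ snd y * t (fst y)" "t \<in> Cspace m" using t(2) unfolding L_comm_iff by blast+
    thus "t \<in> comp_space (gs @ [g2, g1]) \<inter> hyp_set m \<omega> (edge T x y)"
      using t(1) edge_hyp_set[OF lx ly xy(3)] by blast
  qed
qed

text \<open>A point of the hyperplane with \<omega>^a u_i = \<omega>^b u_j = 1 leaves one exponent
  only, because the powers of \<omega> below T are distinct.\<close>

lemma hyp_edge_of_form:
  assumes H: "HEq i j k \<in> hyps m T" and x: "(i, a) \<in> leaves m T" and y: "(j, b) \<in> leaves m T"
    and eq: "u i = \<omega> ^ k * u j" "\<omega> ^ a * u i = 1" "\<omega> ^ b * u j = 1"
  shows "HEq i j k = edge T (i, a) (j, b)"
proof -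
  have k: "k < T" "i < j" and b: "b < T" using H y by (auto simp: hyps_def leaves_def)
  have "\<omega> ^ a * \<omega> ^ k * u j = \<omega> ^ b * u j" using eq by (simp add: mult.assoc)
  moreover have "u j \<noteq> 0" using eq(3) by auto
  ultimately have "\<omega> ^ a * \<omega> ^ k = \<omega> ^ b" by simp
  hence "k = gain T a b" by (rule gain_if[OF k(1) b])
  thus ?thesis using k(2) by (simp add: edge_def)
qed

text \<open>Tested on the points u and v of g1 and g2. The hyperplane excludes u, which is lost in
  the smaller space, and contains u + v, which survives. Hence its equation involves one index of
  each commutator, and the exponent is forced.\<close>

lemma cut_iff:
  assumes gs: "total_degree_ones m T (gs @ [g2, g1])" and H: "H \<in> hyps m T"
  shows "comp_space (gs @ [g2, g1]) \<inter> hyp_set m \<omega> H = comp_space (gs @ [CBracket g1 g2]) \<longleftrightarrow>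
    (\<exists>x\<in>#comm_gens g1. \<exists>y\<in>#comm_gens g2. H = edge T x y \<and> fst x \<noteq> fst y)"
proof
  assume "\<exists>x\<in>#comm_gens g1. \<exists>y\<in>#comm_gens g2. H = edge T x y \<and> fst x \<noteq> fst y"
  thus "comp_space (gs @ [g2, g1]) \<inter> hyp_set m \<omega> H = comp_space (gs @ [CBracket g1 g2])"
    using comp_space_inter_edge[OF gs] by blast
next
  assume eq: "comp_space (gs @ [g2, g1]) \<inter> hyp_set m \<omega> H = comp_space (gs @ [CBracket g1 g2])"
  note P = total_degree_parts[OF gs]
  let ?u = "indicator_vec g1" and ?v = "indicator_vec g2"
  let ?U = "fst ` set_mset (comm_gens g1)" and ?V = "fst ` set_mset (comm_gens g2)"
  have u: "?u \<in> comp_space (gs @ [g2, g1])" using indicator_vec_comp[OF gs, of "gs @ [g2]" g1 "[]"] by simp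
  have gs': "total_degree_ones m T (gs @ [CBracket g1 g2])"
    using gs total_degree_ones_cong[of "gs @ [CBracket g1 g2]" "gs @ [g2, g1]"] by (simp add: ac_simps)
  have w: "indicator_vec (CBracket g1 g2) \<in> comp_space (gs @ [CBracket g1 g2])"
    using indicator_vec_comp[OF gs', of gs "CBracket g1 g2" "[]"] by simp
  have wuv: "indicator_vec (CBracket g1 g2) i = ?u i + ?v i" for i by (simp add: indicator_vec_def)
  have d: "?U \<inter> ?V = {}" using P(3)[of "gs @ [g2]" g1 "[]" g2] by simp
  note lu = indicator_vec_leaf[OF P(2)[of g1, simplified], simplified] and lv = indicator_vec_leaf[OF P(2)[of g2, simplified], simplified]
  obtain x0 y0 where x0: "x0 \<in># comm_gens g1" "y0 \<in># comm_gens g2" using lead_mem[of g1] lead_mem[of g2] by blast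
  have "?u \<notin> comp_space (gs @ [CBracket g1 g2])"
  proof
    assume "?u \<in> comp_space (gs @ [CBracket g1 g2])"
    hence "?u \<in> L_comm m \<omega> (CBracket g1 g2)" unfolding comp_space_bracket by blast
    moreover have "x0 \<in># comm_gens (CBracket g1 g2)" "y0 \<in># comm_gens (CBracket g1 g2)" using x0 by auto
    ultimately have "\<omega> ^ snd x0 * ?u (fst x0) = \<omega> ^ snd y0 * ?u (fst y0)" unfolding L_comm_iff by blast
    moreover have "fst y0 \<notin> ?U" using d x0(2) by blast
    ultimately show False using lu[OF x0(1)] by (simp add: indicator_vec_zero)
  qed
  hence "?u \<notin> hyp_set m \<omega> H" using eq u by blast
  hence fu: "hyp_form \<omega> H ?u \<noteq> 0" using u unfolding hyp_set_form comp_space_def by blast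
  have "hyp_form \<omega> H (indicator_vec (CBracket g1 g2)) = 0"
    using w unfolding eq[symmetric] hyp_set_form by blast
  moreover have "indicator_vec (CBracket g1 g2) = ?u + ?v" using wuv by (intro ext) simp
  ultimately have fuv: "hyp_form \<omega> H ?u + hyp_form \<omega> H ?v = 0" by (simp add: hyp_form_linear)
  hence fv: "hyp_form \<omega> H ?v \<noteq> 0" using fu by auto
  show "\<exists>x\<in>#comm_gens g1. \<exists>y\<in>#comm_gens g2. H = edge T x y \<and> fst x \<noteq> fst y"
  proof (cases H)
    case (HZero i)
    have "i \<in> ?U" "i \<in> ?V" using fu fv indicator_vec_zero[of i g1] indicator_vec_zero[of i g2] unfolding HZero by auto
    thus ?thesis using d by blast
  next
    case (HEq i j k)
    have iju: "i \<in> ?U \<or> j \<in> ?U" using fu indicator_vec_zero[of i g1] indicator_vec_zero[of j g1] unfolding HEq by (cases "i \<in> ?U"; cases "j \<in> ?U") simp_all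
    have ijv: "i \<in> ?V \<or> j \<in> ?V" using fv indicator_vec_zero[of i g2] indicator_vec_zero[of j g2] unfolding HEq by (cases "i \<in> ?V"; cases "j \<in> ?V") simp_all
    have e0: "(?u + ?v) i = \<omega> ^ k * (?u + ?v) j" using fuv unfolding HEq by (simp add: algebra_simps)
    consider "i \<in> ?U" "j \<in> ?V" | "i \<in> ?V" "j \<in> ?U" using iju ijv d by blast
    thus ?thesis
    proof cases
      case 1
      then obtain a b where ab: "(i, a) \<in># comm_gens g1" "(j, b) \<in># comm_gens g2" by auto
      have nm: "?v i = 0" "?u j = 0" using 1 d by (auto intro!: indicator_vec_zero)
      have "HEq i j k = edge T (i, a) (j, b)"
      proof (rule hyp_edge_of_form[where u = "?u + ?v"])
        show "HEq i j k \<in> hyps m T" using H HEq by simp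
        show "(i, a) \<in> leaves m T" "(j, b) \<in> leaves m T" using ab P(1)[of g1] P(1)[of g2] by auto
        show "\<omega> ^ a * (?u + ?v) i = 1" "\<omega> ^ b * (?u + ?v) j = 1" using lu[OF ab(1)] lv[OF ab(2)] nm by simp_all
      qed (rule e0)
      moreover have "i \<noteq> j" using 1 d by auto
      ultimately show ?thesis using ab HEq by (intro bexI[of _ "(i, a)"] bexI[of _ "(j, b)"]) auto
    next
      case 2
      then obtain a b where ab: "(i, a) \<in># comm_gens g2" "(j, b) \<in># comm_gens g1" by auto
      have nm: "?u i = 0" "?v j = 0" using 2 d by (auto intro!: indicator_vec_zero)
      have e: "HEq i j k = edge T (i, a) (j, b)"
      proof (rule hyp_edge_of_form[where u = "?u + ?v"])
        show "HEq i j k \<in> hyps m T" using H HEq by simp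
        show "(i, a) \<in> leaves m T" "(j, b) \<in> leaves m T" using ab P(1)[of g1] P(1)[of g2] by auto
        show "\<omega> ^ a * (?u + ?v) i = 1" "\<omega> ^ b * (?u + ?v) j = 1" using lu[OF ab(2)] lv[OF ab(1)] nm by simp_all
      qed (rule e0)
      have ne: "i \<noteq> j" using 2 d by auto
      have "H = edge T (j, b) (i, a)" unfolding HEq e by (rule edge_commute) (use ne in simp)
      thus ?thesis using ab ne by (intro bexI[of _ "(j, b)"] bexI[of _ "(i, a)"]) auto
    qed
  qed
qed

lemma crossing_value:
  assumes gs: "total_degree_ones m T (gs @ [g2, g1])" and xy: "x \<in># comm_gens g1" "y \<in># comm_gens g2" "fst x \<noteq> fst y"
  shows "crossing T g1 g2 (edge T x y) = orient x y"
proof -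
  note P = total_degree_parts[OF gs]
  have 1: "image_mset fst (total_gens (gs @ [g2, g1])) = mset_set {1..m}" using gs unfolding total_degree_ones_iff by blast
  have I: "image_mset fst (comm_gens g1 + comm_gens g2) = mset_set (fst ` set_mset (comm_gens g1 + comm_gens g2))"
    using multilinear_union(1)[of "comm_gens g1 + comm_gens g2" "total_gens gs" "{1..m}"] 1 by (simp add: ac_simps)
  have "fst ` set_mset (comm_gens g1) \<inter> fst ` set_mset (comm_gens g2) = {}" using P(3)[of "gs @ [g2]" g1 "[]" g2] by simp
  hence "fst x \<in> fst ` set_mset (comm_gens g1)" "fst y \<notin> fst ` set_mset (comm_gens g1)" using xy by blast+
  thus ?thesis using crossing_edge[OF I, of x y T] xy by (simp add: edge_diff_edge[OF xy(3)])
qed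

section \<open>Relations obeyed by the given maps, and the invariant of the stages\<close>

lemma psi_linear:
  assumes "p \<le> m"
  shows "\<psi> p (u + v) = \<psi> p u + \<psi> p v" "\<psi> p (pm_scale c u) = pm_scale c (\<psi> p u)" "\<psi> p (u - v) = \<psi> p u - \<psi> p v"
    "\<psi> p ` (wedge_U_multilinear m T p \<inter> wedge_U_relations m T p) \<subseteq> flag_relations m T \<omega> (m - p)"
proof -
  have "induces_linear (wedge_U_multilinear m T p) (wedge_U_relations m T p)
    (flag_space m T \<omega> (m - p)) (flag_relations m T \<omega> (m - p)) (\<psi> p)"
    using psi assms unfolding psi_maps_def by blast
  hence l: "Vector_Spaces.linear pm_scale pm_scale (\<psi> p)"
    and "\<psi> p ` (wedge_U_multilinear m T p \<inter> wedge_U_relations m T p) \<subseteq> flag_relations m T \<omega> (m - p)"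
    unfolding induces_linear_def by blast+
  thus "\<psi> p ` (wedge_U_multilinear m T p \<inter> wedge_U_relations m T p) \<subseteq> flag_relations m T \<omega> (m - p)" by blast
  interpret l: Vector_Spaces.linear pm_scale pm_scale "\<psi> p" by (rule l)
  show "\<psi> p (u + v) = \<psi> p u + \<psi> p v" "\<psi> p (pm_scale c u) = pm_scale c (\<psi> p u)" "\<psi> p (u - v) = \<psi> p u - \<psi> p v"
    by (rule l.add l.scale l.diff)+
qed

lemma comm_wedge_multilinear:
  assumes "total_degree_ones m T (gs @ xs)"
  shows "comm_wedge T gs xs \<in> wedge_U_multilinear m T (length gs)"
proof -
  have "comm_bar T g \<in> a_fixed_homogeneous m T (leaf_degree g)" if "g \<in> set (gs @ xs)" for g
    by (rule comm_bar_homogeneous[OF T_pos total_degree_parts(1)[OF assms that]])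
  hence "list_all2 (\<lambda>w d. w \<in> a_fixed_homogeneous m T d) (map (comm_bar T) (gs @ xs)) (map leaf_degree (gs @ xs))"
    unfolding list_all2_map1 list_all2_map2 by (intro list.rel_refl_strong) blast
  hence "\<exists>ds. list_all2 (\<lambda>w d. w \<in> a_fixed_homogeneous m T d) (map (comm_bar T) gs @ map (comm_bar T) xs) ds \<and> sum_list ds = ones m"
    using total_leaf_degree[OF assms] by (intro exI[of _ "map leaf_degree (gs @ xs)"]) (simp only: map_append)
  thus ?thesis unfolding wedge_U_multilinear_def comm_wedge_def
    by (intro pm.span_base CollectI exI[of _ "map (comm_bar T) gs"] exI[of _ "map (comm_bar T) xs"]) simp
qed

lemma wedge_U_relation_linear:
  assumes "length ws + length ws' + 1 = p" "set ws \<union> set ws' \<union> set us \<union> {x, y} \<subseteq> a_fixed m T"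
  shows "basis_vec (ws @ [free_scale a x + free_scale b y] @ ws', us)
      - pm_scale a (basis_vec (ws @ [x] @ ws', us)) - pm_scale b (basis_vec (ws @ [y] @ ws', us)) \<in> wedge_U_relations m T p"
  unfolding wedge_U_relations_def
  by (rule pm.span_base, intro UnI1, rule CollectI, rule exI[of _ ws], rule exI[of _ ws'], rule exI[of _ us],
      rule exI[of _ x], rule exI[of _ y], rule exI[of _ a], rule exI[of _ b]) (use assms in blast)

lemma wedge_U_relation_linear_right:
  assumes "length ws = p" "set ws \<union> set us \<union> set us' \<union> {x, y} \<subseteq> a_fixed m T"
  shows "basis_vec (ws, us @ [free_scale a x + free_scale b y] @ us')
      - pm_scale a (basis_vec (ws, us @ [x] @ us')) - pm_scale b (basis_vec (ws, us @ [y] @ us')) \<in> wedge_U_relations m T p"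
  unfolding wedge_U_relations_def
  by (rule pm.span_base, rule UnI1, rule UnI1, rule UnI2, rule CollectI, rule exI[of _ ws], rule exI[of _ us], rule exI[of _ us'],
      rule exI[of _ x], rule exI[of _ y], rule exI[of _ a], rule exI[of _ b]) (use assms in blast)

lemma wedge_U_relation_equal:
  assumes "length ws = p" "set ws \<union> set us \<subseteq> a_fixed m T" "i < j" "j < p" "ws ! i = ws ! j"
  shows "basis_vec (ws, us) \<in> wedge_U_relations m T p"
  unfolding wedge_U_relations_def
  by (rule pm.span_base, rule UnI1, rule UnI2, rule CollectI, rule exI[of _ ws], rule exI[of _ us]) (use assms in blast)

text \<open>Polarisation: the wedge with x + y in both places is a relation and is expanded in each
  of them.\<close>

lemma wedge_swap_relation:
  assumes "set us \<union> set vs \<union> {x, y} \<subseteq> a_fixed m T" "length us + length vs + 2 = p"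
  shows "basis_vec (us @ x # y # vs, []) + basis_vec (us @ y # x # vs, []) \<in> wedge_U_relations m T p"
proof -
  let ?R = "wedge_U_relations m T p" and ?b = "\<lambda>ws. basis_vec (ws, []) :: wedge_U"
  have f: "free.subspace (a_fixed m T)"
  proof -
    have "free.subspace (algebra_a m T)" unfolding algebra_a_span by (rule free.subspace_span)
    thus ?thesis unfolding a_fixed_def free.subspace_def by (auto simp: tau_hom)
  qed
  hence xy: "x + y \<in> a_fixed m T" using assms(1) by (intro free.subspace_add) auto
  have sub: "pm.subspace ?R" unfolding wedge_U_relations_def by (rule pm.subspace_span)
  have eq: "?b (us @ z # z # vs) \<in> ?R" if "z \<in> a_fixed m T" for z
    by (rule wedge_U_relation_equal[of _ _ _ "length us" "Suc (length us)"])
      (use assms that in \<open>auto simp: nth_append\<close>)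
  have lin: "?b (ws @ [x + y] @ ws') - ?b (ws @ [x] @ ws') - ?b (ws @ [y] @ ws') \<in> ?R"
    if "length ws + length ws' + 1 = p" "set ws \<union> set ws' \<subseteq> a_fixed m T" for ws ws'
    using wedge_U_relation_linear[of ws ws' p "[]" x y 1 1] that assms(1) by simp
  have 1: "?b (us @ (x + y) # (x + y) # vs) - ?b (us @ x # (x + y) # vs) - ?b (us @ y # (x + y) # vs) \<in> ?R"
    using lin[of us "(x + y) # vs"] assms xy by simp
  have 2: "?b (us @ x # (x + y) # vs) - ?b (us @ x # x # vs) - ?b (us @ x # y # vs) \<in> ?R"
    using lin[of "us @ [x]" vs] assms by simp
  have 3: "?b (us @ y # (x + y) # vs) - ?b (us @ y # x # vs) - ?b (us @ y # y # vs) \<in> ?R"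
    using lin[of "us @ [y]" vs] assms by simp
  have "?b (us @ (x + y) # (x + y) # vs)
     - (?b (us @ (x + y) # (x + y) # vs) - ?b (us @ x # (x + y) # vs) - ?b (us @ y # (x + y) # vs))
     - (?b (us @ x # (x + y) # vs) - ?b (us @ x # x # vs) - ?b (us @ x # y # vs))
     - (?b (us @ y # (x + y) # vs) - ?b (us @ y # x # vs) - ?b (us @ y # y # vs))
     - ?b (us @ x # x # vs) - ?b (us @ y # y # vs) \<in> ?R"
    using assms(1) by (intro pm.subspace_diff[OF sub] eq xy 1 2 3) auto
  thus ?thesis by (simp add: algebra_simps)
qed

text \<open>One row for the auxiliary index 0 (positions start at 1), m - p edges and p roots form a
  square matrix of size m + 1. The roots are reversed so that those of the last two commutators, on
  which the bracket rule acts, stand next to the edges.\<close>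

definition stage_vol :: "hyp list \<Rightarrow> nat list \<Rightarrow> complex" where
  "stage_vol Hs rs = vol (m + 1) (unit 0 # map incidence Hs @ map unit (rev rs))"

definition roots :: "nat list \<Rightarrow> commutator list \<Rightarrow> bool" where
  "roots = list_all2 (\<lambda>r g. r \<in> fst ` set_mset (comm_gens g))"

definition admissible :: "nat \<Rightarrow> hyp list \<Rightarrow> bool" where
  "admissible q Hs \<longleftrightarrow> length Hs = q \<and> distinct Hs \<and> set Hs \<subseteq> hyps m T"

text \<open>The determinant of the initial stage. Its square is 1, so as a factor it normalises the
  pairing of the initial flag to 1.\<close>

definition base_sign :: complex where
  "base_sign = stage_vol [] [1..<Suc m]"

text \<open>The values of \<open>\<psi>_p\<close> on wedges of commutators are signed flags; their pairing with hyperplanes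
  factors into a determinant of incidence vectors, which carries the orientation, and the coefficients of
  spanning forests.  A choice of one root in every commutator makes the determinant square.\<close>

definition stage :: "commutator list \<Rightarrow> bool" where
  "stage gs \<longleftrightarrow> (\<exists>\<epsilon>\<in>{1, -1}. \<exists>Ls\<in>flags m T \<omega> (m - length gs).
     flag_eq m T \<omega> (m - length gs) (\<psi> (length gs) (comm_wedge T gs [])) (pm_scale \<epsilon> (basis_vec Ls)) \<and>
     last Ls = comp_space gs \<and>
     (\<forall>Hs rs. admissible (m - length gs) Hs \<longrightarrow> roots rs gs \<longrightarrow>
        \<epsilon> * flag_pairing m \<omega> Ls Hs = base_sign * stage_vol Hs rs * forest_coeff T gs (set Hs) \<and>
        (forest_coeff T gs (set Hs) \<noteq> 0 \<longrightarrow> stage_vol Hs rs * stage_vol Hs rs = 1)))"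

lemma base_sign_sq: "base_sign * base_sign = 1"
proof -
  have "mset (0 # rev [1..<Suc m]) = mset [0..<m + 1]" by (simp add: upt_conv_Cons del: upt_Suc)
  from vol_units_sign[OF this] show ?thesis by (simp add: base_sign_def stage_vol_def)
qed

lemma length_le: "total_degree_ones m T gs \<Longrightarrow> length gs \<le> m"
proof -
  assume "total_degree_ones m T gs"
  hence "size (image_mset fst (total_gens gs)) = m" unfolding total_degree_ones_iff by simp
  moreover have "length gs \<le> size (total_gens gs)"
  proof (induction gs)
    case (Cons g gs)
    have "comm_gens g \<noteq> {#}" using lead_mem[of g] by auto
    hence "1 \<le> size (comm_gens g)" by (simp add: Suc_leI nonempty_has_size)
    thus ?case using Cons by simp
  qed simp
  ultimately show ?thesis by simp
qed

lemma stage_base: "stage (map (\<lambda>i. CGen i 0) [1..<Suc m])"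
proof -
  let ?gs = "map (\<lambda>i. CGen i 0) [1..<Suc m]"
  have len: "length ?gs = m" by simp
  have fl: "[Cspace m] \<in> flags m T \<omega> 0" unfolding flags_def using Cspace_edge dim_Cspace by simp
  have eq: "flag_eq m T \<omega> 0 (\<psi> m (comm_wedge T ?gs [])) (basis_vec [Cspace m])"
    using psi unfolding psi_maps_def by blast
  have "L_comm m \<omega> g = Cspace m" if "g \<in> set ?gs" for g using that unfolding L_comm_def by auto
  hence comp: "comp_space ?gs = Cspace m" unfolding comp_space_def by auto
  have det: "flag_pairing m \<omega> [Cspace m] [] = 1"
    by (subst flag_pairing_det[of _ 0]) (auto simp: det_dim_zero)
  have fc: "forest_coeff T (map (\<lambda>i. CGen i 0) is) {} = 1" for "is" by (induction "is") (simp_all add: conv_def)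
  have rs: "rs = [1..<Suc m]" if "roots rs ?gs" for rs
  proof -
    have "list_all2 (=) rs [1..<Suc m]" using that unfolding roots_def list_all2_map2 by (simp del: upt_Suc)
    thus ?thesis by (simp add: list.rel_eq)
  qed
  show ?thesis unfolding stage_def len diff_self_eq_0
  proof (intro bexI[of _ 1] bexI[of _ "[Cspace m]"] conjI allI impI)
    show "flag_eq m T \<omega> 0 (\<psi> m (comm_wedge T ?gs [])) (pm_scale 1 (basis_vec [Cspace m]))"
      using eq by (simp only: pm.scale_one)
    show "last [Cspace m] = comp_space ?gs" using comp by simp
    fix Hs rs assume *: "admissible 0 Hs" "roots rs ?gs"
    hence Hs: "Hs = []" by (simp add: admissible_def)
    show "1 * flag_pairing m \<omega> [Cspace m] Hs = base_sign * stage_vol Hs rs * forest_coeff T ?gs (set Hs)"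
      using base_sign_sq unfolding Hs rs[OF *(2)] by (simp only: base_sign_def det fc list.set mult_1_left mult_1_right)
    show "stage_vol Hs rs * stage_vol Hs rs = 1" unfolding Hs rs[OF *(2)] base_sign_def[symmetric] by (rule base_sign_sq)
  qed (use fl in auto)
qed

text \<open>The exchange of two wedge factors negates \<psi>_p modulo relations and exchanges two
  roots in the determinant. The flag and the forest coefficients do not depend on the order.\<close>

lemma stage_swap:
  assumes tot: "total_degree_ones m T (us @ x # y # vs)" and st: "stage (us @ x # y # vs)"
  shows "stage (us @ y # x # vs)"
proof -
  let ?gs = "us @ x # y # vs" and ?hs = "us @ y # x # vs"
  have toth: "total_degree_ones m T ?hs"
    using tot total_degree_ones_cong[of ?gs ?hs] by (simp add: ac_simps)
  have p: "length ?gs \<le> m" by (rule length_le[OF tot])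
  have len: "length ?hs = length ?gs" by simp
  obtain \<epsilon> Ls where e: "\<epsilon> \<in> {1, -1}" and Ls: "Ls \<in> flags m T \<omega> (m - length ?gs)"
    and eq: "flag_eq m T \<omega> (m - length ?gs) (\<psi> (length ?gs) (comm_wedge T ?gs [])) (pm_scale \<epsilon> (basis_vec Ls))"
    and last: "last Ls = comp_space ?gs"
    and val: "\<And>Hs rs. admissible (m - length ?gs) Hs \<Longrightarrow> roots rs ?gs \<Longrightarrow>
        \<epsilon> * flag_pairing m \<omega> Ls Hs = base_sign * stage_vol Hs rs * forest_coeff T ?gs (set Hs) \<and>
        (forest_coeff T ?gs (set Hs) \<noteq> 0 \<longrightarrow> stage_vol Hs rs * stage_vol Hs rs = 1)"
    using st unfolding stage_def by blast
  have "comm_wedge T ?gs [] + comm_wedge T ?hs [] \<in> wedge_U_multilinear m T (length ?gs)"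
    unfolding wedge_U_multilinear_def
    using comm_wedge_multilinear[of ?gs "[]"] comm_wedge_multilinear[of ?hs "[]"] tot toth len
    by (intro pm.span_add) (simp_all add: wedge_U_multilinear_def)
  moreover have "comm_wedge T ?gs [] + comm_wedge T ?hs [] \<in> wedge_U_relations m T (length ?gs)"
  proof -
    have "comm_bar T g \<in> a_fixed m T" if "g \<in> set ?gs" for g
      using comm_bar_homogeneous[OF T_pos total_degree_parts(1)[OF tot that]] unfolding a_fixed_homogeneous_def by blast
    hence "comm_bar T ` set ?gs \<subseteq> a_fixed m T" by blast
    hence "set (map (comm_bar T) us) \<union> set (map (comm_bar T) vs) \<union> {comm_bar T x, comm_bar T y} \<subseteq> a_fixed m T" by auto
    from wedge_swap_relation[OF this, of "length ?gs"] show ?thesis by (simp add: comm_wedge_def)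
  qed
  ultimately have rel: "\<psi> (length ?gs) (comm_wedge T ?gs []) + \<psi> (length ?gs) (comm_wedge T ?hs []) \<in> flag_relations m T \<omega> (m - length ?gs)"
    unfolding psi_linear(1)[OF p, symmetric] by (intro subsetD[OF psi_linear(4)[OF p]] imageI IntI)
  have sub: "pm.subspace (flag_relations m T \<omega> q)" for q unfolding flag_relations_def by (rule pm.subspace_span)
  have "flag_eq m T \<omega> (m - length ?gs) (\<psi> (length ?gs) (comm_wedge T ?hs [])) (pm_scale (- \<epsilon>) (basis_vec Ls))"
    using pm.subspace_diff[OF sub rel eq[unfolded flag_eq_def]] unfolding flag_eq_def by (simp add: algebra_simps)
  moreover have "last Ls = comp_space ?hs" unfolding last comp_space_def by auto
  moreover have "- \<epsilon> * flag_pairing m \<omega> Ls Hs = base_sign * stage_vol Hs rs * forest_coeff T ?hs (set Hs) \<and>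
        (forest_coeff T ?hs (set Hs) \<noteq> 0 \<longrightarrow> stage_vol Hs rs * stage_vol Hs rs = 1)"
    if Hs: "admissible (m - length ?gs) Hs" and rs: "roots rs ?hs" for Hs rs
  proof -
    obtain as b c ds where r: "rs = as @ b # c # ds" and as: "roots as us" "b \<in> fst ` set_mset (comm_gens y)"
        "c \<in> fst ` set_mset (comm_gens x)" "roots ds vs"
    proof -
      obtain as bs where 1: "rs = as @ bs" "roots as us" "roots bs (y # x # vs)"
        using rs unfolding roots_def list_all2_append2 by blast
      obtain b cs where 2: "bs = b # cs" "b \<in> fst ` set_mset (comm_gens y)" "roots cs (x # vs)"
        using 1(3) unfolding roots_def list_all2_Cons2 by blast
      obtain c ds where 3: "cs = c # ds" "c \<in> fst ` set_mset (comm_gens x)" "roots ds vs"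
        using 2(3) unfolding roots_def list_all2_Cons2 by blast
      show ?thesis by (rule that[OF _ 1(2) 2(2) 3(2,3)]) (simp add: 1 2 3)
    qed
    have "roots (as @ c # b # ds) ?gs" using as unfolding roots_def by (intro list_all2_appendI) auto
    note v = val[OF Hs this]
    have "length as = length us" "length ds = length vs" using as by (auto simp: roots_def dest: list_all2_lengthD)
    hence "1 + length Hs + length ds + length as + 2 = m + 1" using Hs p by (simp add: admissible_def)
    hence "stage_vol Hs (as @ c # b # ds) = - stage_vol Hs rs"
      unfolding stage_vol_def r
      using vol_swap[of "unit 0 # map incidence Hs @ map unit (rev ds)" "m + 1" "map unit (rev as)" "unit b" "unit c"] by simp
    thus ?thesis using v unfolding forest_coeff_swap[of T us x y] by simp
  qed
  ultimately show ?thesis unfolding stage_def len using e Ls by (intro bexI[of _ "- \<epsilon>"] bexI[of _ Ls]) auto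
qed

text \<open>The row of the joining edge is expanded over its two end points. If r lies in g1, the
  end point in g1 has the same unit vector as r modulo the tree, so its term vanishes, and the other
  end point becomes the root of g2. The case of g2 is symmetric.\<close>

lemma stage_vol_edge:
  assumes tot: "total_degree_ones m T (gs @ [g2, g1])" and len: "length Hs + length gs + 1 = m" and j: "j < length Hs"
    and cr: "crossing T g1 g2 (Hs ! j) \<noteq> 0"
    and fo: "forest_coeff T (gs @ [g2, g1]) (set (take j Hs @ drop (Suc j) Hs)) \<noteq> 0"
    and rs: "roots rs gs" and r: "r \<in> fst ` set_mset (comm_gens (CBracket g1 g2))"
  shows "\<exists>r1\<in>fst ` set_mset (comm_gens g1). \<exists>r2\<in>fst ` set_mset (comm_gens g2).
    stage_vol Hs (rs @ [r]) = (-1) ^ (length Hs - Suc j) * crossing T g1 g2 (Hs ! j) * stage_vol (take j Hs @ drop (Suc j) Hs) (rs @ [r2, r1])"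
proof -
  let ?Hs = "take j Hs @ drop (Suc j) Hs" and ?us = "unit 0 # map incidence (take j Hs @ drop (Suc j) Hs)"
  let ?ws = "map unit (rev rs)" and ?n = "m + 1"
  let ?V = "\<lambda>a b. vol ?n (?us @ unit a # unit b # ?ws)"
  have lrs: "length rs = length gs" using rs by (auto simp: roots_def dest: list_all2_lengthD)
  have lH: "length ?Hs + 1 = length Hs" using j by simp
  have n: "length ?us + length ?ws + 2 = ?n" using lrs len j by simp
  obtain x y where xy: "x \<in># comm_gens g1" "y \<in># comm_gens g2" "Hs ! j = edge T x y" "fst x \<noteq> fst y"
    using crossing_nonzeroD[OF cr] by blast
  have fx: "fst x \<in> fst ` set_mset (comm_gens g1)" and fy: "fst y \<in> fst ` set_mset (comm_gens g2)" using xy by auto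
  have "stage_vol Hs (rs @ [r]) = vol ?n ((unit 0 # map incidence (take j Hs)) @ incidence (Hs ! j) # map incidence (drop (Suc j) Hs) @ unit r # ?ws)"
    unfolding stage_vol_def by (subst id_take_nth_drop[OF j]) simp
  \<comment> \<open>The edge is moved behind the later edges, next to the roots; this sign will
    match the one of the Laplace expansion.\<close>
  also have "\<dots> = (-1) ^ length (map incidence (drop (Suc j) Hs)) *
      vol ?n ((unit 0 # map incidence (take j Hs)) @ map incidence (drop (Suc j) Hs) @ incidence (Hs ! j) # unit r # ?ws)"
    by (rule vol_move) (use n j in simp)
  also have "\<dots> = (-1) ^ (length Hs - Suc j) * vol ?n (?us @ incidence (Hs ! j) # unit r # ?ws)" by simp
  also have "vol ?n (?us @ incidence (Hs ! j) # unit r # ?ws) = edge_diff (\<lambda>i. ?V i r) (Hs ! j)"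
    by (rule vol_incidence) (use n in simp)
  also have "\<dots> = orient x y * (?V (fst x) r - ?V (fst y) r)" unfolding xy(3) by (rule edge_diff_edge[OF xy(4)])
  also have "orient x y = crossing T g1 g2 (Hs ! j)" unfolding xy(3) by (rule crossing_value[OF tot xy(1,2,4), symmetric])
  finally have eq: "stage_vol Hs (rs @ [r]) = (-1) ^ (length Hs - Suc j) * crossing T g1 g2 (Hs ! j) * (?V (fst x) r - ?V (fst y) r)"
    by (simp add: mult.assoc)
  have sub: "incidence ` B \<subseteq> set ?us" if "B \<subseteq> set ?Hs" for B using that by auto
  have st: "stage_vol ?Hs (rs @ [a, b]) = ?V b a" for a b by (simp add: stage_vol_def)
  show ?thesis
  proof (cases "r \<in> fst ` set_mset (comm_gens g1)")
    case True
    obtain B where B: "B \<subseteq> set ?Hs" "tree_coeff T g1 B \<noteq> 0"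
      using forest_coeff_component[of T "gs @ [g2]" g1 "[]"] fo by auto
    have "?V (fst x) r = 0" by (rule vol_equal_units[OF B(2) sub[OF B(1)] n fx True])
    moreover have "?V (fst y) r = - ?V r (fst y)" by (rule vol_swap) (use n in simp_all)
    ultimately have d: "?V (fst x) r - ?V (fst y) r = stage_vol ?Hs (rs @ [fst y, r])" unfolding st by simp
    show ?thesis by (rule bexI[OF _ True], rule bexI[OF _ fy]) (simp only: eq d)
  next
    case False
    hence r2: "r \<in> fst ` set_mset (comm_gens g2)" using r by auto
    obtain B where B: "B \<subseteq> set ?Hs" "tree_coeff T g2 B \<noteq> 0"
      using forest_coeff_component[of T gs g2 "[g1]"] fo by auto
    have "?V (fst y) r = 0" by (rule vol_equal_units[OF B(2) sub[OF B(1)] n fy r2])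
    hence d: "?V (fst x) r - ?V (fst y) r = stage_vol ?Hs (rs @ [r, fst x])" unfolding st by simp
    show ?thesis by (rule bexI[OF _ fx], rule bexI[OF _ r2]) (simp only: eq d)
  qed
qed

lemma roots_exist: "\<exists>rs. roots rs gs"
  unfolding roots_def by (intro exI[of _ "map lead gs"]) (auto simp: list_all2_map1 lead_mem intro: list.rel_refl_strong)

lemma sum_remove_nth:
  assumes "distinct Hs"
  shows "(\<Sum>e\<in>set Hs. f e (set Hs - {e})) = (\<Sum>j<length Hs. f (Hs ! j) (set (take j Hs @ drop (Suc j) Hs)) :: complex)"
proof -
  have rem: "set (take j Hs @ drop (Suc j) Hs) = set Hs - {Hs ! j}" if j: "j < length Hs" for j
  proof -
    have "distinct (take j Hs @ Hs ! j # drop (Suc j) Hs)" "set Hs = set (take j Hs @ Hs ! j # drop (Suc j) Hs)"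
      using assms id_take_nth_drop[OF j] by simp_all
    thus ?thesis by auto
  qed
  have "(\<Sum>e\<in>set Hs. f e (set Hs - {e})) = (\<Sum>j<length Hs. f (Hs ! j) (set Hs - {Hs ! j}))"
    by (rule sum.reindex_bij_betw[OF bij_betw_nth[OF assms HOL.refl HOL.refl], symmetric])
  thus ?thesis using rem by simp
qed

lemma admissible_remove: "admissible q Hs \<Longrightarrow> j < length Hs \<Longrightarrow> admissible (q - 1) (take j Hs @ drop (Suc j) Hs)"
proof -
  assume Hs: "admissible q Hs" and j: "j < length Hs"
  have "distinct (take j Hs @ Hs ! j # drop (Suc j) Hs)" using Hs id_take_nth_drop[OF j] by (simp add: admissible_def)
  moreover have "set (take j Hs @ drop (Suc j) Hs) \<subseteq> set Hs" by (auto dest: in_set_takeD in_set_dropD)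
  ultimately show ?thesis using Hs j unfolding admissible_def by auto
qed

lemma comp_space_edge: "L \<in> edges m T \<omega> \<Longrightarrow> total_degree_ones m T (gs @ [g2, g1]) \<Longrightarrow> L = comp_space (gs @ [g2, g1]) \<Longrightarrow>
    comp_space (gs @ [CBracket g1 g2]) \<in> edges m T \<omega> \<and> comp_space (gs @ [CBracket g1 g2]) \<subset> L \<and>
    pt.dim L = pt.dim (comp_space (gs @ [CBracket g1 g2])) + 1"
proof -
  assume L: "L \<in> edges m T \<omega>" and tot: "total_degree_ones m T (gs @ [g2, g1])" and eq: "L = comp_space (gs @ [g2, g1])"
  note P = total_degree_parts[OF tot]
  obtain x y where xy: "x \<in># comm_gens g1" "y \<in># comm_gens g2" using lead_mem[of g1] lead_mem[of g2] by blast
  have ne: "fst x \<noteq> fst y" using P(3)[of "gs @ [g2]" g1 "[]" g2] xy by auto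
  have l: "x \<in> leaves m T" "y \<in> leaves m T" using P(1)[of g1] P(1)[of g2] xy by auto
  have inter: "L \<inter> hyp_set m \<omega> (edge T x y) = comp_space (gs @ [CBracket g1 g2])"
    unfolding eq by (rule comp_space_inter_edge[OF tot xy ne])
  have u: "indicator_vec g1 \<in> L" unfolding eq using indicator_vec_comp[OF tot, of "gs @ [g2]" g1 "[]"] by simp
  have "fst y \<notin> fst ` set_mset (comm_gens g1)" using P(3)[of "gs @ [g2]" g1 "[]" g2] xy by auto
  hence nu: "indicator_vec g1 \<notin> hyp_set m \<omega> (edge T x y)"
    unfolding edge_hyp_set[OF l ne] using indicator_vec_leaf[OF P(2)[of g1] _ xy(1)] by (simp add: indicator_vec_zero)
  have sub: "pt.subspace L" "L \<subseteq> Cspace m" using subspace_edge[OF L] by blast+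
  have "comp_space (gs @ [CBracket g1 g2]) \<in> edges m T \<omega>"
    unfolding inter[symmetric] by (rule edge_inter_hyp[OF L edge_hyps[OF T_pos l ne]])
  moreover have "comp_space (gs @ [CBracket g1 g2]) \<subset> L" unfolding inter[symmetric] using u nu by blast
  moreover have "pt.dim L = pt.dim (comp_space (gs @ [CBracket g1 g2])) + 1"
    unfolding inter[symmetric] by (rule dim_inter_hyp_strict[OF sub u nu])
  ultimately show ?thesis by blast
qed

lemma flags_snoc:
  assumes Ls: "Ls \<in> flags m T \<omega> q" and L: "L \<in> edges m T \<omega>" "L \<subseteq> last Ls" "pt.dim (last Ls) = pt.dim L + 1"
  shows "Ls @ [L] \<in> flags m T \<omega> (Suc q)"
proof -
  have len: "length Ls = Suc q" and 0: "Ls ! 0 = Cspace m"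
    and e: "\<And>j. j \<le> q \<Longrightarrow> Ls ! j \<in> edges m T \<omega> \<and> pt.dim (Ls ! j) + j = m"
    and d: "\<And>j. j < q \<Longrightarrow> Ls ! Suc j \<subseteq> Ls ! j" using Ls unfolding flags_def by blast+
  have last: "last Ls = Ls ! q" using len by (metis diff_Suc_1 last_conv_nth list.size(3) nat.distinct(1))
  show ?thesis unfolding flags_def
  proof (intro CollectI conjI allI impI)
    show "length (Ls @ [L]) = Suc (Suc q)" using len by simp
    show "(Ls @ [L]) ! 0 = Cspace m" using 0 len by (simp add: nth_append)
    fix j
    show "(Ls @ [L]) ! j \<in> edges m T \<omega>" "pt.dim ((Ls @ [L]) ! j) + j = m" if "j \<le> Suc q"
      using that e[of j] e[of q] L last len by (cases "j = Suc q"; simp add: nth_append)+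
    show "(Ls @ [L]) ! Suc j \<subseteq> (Ls @ [L]) ! j" if "j < Suc q"
      using that d[of j] L last len by (cases "j = q") (simp_all add: nth_append)
  qed
qed

text \<open>Laplace expansion of the pairing and expansion of the forest polynomial by
  \<open>conv_link\<close> both run over the hyperplane that performs the last cut. They agree term
  by term: the determinant supplies one factor \<open>crossing\<close>, the forest polynomial
  another, and their product tells whether the hyperplane makes the required cut.\<close>

lemma stage_bracket:
  assumes tot: "total_degree_ones m T (gs @ [g2, g1])" and st: "stage (gs @ [g2, g1])"
  shows "stage (gs @ [CBracket g1 g2])"
proof -
  let ?gs = "gs @ [g2, g1]" and ?hs = "gs @ [CBracket g1 g2]" and ?p = "length gs + 1"
  define q where "q = m - length ?gs"
  have lm: "length ?gs \<le> m" by (rule length_le[OF tot])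
  have q: "m - length ?hs = Suc q" "m - ?p - 1 = q" "m - ?p = Suc q" using lm by (simp_all add: q_def)
  obtain \<epsilon> Ls where e: "\<epsilon> \<in> {1, -1}" and Ls: "Ls \<in> flags m T \<omega> q"
    and eq: "flag_eq m T \<omega> q (\<psi> (length ?gs) (comm_wedge T ?gs [])) (pm_scale \<epsilon> (basis_vec Ls))"
    and last: "last Ls = comp_space ?gs"
    and val: "\<And>Hs rs. admissible q Hs \<Longrightarrow> roots rs ?gs \<Longrightarrow>
        \<epsilon> * flag_pairing m \<omega> Ls Hs = base_sign * stage_vol Hs rs * forest_coeff T ?gs (set Hs) \<and>
        (forest_coeff T ?gs (set Hs) \<noteq> 0 \<longrightarrow> stage_vol Hs rs * stage_vol Hs rs = 1)"
    using st unfolding stage_def q_def[symmetric] by blast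
  have len: "length Ls = Suc q" and L0: "Ls ! 0 = Cspace m" and Le: "Ls ! q \<in> edges m T \<omega>"
    using Ls unfolding flags_def by blast+
  have lq: "last Ls = Ls ! q" using len by (metis diff_Suc_1 last_conv_nth list.size(3) nat.distinct(1))
  define L where "L = comp_space ?hs"
  have L: "L \<in> edges m T \<omega>" "L \<subset> last Ls" "pt.dim (last Ls) = pt.dim L + 1"
    using comp_space_edge[OF _ tot last] Le unfolding lq[symmetric] L_def by blast+
  have Leq: "last Ls \<inter> L_comm m \<omega> (CBracket g1 g2) = L" unfolding L_def last comp_space_bracket ..
  have "flag_eq m T \<omega> (m - ?p) (\<psi> ?p (comm_wedge T ?hs []))
    (pm_scale \<epsilon> (basis_vec (Ls @ [last Ls \<inter> L_comm m \<omega> (CBracket g1 g2)])))"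
  proof -
    have rule3: "\<And>p gs g1 g2 xs Ls \<epsilon>.
        p + 1 \<le> m \<longrightarrow> length gs + 1 = p \<longrightarrow> total_degree_ones m T (gs @ [g2, g1] @ xs) \<longrightarrow>
        Ls \<in> flags m T \<omega> (m - p - 1) \<longrightarrow> \<epsilon> \<in> {1, -1} \<longrightarrow>
        flag_eq m T \<omega> (m - p - 1) (\<psi> (p + 1) (comm_wedge T (gs @ [g2, g1]) xs))
                                   (pm_scale \<epsilon> (basis_vec Ls)) \<longrightarrow>
        flag_eq m T \<omega> (m - p) (\<psi> p (comm_wedge T (gs @ [CBracket g1 g2]) xs))
                               (pm_scale \<epsilon> (basis_vec (Ls @ [last Ls \<inter> L_comm m \<omega> (CBracket g1 g2)])))"
      using psi unfolding psi_maps_def by blast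
    show ?thesis
      by (rule rule3[of ?p gs g2 g1 "[]" Ls \<epsilon>, unfolded q(2), rule_format, OF _ HOL.refl _ Ls e])
        (use lm tot eq in simp_all)
  qed
  hence fe: "flag_eq m T \<omega> (Suc q) (\<psi> (length ?hs) (comm_wedge T ?hs [])) (pm_scale \<epsilon> (basis_vec (Ls @ [L])))"
    unfolding Leq q(3) by simp
  have "\<epsilon> * flag_pairing m \<omega> (Ls @ [L]) Hs = base_sign * stage_vol Hs rs * forest_coeff T ?hs (set Hs) \<and>
        (forest_coeff T ?hs (set Hs) \<noteq> 0 \<longrightarrow> stage_vol Hs rs * stage_vol Hs rs = 1)"
    if Hs: "admissible (Suc q) Hs" and rs: "roots rs ?hs" for Hs rs
  proof -
    let ?R = "\<lambda>j. take j Hs @ drop (Suc j) Hs"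
    obtain rs' r where r: "rs = rs' @ [r]" "roots rs' gs" "r \<in> fst ` set_mset (comm_gens (CBracket g1 g2))"
      using rs unfolding roots_def list_all2_append2 list_all2_Cons2 by auto
    have lH: "length Hs = Suc q" and dH: "distinct Hs" and sH: "set Hs \<subseteq> hyps m T" using Hs unfolding admissible_def by blast+
    have lH': "length Hs + length gs + 1 = m" using lH lm by (simp add: q_def)
    have fc: "forest_coeff T ?hs (set Hs) = (\<Sum>j<Suc q. crossing T g1 g2 (Hs ! j) * forest_coeff T ?gs (set (?R j)))"
      unfolding forest_coeff_bracket conv_link[OF finite_set] lH[symmetric]
      by (rule sum_remove_nth[OF dH, of "\<lambda>e A. crossing T g1 g2 e * forest_coeff T ?gs A"])
    have adm: "admissible q (?R j)" if "j < Suc q" for j using admissible_remove[OF Hs, of j] that lH by simp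
    have V: "\<exists>t. stage_vol (?R j) t * stage_vol (?R j) t = 1 \<and>
        stage_vol Hs rs = (-1) ^ (q + j) * crossing T g1 g2 (Hs ! j) * stage_vol (?R j) t \<and> roots t ?gs"
      if j: "j < Suc q" and nz: "crossing T g1 g2 (Hs ! j) \<noteq> 0" "forest_coeff T ?gs (set (?R j)) \<noteq> 0" for j
    proof -
      \<comment> \<open>The edge passes q - j rows, a number of the same parity as the Laplace
        exponent q + j.\<close>
      have "(-1 :: complex) ^ (q + j) = (-1) ^ (q - j + 2 * j)" using j by (simp add: add.commute)
      hence sg: "(-1 :: complex) ^ (q - j) = (-1) ^ (q + j)" unfolding power_add power_mult by simp
      obtain r1 r2 where r12: "r1 \<in> fst ` set_mset (comm_gens g1)" "r2 \<in> fst ` set_mset (comm_gens g2)"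
        "stage_vol Hs (rs' @ [r]) = (-1) ^ (length Hs - Suc j) * crossing T g1 g2 (Hs ! j) * stage_vol (?R j) (rs' @ [r2, r1])"
        using stage_vol_edge[OF tot lH' _ nz r(2,3)] j lH by auto
      have "roots (rs' @ [r2, r1]) ?gs" using r(2) r12(1,2) unfolding roots_def by (intro list_all2_appendI) auto
      thus ?thesis using val[OF adm[OF j]] nz(2) r12(3) lH sg r(1) by (intro exI[of _ "rs' @ [r2, r1]"]) simp
    qed
    have cr: "crossing T g1 g2 e * crossing T g1 g2 e = cut m \<omega> (last Ls) e L" if e: "e \<in> set Hs" for e
    proof (cases "crossing T g1 g2 e = 0")
      case True
      have "last Ls \<inter> hyp_set m \<omega> e \<noteq> L"
      proof
        assume *: "last Ls \<inter> hyp_set m \<omega> e = L"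
        have "\<exists>x\<in>#comm_gens g1. \<exists>y\<in>#comm_gens g2. e = edge T x y \<and> fst x \<noteq> fst y"
          by (rule iffD1[OF cut_iff[OF tot] *[unfolded last L_def]]) (use e sH in blast)
        then obtain x y where "x \<in># comm_gens g1" "y \<in># comm_gens g2" "e = edge T x y" "fst x \<noteq> fst y" by blast
        hence "crossing T g1 g2 e = orient x y" "orient x y * orient x y = 1"
          using crossing_value[OF tot] orient_nonzero by simp_all
        thus False using True by simp
      qed
      thus ?thesis using True by (simp add: cut_def)
    next
      case False
      then obtain x y where xy: "x \<in># comm_gens g1" "y \<in># comm_gens g2" "e = edge T x y" "fst x \<noteq> fst y"
        using crossing_nonzeroD by blast
      have "last Ls \<inter> hyp_set m \<omega> e = L"
        unfolding last L_def xy(3) by (rule comp_space_inter_edge[OF tot xy(1,2,4)])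
      moreover have "crossing T g1 g2 e = orient x y" unfolding xy(3) by (rule crossing_value[OF tot xy(1,2,4)])
      ultimately show ?thesis using orient_nonzero[OF xy(4)] by (simp add: cut_def)
    qed
    have "\<epsilon> * flag_pairing m \<omega> (Ls @ [L]) Hs =
      (\<Sum>j<Suc q. (-1) ^ (q + j) * cut m \<omega> (last Ls) (Hs ! j) L * (\<epsilon> * flag_pairing m \<omega> Ls (?R j)))"
      by (subst flag_pairing_snoc[OF len lH L0 flags_psubset[OF Ls] L(2)], assumption)
        (simp add: sum_distrib_left mult_ac del: sum.lessThan_Suc)
    also have "\<dots> = (\<Sum>j<Suc q. base_sign * stage_vol Hs rs * (crossing T g1 g2 (Hs ! j) * forest_coeff T ?gs (set (?R j))))"
    proof (intro sum.cong HOL.refl)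
      fix j assume "j \<in> {..<Suc q}"
      hence j: "j < Suc q" by simp
      have c: "crossing T g1 g2 (Hs ! j) * crossing T g1 g2 (Hs ! j) = cut m \<omega> (last Ls) (Hs ! j) L"
        by (rule cr) (use j lH in simp)
      show "(-1) ^ (q + j) * cut m \<omega> (last Ls) (Hs ! j) L * (\<epsilon> * flag_pairing m \<omega> Ls (?R j)) =
        base_sign * stage_vol Hs rs * (crossing T g1 g2 (Hs ! j) * forest_coeff T ?gs (set (?R j)))"
      \<comment> \<open>If either factor vanishes, both sides are zero: one through the missing cut,
        the other through the invariant for the smaller tuple.\<close>
      proof (cases "crossing T g1 g2 (Hs ! j) = 0 \<or> forest_coeff T ?gs (set (?R j)) = 0")
        case True
        obtain t where "roots t ?gs" using roots_exist by blast
        with val[OF adm[OF j]] True c show ?thesis by auto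
      next
        case False
        with V[OF j] obtain t where t: "stage_vol Hs rs = (-1) ^ (q + j) * crossing T g1 g2 (Hs ! j) * stage_vol (?R j) t" "roots t ?gs"
          by blast
        show ?thesis unfolding conjunct1[OF val[OF adm[OF j] t(2)]] t(1) c[symmetric] by (simp only: mult_ac)
      qed
    qed
    also have "\<dots> = base_sign * stage_vol Hs rs * forest_coeff T ?hs (set Hs)" unfolding fc sum_distrib_left ..
    finally have 1: "\<epsilon> * flag_pairing m \<omega> (Ls @ [L]) Hs = base_sign * stage_vol Hs rs * forest_coeff T ?hs (set Hs)" .
    \<comment> \<open>A single nonzero term of the expansion already shows that the determinant is a
      sign.\<close>
    have "stage_vol Hs rs * stage_vol Hs rs = 1" if nz: "forest_coeff T ?hs (set Hs) \<noteq> 0"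
    proof -
      obtain j where j: "j < Suc q" "crossing T g1 g2 (Hs ! j) * forest_coeff T ?gs (set (?R j)) \<noteq> 0"
        using nz unfolding fc by (auto elim: sum.not_neutral_contains_not_neutral simp del: sum.lessThan_Suc)
      hence "crossing T g1 g2 (Hs ! j) \<noteq> 0" "forest_coeff T ?gs (set (?R j)) \<noteq> 0" by auto
      with V[OF j(1)] obtain t where t: "stage_vol (?R j) t * stage_vol (?R j) t = 1"
        "stage_vol Hs rs = (-1) ^ (q + j) * crossing T g1 g2 (Hs ! j) * stage_vol (?R j) t" by blast
      have "crossing T g1 g2 (Hs ! j) * crossing T g1 g2 (Hs ! j) = cut m \<omega> (last Ls) (Hs ! j) L"
        by (rule cr) (use j lH in simp)
      moreover have "cut m \<omega> (last Ls) (Hs ! j) L = 0 \<or> cut m \<omega> (last Ls) (Hs ! j) L = 1" by (simp add: cut_def)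
      ultimately have c1: "crossing T g1 g2 (Hs ! j) * crossing T g1 g2 (Hs ! j) = 1" using j(2) by auto
      have s1: "(-1 :: complex) ^ (q + j) * (-1) ^ (q + j) = 1" by (simp add: power_mult_distrib[symmetric])
      have "stage_vol Hs rs * stage_vol Hs rs = ((-1) ^ (q + j) * (-1) ^ (q + j)) *
        (crossing T g1 g2 (Hs ! j) * crossing T g1 g2 (Hs ! j)) * (stage_vol (?R j) t * stage_vol (?R j) t)"
        unfolding t(2) by (simp only: mult_ac)
      thus ?thesis unfolding s1 c1 t(1) by simp
    qed
    thus ?thesis using 1 by blast
  qed
  moreover have "Ls @ [L] \<in> flags m T \<omega> (Suc q)" using flags_snoc[OF Ls L(1) _ L(3)] L(2) by blast
  moreover have "last (Ls @ [L]) = comp_space ?hs" by (simp add: L_def)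
  ultimately show ?thesis unfolding stage_def q(1) using fe e by blast
qed

text \<open>The bar of a generator does not depend on its label, so all labels may be set to 0;
  adjacent exchanges then reach the wedge on which \<psi>_m is prescribed.\<close>

lemma stage_generators:
  assumes tot: "total_degree_ones m T gs" and gen: "\<And>g. g \<in> set gs \<Longrightarrow> \<exists>i k. g = CGen i k"
  shows "stage gs"
proof -
  define hs where "hs = map (\<lambda>g. CGen (lead g) 0) gs"
  have "image_mset fst (comm_gens g) = {#lead g#}" "tree_coeff T (CGen (lead g) 0) = tree_coeff T g" if g: "g \<in> set gs" for g
    using gen[OF g] by (elim exE, simp)+
  note lead = this
  have fst: "image_mset fst (total_gens hs) = image_mset fst (total_gens gs)"
    unfolding hs_def using lead(1) by (induction gs) simp_all
  have toth: "total_degree_ones m T hs"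
  proof -
    have snd: "snd x = 0" if "x \<in># total_gens hs" for x using that unfolding hs_def by (induction gs) auto
    have im: "image_mset fst (total_gens hs) = mset_set {1..m}" using tot fst unfolding total_degree_ones_iff by simp
    have "x \<in> leaves m T" if x: "x \<in># total_gens hs" for x
    proof -
      have "fst x \<in># image_mset fst (total_gens hs)" using x by simp
      hence "fst x \<in> {1..m}" unfolding im by simp
      thus ?thesis using snd[OF x] T_pos by (cases x) (simp add: leaves_def)
    qed
    thus ?thesis using im unfolding total_degree_ones_iff by blast
  qed
  have st: "stage hs"
  proof -
    let ?P = "\<lambda>gs. total_degree_ones m T gs \<and> stage gs" and ?b = "map (\<lambda>i. CGen i 0) [1..<Suc m]"
    have base: "total_gens ?b = image_mset (\<lambda>i. (i, 0)) (mset [1..<Suc m])"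
    proof -
      have "total_gens (map (\<lambda>i. CGen i 0) is) = image_mset (\<lambda>i. (i, 0)) (mset is)" for "is" by (induction "is") simp_all
      thus ?thesis .
    qed
    have tb: "total_degree_ones m T ?b"
      unfolding total_degree_ones_iff base using T_pos
      by (simp add: image_mset.compositionality o_def leaves_def image_subset_iff del: upt_Suc)
        (simp add: atLeastLessThanSuc_atLeastAtMost mset_upt del: upt_Suc)
    have "mset (map lead hs) = mset_set {1..m}"
    proof -
      have "image_mset fst (total_gens hs) = mset (map lead hs)" unfolding hs_def by (induction gs) simp_all
      thus ?thesis using toth unfolding total_degree_ones_iff by simp
    qed
    hence "mset (map (\<lambda>i. CGen i 0) (map lead hs)) = image_mset (\<lambda>i. CGen i 0) (mset_set {1..m})" by (simp only: mset_map)
    moreover have "map (\<lambda>i. CGen i 0) (map lead hs) = hs" unfolding hs_def by simp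
    ultimately have "mset ?b = mset hs"
      by (simp only: mset_map mset_upt atLeastLessThanSuc_atLeastAtMost)
    moreover have "?P (us @ y # x # vs)" if *: "?P (us @ x # y # vs)" for us x y vs
      using stage_swap[of us x y vs] * total_degree_ones_cong[of "us @ y # x # vs" "us @ x # y # vs" m T]
      by (simp add: ac_simps)
    ultimately have "?P hs" using adjacent_swap_induct[of ?P ?b hs] tb stage_base by blast
    thus ?thesis ..
  qed
  have len: "length hs = length gs" by (simp add: hs_def)
  have "comm_bar T (CGen i 0) = comm_bar T (CGen i k)" for i k
    using comm_bar_shift[of T k "CGen i 0"] comm_bar_shift[of T 0 "CGen i k"] by simp
  hence "map (comm_bar T) hs = map (comm_bar T) gs"
    unfolding hs_def map_map o_def using gen by (intro map_cong HOL.refl) (metis lead.simps(1))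
  hence 1: "comm_wedge T hs [] = comm_wedge T gs []" by (simp add: comm_wedge_def)
  have 2: "comp_space hs = comp_space gs"
  proof -
    have "L_comm m \<omega> (CGen i k) = Cspace m" for i k unfolding L_comm_def by auto
    hence "L_comm m \<omega> g = Cspace m" if g: "g \<in> set gs \<union> set hs" for g
    proof (cases "g \<in> set gs")
      case True
      with gen obtain i k where "g = CGen i k" by blast
      thus ?thesis using \<open>\<And>i k. L_comm m \<omega> (CGen i k) = Cspace m\<close> by simp
    next
      case False
      with g have "g \<in> set hs" by simp
      thus ?thesis using \<open>\<And>i k. L_comm m \<omega> (CGen i k) = Cspace m\<close> unfolding hs_def by auto
    qed
    thus ?thesis unfolding comp_space_def by auto
  qed
  have 3: "forest_coeff T hs = forest_coeff T gs"
    unfolding hs_def using lead(2) by (induction gs) (simp_all del: tree_coeff.simps)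
  have 4: "roots rs hs = roots rs gs" for rs
  proof -
    have "fst ` set_mset (comm_gens (CGen (lead g) 0)) = fst ` set_mset (comm_gens g)" if g: "g \<in> set gs" for g
    proof -
      have "set_mset (image_mset fst (comm_gens g)) = {lead g}" unfolding lead(1)[OF g] by simp
      thus ?thesis by simp
    qed
    thus ?thesis unfolding roots_def hs_def list_all2_conv_all_nth by auto
  qed
  show ?thesis using st unfolding stage_def len 1 2 3 4 .
qed

text \<open>Induction on the total size: some bracket is moved to the last place and opened into its
  two halves, which lowers the size.\<close>

theorem stage_all: "total_degree_ones m T gs \<Longrightarrow> stage gs"
proof (induction "sum_list (map size gs)" arbitrary: gs rule: less_induct)
  case less
  show ?case
  proof (cases "\<forall>g\<in>set gs. \<exists>i k. g = CGen i k")
    case True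
    thus ?thesis using stage_generators[OF less.prems] by blast
  next
    case False
    then obtain g where g: "g \<in> set gs" "\<And>i k. g \<noteq> CGen i k" by blast
    obtain g1 g2 where g12: "g = CBracket g1 g2" using g(2) by (cases g) blast+
    obtain us vs where gs: "gs = us @ CBracket g1 g2 # vs" using split_list[OF g(1)] g12 by blast
    have tot: "total_degree_ones m T ((us @ vs) @ [g2, g1])" "total_degree_ones m T ((us @ vs) @ [CBracket g1 g2])"
      using less.prems total_degree_ones_cong[of gs "(us @ vs) @ [g2, g1]"] total_degree_ones_cong[of gs "(us @ vs) @ [CBracket g1 g2]"]
      unfolding gs by (simp_all add: ac_simps)
    have "stage ((us @ vs) @ [g2, g1])" by (rule less.hyps[OF _ tot(1)]) (simp add: gs)
    hence st: "stage ((us @ vs) @ [CBracket g1 g2])" by (rule stage_bracket[OF tot(1)])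
    let ?P = "\<lambda>gs. total_degree_ones m T gs \<and> stage gs"
    have sw: "?P (us @ y # x # vs)" if *: "?P (us @ x # y # vs)" for us x y vs
      using stage_swap[of us x y vs] * total_degree_ones_cong[of "us @ y # x # vs" "us @ x # y # vs" m T]
      by (simp add: ac_simps)
    have "?P gs"
    proof (rule adjacent_swap_induct[of ?P "(us @ vs) @ [CBracket g1 g2]" gs])
      show "?P ((us @ vs) @ [CBracket g1 g2])" using tot(2) st by blast
      show "mset ((us @ vs) @ [CBracket g1 g2]) = mset gs" unfolding gs by simp
    qed (rule sw)
    thus ?thesis ..
  qed
qed

end

lemma tree_coeff_card: "tree_coeff T g A \<noteq> 0 \<Longrightarrow> finite A \<and> card A + 1 = size (comm_gens g)"
proof (induction g arbitrary: A)
  case (CGen i k)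
  thus ?case by (auto split: if_splits)
next
  case (CBracket u v)
  have fin: "finite A"
  proof (rule ccontr)
    assume "infinite A"
    thus False using CBracket.prems by (simp add: conv_infinite)
  qed
  obtain B where B: "B \<subseteq> A" "link T u v B \<noteq> 0" "conv (tree_coeff T u) (tree_coeff T v) (A - B) \<noteq> 0"
    using conv_nonzeroD[OF CBracket.prems[unfolded tree_coeff.simps]] by blast
  obtain C where C: "C \<subseteq> A - B" "tree_coeff T u C \<noteq> 0" "tree_coeff T v (A - B - C) \<noteq> 0" using conv_nonzeroD[OF B(3)] by blast
  have "card B = 1" using link_nonzeroD[OF B(2)] by auto
  moreover have "card (A - B) = card C + card (A - B - C)"
    using C(1) fin by (metis card_Diff_subset card_mono finite_Diff finite_subset le_add_diff_inverse)
  moreover have "card A = card B + card (A - B)"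
    using B(1) fin by (metis card_Diff_subset card_mono finite_subset le_add_diff_inverse)
  ultimately show ?case using CBracket.IH(1)[OF C(2)] CBracket.IH(2)[OF C(3)] fin by simp
qed

lemma inner_edges_cong: "comm_gens g = comm_gens h \<Longrightarrow> inner_edges T g = inner_edges T h"
  by (simp add: inner_edges_def)

lemma inner_edges_shift: "inner_edges T (shift T c g) = inner_edges T g"
proof (intro equalityI subsetI)
  fix e assume "e \<in> inner_edges T (shift T c g)"
  then obtain x y where xy: "e = edge T (case x of (i, k) \<Rightarrow> (i, (k + c) mod T)) (case y of (i, k) \<Rightarrow> (i, (k + c) mod T))"
    "x \<in># comm_gens g" "y \<in># comm_gens g" "fst x \<noteq> fst y"
    unfolding inner_edges_def comm_gens_shift by (auto simp: case_prod_beta')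
  thus "e \<in> inner_edges T g" unfolding edge_shift' using inner_edgesI by blast
next
  fix e assume "e \<in> inner_edges T g"
  then obtain x y where xy: "e = edge T x y" "x \<in># comm_gens g" "y \<in># comm_gens g" "fst x \<noteq> fst y"
    unfolding inner_edges_def by blast
  let ?s = "\<lambda>x. case x of (i, k) \<Rightarrow> (i, (k + c) mod T)"
  have "?s x \<in># comm_gens (shift T c g)" "?s y \<in># comm_gens (shift T c g)" "fst (?s x) \<noteq> fst (?s y)"
    using xy by (auto simp: comm_gens_shift case_prod_beta')
  from inner_edgesI[OF this, of T] show "e \<in> inner_edges T (shift T c g)" unfolding edge_shift' xy(1) .
qed

lemma HEq_inner_iff: "HEq i j k \<in> inner_edges T h \<longleftrightarrow>
    i < j \<and> (\<exists>a b. (i, a) \<in># comm_gens h \<and> (j, b) \<in># comm_gens h \<and> k = gain T a b)"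
proof
  assume "HEq i j k \<in> inner_edges T h"
  thus "i < j \<and> (\<exists>a b. (i, a) \<in># comm_gens h \<and> (j, b) \<in># comm_gens h \<and> k = gain T a b)"
  proof (rule inner_edges_orderedE)
    fix x y assume "HEq i j k = edge T x y" "x \<in># comm_gens h" "y \<in># comm_gens h" "fst x < fst y"
    thus ?thesis by (intro conjI exI[of _ "snd x"] exI[of _ "snd y"]) (simp_all add: edge_def)
  qed
next
  assume "i < j \<and> (\<exists>a b. (i, a) \<in># comm_gens h \<and> (j, b) \<in># comm_gens h \<and> k = gain T a b)"
  then obtain a b where "i < j" "(i, a) \<in># comm_gens h" "(j, b) \<in># comm_gens h" "k = gain T a b" by blast
  thus "HEq i j k \<in> inner_edges T h" using inner_edgesI[of "(i, a)" h "(j, b)" T] by (simp add: edge_def)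
qed

lemma gain_eq_iff: "0 < T \<Longrightarrow> b < T \<Longrightarrow> k < T \<Longrightarrow> gain T a b = k \<longleftrightarrow> (a + k) mod T = b"
  using gain_add[of b T a] gain_unique[of "gain T a b" T k a] gain_less[of T a b] by auto

lemma sum_unique_shift:
  fixes T b d :: nat
  assumes "0 < T" "d < T"
  shows "(\<Sum>c<T. if (b + c) mod T = d then (1 :: complex) else 0) = 1"
proof -
  have "(b + c) mod T = d \<longleftrightarrow> c = gain T b d" if "c < T" for c
    using gain_eq_iff[OF assms(1,2) that, of b] by auto
  hence "(\<Sum>c<T. if (b + c) mod T = d then (1 :: complex) else 0) = (\<Sum>c<T. if c = gain T b d then 1 else 0)"
    by (intro sum.cong) auto
  thus ?thesis using gain_less[OF assms(1), of b d] by (simp add: sum.delta)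
qed

lemma comm_gens_shift_0: "\<forall>x\<in>#comm_gens v. snd x < T \<Longrightarrow> comm_gens (shift T 0 v) = comm_gens v"
proof -
  assume "\<forall>x\<in>#comm_gens v. snd x < T"
  hence "image_mset (\<lambda>(i, k). (i, (k + 0) mod T)) (comm_gens v) = image_mset (\<lambda>x. x) (comm_gens v)"
    by (intro image_mset_cong) (auto simp: case_prod_beta')
  thus ?thesis unfolding comm_gens_shift by simp
qed

section \<open>Flags ending at the origin, and products of two pairings\<close>

context psi_family
begin

abbreviation X :: "hyp set" where "X \<equiv> hyps m T"

lemma X_finite: "finite X" by (rule finite_hyps)

text \<open>The sign of the tree that omits e, rooted at vertex 1. Putting \<open>unit 0\<close> in
  the place of e keeps the other rows where they are, so the signs for different e refer to one
  ordering of Hs.\<close>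

definition nu :: "hyp list \<Rightarrow> hyp \<Rightarrow> complex" where
  "nu Hs e = vol (m + 1) (map (\<lambda>H. if H = e then unit 0 else incidence H) Hs @ [unit 1])"

text \<open>The sign common to all terms of the last Laplace expansion. It enters both arguments of
  the flag form and cancels.\<close>

definition end_sign :: complex where
  "end_sign = (-1) ^ (m - 1) * base_sign"

lemma end_sign_sq: "end_sign * end_sign = 1"
proof -
  have "end_sign * end_sign = ((-1) ^ (m - 1) * (-1) ^ (m - 1)) * (base_sign * base_sign)"
    unfolding end_sign_def by (simp only: mult_ac)
  thus ?thesis unfolding base_sign_sq by (simp add: power_mult_distrib[symmetric])
qed

lemma stage_vol_nu:
  assumes Hs: "admissible m Hs" and j: "j < m"
  shows "stage_vol (take j Hs @ drop (Suc j) Hs) [1] = (-1) ^ j * nu Hs (Hs ! j)"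
proof -
  have len: "length Hs = m" and dis: "distinct Hs" using Hs unfolding admissible_def by blast+
  have Hj: "Hs = take j Hs @ Hs ! j # drop (Suc j) Hs" using id_take_nth_drop[of j Hs] len j by simp
  have "distinct (take j Hs @ Hs ! j # drop (Suc j) Hs)" using dis Hj by simp
  hence ne: "H \<noteq> Hs ! j" if "H \<in> set (take j Hs) \<union> set (drop (Suc j) Hs)" for H using that by auto
  let ?f = "\<lambda>H. if H = Hs ! j then unit 0 else incidence H"
  have "map ?f Hs = map ?f (take j Hs @ Hs ! j # drop (Suc j) Hs)" by (rule arg_cong[OF Hj])
  also have "\<dots> = map ?f (take j Hs) @ unit 0 # map ?f (drop (Suc j) Hs)" by simp
  also have "map ?f (take j Hs) = map incidence (take j Hs)" using ne by (intro map_cong) auto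
  also have "map ?f (drop (Suc j) Hs) = map incidence (drop (Suc j) Hs)" using ne by (intro map_cong) auto
  finally have f: "nu Hs (Hs ! j) = vol (m + 1) (map incidence (take j Hs) @ unit 0 # map incidence (drop (Suc j) Hs) @ [unit 1])"
    unfolding nu_def by simp
  have "stage_vol (take j Hs @ drop (Suc j) Hs) [1] =
    vol (m + 1) ([] @ unit 0 # map incidence (take j Hs) @ (map incidence (drop (Suc j) Hs) @ [unit 1]))"
    unfolding stage_vol_def by simp
  also have "\<dots> = (-1) ^ length (map incidence (take j Hs)) *
    vol (m + 1) ([] @ map incidence (take j Hs) @ unit 0 # (map incidence (drop (Suc j) Hs) @ [unit 1]))"
    by (rule vol_move) (use len j in simp)
  finally show ?thesis using len j unfolding f by simp
qed

lemma forest_single: "finite A \<Longrightarrow> forest_coeff T [g] A = tree_coeff T g A"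
  by (simp add: conv_one)

lemma total_fst: "total_degree_ones m T [g] \<Longrightarrow> image_mset fst (comm_gens g) = mset_set {1..m}"
    "total_degree_ones m T [g] \<Longrightarrow> fst ` set_mset (comm_gens g) = {1..m}"
    "total_degree_ones m T [g] \<Longrightarrow> set_mset (comm_gens g) \<subseteq> leaves m T"
    "total_degree_ones m T [g] \<Longrightarrow> size (comm_gens g) = m"
proof -
  assume t: "total_degree_ones m T [g]"
  show 1: "image_mset fst (comm_gens g) = mset_set {1..m}" and "set_mset (comm_gens g) \<subseteq> leaves m T"
    using t unfolding total_degree_ones_iff by simp_all
  show "fst ` set_mset (comm_gens g) = {1..m}" using multilinear_gens(3)[OF 1] by simp
  show "size (comm_gens g) = m" using arg_cong[OF 1, of size] by simp
qed

text \<open>A single commutator of degree [1^m] leaves a line through a point without zero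
  coordinates among the first m. A hyperplane contains this line, and then the labels force its
  exponent, or meets it in the origin.\<close>

lemma cut_zero_iff:
  assumes tot: "total_degree_ones m T [g]" and H: "H \<in> X"
  shows "comp_space [g] \<inter> hyp_set m \<omega> H = {0} \<longleftrightarrow> H \<notin> inner_edges T g"
proof
  assume eq: "comp_space [g] \<inter> hyp_set m \<omega> H = {0}"
  show "H \<notin> inner_edges T g"
  proof
    assume "H \<in> inner_edges T g"
    then obtain x y where xy: "H = edge T x y" "x \<in># comm_gens g" "y \<in># comm_gens g" "fst x \<noteq> fst y"
      unfolding inner_edges_def by blast
    have v: "indicator_vec g \<in> comp_space [g]" by (rule indicator_vec_comp[OF tot, of "[]" g "[]"]) simp
    have leaf: "\<omega> ^ snd x * indicator_vec g (fst x) = 1" if "x \<in># comm_gens g" for x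
      by (rule indicator_vec_leaf[OF total_fst(1)[OF tot] _ that]) simp
    have l: "x \<in> leaves m T" "y \<in> leaves m T" using total_fst(3)[OF tot] xy by blast+
    have "indicator_vec g \<in> hyp_set m \<omega> H"
      unfolding xy(1) edge_hyp_set[OF l xy(4)] leaf[OF xy(2)] leaf[OF xy(3)] using v unfolding comp_space_def by simp
    hence "indicator_vec g = 0" using v eq by blast
    thus False using leaf[OF xy(2)] by simp
  qed
next
  assume ni: "H \<notin> inner_edges T g"
  show "comp_space [g] \<inter> hyp_set m \<omega> H = {0}"
  proof (intro equalityI subsetI)
    fix t assume t: "t \<in> comp_space [g] \<inter> hyp_set m \<omega> H"
    hence tC: "t \<in> Cspace m" and tL: "t \<in> L_comm m \<omega> g" unfolding comp_space_def by auto
    obtain x0 where x0: "x0 \<in># comm_gens g" using lead_mem by blast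
    define c where "c = \<omega> ^ snd x0 * t (fst x0)"
    have c: "\<omega> ^ snd x * t (fst x) = c" if "x \<in># comm_gens g" for x
      using tL that x0 unfolding L_comm_iff c_def by blast
    have lab: "\<exists>a. (i, a) \<in># comm_gens g" if "i \<in> {1..m}" for i
      using that unfolding total_fst(2)[OF tot, symmetric] by auto
    have c0: "c = 0"
    proof (rule ccontr)
      assume nz: "c \<noteq> 0"
      show False
      proof (cases H)
        case (HZero i)
        hence "i \<in> {1..m}" using H by (auto simp: hyps_def)
        then obtain a where "(i, a) \<in># comm_gens g" using lab by blast
        thus False using c[of "(i, a)"] t nz HZero by simp
      next
        case (HEq i j k)
        hence ij: "i \<in> {1..m}" "j \<in> {1..m}" "i < j" using H by (auto simp: hyps_def)
        obtain a b where ab: "(i, a) \<in># comm_gens g" "(j, b) \<in># comm_gens g" using lab ij by blast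
        have "HEq i j k = edge T (i, a) (j, b)"
        proof (rule hyp_edge_of_form[where u = "\<lambda>i. t i / c"])
          show "HEq i j k \<in> X" using H HEq by simp
          show "(i, a) \<in> leaves m T" "(j, b) \<in> leaves m T" using ab total_fst(3)[OF tot] by blast+
          show "t i / c = \<omega> ^ k * (t j / c)" using t HEq by simp
          show "\<omega> ^ a * (t i / c) = 1" "\<omega> ^ b * (t j / c) = 1" using c[OF ab(1)] c[OF ab(2)] nz by simp_all
        qed
        thus False using ni inner_edgesI[OF ab, of T] ij(3) HEq by simp
      qed
    qed
    have "t i = 0" for i
    proof (cases "i \<in> {1..m}")
      case True
      then obtain a where a: "(i, a) \<in># comm_gens g" using lab by blast
      show ?thesis using c[OF a] c0 omega_nonzero by simp
    qed (use tC in \<open>simp add: Cspace_def\<close>)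
    thus "t \<in> {0}" by (simp add: fun_eq_iff)
  next
    fix t :: pt assume "t \<in> {0}"
    hence "t = 0" by simp
    thus "t \<in> comp_space [g] \<inter> hyp_set m \<omega> H"
      unfolding comp_space_def L_comm_iff hyp_set_form by (auto simp: Cspace_def hyp_form_linear)
  qed
qed

text \<open>The rule for the enveloping algebra appends the origin to the flag of g. The Laplace
  expansion then runs over the hyperplane outside the tree, which has to avoid the line of
  g.\<close>

lemma psi0_pairing:
  assumes tot: "total_degree_ones m T [g]" and Hs: "admissible m Hs"
  shows "pairing m \<omega> (psi0 \<psi> (comm_bar T g)) Hs =
      end_sign * (\<Sum>e\<in>set Hs. if e \<in> inner_edges T g then 0 else nu Hs e * tree_coeff T g (set Hs - {e}))"
    and "e \<in> set Hs \<Longrightarrow> tree_coeff T g (set Hs - {e}) \<noteq> 0 \<Longrightarrow> nu Hs e * nu Hs e = 1"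
proof -
  define q where "q = m - 1"
  have mq: "m = Suc q" using m_pos by (simp add: q_def)
  have "stage [g]" by (rule stage_all[OF tot])
  then obtain \<epsilon> Ls where e: "\<epsilon> \<in> {1, -1}" and Ls: "Ls \<in> flags m T \<omega> q"
    and eq: "flag_eq m T \<omega> q (\<psi> 1 (comm_wedge T [g] [])) (pm_scale \<epsilon> (basis_vec Ls))"
    and last: "last Ls = comp_space [g]"
    and val: "\<And>Hs rs. admissible q Hs \<Longrightarrow> roots rs [g] \<Longrightarrow>
        \<epsilon> * flag_pairing m \<omega> Ls Hs = base_sign * stage_vol Hs rs * forest_coeff T [g] (set Hs) \<and>
        (forest_coeff T [g] (set Hs) \<noteq> 0 \<longrightarrow> stage_vol Hs rs * stage_vol Hs rs = 1)"
  proof -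
    have "length [g] = 1" by simp
    from that show ?thesis using \<open>stage [g]\<close> unfolding stage_def \<open>length [g] = 1\<close> q_def[symmetric] by blast
  qed
  have len: "length Ls = Suc q" and L0: "Ls ! 0 = Cspace m" using Ls unfolding flags_def by blast+
  have lH: "length Hs = Suc q" and dH: "distinct Hs" and sH: "set Hs \<subseteq> X"
    using Hs mq unfolding admissible_def by simp_all
  let ?R = "\<lambda>j. take j Hs @ drop (Suc j) Hs"
  have adm: "admissible q (?R j)" if "j < Suc q" for j using admissible_remove[OF Hs, of j] that lH mq by simp
  \<comment> \<open>Every vertex is a possible root, since g contains all indices; vertex 1 exists
    because m > 0.\<close>
  have roots: "roots [1] [g]" using total_fst(2)[OF tot] m_pos unfolding roots_def by simp
  have dropset: "set (?R j) = set Hs - {Hs ! j}" if "j < Suc q" for j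
  proof -
    have "distinct (take j Hs @ Hs ! j # drop (Suc j) Hs)" "set Hs = set (take j Hs @ Hs ! j # drop (Suc j) Hs)"
      using dH id_take_nth_drop[of j Hs] that lH by simp_all
    thus ?thesis by auto
  qed
  show nu1: "nu Hs e * nu Hs e = 1" if eH: "e \<in> set Hs" and nz: "tree_coeff T g (set Hs - {e}) \<noteq> 0"
  proof -
    obtain j where j: "j < Suc q" "e = Hs ! j" using eH lH by (auto simp: in_set_conv_nth)
    have "forest_coeff T [g] (set (?R j)) \<noteq> 0"
      unfolding dropset[OF j(1)] using nz j(2) forest_single[of "set Hs - {e}" g] by simp
    hence "stage_vol (?R j) [1] * stage_vol (?R j) [1] = 1" using val[OF adm[OF j(1)] roots] by blast
    hence "((-1) ^ j * (-1) ^ j) * (nu Hs e * nu Hs e) = 1"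
      using stage_vol_nu[OF Hs, of j] j mq by (simp add: mult_ac)
    thus ?thesis by (simp add: power_mult_distrib[symmetric])
  qed
  define L where "L = last Ls \<inter> L0_comm m g"
  have L: "L = {0}"
  proof -
    have "t = 0" if "t \<in> L0_comm m g" for t
    proof
      fix i
      show "t i = 0 i"
      proof (cases "i \<in> {1..m}")
        case True
        then obtain a where "(i, a) \<in># comm_gens g" unfolding total_fst(2)[OF tot, symmetric] by auto
        thus ?thesis using that unfolding L0_comm_def by auto
      qed (use that in \<open>simp add: L0_comm_def Cspace_def\<close>)
    qed
    moreover have "(0 :: pt) \<in> last Ls \<inter> L0_comm m g"
      unfolding last comp_space_def L_comm_iff L0_comm_def by (auto simp: Cspace_def)
    ultimately show ?thesis unfolding L_def by blast
  qed
  have "flag_eq m T \<omega> m (\<psi> 0 (comm_wedge T [] [g])) (pm_scale \<epsilon> (basis_vec (Ls @ [last Ls \<inter> L0_comm m g])))"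
  proof -
    have rule2: "\<And>p gs g1 xs Ls \<epsilon>.
        p + 1 \<le> m \<longrightarrow> length gs = p \<longrightarrow> total_degree_ones m T (gs @ [g1] @ xs) \<longrightarrow>
        Ls \<in> flags m T \<omega> (m - p - 1) \<longrightarrow> \<epsilon> \<in> {1, -1} \<longrightarrow>
        flag_eq m T \<omega> (m - p - 1) (\<psi> (p + 1) (comm_wedge T (gs @ [g1]) xs))
                                   (pm_scale \<epsilon> (basis_vec Ls)) \<longrightarrow>
        flag_eq m T \<omega> (m - p) (\<psi> p (comm_wedge T gs (g1 # xs)))
                               (pm_scale \<epsilon> (basis_vec (Ls @ [last Ls \<inter> L0_comm m g1])))"
      using psi unfolding psi_maps_def by blast
    have "flag_eq m T \<omega> (m - 0) (\<psi> 0 (comm_wedge T [] [g])) (pm_scale \<epsilon> (basis_vec (Ls @ [last Ls \<inter> L0_comm m g])))"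
      by (rule rule2[of 0 "[]" g "[]" Ls \<epsilon>, rule_format, OF _ _ _ _ e]) (use m_pos tot Ls eq in \<open>simp_all add: q_def\<close>)
    thus ?thesis by simp
  qed
  hence "pairing m \<omega> (psi0 \<psi> (comm_bar T g)) Hs = pairing m \<omega> (pm_scale \<epsilon> (basis_vec (Ls @ [L]))) Hs"
    unfolding psi0_def L_def comm_wedge_def using lH mq sH by (intro pairing_flag_eq) simp_all
  also have "\<dots> = \<epsilon> * flag_pairing m \<omega> (Ls @ [L]) Hs" by (simp add: pairing_scale pairing_basis)
  also have "\<dots> = (\<Sum>j<Suc q. (-1) ^ (q + j) * cut m \<omega> (last Ls) (Hs ! j) L * (\<epsilon> * flag_pairing m \<omega> Ls (?R j)))"
  proof -
    obtain x0 where x0: "x0 \<in># comm_gens g" using lead_mem by blast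
    have "indicator_vec g \<in> comp_space [g]" by (rule indicator_vec_comp[OF tot, of "[]" g "[]"]) simp
    moreover have "\<omega> ^ snd x0 * indicator_vec g (fst x0) = 1"
      by (rule indicator_vec_leaf[OF total_fst(1)[OF tot] _ x0]) simp
    hence "indicator_vec g \<noteq> 0" by auto
    moreover have "L \<subseteq> last Ls" unfolding L_def by blast
    ultimately have Lp: "L \<subset> last Ls" unfolding L last by blast
    show ?thesis by (subst flag_pairing_snoc[OF len lH L0 flags_psubset[OF Ls] Lp], assumption)
        (simp add: sum_distrib_left mult_ac del: sum.lessThan_Suc)
  qed
  also have "\<dots> = (\<Sum>j<length Hs. end_sign * (if Hs ! j \<in> inner_edges T g then 0 else nu Hs (Hs ! j) * tree_coeff T g (set (?R j))))"
    unfolding lH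
  proof (intro sum.cong HOL.refl)
    fix j assume "j \<in> {..<Suc q}"
    hence j: "j < Suc q" by simp
    have c: "cut m \<omega> (last Ls) (Hs ! j) L = (if Hs ! j \<in> inner_edges T g then 0 else 1)"
    proof -
      have "Hs ! j \<in> X" using j lH sH nth_mem[of j Hs] by auto
      from cut_zero_iff[OF tot this] show ?thesis unfolding cut_def last L by simp
    qed
    have v: "\<epsilon> * flag_pairing m \<omega> Ls (?R j) = base_sign * ((-1) ^ j * nu Hs (Hs ! j)) * tree_coeff T g (set (?R j))"
      using conjunct1[OF val[OF adm[OF j] roots]] stage_vol_nu[OF Hs, of j] j mq
      unfolding forest_single[OF finite_set] by simp
    have s: "(-1 :: complex) ^ (q + j) * (-1) ^ j = (-1) ^ (m - 1)"
      by (simp add: power_add mult.assoc power_mult_distrib[symmetric] q_def)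
    show "(-1) ^ (q + j) * cut m \<omega> (last Ls) (Hs ! j) L * (\<epsilon> * flag_pairing m \<omega> Ls (?R j)) =
      end_sign * (if Hs ! j \<in> inner_edges T g then 0 else nu Hs (Hs ! j) * tree_coeff T g (set (?R j)))"
      unfolding c v end_sign_def s[symmetric] by simp
  qed
  also have "\<dots> = end_sign * (\<Sum>e\<in>set Hs. if e \<in> inner_edges T g then 0 else nu Hs e * tree_coeff T g (set Hs - {e}))"
    unfolding sum_distrib_left
    by (rule sum_remove_nth[OF dH, of "\<lambda>e A. end_sign * (if e \<in> inner_edges T g then 0 else nu Hs e * tree_coeff T g A)", symmetric])
  finally show "pairing m \<omega> (psi0 \<psi> (comm_bar T g)) Hs =
      end_sign * (\<Sum>e\<in>set Hs. if e \<in> inner_edges T g then 0 else nu Hs e * tree_coeff T g (set Hs - {e}))" .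
qed

text \<open>A potential on the vertices, constant along the edges of \<open>A\<close>; it measures how a further edge joins
  the components of the forest \<open>A\<close>.\<close>

definition ell :: "hyp set \<Rightarrow> nat \<Rightarrow> complex" where
  "ell A = (let L = (SOME L. distinct L \<and> set L = A) in (\<lambda>i. vol (m + 1) (map incidence L @ [unit i, unit 0, unit 1])))"

lemma ellE:
  assumes "A \<subseteq> X" "card A + 2 = m"
  obtains L where "admissible (m - 2) L" "set L = A" "\<And>i. ell A i = vol (m + 1) (map incidence L @ [unit i, unit 0, unit 1])"
proof -
  have "finite A" using assms(1) X_finite finite_subset by blast
  hence "\<exists>L. distinct L \<and> set L = A" using finite_distinct_list by blast
  hence L: "distinct (SOME L. distinct L \<and> set L = A)" "set (SOME L. distinct L \<and> set L = A) = A" by (metis (mono_tags, lifting) someI_ex)+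
  have "length (SOME L. distinct L \<and> set L = A) = m - 2" using distinct_card[OF L(1)] L(2) assms(2) by simp
  thus ?thesis using that[of "SOME L. distinct L \<and> set L = A"] L assms(1) by (simp add: admissible_def ell_def Let_def)
qed

lemma ell_edge:
  assumes "A \<subseteq> X" "card A + 2 = m"
  shows "\<forall>e\<in>A. edge_diff (ell A) e = 0"
proof
  fix e assume e: "e \<in> A"
  obtain L where L: "admissible (m - 2) L" "set L = A" "\<And>i. ell A i = vol (m + 1) (map incidence L @ [unit i, unit 0, unit 1])"
    using ellE[OF assms] by blast
  obtain k where k: "k < length L" "L ! k = e" using e L(2) by (auto simp: in_set_conv_nth)
  have len: "length L = m - 2" using L(1) unfolding admissible_def by blast
  have el: "ell A = (\<lambda>i. vol (m + 1) (map incidence L @ unit i # [unit 0, unit 1]))" using L(3) by blast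
  have "edge_diff (ell A) e = vol (m + 1) (map incidence L @ incidence e # [unit 0, unit 1])"
    unfolding el by (rule vol_incidence[symmetric]) (use len in simp)
  also have "\<dots> = 0"
    by (rule vol_identical[of k _ "length L"]) (use k len in \<open>auto simp: nth_append\<close>)
  finally show "edge_diff (ell A) e = 0" .
qed

lemma ell_one:
  assumes "A \<subseteq> X" "card A + 2 = m"
  shows "ell A 1 = 0"
proof -
  obtain L where L: "admissible (m - 2) L" "set L = A" "\<And>i. ell A i = vol (m + 1) (map incidence L @ [unit i, unit 0, unit 1])"
    using ellE[OF assms] by blast
  have len: "length L = m - 2" using L(1) unfolding admissible_def by blast
  show ?thesis unfolding L(3)
    by (rule vol_identical[of "length L" _ "length L + 2"]) (use assms(2) len in \<open>auto simp: nth_append\<close>)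
qed

text \<open>The two determinants differ only in the places of e and e'. Moving the common forest to
  the front costs the same sign in both; the remaining rows give the two coboundaries, and one
  exchange of rows gives the minus sign.\<close>

lemma nu_ell:
  assumes Hs: "admissible m Hs" and e: "e \<in> set Hs" "e' \<in> set Hs" "e \<noteq> e'"
  shows "nu Hs e * nu Hs e' = - (edge_diff (ell (set Hs - {e} - {e'})) e * edge_diff (ell (set Hs - {e} - {e'})) e')"
proof -
  let ?A = "set Hs - {e} - {e'}"
  have lH: "length Hs = m" and dH: "distinct Hs" and sH: "set Hs \<subseteq> X" using Hs unfolding admissible_def by blast+
  have "card (set Hs) = m" using distinct_card[OF dH] lH by simp
  moreover have "card {e, e'} \<le> card (set Hs)" by (rule card_mono) (use e in auto)
  ultimately have A: "?A \<subseteq> X" "card ?A + 2 = m" using e sH by auto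
  obtain L where L: "admissible (m - 2) L" "set L = ?A" "\<And>i. ell ?A i = vol (m + 1) (map incidence L @ [unit i, unit 0, unit 1])"
    using ellE[OF A] by blast
  have len: "length L = m - 2" and dL: "distinct L" using L(1) unfolding admissible_def by blast+
  \<comment> \<open>\<open>Some\<close> stands for a hyperplane and \<open>None\<close> for the
    root, so that one permutation serves the row functions of e and of e'.\<close>
  let ?x = "map Some Hs @ [None]" and ?y = "map Some L @ [Some e, Some e', None]"
  let ?f = "\<lambda>e z. case z of Some H \<Rightarrow> if H = e then unit 0 else incidence H | None \<Rightarrow> unit 1"
  have "distinct ?x" "distinct ?y" "set ?x = set ?y" using dH dL L(2) e by (auto simp: distinct_map)
  hence "mset ?y = mset ?x" by (simp only: set_eq_iff_mset_eq_distinct)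
  then obtain s where s: "s \<in> {1, -1}" "\<And>f. vol (m + 1) (map f ?x) = s * vol (m + 1) (map f ?y)"
    using vol_mset[of ?y ?x "m + 1"] len A(2) by fastforce
  have nux: "nu Hs z = vol (m + 1) (map (?f z) ?x)" for z unfolding nu_def by (simp add: o_def)
  have Lne: "map (\<lambda>x. if x = z then unit 0 else incidence x) L = map incidence L" if "z \<in> {e, e'}" for z
    using that L(2) by (intro map_cong) auto
  have el: "ell ?A = (\<lambda>i. vol (m + 1) (map incidence L @ unit i # [unit 0, unit 1]))" using L(3) by blast
  have ed: "vol (m + 1) (map incidence L @ incidence z # [unit 0, unit 1]) = edge_diff (ell ?A) z" for z
    unfolding el by (rule vol_incidence) (use len in simp)
  have 1: "map (?f e) ?y = map incidence L @ unit 0 # incidence e' # [unit 1]" and 2: "map (?f e') ?y = map incidence L @ incidence e # [unit 0, unit 1]"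
    using e(3) Lne by (simp_all add: o_def)
  have "vol (m + 1) (map incidence L @ unit 0 # incidence e' # [unit 1]) = - vol (m + 1) (map incidence L @ incidence e' # unit 0 # [unit 1])"
    by (rule vol_swap) (use len A(2) in simp_all)
  hence "nu Hs e = - (s * edge_diff (ell ?A) e')" "nu Hs e' = s * edge_diff (ell ?A) e"
    unfolding nux s(2) 1 2 ed by simp_all
  thus ?thesis using s(1) by auto
qed

text \<open>A tree of g with all its edges in h forces the labels of h to be a rotation of those of
  g, and rotations have the same edges.\<close>

lemma inner_edges_eq:
  assumes g: "total_degree_ones m T [g]" and h: "total_degree_ones m T [h]"
    and A: "tree_coeff T g A \<noteq> 0" "A \<subseteq> inner_edges T h"
  shows "inner_edges T h = inner_edges T g"
proof -
  have lt: "\<forall>x\<in>#comm_gens h. snd x < T" using total_fst(3)[OF h] by (auto simp: leaves_def)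
  obtain s where "comm_gens h = comm_gens (shift T s g)"
    using tree_coeff_labels[OF T_pos total_fst(1)[OF g] total_fst(1)[OF h] _ lt A(1) tree_coeff_inner[OF A(1)] A(2)] by auto
  thus ?thesis using inner_edges_cong inner_edges_shift by metis
qed

text \<open>Between the two components the potential jumps by a sign. One component contains vertex
  1, where the potential is zero; on the other its value is, up to the order of the rows, the
  determinant of a rooted forest, whose square is known from \<open>stage\<close>.\<close>

lemma ell_lead_sq:
  assumes tot: "total_degree_ones m T [v, u]" and A: "A \<subseteq> X" "card A + 2 = m"
    and nz: "conv (tree_coeff T u) (tree_coeff T v) A \<noteq> 0"
  shows "(ell A (lead u) - ell A (lead v)) * (ell A (lead u) - ell A (lead v)) = 1"
    and "x \<in># comm_gens u \<Longrightarrow> ell A (fst x) = ell A (lead u)"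
    and "x \<in># comm_gens v \<Longrightarrow> ell A (fst x) = ell A (lead v)"
proof -
  obtain B where B: "B \<subseteq> A" "tree_coeff T u B \<noteq> 0" "tree_coeff T v (A - B) \<noteq> 0" using conv_nonzeroD[OF nz] by blast
  have e: "\<forall>e\<in>B. edge_diff (ell A) e = 0" "\<forall>e\<in>A - B. edge_diff (ell A) e = 0" using ell_edge[OF A] B(1) by blast+
  show u: "ell A (fst x) = ell A (lead u)" if "x \<in># comm_gens u" for x by (rule tree_coeff_connected[OF B(2) e(1) that])
  show v: "ell A (fst x) = ell A (lead v)" if "x \<in># comm_gens v" for x by (rule tree_coeff_connected[OF B(3) e(2) that])
  obtain L where L: "admissible (m - 2) L" "set L = A" "\<And>i. ell A i = vol (m + 1) (map incidence L @ [unit i, unit 0, unit 1])"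
    using ellE[OF A] by blast
  have len: "length L = m - 2" using L(1) unfolding admissible_def by blast
  have st: "stage_vol L rs * stage_vol L rs = 1" if "roots rs [v, u]" for rs
  proof -
    have "finite A" using A(1) X_finite finite_subset by blast
    hence "forest_coeff T [v, u] (set L) = conv (tree_coeff T v) (tree_coeff T u) A"
      unfolding L(2) forest_coeff.simps conv_assoc[symmetric] by (rule conv_one)
    hence "forest_coeff T [v, u] (set L) \<noteq> 0" using nz by (simp add: conv_commute)
    moreover have "length [v, u] = 2" by simp
    moreover have "stage [v, u]" by (rule stage_all[OF tot])
    ultimately show ?thesis using that L(1) unfolding stage_def \<open>length [v, u] = 2\<close> by blast
  qed
  have sq: "vol (m + 1) (map incidence L @ [unit i, unit 0, unit 1]) * vol (m + 1) (map incidence L @ [unit i, unit 0, unit 1])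
      = stage_vol L [a, b] * stage_vol L [a, b]" if ab: "{#a, b#} = {#i, 1#}" for i a b
  proof -
    let ?x = "map incidence L @ [unit i, unit 0, unit 1]" and ?y = "unit 0 # map incidence L @ [unit b, unit a]"
    have "{#unit a, unit b#} = {#unit i, unit 1#}" using arg_cong[OF ab, of "image_mset unit"] by simp
    hence "mset ?x = mset ?y" by (simp add: add_mset_commute)
    moreover have "length ?x = m + 1" using len A(2) by simp
    ultimately obtain s where "s \<in> {1, -1}" "\<And>f. vol (m + 1) (map f ?y) = s * vol (m + 1) (map f ?x)" using vol_mset by blast
    from this(1) this(2)[of "\<lambda>x. x"] have "vol (m + 1) ?y * vol (m + 1) ?y = vol (m + 1) ?x * vol (m + 1) ?x" by auto
    thus ?thesis by (simp add: stage_vol_def)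
  qed
  have one: "1 \<in> fst ` set_mset (comm_gens u) \<or> 1 \<in> fst ` set_mset (comm_gens v)"
  proof -
    have "image_mset fst (total_gens [v, u]) = mset_set {1..m}" using tot unfolding total_degree_ones_iff by blast
    from multilinear_gens(3)[OF this] show ?thesis using m_pos by (auto simp: image_Un)
  qed
  note l1 = ell_one[OF A]
  show "(ell A (lead u) - ell A (lead v)) * (ell A (lead u) - ell A (lead v)) = 1"
  proof (cases "1 \<in> fst ` set_mset (comm_gens u)")
    case True
    then obtain x where "x \<in># comm_gens u" "fst x = 1" by auto
    hence "ell A (lead u) = 0" using u[of x] l1 by simp
    hence "(ell A (lead u) - ell A (lead v)) * (ell A (lead u) - ell A (lead v)) = ell A (lead v) * ell A (lead v)" by simp
    also have "\<dots> = stage_vol L [lead v, 1] * stage_vol L [lead v, 1]" unfolding L(3) by (rule sq) simp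
    also have "\<dots> = 1" by (rule st) (use True lead_mem[of v] in \<open>simp add: roots_def\<close>)
    finally show ?thesis .
  next
    case False
    then obtain x where x: "x \<in># comm_gens v" "fst x = 1" using one by auto
    hence "ell A (lead v) = 0" using v[of x] l1 by simp
    hence "(ell A (lead u) - ell A (lead v)) * (ell A (lead u) - ell A (lead v)) = ell A (lead u) * ell A (lead u)" by simp
    also have "\<dots> = stage_vol L [1, lead u] * stage_vol L [1, lead u]" unfolding L(3) by (rule sq) simp
    also have "\<dots> = 1" by (rule st) (use False one lead_mem[of u] in \<open>simp add: roots_def\<close>)
    finally show ?thesis .
  qed
qed

text \<open>A hyperplane joining an index of u to an index of v has the gain prescribed by exactly
  one rotation c of v. The value c = 0 means that it belongs to h itself; this leaves c from 1 to T
  - 1 on the right.\<close>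

lemma crossing_shift_sum:
  assumes tot: "total_degree_ones m T [h]" and uv: "comm_gens u + comm_gens v = comm_gens h" and e: "e \<in> X"
    and lu: "\<And>x. x \<in># comm_gens u \<Longrightarrow> l (fst x) = lu" and lv: "\<And>x. x \<in># comm_gens v \<Longrightarrow> l (fst x) = lv"
    and sq: "(lu - lv) * (lu - lv) = 1"
  shows "(if e \<in> inner_edges T h then 0 else edge_diff l e * (lu - lv)) = (\<Sum>c\<in>{1..<T}. crossing T u (shift T c v) e)"
proof (cases e)
  case (HZero i)
  have "crossing T u (shift T c v) e = 0" for c
  proof (rule ccontr)
    assume "crossing T u (shift T c v) e \<noteq> 0"
    then obtain x y where "e = edge T x y" using crossing_nonzeroD by blast
    thus False using HZero by (simp add: edge_def split: if_splits)
  qed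
  thus ?thesis using HZero by simp
next
  case (HEq i j k)
  have ij: "i \<in> {1..m}" "j \<in> {1..m}" "i < j" "k < T" using e HEq by (auto simp: hyps_def)
  let ?h = "\<lambda>c. CBracket u (shift T c v)" and ?U = "fst ` set_mset (comm_gens u)" and ?V = "fst ` set_mset (comm_gens v)"
  define d where "d = edge_diff (\<lambda>i. if i \<in> ?U then 1 else (0 :: complex)) e"
  have fst: "image_mset fst (comm_gens (?h c)) = mset_set {1..m}" for c
    using total_fst(1)[OF tot] unfolding uv[symmetric] by (simp add: fst_comm_gens_shift)
  have UV: "?U \<union> ?V = {1..m}" "?U \<inter> ?V = {}"
    using total_fst(2)[OF tot] multilinear_union(3)[of "comm_gens u" "comm_gens v" "{1..m}"] total_fst(1)[OF tot]
    unfolding uv[symmetric] by (auto simp: image_Un)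
  have lt: "snd x < T" if "x \<in># comm_gens u \<or> x \<in># comm_gens v" for x
    using total_fst(3)[OF tot] that unfolding uv[symmetric] by (auto simp: leaves_def)
  have inj: "inj_on fst (set_mset (comm_gens u + comm_gens v))"
    unfolding uv using multilinear_gens(2)[OF total_fst(1)[OF tot]] by simp
  have cr: "crossing T u (shift T c v) e = (if e \<in> inner_edges T (?h c) then d else 0)" for c
  proof (cases "e \<in> inner_edges T (?h c)")
    case True
    then obtain x y where xy: "e = edge T x y" "x \<in># comm_gens (?h c)" "y \<in># comm_gens (?h c)" "fst x \<noteq> fst y"
      unfolding inner_edges_def by blast
    have "crossing T u (shift T c v) (edge T x y) = edge_diff (\<lambda>i. if i \<in> ?U then 1 else 0) (edge T x y)"
      by (rule crossing_edge[of _ _ "{1..m}"]) (use xy fst[of c] in simp_all)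
    thus ?thesis using True xy(1) by (simp add: d_def)
  next
    case False
    have "crossing T u (shift T c v) e = 0"
    proof (rule ccontr)
      assume "crossing T u (shift T c v) e \<noteq> 0"
      then obtain x y where "x \<in># comm_gens u" "y \<in># comm_gens (shift T c v)" "e = edge T x y" "fst x \<noteq> fst y"
        using crossing_nonzeroD by blast
      thus False using False inner_edgesI[of x "?h c" y T] by simp
    qed
    thus ?thesis using False by simp
  qed
  have h0: "inner_edges T (?h 0) = inner_edges T h"
    by (rule inner_edges_cong) (use comm_gens_shift_0[of v T] lt uv in simp)
  \<comment> \<open>The potential is affine in the indicator of u, so its coboundary is lu - lv
    times the one computed by \<open>crossing\<close>.\<close>
  have l: "l p = lv + (lu - lv) * (if p \<in> ?U then 1 else 0)" if "p \<in> {1..m}" for p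
  proof (cases "p \<in> ?U")
    case True
    thus ?thesis using lu by auto
  next
    case False
    hence "p \<in> ?V" using that UV(1) by blast
    thus ?thesis using False lv by auto
  qed
  have "edge_diff l e = (lu - lv) * d" 
    unfolding d_def HEq edge_diff.simps l[OF ij(1)] l[OF ij(2)] by (simp only: add_diff_cancel_left right_diff_distrib)
  hence "edge_diff l e * (lu - lv) = d * ((lu - lv) * (lu - lv))" by (simp only: mult_ac)
  hence lhs: "edge_diff l e * (lu - lv) = d" using sq by simp
  show ?thesis
  proof (cases "d = 0")
    case True
    thus ?thesis unfolding lhs cr by (simp cong: if_cong)
  next
    case False
    have shift_mem: "(p, b) \<in># comm_gens (shift T c v) \<longleftrightarrow> (\<exists>b'. (p, b') \<in># comm_gens v \<and> b = (b' + c) mod T)" for p b c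
      unfolding comm_gens_shift by force
    have nshift: "(p, b) \<notin># comm_gens (shift T c v)" if "p \<in> ?U" for p b c
    proof
      assume "(p, b) \<in># comm_gens (shift T c v)"
      then obtain b' where "(p, b') \<in># comm_gens v" using shift_mem by blast
      hence "p \<in> ?V" by force
      thus False using that UV(2) by blast
    qed
    have nU: "(p, b) \<notin># comm_gens u" if "p \<in> ?V" for p b
    proof
      assume "(p, b) \<in># comm_gens u"
      hence "p \<in> ?U" by force
      thus False using that UV(2) by blast
    qed
    have uni: "b = b'" if "(p, b) \<in># comm_gens u + comm_gens v" "(p, b') \<in># comm_gens u + comm_gens v" for p b b'
      using inj_onD[OF inj, of "(p, b)" "(p, b')"] that by simp
    \<comment> \<open>The edge has one end in u and the other in v. Each of the two orders gives a
      congruence modulo T with a single solution c.\<close>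
    have one: "(\<Sum>c<T. if e \<in> inner_edges T (?h c) then (1 :: complex) else 0) = 1"
    proof (cases "i \<in> ?U")
      case True
      have "j \<notin> ?U"
      proof
        assume "j \<in> ?U"
        hence "d = 0" using True unfolding d_def HEq by simp
        thus False using False by simp
      qed
      hence j: "j \<in> ?V" using UV(1) ij by blast
      obtain a b where ab: "(i, a) \<in># comm_gens u" "(j, b) \<in># comm_gens v" using True j by auto
      have "e \<in> inner_edges T (?h c) \<longleftrightarrow> (b + c) mod T = (a + k) mod T" for c
      proof -
        have "e \<in> inner_edges T (?h c) \<longleftrightarrow> k = gain T a ((b + c) mod T)"
          unfolding HEq HEq_inner_iff
        proof
          assume "i < j \<and> (\<exists>a b. (i, a) \<in># comm_gens (?h c) \<and> (j, b) \<in># comm_gens (?h c) \<and> k = gain T a b)"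
          then obtain a' b' where *: "(i, a') \<in># comm_gens (?h c)" "(j, b') \<in># comm_gens (?h c)" "k = gain T a' b'" by blast
          have "(i, a') \<in># comm_gens u" using *(1) nshift[OF True] by auto
          hence a': "a' = a" using uni[of i a' a] ab(1) by simp
          have "(j, b') \<in># comm_gens (shift T c v)" using *(2) nU[OF j] by auto
          then obtain b'' where "(j, b'') \<in># comm_gens v" "b' = (b'' + c) mod T" using shift_mem by blast
          hence "b' = (b + c) mod T" using uni[of j b'' b] ab(2) by simp
          thus "k = gain T a ((b + c) mod T)" using *(3) a' by simp
        next
          assume "k = gain T a ((b + c) mod T)"
          moreover have "(j, (b + c) mod T) \<in># comm_gens (shift T c v)" using shift_mem ab(2) by blast
          ultimately show "i < j \<and> (\<exists>a b. (i, a) \<in># comm_gens (?h c) \<and> (j, b) \<in># comm_gens (?h c) \<and> k = gain T a b)"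
            using ab(1) ij(3) by auto
        qed
        thus ?thesis using gain_eq_iff[OF T_pos _ ij(4), of "(b + c) mod T" a] T_pos by auto
      qed
      thus ?thesis using sum_unique_shift[OF T_pos, of "(a + k) mod T" b] T_pos by simp
    next
      case i: False
      hence iV: "i \<in> ?V" using UV(1) ij by blast
      have j: "j \<in> ?U" using False i unfolding d_def HEq by (auto split: if_splits)
      obtain a b where ab: "(i, a) \<in># comm_gens v" "(j, b) \<in># comm_gens u" using iV j by auto
      have bT: "b < T" using lt[of "(j, b)"] ab(2) by simp
      have "e \<in> inner_edges T (?h c) \<longleftrightarrow> (a + k + c) mod T = b" for c
      proof -
        have "e \<in> inner_edges T (?h c) \<longleftrightarrow> k = gain T ((a + c) mod T) b"
          unfolding HEq HEq_inner_iff
        proof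
          assume "i < j \<and> (\<exists>a b. (i, a) \<in># comm_gens (?h c) \<and> (j, b) \<in># comm_gens (?h c) \<and> k = gain T a b)"
          then obtain a' b' where *: "(i, a') \<in># comm_gens (?h c)" "(j, b') \<in># comm_gens (?h c)" "k = gain T a' b'" by blast
          have "(j, b') \<in># comm_gens u" using *(2) nshift[OF j] by auto
          hence b': "b' = b" using uni[of j b' b] ab(2) by simp
          have "(i, a') \<in># comm_gens (shift T c v)" using *(1) nU[OF iV] by auto
          then obtain a'' where "(i, a'') \<in># comm_gens v" "a' = (a'' + c) mod T" using shift_mem by blast
          hence "a' = (a + c) mod T" using uni[of i a'' a] ab(1) by simp
          thus "k = gain T ((a + c) mod T) b" using *(3) b' by simp
        next
          assume "k = gain T ((a + c) mod T) b"
          moreover have "(i, (a + c) mod T) \<in># comm_gens (shift T c v)" using shift_mem ab(1) by blast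
          ultimately show "i < j \<and> (\<exists>a b. (i, a) \<in># comm_gens (?h c) \<and> (j, b) \<in># comm_gens (?h c) \<and> k = gain T a b)"
            using ab(2) ij(3) by auto
        qed
        moreover have "((a + c) mod T + k) mod T = (a + k + c) mod T" by (simp add: mod_simps ac_simps)
        ultimately show ?thesis using gain_eq_iff[OF T_pos bT ij(4), of "(a + c) mod T"] by auto
      qed
      thus ?thesis using sum_unique_shift[OF T_pos bT, of "a + k"] by simp
    qed
    have "{..<T} = insert 0 {1..<T}" using T_pos by auto
    hence "(\<Sum>c<T. if e \<in> inner_edges T (?h c) then (1 :: complex) else 0) =
        (if e \<in> inner_edges T h then 1 else 0) + (\<Sum>c\<in>{1..<T}. if e \<in> inner_edges T (?h c) then 1 else 0)"
      by (simp add: h0)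
    hence s: "(\<Sum>c\<in>{1..<T}. if e \<in> inner_edges T (?h c) then (1 :: complex) else 0) = (if e \<in> inner_edges T h then 0 else 1)"
      unfolding one by (auto simp: algebra_simps split: if_splits)
    have "(\<Sum>c\<in>{1..<T}. crossing T u (shift T c v) e) = d * (\<Sum>c\<in>{1..<T}. if e \<in> inner_edges T (?h c) then 1 else 0)"
      unfolding cr sum_distrib_left by (intro sum.cong) auto
    thus ?thesis unfolding lhs s by simp
  qed
qed

text \<open>Change of variables from a tuple with marked hyperplanes to the tree or forest left
  after their removal. The vanishing assumptions admit sets of every size, so no cardinality is
  carried along.\<close>

lemma sum_pairs_of_edges:
  assumes fin: "finite X"
    and D: "\<And>A e. A \<subseteq> X \<Longrightarrow> e \<in> A \<Longrightarrow> card A \<noteq> m \<Longrightarrow> D (A - {e}) e = 0"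
    and H: "\<And>A e e'. A \<subseteq> X \<Longrightarrow> e \<in> A \<Longrightarrow> e' \<in> A \<Longrightarrow> e \<noteq> e' \<Longrightarrow> card A \<noteq> m \<Longrightarrow> H (A - {e} - {e'}) e' e = 0"
  shows "(\<Sum>A\<in>{A. A \<subseteq> X \<and> card A = m}. \<Sum>e\<in>A. D (A - {e}) e + (\<Sum>e'\<in>A - {e}. H (A - {e} - {e'}) e' e)) =
    (\<Sum>B\<in>Pow X. \<Sum>e\<in>X - B. D B e) + (\<Sum>B\<in>Pow X. \<Sum>e'\<in>X - B. \<Sum>e\<in>X - insert e' B. (H B e' e :: complex))"
proof -
  have "(\<Sum>A\<in>{A. A \<subseteq> X \<and> card A = m}. \<Sum>e\<in>A. D (A - {e}) e + (\<Sum>e'\<in>A - {e}. H (A - {e} - {e'}) e' e)) =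
    (\<Sum>A\<in>Pow X. \<Sum>e\<in>A. D (A - {e}) e + (\<Sum>e'\<in>A - {e}. H (A - {e} - {e'}) e' e))"
  proof (intro sum.mono_neutral_left ballI)
    fix A assume A: "A \<in> Pow X - {A. A \<subseteq> X \<and> card A = m}"
    show "(\<Sum>e\<in>A. D (A - {e}) e + (\<Sum>e'\<in>A - {e}. H (A - {e} - {e'}) e' e)) = 0"
    proof (rule sum.neutral, rule ballI)
      fix e assume e: "e \<in> A"
      have "(\<Sum>e'\<in>A - {e}. H (A - {e} - {e'}) e' e) = 0"
        by (rule sum.neutral, rule ballI, rule H) (use A e in auto)
      moreover have "D (A - {e}) e = 0" by (rule D) (use A e in auto)
      ultimately show "D (A - {e}) e + (\<Sum>e'\<in>A - {e}. H (A - {e} - {e'}) e' e) = 0" by simp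
    qed
  qed (use fin in auto)
  also have "\<dots> = (\<Sum>B\<in>Pow X. \<Sum>e\<in>X - B. D B e + (\<Sum>e'\<in>B. H (B - {e'}) e' e))"
    by (rule sum_Pow_remove[OF fin, of "\<lambda>B e. D B e + (\<Sum>e'\<in>B. H (B - {e'}) e' e)"])
  also have "\<dots> = (\<Sum>B\<in>Pow X. \<Sum>e\<in>X - B. D B e) + (\<Sum>B\<in>Pow X. \<Sum>e\<in>X - B. \<Sum>e'\<in>B. H (B - {e'}) e' e)"
    by (simp add: sum.distrib)
  also have "(\<Sum>B\<in>Pow X. \<Sum>e\<in>X - B. \<Sum>e'\<in>B. H (B - {e'}) e' e) =
      (\<Sum>B\<in>Pow X. \<Sum>e'\<in>B. \<Sum>e\<in>X - insert e' (B - {e'}). H (B - {e'}) e' e)"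
  proof (rule sum.cong[OF HOL.refl])
    fix B assume "B \<in> Pow X"
    have "(\<Sum>e\<in>X - B. \<Sum>e'\<in>B. H (B - {e'}) e' e) = (\<Sum>e'\<in>B. \<Sum>e\<in>X - B. H (B - {e'}) e' e)" by (rule sum.swap)
    also have "\<dots> = (\<Sum>e'\<in>B. \<Sum>e\<in>X - insert e' (B - {e'}). H (B - {e'}) e' e)"
      by (intro sum.cong HOL.refl) (auto simp: insert_absorb)
    finally show "(\<Sum>e\<in>X - B. \<Sum>e'\<in>B. H (B - {e'}) e' e) = (\<Sum>e'\<in>B. \<Sum>e\<in>X - insert e' (B - {e'}). H (B - {e'}) e' e)" .
  qed
  also have "\<dots> = (\<Sum>B\<in>Pow X. \<Sum>e'\<in>X - B. \<Sum>e\<in>X - insert e' B. H B e' e)"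
    by (rule sum_Pow_remove[OF fin, of "\<lambda>B e'. \<Sum>e\<in>X - insert e' B. H B e' e"])
  finally show ?thesis .
qed

text \<open>Expanding both pairings over the hyperplane that is omitted from the tree, the diagonal terms give
  the first summand.  In the other terms the omitted hyperplanes \<open>e\<close> and \<open>e'\<close> both join the two components
  of the common forest; the sum over \<open>e\<close> is a derivative of \<open>tree_coeff T h\<close>, hence a cobracket, and the
  hyperplane \<open>e'\<close> then reconnects the two halves after one of them has been rotated.\<close>

theorem flag_form_comm:
  assumes g: "total_degree_ones m T [g]" and h: "total_degree_ones m T [h]"
    and w: "\<And>x y. x \<in># comm_gens h \<Longrightarrow> y \<in># comm_gens h \<Longrightarrow> fst x \<noteq> fst y \<Longrightarrow> a (edge T x y) = \<beta> x y"
  shows "flag_form m T \<omega> a m (psi0 \<psi> (comm_bar T g)) (psi0 \<psi> (comm_bar T h)) =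
    (\<Sum>e\<in>X - inner_edges T h. a e) * tree_pair X a (tree_coeff T h) (tree_coeff T g)
    - cobracket_sum (*) \<beta> h (\<lambda>u v. \<Sum>c\<in>{1..<T}. tree_pair X a (tree_coeff T (CBracket u (shift T c v))) (tree_coeff T g))"
proof -
  note fin = X_finite
  let ?P = "tree_coeff T g" and ?Q = "tree_coeff T h" and ?I = "inner_edges T g" and ?J = "inner_edges T h"
  let ?d = "\<lambda>B e. edge_diff (ell B) e"
  \<comment> \<open>D and H are the diagonal and off-diagonal summands as functions of the remaining
    tree or forest, with the products of the signs \<open>nu\<close> already evaluated.\<close>
  define D where "D = (\<lambda>B e. if e \<in> ?J then 0 else prod a B * a e * ?P B * ?Q B)"
  define H where "H = (\<lambda>B e' e. if e \<in> ?I \<or> e' \<in> ?J then 0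
    else - (prod a B * a e * a e' * ?P (insert e' B) * ?Q (insert e B) * ?d B e * ?d B e'))"
  have cP: "finite B \<and> card B + 1 = m" if "?P B \<noteq> 0" for B using tree_coeff_card[OF that] total_fst(4)[OF g] by simp
  have finX: "finite B" if "B \<subseteq> X" for B using that fin by (rule finite_subset)
  have summand: "(let Hs = (SOME Hs. distinct Hs \<and> set Hs = A)
        in pairing m \<omega> (psi0 \<psi> (comm_bar T g)) Hs * pairing m \<omega> (psi0 \<psi> (comm_bar T h)) Hs * (\<Prod>H\<in>A. a H)) =
     (\<Sum>e\<in>A. D (A - {e}) e + (\<Sum>e'\<in>A - {e}. H (A - {e} - {e'}) e' e))" if A: "A \<in> {A. A \<subseteq> X \<and> card A = m}" for A
  proof -
    define Hs where "Hs = (SOME Hs. distinct Hs \<and> set Hs = A)"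
    have fA: "finite A" using A finX by blast
    have "\<exists>Hs. distinct Hs \<and> set Hs = A" using finite_distinct_list[OF fA] by blast
    hence "distinct Hs \<and> set Hs = A" unfolding Hs_def by (rule someI_ex)
    hence Hs: "distinct Hs" "set Hs = A" by blast+
    have "length Hs = m" using distinct_card[OF Hs(1)] Hs(2) A by simp
    hence adm: "admissible m Hs" unfolding admissible_def using Hs A by blast
    define p q where "p = (\<lambda>e. if e \<in> ?I then 0 else nu Hs e * ?P (A - {e}))"
      and "q = (\<lambda>e. if e \<in> ?J then 0 else nu Hs e * ?Q (A - {e}))"
    have "pairing m \<omega> (psi0 \<psi> (comm_bar T g)) Hs * pairing m \<omega> (psi0 \<psi> (comm_bar T h)) Hs * (\<Prod>H\<in>A. a H) =
      (end_sign * sum p A) * (end_sign * sum q A) * prod a A"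
      unfolding psi0_pairing(1)[OF g adm] psi0_pairing(1)[OF h adm] Hs(2) p_def q_def ..
    also have "\<dots> = (end_sign * end_sign) * (sum p A * sum q A * prod a A)" by (simp only: mult_ac)
    also have "\<dots> = (\<Sum>e\<in>A. \<Sum>e'\<in>A. p e * q e' * prod a A)"
      unfolding end_sign_sq mult_1_left sum_product by (simp only: sum_distrib_right)
    also have "\<dots> = (\<Sum>e\<in>A. p e * q e * prod a A + (\<Sum>e'\<in>A - {e}. p e * q e' * prod a A))"
      by (intro sum.cong HOL.refl sum.remove fA)
    also have "\<dots> = (\<Sum>e\<in>A. D (A - {e}) e + (\<Sum>e'\<in>A - {e}. H (A - {e} - {e'}) e' e))"
    proof (intro sum.cong HOL.refl arg_cong2[of _ _ _ _ "(+)"])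
      fix e assume e: "e \<in> A"
      have pr: "prod a A = a e * prod a (A - {e})" by (rule prod.remove[OF fA e])
      show "p e * q e * prod a A = D (A - {e}) e"
      proof (cases "?P (A - {e}) = 0 \<or> ?Q (A - {e}) = 0")
        case True
        thus ?thesis unfolding p_def q_def D_def by auto
      next
        case False
        have n: "nu Hs e * nu Hs e = 1" by (rule psi0_pairing(2)[OF g adm]) (use False e Hs(2) in auto)
        have ij: "?J = ?I" by (rule inner_edges_eq[OF g h _ tree_coeff_inner]) (use False in auto)
        have "p e * q e * prod a A = (if e \<in> ?J then 0 else (nu Hs e * nu Hs e) * (prod a (A - {e}) * a e * ?P (A - {e}) * ?Q (A - {e})))"
          unfolding p_def q_def pr ij by (simp add: mult_ac)
        thus ?thesis unfolding n D_def by simp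
      qed
      fix e' assume e': "e' \<in> A - {e}"
      have pr2: "prod a (A - {e}) = a e' * prod a (A - {e} - {e'})" by (rule prod.remove) (use e' fA in auto)
      have ins: "insert e' (A - {e} - {e'}) = A - {e}" "insert e (A - {e} - {e'}) = A - {e'}" using e e' by auto
      have n: "nu Hs e * nu Hs e' = - (?d (A - {e} - {e'}) e * ?d (A - {e} - {e'}) e')"
        using nu_ell[OF adm, of e e'] e e' Hs(2) by auto
      have "p e * q e' * prod a A = (if e \<in> ?I \<or> e' \<in> ?J then 0 else (nu Hs e * nu Hs e') * (prod a (A - {e} - {e'}) * a e * a e' * ?P (A - {e}) * ?Q (A - {e'})))"
        unfolding p_def q_def pr pr2 by (simp add: mult_ac)
      thus "p e * q e' * prod a A = H (A - {e} - {e'}) e' e"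
        unfolding n H_def ins by (simp add: mult_ac)
    qed
    finally show ?thesis unfolding Let_def Hs_def .
  qed
  have "flag_form m T \<omega> a m (psi0 \<psi> (comm_bar T g)) (psi0 \<psi> (comm_bar T h)) =
    (\<Sum>A\<in>{A. A \<subseteq> X \<and> card A = m}. \<Sum>e\<in>A. D (A - {e}) e + (\<Sum>e'\<in>A - {e}. H (A - {e} - {e'}) e' e))"
    unfolding flag_form_def by (intro sum.cong HOL.refl summand)
  also have "\<dots> = (\<Sum>B\<in>Pow X. \<Sum>e\<in>X - B. D B e) + (\<Sum>B\<in>Pow X. \<Sum>e'\<in>X - B. \<Sum>e\<in>X - insert e' B. H B e' e)"
  proof (rule sum_pairs_of_edges[OF fin])
    fix A e assume A: "A \<subseteq> X" "e \<in> A" "card A \<noteq> m"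
    have fA: "finite A" by (rule finX[OF A(1)])
    have "?P (A - {e}) = 0" using cP[of "A - {e}"] A(3) card.remove[OF fA A(2)] by auto
    thus "D (A - {e}) e = 0" by (simp add: D_def)
    fix e' assume e': "e' \<in> A" "e \<noteq> e'"
    hence "insert e' (A - {e} - {e'}) = A - {e}" by auto
    thus "H (A - {e} - {e'}) e' e = 0" using \<open>?P (A - {e}) = 0\<close> by (simp add: H_def)
  qed
  also have "(\<Sum>B\<in>Pow X. \<Sum>e\<in>X - B. D B e) = (\<Sum>e\<in>X - ?J. a e) * tree_pair X a ?Q ?P"
  proof -
    have "(\<Sum>e\<in>X - B. D B e) = (\<Sum>e\<in>X - ?J. a e) * (prod a B * ?Q B * ?P B)" if B: "B \<in> Pow X" for B
    proof (cases "?Q B = 0")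
      case True
      thus ?thesis by (simp add: D_def cong: if_cong)
    next
      case False
      hence BJ: "B \<subseteq> ?J" by (rule tree_coeff_inner)
      have "(\<Sum>e\<in>X - B. D B e) = (\<Sum>e\<in>X - ?J. D B e)"
        by (rule sum.mono_neutral_right) (use fin BJ in \<open>auto simp: D_def\<close>)
      also have "\<dots> = (\<Sum>e\<in>X - ?J. a e * (prod a B * ?Q B * ?P B))" by (intro sum.cong HOL.refl) (simp add: D_def)
      finally show ?thesis by (simp add: sum_distrib_right)
    qed
    thus ?thesis unfolding tree_pair_def sum_distrib_left by (intro sum.cong HOL.refl)
  qed
  also have "(\<Sum>B\<in>Pow X. \<Sum>e'\<in>X - B. \<Sum>e\<in>X - insert e' B. H B e' e) =
    - cobracket_sum (*) \<beta> h (\<lambda>u v. \<Sum>c\<in>{1..<T}. tree_pair X a (tree_coeff T (CBracket u (shift T c v))) ?P)"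
  proof -
    let ?c = "\<lambda>u v B. conv (tree_coeff T u) (tree_coeff T v) B"
    have in1: "(\<Sum>e\<in>X - insert e' B. H B e' e) =
      - (prod a B * a e' * ?P (insert e' B)) * cobracket_sum (*) \<beta> h (\<lambda>u v. ?c u v B * (\<Sum>c\<in>{1..<T}. crossing T u (shift T c v) e'))"
      if B: "B \<in> Pow X" and e': "e' \<in> X - B" for B e'
    proof (cases "?P (insert e' B) = 0")
      case True
      thus ?thesis by (simp add: H_def cong: if_cong)
    next
      case nz: False
      have fB: "finite B" using B finX by blast
      have cB: "B \<subseteq> X" "card B + 2 = m" using cP[OF nz] fB e' B by auto
      have ed: "\<forall>e\<in>B. ?d B e = 0" by (rule ell_edge[OF cB])
      \<comment> \<open>If e were an edge of g, then g and h would have the same edges, and e' would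
        be an edge of h. So the condition on e in H follows from that on e' and the two
        trees.\<close>
      have key: "e \<notin> ?I \<and> e \<noteq> e'" if "?Q (insert e B) \<noteq> 0" "e' \<notin> ?J" for e
      proof
        have BJ: "insert e B \<subseteq> ?J" using tree_coeff_inner[OF that(1)] .
        show "e \<notin> ?I"
        proof
          assume "e \<in> ?I"
          moreover have "insert e' B \<subseteq> ?I" by (rule tree_coeff_inner[OF nz])
          ultimately have "insert e B \<subseteq> ?I" by blast
          hence "?I = ?J" by (rule inner_edges_eq[OF h g that(1)])
          thus False using \<open>insert e' B \<subseteq> ?I\<close> that(2) by blast
        qed
        show "e \<noteq> e'" using BJ that(2) by blast
      qed
      have "(\<Sum>e\<in>X - insert e' B. H B e' e) =
        (if e' \<in> ?J then 0 else - (prod a B * a e' * ?P (insert e' B)) * (?d B e' * deriv_along X a (ell B) ?Q B))"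
      proof (cases "e' \<in> ?J")
        case True
        thus ?thesis by (simp add: H_def)
      next
        case False
        \<comment> \<open>Edges e in B drop out because the potential is constant along B, and e =
          e' is excluded by \<open>key\<close>; what remains of the sum over e is a full
          derivative.\<close>
        have "deriv_along X a (ell B) ?Q B = (\<Sum>e\<in>X - insert e' B. a e * ?d B e * ?Q (insert e B))"
          unfolding deriv_along_def
          by (rule sum.mono_neutral_right) (use fin ed key[OF _ False] in auto)
        moreover have "H B e' e = - (prod a B * a e' * ?P (insert e' B)) * (?d B e' * (a e * ?d B e * ?Q (insert e B)))" for e
        proof (cases "?Q (insert e B) = 0")
          case True
          thus ?thesis by (simp add: H_def)
        next
          case Q: False
          thus ?thesis using key[OF Q False] False by (simp add: H_def mult_ac)
        qed
        ultimately show ?thesis using False by (simp add: sum_distrib_left)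
      qed
      also have "\<dots> = - (prod a B * a e' * ?P (insert e' B)) *
          cobracket_sum (*) \<beta> h (\<lambda>u v. (if e' \<in> ?J then 0 else ?d B e') * ((ell B (lead u) - ell B (lead v)) * ?c u v B))"
      proof -
        have "deriv_along X a (ell B) ?Q B = cobracket_sum (*) \<beta> h (\<lambda>u v. (ell B (lead u) - ell B (lead v)) * ?c u v B)"
        proof (rule deriv_along_tree[OF fin fB ed])
          fix x y assume xy: "x \<in># comm_gens h" "y \<in># comm_gens h" "fst x \<noteq> fst y"
          have "edge T x y \<in> X" by (rule edge_hyps[OF T_pos _ _ xy(3)]) (use xy total_fst(3)[OF h] in auto)
          thus "edge T x y \<in> X \<and> a (edge T x y) = \<beta> x y" using w[OF xy] by blast
        qed
        thus ?thesis unfolding cobracket_sum_scale by simp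
      qed
      also have "cobracket_sum (*) \<beta> h (\<lambda>u v. (if e' \<in> ?J then 0 else ?d B e') * ((ell B (lead u) - ell B (lead v)) * ?c u v B)) =
          cobracket_sum (*) \<beta> h (\<lambda>u v. ?c u v B * (\<Sum>c\<in>{1..<T}. crossing T u (shift T c v) e'))"
      proof (rule cobracket_sum_cong)
        fix u v assume uv: "comm_gens u + comm_gens v = comm_gens h"
        have tot: "total_degree_ones m T [v, u]"
          using h total_degree_ones_cong[of "[v, u]" "[h]" m T] uv by (simp add: add.commute)
        show "(if e' \<in> ?J then 0 else ?d B e') * ((ell B (lead u) - ell B (lead v)) * ?c u v B) =
          ?c u v B * (\<Sum>c\<in>{1..<T}. crossing T u (shift T c v) e')"
        proof (cases "?c u v B = 0")
          case False
          note L = ell_lead_sq[OF tot cB False]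
          \<comment> \<open>The derivative supplies one factor of the jump of the potential and e'
            the other. The square of the jump is 1, so e' keeps the coefficient of an edge from u to
            a proper rotation of v.\<close>
          have "(if e' \<in> ?J then 0 else ?d B e' * (ell B (lead u) - ell B (lead v))) = (\<Sum>c\<in>{1..<T}. crossing T u (shift T c v) e')"
            by (rule crossing_shift_sum[OF h uv, of e' "ell B" "ell B (lead u)" "ell B (lead v)", OF _ L(2) L(3) L(1)]) (use e' in auto)
          thus ?thesis by (simp split: if_splits)
        qed simp
      qed
      finally show ?thesis .
    qed
    have "(\<Sum>B\<in>Pow X. \<Sum>e'\<in>X - B. \<Sum>e\<in>X - insert e' B. H B e' e) =
      (\<Sum>B\<in>Pow X. \<Sum>e'\<in>X - B. cobracket_sum (*) \<beta> h (\<lambda>u v. - (prod a B * a e' * ?P (insert e' B)) *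
         (?c u v B * (\<Sum>c\<in>{1..<T}. crossing T u (shift T c v) e'))))"
      unfolding cobracket_sum_scale by (intro sum.cong HOL.refl in1)
    also have "\<dots> = cobracket_sum (*) \<beta> h (\<lambda>u v. \<Sum>B\<in>Pow X. \<Sum>e'\<in>X - B. - (prod a B * a e' * ?P (insert e' B)) *
         (?c u v B * (\<Sum>c\<in>{1..<T}. crossing T u (shift T c v) e')))"
      unfolding cobracket_sum_sum ..
    \<comment> \<open>Read backwards, \<open>tree_pair_link\<close> absorbs e' into the tree
      polynomial of the bracket of u with the rotated v.\<close>
    also have "\<dots> = cobracket_sum (*) \<beta> h (\<lambda>u v. (- 1) * (\<Sum>c\<in>{1..<T}. tree_pair X a (tree_coeff T (CBracket u (shift T c v))) ?P))"
    proof (rule cobracket_sum_cong)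
      fix u v
      have "(\<Sum>c\<in>{1..<T}. tree_pair X a (tree_coeff T (CBracket u (shift T c v))) ?P) =
        (\<Sum>c\<in>{1..<T}. \<Sum>B\<in>Pow X. \<Sum>e'\<in>X - B. prod a B * ?c u v B * (crossing T u (shift T c v) e' * a e' * ?P (insert e' B)))"
        by (simp add: tree_pair_link[OF fin] tree_coeff_shift sum_distrib_left)
      also have "\<dots> = (\<Sum>B\<in>Pow X. \<Sum>c\<in>{1..<T}. \<Sum>e'\<in>X - B. prod a B * ?c u v B * (crossing T u (shift T c v) e' * a e' * ?P (insert e' B)))"
        by (rule sum.swap)
      also have "\<dots> = (\<Sum>B\<in>Pow X. \<Sum>e'\<in>X - B. \<Sum>c\<in>{1..<T}. prod a B * ?c u v B * (crossing T u (shift T c v) e' * a e' * ?P (insert e' B)))"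
        by (intro sum.cong HOL.refl sum.swap)
      also have "\<dots> = (\<Sum>B\<in>Pow X. \<Sum>e'\<in>X - B. (prod a B * a e' * ?P (insert e' B)) * (?c u v B * (\<Sum>c\<in>{1..<T}. crossing T u (shift T c v) e')))"
        by (intro sum.cong HOL.refl) (simp add: sum_distrib_left mult_ac)
      finally show "(\<Sum>B\<in>Pow X. \<Sum>e'\<in>X - B. - (prod a B * a e' * ?P (insert e' B)) * (?c u v B * (\<Sum>c\<in>{1..<T}. crossing T u (shift T c v) e'))) =
        (- 1) * (\<Sum>c\<in>{1..<T}. tree_pair X a (tree_coeff T (CBracket u (shift T c v))) ?P)"
        by (simp add: sum_negf)
    qed
    also have "\<dots> = - cobracket_sum (*) \<beta> h (\<lambda>u v. \<Sum>c\<in>{1..<T}. tree_pair X a (tree_coeff T (CBracket u (shift T c v))) ?P)"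
      unfolding cobracket_sum_scale by simp
    finally show ?thesis .
  qed
  finally show ?thesis by simp
qed

end

subsection \<open>The flag form on bracket classes\<close>

lemma flag_form_commute: "flag_form m T \<omega> a p u v = flag_form m T \<omega> a p v u"
  unfolding flag_form_def by (simp add: mult_ac)

lemma flag_form_add: "flag_form m T \<omega> a p (u + v) z = flag_form m T \<omega> a p u z + flag_form m T \<omega> a p v z"
  unfolding flag_form_def by (simp add: Let_def pairing_add algebra_simps sum.distrib)

lemma flag_form_scale: "flag_form m T \<omega> a p (pm_scale c u) z = c * flag_form m T \<omega> a p u z"
  unfolding flag_form_def by (simp add: Let_def pairing_scale sum_distrib_left mult_ac)

lemma flag_form_cong: "flag_eq m T \<omega> p u v \<Longrightarrow> flag_form m T \<omega> a p u z = flag_form m T \<omega> a p v z"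
proof -
  assume eq: "flag_eq m T \<omega> p u v"
  have "pairing m \<omega> u (SOME Hs. distinct Hs \<and> set Hs = A) = pairing m \<omega> v (SOME Hs. distinct Hs \<and> set Hs = A)"
    if A: "A \<subseteq> hyps m T" "card A = p" for A
  proof (rule pairing_flag_eq[OF eq])
    have "finite A" using A(1) finite_hyps finite_subset by blast
    hence "\<exists>Hs. distinct Hs \<and> set Hs = A" using finite_distinct_list by blast
    hence *: "distinct (SOME Hs. distinct Hs \<and> set Hs = A) \<and> set (SOME Hs. distinct Hs \<and> set Hs = A) = A" by (rule someI_ex)
    show "length (SOME Hs. distinct Hs \<and> set Hs = A) = p" using * distinct_card A(2) by metis
    show "set (SOME Hs. distinct Hs \<and> set Hs = A) \<subseteq> hyps m T" using * A(1) by simp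
  qed
  thus ?thesis unfolding flag_form_def by (intro sum.cong HOL.refl) (simp add: Let_def)
qed

lemma leaf_degree_count: "leaf_degree g i = count (image_mset fst (comm_gens g)) i"
proof -
  have "(\<Sum>(p, k)\<in>#M. unit_degree p) i = count (image_mset fst M) i" for M :: "(nat \<times> nat) multiset"
    by (induction M) (auto simp: unit_degree_def)
  thus ?thesis by (simp add: word_degree_def)
qed

lemma total_degree_onesI:
  assumes "set_mset (comm_gens g) \<subseteq> leaves m T" "leaf_degree g = ones m"
  shows "total_degree_ones m T [g]"
proof -
  have "image_mset fst (comm_gens g) = mset_set {1..m}"
  proof (rule multiset_eqI)
    fix i show "count (image_mset fst (comm_gens g)) i = count (mset_set {1..m}) i"
      using leaf_degree_count[of g i] assms(2) by (simp add: ones_def count_mset_set')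
  qed
  thus ?thesis using assms(1) unfolding total_degree_ones_iff by simp
qed

context psi_family
begin

abbreviation V :: "(nat \<times> nat) free_lie set" where "V \<equiv> a_fixed_homogeneous m T (ones m)"

lemma subspace_V: "free.subspace V"
proof -
  have "free.subspace (algebra_a m T)" unfolding algebra_a_span by (rule free.subspace_span)
  hence "free.subspace (a_fixed m T)" unfolding a_fixed_def free.subspace_def by (auto simp: tau_hom)
  thus ?thesis unfolding a_fixed_homogeneous_def by (intro free.subspace_inter subspace_a_homogeneous)
qed

lemma comm_bar_V: "total_degree_ones m T [g] \<Longrightarrow> comm_bar T g \<in> V"
  using comm_bar_homogeneous[OF T_pos total_fst(3)[of g]] total_leaf_degree[of m T "[g]"] by simp

text \<open>Additivity inside the enveloping algebra holds modulo relations, which \<psi>_0 carries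
  to flag relations. The pairing kills these, and this makes the form G below bilinear.\<close>

lemma psi0_linear:
  assumes "x \<in> V" "y \<in> V"
  shows "flag_eq m T \<omega> m (psi0 \<psi> (free_scale a x + free_scale b y)) (pm_scale a (psi0 \<psi> x) + pm_scale b (psi0 \<psi> y))"
proof -
  let ?b = "\<lambda>z. basis_vec ([], [z]) :: wedge_U"
  let ?z = "free_scale a x + free_scale b y"
  have z: "?z \<in> V" by (intro free.subspace_add[OF subspace_V] free.subspace_scale[OF subspace_V] assms)
  have ml: "?b z \<in> wedge_U_multilinear m T 0" if "z \<in> V" for z
    unfolding wedge_U_multilinear_def
    by (intro pm.span_base CollectI exI[of _ "[]"] exI[of _ "[z]"] conjI HOL.refl exI[of _ "[ones m]"]) (use that in simp_all)
  have "V \<subseteq> a_fixed m T" by (auto simp: a_fixed_homogeneous_def)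
  hence "?b ?z - pm_scale a (?b x) - pm_scale b (?b y) \<in> wedge_U_relations m T 0"
    using wedge_U_relation_linear_right[of "[]" 0 "[]" "[]" x y a b] assms by auto
  moreover have "?b ?z - pm_scale a (?b x) - pm_scale b (?b y) \<in> wedge_U_multilinear m T 0"
    using ml[OF z] ml[OF assms(1)] ml[OF assms(2)] unfolding wedge_U_multilinear_def
    by (intro pm.span_diff pm.span_scale)
  ultimately have "\<psi> 0 (?b ?z - pm_scale a (?b x) - pm_scale b (?b y)) \<in> flag_relations m T \<omega> (m - 0)"
    by (intro subsetD[OF psi_linear(4)[of 0]] imageI IntI) simp_all
  thus ?thesis unfolding flag_eq_def psi0_def by (simp add: psi_linear(1-3) diff_diff_eq)
qed

context
  fixes a :: "hyp \<Rightarrow> complex"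
begin

definition G :: "(nat \<times> nat) free_lie \<Rightarrow> (nat \<times> nat) free_lie \<Rightarrow> complex" where
  "G x y = flag_form m T \<omega> a m (psi0 \<psi> x) (psi0 \<psi> y)"

lemma G_commute: "G x y = G y x"
  unfolding G_def by (rule flag_form_commute)

lemma G_linear:
  assumes "x \<in> V" "y \<in> V"
  shows "G (x + y) z = G x z + G y z" "G (free_scale c x) z = c * G x z" "G 0 z = 0"
proof -
  have *: "G (free_scale c x + free_scale b y) z = c * G x z + b * G y z" for c b
    unfolding G_def flag_form_cong[OF psi0_linear[OF assms]] flag_form_add flag_form_scale ..
  show "G (x + y) z = G x z + G y z" using *[of 1 1] by simp
  show "G (free_scale c x) z = c * G x z" using *[of c 0] by simp
  show "G 0 z = 0" using *[of 0 0] by simp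
qed

lemma G_sum: "(\<And>i. i \<in> I \<Longrightarrow> f i \<in> V) \<Longrightarrow> G (\<Sum>i\<in>I. f i) z = (\<Sum>i\<in>I. G (f i) z)"
proof (induction I rule: infinite_finite_induct)
  case (insert i I)
  have "(\<Sum>i\<in>I. f i) \<in> V" by (rule free.subspace_sum[OF subspace_V]) (use insert.prems in simp)
  thus ?case using insert G_linear(1)[of "f i" "\<Sum>i\<in>I. f i"] by simp
qed (use G_linear(3)[OF free.subspace_0[OF subspace_V] free.subspace_0[OF subspace_V]] in simp_all)

lemma bar_V: "x \<in> a_homogeneous m T (ones m) \<Longrightarrow> bar T x \<in> V"
proof -
  assume "x \<in> a_homogeneous m T (ones m)"
  thus ?thesis unfolding a_homogeneous_span
  proof (induction rule: free.span_induct_alt)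
    case base
    show ?case using free.subspace_0[OF subspace_V] by (simp add: bar_hom)
  next
    case (step c x y)
    then obtain g where "x = comm_value T g" "total_degree_ones m T [g]" using total_degree_onesI by blast
    hence "bar T x \<in> V" using comm_bar_V[of g] by (simp add: comm_bar_def)
    thus ?case unfolding bar_hom by (intro free.subspace_add[OF subspace_V] free.subspace_scale[OF subspace_V] step.IH)
  qed
qed

lemma G_bar_zero:
  assumes zero: "\<And>g. total_degree_ones m T [g] \<Longrightarrow> G (comm_bar T g) z = 0" and x: "x \<in> a_homogeneous m T (ones m)"
  shows "G (bar T x) z = 0"
proof -
  have "bar T x \<in> V \<and> G (bar T x) z = 0"
    using x unfolding a_homogeneous_span
  proof (induction rule: free.span_induct_alt)
    case base
    show ?case
      using free.subspace_0[OF subspace_V] G_linear(3)[OF free.subspace_0[OF subspace_V] free.subspace_0[OF subspace_V]] by (simp add: bar_hom)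
  next
    case (step c x y)
    then obtain g where g: "x = comm_value T g" "total_degree_ones m T [g]" using total_degree_onesI by blast
    have 1: "bar T x \<in> V" and 2: "G (bar T x) z = 0" using comm_bar_V[OF g(2)] zero[OF g(2)] by (simp_all add: g(1) comm_bar_def)
    have 3: "free_scale c (bar T x) \<in> V" by (rule free.subspace_scale[OF subspace_V 1])
    have 4: "bar T y \<in> V" "G (bar T y) z = 0" using step.IH by blast+
    show ?case unfolding bar_hom using free.subspace_add[OF subspace_V 3 4(1)] G_linear(1)[OF 3 4(1)] G_linear(2)[OF 1 1] 2 4(2) by simp
  qed
  thus ?thesis ..
qed

end

end

subsection \<open>Comparison with the Shapovalov form\<close>

context diagram_automorphism
begin

text \<open>The exponents are defined with the label of the first position normalised to 0. Rotating
  both roots by that label changes nothing, because \<pi> preserves the form on roots.\<close>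

lemma weight_edge:
  assumes x: "x \<in> leaves (weight_sum l) T" and y: "y \<in> leaves (weight_sum l) T" and ne: "fst x \<noteq> fst y"
  shows "hyp_weight l (edge T x y) = letter_form (color l) x y"
proof -
  have *: "dual_form B (\<alpha> (\<iota> (block l (fst x)))) (\<alpha> ((\<pi> ^^ gain T (snd x) (snd y)) (\<iota> (block l (fst y))))) = letter_form (color l) x y"
    if x: "x \<in> leaves (weight_sum l) T" and y: "y \<in> leaves (weight_sum l) T" for x y
  proof -
    let ?i = "\<iota> (block l (fst x))" and ?j = "\<iota> (block l (fst y))" and ?k = "gain T (snd x) (snd y)"
    have i: "?i \<in> {1..R}" using x by (intro iota_mem block_mem) (auto simp: leaves_def)
    have j: "?j \<in> {1..R}" using y by (intro iota_mem block_mem) (auto simp: leaves_def)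
    have "(snd x + ?k) mod T = snd y" by (rule gain_add) (use y in \<open>auto simp: leaves_def\<close>)
    hence "(\<pi> ^^ snd y) ?j = (\<pi> ^^ (snd x + ?k)) ?j" using funpow_mod_eq[OF pi_pow_T[OF j], of "snd x + ?k"] by simp
    hence "letter_form (color l) x y = dual_form B (\<alpha> ((\<pi> ^^ snd x) ?i)) (\<alpha> ((\<pi> ^^ snd x) ((\<pi> ^^ ?k) ?j)))"
      by (simp add: letter_form_def color_def letter_def funpow_add)
    thus ?thesis using dual_form_pi_pow[OF i pi_mem[OF j]] by simp
  qed
  show ?thesis
  proof (cases "fst x < fst y")
    case True
    thus ?thesis using *[OF x y] by (simp add: edge_def)
  next
    case False
    have "letter_form (color l) x y = letter_form (color l) y x" unfolding letter_form_def by (rule dual_form_commute)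
    thus ?thesis using False *[OF y x] by (simp add: edge_def)
  qed
qed

lemma K_E_bracket:
  assumes "i \<in> {1..R}" "x \<in> n_minus" "y \<in> n_minus"
  shows "K (E i) (br x y) = 0"
proof -
  obtain p H where p: "p \<in> n_minus" "br (E i) x = p + inc H" using br_E_n_minus[OF assms(1,2)] by blast
  have "K (E i) (br x y) = K (p + inc H) y" unfolding K_invariant[symmetric] p(2) ..
  also have "\<dots> = 0" using K_minus[OF p(1) assms(3)] K_h_orthogonal[of y H] assms(3) by (simp add: K_linear)
  finally show ?thesis .
qed

context
  fixes l :: "nat \<Rightarrow> nat" and m :: nat
  assumes m: "m = weight_sum l"
begin

abbreviation S :: "commutator \<Rightarrow> commutator \<Rightarrow> complex" where
  "S h g \<equiv> tree_pair (hyps m T) (hyp_weight l) (tree_coeff T h) (tree_coeff T g)"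

abbreviation Lab :: "commutator \<Rightarrow> commutator set" where
  "Lab \<equiv> labellings (color l) m T"

definition leafy :: "commutator \<Rightarrow> bool" where
  "leafy h \<longleftrightarrow> set_mset (comm_gens h) \<subseteq> leaves m T \<and> image_mset fst (comm_gens h) = mset_set (fst ` set_mset (comm_gens h))"

lemma leafy_part: "leafy h \<Longrightarrow> comm_gens c + comm_gens d = comm_gens h \<Longrightarrow> leafy c \<and> leafy d"
proof -
  assume h: "leafy h" and cd: "comm_gens c + comm_gens d = comm_gens h"
  have "image_mset fst (comm_gens c + comm_gens d) = mset_set (fst ` set_mset (comm_gens h))" using h unfolding cd leafy_def by blast
  from multilinear_union(1,2)[OF this] show ?thesis using h unfolding leafy_def cd[symmetric] by auto
qed

lemma leafy_letters: "leafy h \<Longrightarrow> letters (color l) h"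
  unfolding leafy_def letters_def using color_mem m by blast

text \<open>Induction on M: the left side splits by \<open>tree_pair_bracket\<close> and the right
  side by \<open>K_cobracket\<close>, along the same cobracket of h. The minus sign in the latter
  accounts for the power of -1.\<close>

theorem sum_labellings_tree_pair:
  assumes "letter_word M" "leafy h"
  shows "(\<Sum>g\<in>Lab M. if comm_gens g = comm_gens h then S h g else 0) =
    (-1) ^ (size (comm_gens h) - 1) * K (\<phi> (plain_word M)) (F_word (color l) h)"
  using assms
proof (induction M arbitrary: h)
  case (CGen a k)
  hence a: "a \<in> {1..R}" "k = 0" by (auto simp: letter_word_def)
  show ?case
  proof (cases h)
    case h: (CGen p q)
    hence pq: "(p, q) \<in> leaves m T" using CGen.prems(2) by (simp add: leafy_def)
    have c: "color l (p, q) \<in> {1..R}" using pq color_mem m by blast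
    have "(\<Sum>g\<in>Lab (CGen a 0). if comm_gens g = comm_gens h then S h g else 0) =
      (\<Sum>x\<in>{x \<in> leaves m T. color l x = a}. if x = (p, q) then S h h else 0)"
      unfolding labellings_CGen
      by (subst sum.reindex) (auto simp: inj_on_def h intro!: sum.cong)
    also have "\<dots> = (if color l (p, q) = a then S h h else 0)"
    proof -
      have "finite {x \<in> leaves m T. color l x = a}" by (rule finite_subset[of _ "leaves m T"]) (auto simp: leaves_def)
      thus ?thesis using pq by (simp add: sum.delta)
    qed
    also have "S h h = 1"
    proof -
      have "S h h = (\<Sum>A\<in>Pow (hyps m T). if A = {} then 1 else 0)"
        unfolding tree_pair_def h by (intro sum.cong) auto
      thus ?thesis using finite_hyps[of m T] by (simp add: sum.delta)
    qed
    finally show ?thesis using a c by (simp add: h phi_F K_EF)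
  next
    case h: (CBracket h1 h2)
    have "size (comm_gens h) \<noteq> 1"
    proof -
      have "comm_gens g \<noteq> {#}" for g using lead_mem[of g] by auto
      hence "size (comm_gens g) \<noteq> 0" for g by simp
      from this[of h1] this[of h2] show ?thesis unfolding h comm_gens.simps size_union by arith
    qed
    hence "comm_gens g \<noteq> comm_gens h" if "g \<in> Lab (CGen a 0)" for g
      using that unfolding labellings_CGen by (metis (no_types, lifting) case_prod_beta' comm_gens.simps(1) image_iff size_single)
    moreover have "letters (color l) h1 \<and> letters (color l) h2" using leafy_letters[OF CGen.prems(2)] lettersD unfolding h by blast
    ultimately show ?thesis using a K_E_bracket[OF a(1) F_word_n_minus F_word_n_minus, of "color l" h1 "color l" h2]
      by (simp add: h phi_F)
  qed
next
  case (CBracket M1 M2)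
  have l12: "letter_word M1" "letter_word M2" using CBracket.prems(1) by (auto simp: letter_word_def)
  let ?X = "\<phi> (plain_word M1)" and ?Y = "\<phi> (plain_word M2)" and ?v = "F_word (color l)"
  have XY: "?X \<in> n_plus" "?Y \<in> n_plus" using l12 by (auto intro!: phi_n_minus plain_word_n_minus)
  define Z where "Z = (\<lambda>M c. \<Sum>g\<in>Lab M. if comm_gens g = comm_gens c then S c g else 0)"
  have I: "image_mset fst (comm_gens h) = mset_set (fst ` set_mset (comm_gens h))" using CBracket.prems(2) by (simp add: leafy_def)
  have w: "edge T x y \<in> hyps m T \<and> hyp_weight l (edge T x y) = letter_form (color l) x y"
    if "x \<in># comm_gens h" "y \<in># comm_gens h" "fst x \<noteq> fst y" for x y
  proof -
    have "x \<in> leaves m T" "y \<in> leaves m T" using CBracket.prems(2) that(1,2) unfolding leafy_def by blast+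
    thus ?thesis using weight_edge[of x l y, folded m] edge_hyps[OF T_pos, of x m y] that(3) by blast
  qed
  \<comment> \<open>The conditions on the generators are distributed over the two factors. In this
    form the identity also covers words whose generators do not match those of h, and the double sum
    over labellings factors.\<close>
  have in1: "(if comm_gens (CBracket g1 g2) = comm_gens h then S h (CBracket g1 g2) else 0) =
      cobracket_sum (*) (letter_form (color l)) h (\<lambda>c d.
       (if comm_gens g1 = comm_gens c then S c g1 else 0) * (if comm_gens g2 = comm_gens d then S d g2 else 0)
     - (if comm_gens g1 = comm_gens d then S d g1 else 0) * (if comm_gens g2 = comm_gens c then S c g2 else 0))" for g1 g2
  proof (cases "comm_gens (CBracket g1 g2) = comm_gens h")
    case True
    have uv: "comm_gens h = comm_gens g1 + comm_gens g2" using True by simp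
    have "S h (CBracket g1 g2) = cobracket_sum (*) (letter_form (color l)) h (\<lambda>c d.
       (if comm_gens c = comm_gens g1 \<and> comm_gens d = comm_gens g2 then S c g1 * S d g2 else 0)
     - (if comm_gens c = comm_gens g2 \<and> comm_gens d = comm_gens g1 then S c g2 * S d g1 else 0))"
      by (rule tree_pair_bracket[OF finite_hyps I _ uv w]) simp
    also have "\<dots> = cobracket_sum (*) (letter_form (color l)) h (\<lambda>c d.
       (if comm_gens g1 = comm_gens c then S c g1 else 0) * (if comm_gens g2 = comm_gens d then S d g2 else 0)
     - (if comm_gens g1 = comm_gens d then S d g1 else 0) * (if comm_gens g2 = comm_gens c then S c g2 else 0))"
    proof (rule cobracket_sum_cong)
      have if2: "(if P \<and> Q then a * b else 0) = (if P then a else 0) * (if Q then b else (0 :: complex))" for P Q a b by simp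
      fix c d
      show "(if comm_gens c = comm_gens g1 \<and> comm_gens d = comm_gens g2 then S c g1 * S d g2 else 0)
         - (if comm_gens c = comm_gens g2 \<and> comm_gens d = comm_gens g1 then S c g2 * S d g1 else 0) =
        (if comm_gens g1 = comm_gens c then S c g1 else 0) * (if comm_gens g2 = comm_gens d then S d g2 else 0)
         - (if comm_gens g1 = comm_gens d then S d g1 else 0) * (if comm_gens g2 = comm_gens c then S c g2 else 0)"
        unfolding if2 eq_commute[of "comm_gens g1"] eq_commute[of "comm_gens g2"] by (simp only: mult.commute)
    qed
    finally show ?thesis using True by simp
  next
    case False
    have "cobracket_sum (*) (letter_form (color l)) h (\<lambda>c d.
       (if comm_gens g1 = comm_gens c then S c g1 else 0) * (if comm_gens g2 = comm_gens d then S d g2 else 0)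
     - (if comm_gens g1 = comm_gens d then S d g1 else 0) * (if comm_gens g2 = comm_gens c then S c g2 else 0)) =
     cobracket_sum (*) (letter_form (color l)) h (\<lambda>c d. 0)"
    proof (rule cobracket_sum_cong)
      have if3: "\<not> (P \<and> Q) \<Longrightarrow> \<not> (P' \<and> Q') \<Longrightarrow>
        (if P then a else 0) * (if Q then b else 0) - (if P' then a' else 0) * (if Q' then b' else (0 :: complex)) = 0" for P Q P' Q' a b a' b'
        by auto
      fix c d assume cd: "comm_gens c + comm_gens d = comm_gens h"
      show "(if comm_gens g1 = comm_gens c then S c g1 else 0) * (if comm_gens g2 = comm_gens d then S d g2 else 0)
     - (if comm_gens g1 = comm_gens d then S d g1 else 0) * (if comm_gens g2 = comm_gens c then S c g2 else 0) = 0"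
      proof (rule if3; rule notI; elim conjE)
        assume "comm_gens g1 = comm_gens c" "comm_gens g2 = comm_gens d"
        thus False using False cd by simp
      next
        assume "comm_gens g1 = comm_gens d" "comm_gens g2 = comm_gens c"
        thus False using False cd by (simp add: add.commute)
      qed
    qed
    thus ?thesis using False by (simp add: cobracket_sum_zero)
  qed
  have "(\<Sum>g\<in>Lab (CBracket M1 M2). if comm_gens g = comm_gens h then S h g else 0) =
    (\<Sum>g1\<in>Lab M1. \<Sum>g2\<in>Lab M2. cobracket_sum (*) (letter_form (color l)) h (\<lambda>c d.
       (if comm_gens g1 = comm_gens c then S c g1 else 0) * (if comm_gens g2 = comm_gens d then S d g2 else 0)
     - (if comm_gens g1 = comm_gens d then S d g1 else 0) * (if comm_gens g2 = comm_gens c then S c g2 else 0)))"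
    unfolding sum_labellings_CBracket by (rule sum.cong[OF HOL.refl], rule sum.cong[OF HOL.refl], rule in1)
  also have "\<dots> = cobracket_sum (*) (letter_form (color l)) h (\<lambda>c d. Z M1 c * Z M2 d - Z M1 d * Z M2 c)"
    unfolding cobracket_sum_sum Z_def by (simp only: sum_subtractf sum_product)
  also have "\<dots> = cobracket_sum (*) (letter_form (color l)) h (\<lambda>c d. (- ((-1) ^ (size (comm_gens h) - 1))) *
      (K ?X (?v c) * K ?Y (?v d) - K ?X (?v d) * K ?Y (?v c)))"
  proof (rule cobracket_sum_cong)
    fix c d assume cd: "comm_gens c + comm_gens d = comm_gens h"
    have lf: "leafy c" "leafy d" using leafy_part[OF CBracket.prems(2) cd] by blast+
    have "comm_gens g \<noteq> {#}" for g using lead_mem[of g] by auto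
    hence "size (comm_gens c) \<noteq> 0" "size (comm_gens d) \<noteq> 0" by simp_all
    \<comment> \<open>The exponents are sizes minus one: p and q for the halves, but p + q + 1 for
      h. The surplus of one is the minus sign.\<close>
    then obtain p q where pq: "size (comm_gens c) = Suc p" "size (comm_gens d) = Suc q" by (meson not0_implies_Suc)
    have "size (comm_gens h) = Suc (Suc (p + q))" using pq unfolding cd[symmetric] by simp
    thus "Z M1 c * Z M2 d - Z M1 d * Z M2 c =
      (- ((-1) ^ (size (comm_gens h) - 1))) * (K ?X (?v c) * K ?Y (?v d) - K ?X (?v d) * K ?Y (?v c))"
      unfolding Z_def CBracket.IH(1)[OF l12(1) lf(1)] CBracket.IH(1)[OF l12(1) lf(2)]
        CBracket.IH(2)[OF l12(2) lf(1)] CBracket.IH(2)[OF l12(2) lf(2)] pq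
      by (simp add: power_add algebra_simps)
  qed
  also have "\<dots> = (-1) ^ (size (comm_gens h) - 1) * K (br ?Y ?X) (?v h)"
    unfolding cobracket_sum_scale K_cobracket[OF leafy_letters[OF CBracket.prems(2)] XY] by simp
  finally show ?case by (simp add: phi_bracket)
qed

text \<open>Shapovalov pairing of x with the rotations of h, read as words in the F_a. The formula
  is linear in x and vanishes on the kernel.\<close>

definition shapo_sum :: "commutator \<Rightarrow> 'g \<Rightarrow> complex" where
  "shapo_sum h x = (\<Sum>s<T. (-1) ^ (m - 1) * K (\<phi> x) (F_word (color l) (shift T s h)))"

lemma shapo_sum_linear: "shapo_sum h (x + y) = shapo_sum h x + shapo_sum h y" "shapo_sum h (sg c x) = c * shapo_sum h x"
    "shapo_sum h 0 = 0"
  unfolding shapo_sum_def phi_facts phi_zero K_linear K_zero by (simp_all add: sum.distrib sum_distrib_left algebra_simps)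

text \<open>\<open>tree_pair_shift_sum\<close> introduces the rotations. For each of them only
  labellings with the generators of the rotated word contribute, and these have degree [1^m]
  automatically.\<close>

lemma sum_tree_pair_word:
  assumes M: "letter_word M" and h: "total_degree_ones m T [h]" and pos: "0 < m"
  shows "(\<Sum>g\<in>{g \<in> Lab M. leaf_degree g = ones m}. S h g) = shapo_sum h (plain_word M)"
proof -
  let ?L = "{g \<in> Lab M. leaf_degree g = ones m}"
  have gens: "total_degree_ones m T [k] \<Longrightarrow> image_mset fst (comm_gens k) = mset_set {1..m} \<and> set_mset (comm_gens k) \<subseteq> leaves m T" for k
    unfolding total_degree_ones_iff by simp
  have fin: "finite (Lab M)" by (rule finite_labellings) (use M in \<open>auto simp: letter_word_def\<close>)
  have tot: "total_degree_ones m T [g]" if "g \<in> ?L" for g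
    using that by (intro total_degree_onesI) (auto simp: labellings_def)
  have "S h g = (\<Sum>s<T. if comm_gens g = comm_gens (shift T s h) then S (shift T s h) g else 0)" if g: "g \<in> ?L" for g
  proof (rule tree_pair_shift_sum[OF T_pos finite_hyps])
    show "image_mset fst (comm_gens h) = mset_set {1..m}" "image_mset fst (comm_gens g) = mset_set {1..m}"
      using gens[OF h] gens[OF tot[OF g]] by blast+
    show "\<forall>x\<in>#comm_gens g. snd x < T" using gens[OF tot[OF g]] by (auto simp: leaves_def)
  qed (use pos in auto)
  hence "(\<Sum>g\<in>?L. S h g) = (\<Sum>g\<in>?L. \<Sum>s<T. if comm_gens g = comm_gens (shift T s h) then S (shift T s h) g else 0)"
    by (rule sum.cong[OF HOL.refl])
  also have "\<dots> = (\<Sum>s<T. \<Sum>g\<in>?L. if comm_gens g = comm_gens (shift T s h) then S (shift T s h) g else 0)" by (rule sum.swap)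
  also have "\<dots> = (\<Sum>s<T. (-1) ^ (m - 1) * K (\<phi> (plain_word M)) (F_word (color l) (shift T s h)))"
  proof (rule sum.cong[OF HOL.refl])
    fix s
    have f: "image_mset fst (comm_gens (shift T s h)) = mset_set {1..m}" using gens[OF h] by (simp add: fst_comm_gens_shift)
    have lv: "set_mset (comm_gens (shift T s h)) \<subseteq> leaves m T" using comm_gens_shift_leaves[OF T_pos] gens[OF h] by blast
    have lf: "leafy (shift T s h)" unfolding leafy_def using f lv multilinear_gens(3)[OF f] by simp
    have sz: "size (comm_gens (shift T s h)) = m" using arg_cong[OF f, of size] by simp
    have "(\<Sum>g\<in>?L. if comm_gens g = comm_gens (shift T s h) then S (shift T s h) g else 0) =
      (\<Sum>g\<in>Lab M. if comm_gens g = comm_gens (shift T s h) then S (shift T s h) g else 0)"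
    proof (rule sum.mono_neutral_left[OF fin], blast, rule ballI)
      fix g assume g: "g \<in> Lab M - ?L"
      have "comm_gens g \<noteq> comm_gens (shift T s h)"
      proof
        assume eq: "comm_gens g = comm_gens (shift T s h)"
        have "leaf_degree g = ones m" using leaf_degree_count[of g] unfolding eq f by (auto simp: ones_def)
        thus False using g by blast
      qed
      thus "(if comm_gens g = comm_gens (shift T s h) then S (shift T s h) g else 0) = 0" by simp
    qed
    thus "(\<Sum>g\<in>?L. if comm_gens g = comm_gens (shift T s h) then S (shift T s h) g else 0) =
      (-1) ^ (m - 1) * K (\<phi> (plain_word M)) (F_word (color l) (shift T s h))"
      unfolding sum_labellings_tree_pair[OF M lf] sz .
  qed
  finally show ?thesis by (simp only: shapo_sum_def)
qed

end

end

section \<open>Vanishing of the skew form on the kernel\<close>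

context omega_form
begin

lemma weight_sum_pos: "l \<in> degrees \<Longrightarrow> l \<noteq> 0 \<Longrightarrow> 0 < weight_sum l"
proof -
  assume l: "l \<in> degrees" "l \<noteq> 0"
  have "\<exists>i. l i \<noteq> 0"
  proof (rule ccontr)
    assume "\<not> (\<exists>i. l i \<noteq> 0)"
    hence "l = 0" by (intro ext) simp
    thus False using l(2) by blast
  qed
  then obtain i where i: "l i \<noteq> 0" by blast
  have "i \<in> {1..r}"
  proof (rule ccontr)
    assume "i \<notin> {1..r}"
    hence "l i = 0" using l(1) unfolding degrees_def by blast
    thus False using i by simp
  qed
  hence "l i \<le> weight_sum l" unfolding weight_sum_def by (intro member_le_sum) auto
  thus ?thesis using i by simp
qed

text \<open>Both arguments are replaced by bars. Against the bar of a commutator h the value is a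
  linear function of the first element built from Shapovalov pairings, hence zero on the kernel;
  linearity then passes from commutators to the second argument.\<close>

lemma kernel_flag_form:
  assumes l: "l \<in> degrees" "l \<noteq> 0" and x: "x \<in> n_minus_deg l" "\<sigma> x = x" and y: "y \<in> n_minus_deg l" "\<sigma> y = y"
    and ker: "\<And>z. K (\<phi> x) z = 0"
  shows "flag_form (weight_sum l) T \<omega> (hyp_weight l) (weight_sum l)
    (psi0 (\<psi> (weight_sum l)) (s_map l (jm l) x)) (psi0 (\<psi> (weight_sum l)) (s_map l (jm l) y)) = 0"
proof -
  define m where "m = weight_sum l"
  have pos: "0 < m" using weight_sum_pos[OF l] by (simp add: m_def)
  interpret P: psi_family m T \<omega> "\<psi> m"
    by unfold_locales (use pos T_pos omega psi[OF pos] in auto)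
  note j = jmath[OF l]
  let ?s = "s_map l (jm l)" and ?G = "P.G (hyp_weight l)"
  have xm: "x \<in> n_minus" "y \<in> n_minus" using x(1) y(1) n_minus_deg_subset by blast+
  have hom: "?s z \<in> a_homogeneous m T (ones m)" if "z \<in> n_minus" for z
    using s_map_facts(4)[OF j that] by (simp add: m_def)
  have fixed: "?s z \<in> P.V" "bar T (?s z) = free_scale (of_nat T) (?s z)" if "z \<in> n_minus" "\<sigma> z = z" for z
  proof -
    have t: "tau T (?s z) = ?s z" by (rule s_map_fixed[OF j that])
    thus "bar T (?s z) = free_scale (of_nat T) (?s z)" by (rule bar_fixed)
    show "?s z \<in> P.V" unfolding a_fixed_homogeneous_def a_fixed_def using t hom[OF that(1)] a_homogeneous_algebra_a by blast
  qed
  have bars: "?G (?s z) u = ?G (bar T (?s z)) u / of_nat T" if "z \<in> n_minus" "\<sigma> z = z" for z u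
    using P.G_linear(2)[OF fixed(1)[OF that] fixed(1)[OF that], of "hyp_weight l" "of_nat T" u] fixed(2)[OF that] T_pos by simp
  have comm: "?G (bar T (?s x)) (comm_bar T h) = 0" if h: "total_degree_ones m T [h]" for h
  proof -
    let ?S = "\<lambda>h g. tree_pair (hyps m T) (hyp_weight l) (tree_coeff T h) (tree_coeff T g)"
    let ?C = "\<Sum>e\<in>hyps m T - inner_edges T h. hyp_weight l e" and ?Z = "\<lambda>h x. shapo_sum l m h x"
    \<comment> \<open>The value given by \<open>flag_form_comm\<close> after summation over
      labellings. It is a functional on all of \<open>n_minus\<close>, because the words by which it
      is verified are in general not fixed by \<sigma>.\<close>
    define L where "L = (\<lambda>x. ?C * ?Z h x - cobracket_sum (*) (letter_form (color l)) h
      (\<lambda>u v. \<Sum>c\<in>{1..<T}. ?Z (CBracket u (shift T c v)) x))"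
    note Zlin = shapo_sum_linear[OF m_def]
    have lin: "L (a + b) = L a + L b" "L (sg c a) = c * L a" "L 0 = 0" for a b c
      unfolding L_def Zlin sum.distrib cobracket_sum_add sum_distrib_left[symmetric] cobracket_sum_scale
      by (simp_all add: algebra_simps cobracket_sum_zero)
    have w: "hyp_weight l (edge T x y) = letter_form (color l) x y"
      if "x \<in># comm_gens h" "y \<in># comm_gens h" "fst x \<noteq> fst y" for x y
      using that P.total_fst(3)[OF h] weight_edge[of x l y] unfolding m_def by blast
    have word: "?G (bar T (?s (plain_word M))) (comm_bar T h) = L (plain_word M)" if M: "letter_word M" for M
    proof -
      let ?L = "{g \<in> labellings (color l) m T M. leaf_degree g = ones m}"
      have tot: "total_degree_ones m T [g]" if "g \<in> ?L" for g
        using that by (intro total_degree_onesI) (auto simp: labellings_def)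
      have "bar T (\<Sum>g\<in>I. comm_value T g) = (\<Sum>g\<in>I. comm_bar T g)" for I
        by (induction I rule: infinite_finite_induct) (simp_all add: bar_hom comm_bar_def)
      hence "bar T (?s (plain_word M)) = (\<Sum>g\<in>?L. comm_bar T g)" unfolding s_map_word[OF j M] m_def .
      hence "?G (bar T (?s (plain_word M))) (comm_bar T h) = (\<Sum>g\<in>?L. ?G (comm_bar T g) (comm_bar T h))"
        using P.G_sum[of ?L "comm_bar T"] P.comm_bar_V tot by simp
      also have "\<dots> = (\<Sum>g\<in>?L. ?C * ?S h g - cobracket_sum (*) (letter_form (color l)) h (\<lambda>u v. \<Sum>c\<in>{1..<T}. ?S (CBracket u (shift T c v)) g))"
        unfolding P.G_def by (intro sum.cong HOL.refl P.flag_form_comm tot h w)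
      also have "\<dots> = ?C * (\<Sum>g\<in>?L. ?S h g) - cobracket_sum (*) (letter_form (color l)) h (\<lambda>u v. \<Sum>g\<in>?L. \<Sum>c\<in>{1..<T}. ?S (CBracket u (shift T c v)) g)"
        by (simp only: sum_subtractf sum_distrib_left cobracket_sum_sum)
      also have "(\<Sum>g\<in>?L. ?S h g) = ?Z h (plain_word M)" by (rule sum_tree_pair_word[OF m_def M h pos])
      also have "cobracket_sum (*) (letter_form (color l)) h (\<lambda>u v. \<Sum>g\<in>?L. \<Sum>c\<in>{1..<T}. ?S (CBracket u (shift T c v)) g) =
        cobracket_sum (*) (letter_form (color l)) h (\<lambda>u v. \<Sum>c\<in>{1..<T}. ?Z (CBracket u (shift T c v)) (plain_word M))"
      proof (rule cobracket_sum_cong)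
        fix u v assume uv: "comm_gens u + comm_gens v = comm_gens h"
        have th: "total_degree_ones m T [CBracket u (shift T c v)]" for c
        proof -
          have "set_mset (comm_gens (shift T c v)) \<subseteq> leaves m T"
            by (rule comm_gens_shift_leaves[OF T_pos]) (use P.total_fst(3)[OF h] uv[symmetric] in auto)
          moreover have "set_mset (comm_gens u) \<subseteq> leaves m T" using P.total_fst(3)[OF h] uv[symmetric] by auto
          moreover have "image_mset fst (comm_gens u + comm_gens v) = mset_set {1..m}" using P.total_fst(1)[OF h] uv by simp
          ultimately show ?thesis unfolding total_degree_ones_iff by (simp add: fst_comm_gens_shift)
        qed
        have "(\<Sum>g\<in>?L. \<Sum>c\<in>{1..<T}. ?S (CBracket u (shift T c v)) g) = (\<Sum>c\<in>{1..<T}. \<Sum>g\<in>?L. ?S (CBracket u (shift T c v)) g)"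
          by (rule sum.swap)
        also have "\<dots> = (\<Sum>c\<in>{1..<T}. ?Z (CBracket u (shift T c v)) (plain_word M))"
          by (rule sum.cong[OF HOL.refl], rule sum_tree_pair_word[OF m_def M th pos])
        finally show "(\<Sum>g\<in>?L. \<Sum>c\<in>{1..<T}. ?S (CBracket u (shift T c v)) g) =
          (\<Sum>c\<in>{1..<T}. ?Z (CBracket u (shift T c v)) (plain_word M))" .
      qed
      finally show ?thesis by (simp only: L_def)
    qed
    have "?G (bar T (?s z)) (comm_bar T h) = L z" if z: "z \<in> n_minus" for z
      using z
    proof (induction rule: n_minus_induct)
      case zero
      have "?s 0 = 0" by (rule s_map_facts(3)[OF j xm(1)])
      thus ?case using P.G_linear(3)[OF free.subspace_0[OF P.subspace_V] free.subspace_0[OF P.subspace_V]] lin(3) by (simp add: bar_hom)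
    next
      case (add c M z)
      have w: "plain_word M \<in> n_minus" by (rule plain_word_n_minus[OF add(1)])
      have b: "bar T (?s (plain_word M)) \<in> P.V" "bar T (?s z) \<in> P.V" using P.bar_V hom w add(2) by blast+
      have "?s (sg c (plain_word M) + z) = free_scale c (?s (plain_word M)) + ?s z"
        using s_map_facts(1)[OF j g.subspace_scale[OF n_facts(1) w] add(2)] s_map_facts(2)[OF j w] by simp
      hence "bar T (?s (sg c (plain_word M) + z)) = free_scale c (bar T (?s (plain_word M))) + bar T (?s z)" by (simp add: bar_hom)
      thus ?case using P.G_linear(1)[OF free.subspace_scale[OF P.subspace_V b(1)] b(2)] P.G_linear(2)[OF b(1) b(1)]
          word[OF add(1)] add(3) lin by simp
    qed
    moreover have "L x = 0" unfolding L_def shapo_sum_def[OF m_def] ker by (simp add: cobracket_sum_zero)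
    ultimately show ?thesis using xm(1) by simp
  qed
  have "?G (bar T (?s y)) (bar T (?s x)) = 0"
    by (rule P.G_bar_zero[OF _ hom[OF xm(2)]]) (use comm P.G_commute in metis)
  hence "?G (?s y) (bar T (?s x)) = 0" unfolding bars[OF xm(2) y(2)] by simp
  hence "?G (bar T (?s x)) (?s y) = 0" by (subst P.G_commute)
  hence "?G (?s x) (?s y) = 0" unfolding bars[OF xm(1) x(2)] by simp
  thus ?thesis unfolding P.G_def unfolding m_def .
qed

lemma Omega_sum:
  assumes "\<And>i. i \<in> I \<Longrightarrow> f i \<in> fixed_points \<sigma>" "y \<in> fixed_points \<sigma>"
  shows "\<Omega> (\<Sum>i\<in>I. f i) y = (\<Sum>i\<in>I. \<Omega> (f i) y)" "\<Omega> y (\<Sum>i\<in>I. f i) = (\<Sum>i\<in>I. \<Omega> y (f i))"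
proof -
  have sum: "(\<Sum>i\<in>I. f i) \<in> fixed_points \<sigma>" if "\<And>i. i \<in> I \<Longrightarrow> f i \<in> fixed_points \<sigma>" for I
    using that unfolding fixed_points_def by (simp add: sigma_sum)
  have zero: "\<Omega> 0 y = 0" using Omega_scale[of 0 y 0] assms(2) sum[of "{}"] by simp
  show 1: "\<Omega> (\<Sum>i\<in>I. f i) y = (\<Sum>i\<in>I. \<Omega> (f i) y)"
    using assms(1)
  proof (induction I rule: infinite_finite_induct)
    case (insert i I)
    thus ?case using Omega_add[of "f i" "\<Sum>i\<in>I. f i" y] sum[of I] assms(2) by simp
  qed (simp_all add: zero)
  have "\<Omega> y (\<Sum>i\<in>I. f i) = - (\<Sum>i\<in>I. \<Omega> (f i) y)" using Omega_skew[OF assms(2) sum[of I]] assms(1) 1 by simp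
  also have "\<dots> = (\<Sum>i\<in>I. \<Omega> y (f i))" unfolding sum_negf[symmetric] using Omega_skew[OF assms(2)] assms(1) by (intro sum.cong) auto
  finally show "\<Omega> y (\<Sum>i\<in>I. f i) = (\<Sum>i\<in>I. \<Omega> y (f i))" .
qed

text \<open>The kernel is graded, so every part of x lies in it, and only opposite components
  interact. It remains to bring each such pair into the form for which \<Omega> is
  prescribed.\<close>

theorem Omega_kernel:
  assumes x: "x \<in> fixed_points \<sigma>" "x \<in> form_kernel (shapovalov_form K \<phi>)" and y: "y \<in> fixed_points \<sigma>"
  shows "\<Omega> x y = 0"
proof -
  have ker: "K (\<phi> x) z = 0" for z using x(2) by (simp add: form_kernel_def shapovalov_form_def)
  obtain J f where J: "finite J" "J \<subseteq> components" "\<forall>C\<in>J. f C \<in> component_space C" "x = (\<Sum>C\<in>J. f C)"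
    using component_decomposition[OF x(1)] by (elim exE conjE)
  obtain L h where L: "finite L" "L \<subseteq> components" "\<forall>D\<in>L. h D \<in> component_space D" "y = (\<Sum>D\<in>L. h D)"
    using component_decomposition[OF y] by (elim exE conjE)
  have fx: "f C \<in> raw_space C" "\<sigma> (f C) = f C" if "C \<in> J" for C
    using J(3) that unfolding component_space_eq fixed_points_def by blast+
  have hx: "h D \<in> raw_space D" "\<sigma> (h D) = h D" if "D \<in> L" for D
    using L(3) that unfolding component_space_eq fixed_points_def by blast+
  have kerC: "K (\<phi> (f C)) z = 0" if "C \<in> J" for C z
    by (rule component_kernel[OF J(1,2) _ _ that]) (use fx ker J(4) in auto)
  have "\<Omega> (f C) (h D) = 0" if C: "C \<in> J" and D: "D \<in> L" for C D
  proof (cases "\<exists>l. {C, D} = {Neg l, Pos l}")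
    case False
    thus ?thesis using Omega_zero[of C D "f C" "h D"] C D J(2,3) L(2,3) by blast
  next
    case True
    then obtain l where l: "{C, D} = {Neg l, Pos l}" by blast
    have "Neg l \<in> components" using l C D J(2) L(2) by (metis insertCI insert_iff singletonD subsetD)
    hence ld: "l \<in> degrees" "l \<noteq> 0" unfolding components_def by auto
    have phi_fixed: "\<sigma> (\<phi> z) = \<phi> z" if "\<sigma> z = z" for z using sigma_phi[of z] that by simp
    from l consider "C = Pos l" "D = Neg l" | "C = Neg l" "D = Pos l" by (auto simp: doubleton_eq_iff)
    thus ?thesis
    proof cases
      case 1
      \<comment> \<open>\<Omega> is prescribed when \<phi> of an element of \<open>n_minus\<close>
        stands first. As \<phi> is an involution preserving K, this u is again in the
        kernel.\<close>
      define u where "u = \<phi> (f C)"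
      have u: "u \<in> n_minus_deg l" "\<sigma> u = u" "\<phi> u = f C"
        using fx[OF C] 1 phi_deg(1) phi_fixed phi_phi by (auto simp: u_def)
      have hD: "h D \<in> n_minus_deg l" "\<sigma> (h D) = h D" using hx[OF D] 1 by auto
      have ku: "K (\<phi> u) z = 0" for z
        using K_phi[of u "\<phi> z"] kerC[OF C, of "\<phi> z"] by (simp add: phi_phi u_def)
      show ?thesis
        using Omega_value[OF ld, of u "h D"] kernel_flag_form[OF ld u(1,2) hD ku] u hD by (simp add: fixed_points_def)
    next
      case 2
      \<comment> \<open>Here the part of x lies in \<open>n_minus\<close>, so the pair is turned
        around by skewness, and the symmetry of the flag form puts the kernel element in the first
        argument.\<close>
      define v where "v = \<phi> (h D)"
      have v: "v \<in> n_minus_deg l" "\<sigma> v = v" "\<phi> v = h D"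
        using hx[OF D] 2 phi_deg(1) phi_fixed phi_phi by (auto simp: v_def)
      have fC: "f C \<in> n_minus_deg l" "\<sigma> (f C) = f C" using fx[OF C] 2 by auto
      have "\<Omega> (h D) (f C) = 0"
        using Omega_value[OF ld, of v "f C"] kernel_flag_form[OF ld fC v(1,2) kerC[OF C]] v fC
        by (simp add: fixed_points_def flag_form_commute[of _ _ _ _ _ "psi0 (\<psi> (weight_sum l)) (s_map l (jm l) v)"])
      thus ?thesis using Omega_skew[of "f C" "h D"] fx(2)[OF C] hx(2)[OF D] by (simp add: fixed_points_def)
    qed
  qed
  moreover have "\<Omega> x y = (\<Sum>C\<in>J. \<Sum>D\<in>L. \<Omega> (f C) (h D))"
  proof -
    have "f C \<in> fixed_points \<sigma>" if "C \<in> J" for C using fx(2)[OF that] by (simp add: fixed_points_def)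
    moreover have "h D \<in> fixed_points \<sigma>" if "D \<in> L" for D using hx(2)[OF that] by (simp add: fixed_points_def)
    ultimately show ?thesis using Omega_sum(1)[of J f y] Omega_sum(2)[of L h] y unfolding J(4) L(4) by simp
  qed
  ultimately show ?thesis by simp
qed

end

theorem proposition7p5:
  fixes sh :: "complex \<Rightarrow> 'h::ab_group_add \<Rightarrow> 'h"
    and B :: "'h \<Rightarrow> 'h \<Rightarrow> complex"
    and R :: nat
    and \<alpha> :: "nat \<Rightarrow> 'h \<Rightarrow> complex"
    and Hc :: "nat \<Rightarrow> 'h"
    and sg :: "complex \<Rightarrow> 'g::ab_group_add \<Rightarrow> 'g"
    and br :: "'g \<Rightarrow> 'g \<Rightarrow> 'g"
    and inc :: "'h \<Rightarrow> 'g"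
    and E F :: "nat \<Rightarrow> 'g"
    and \<phi> :: "'g \<Rightarrow> 'g"
    and K :: "'g \<Rightarrow> 'g \<Rightarrow> complex"
    and \<sigma> :: "'g \<Rightarrow> 'g"
    and \<pi> :: "nat \<Rightarrow> nat"
    and T :: nat
    and \<omega> :: complex
    and r :: nat
    and \<iota> :: "nat \<Rightarrow> nat"
    and jm :: "(nat \<Rightarrow> nat) \<Rightarrow> 'g \<Rightarrow> (nat \<times> nat) free_lie"
    and \<psi> :: "nat \<Rightarrow> nat \<Rightarrow> wedge_U \<Rightarrow> flag_vec"
    and \<Omega> :: "'g \<Rightarrow> 'g \<Rightarrow> complex"
    and x :: 'g
  assumes "omega_form sh B R \<alpha> Hc sg br inc E F \<phi> K \<sigma> \<pi> T \<omega> r \<iota> jm \<psi> \<Omega>"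
    and "x \<in> fixed_points \<sigma>"
    and "x \<in> form_kernel (shapovalov_form K \<phi>)"
  shows "\<forall>y \<in> fixed_points \<sigma>. \<Omega> x y = 0"
  using omega_form.Omega_kernel[OF assms] by blast

end
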